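(* Let $S\colon\mathbf{CAT}\to\mathbf{CAT}$ be the 2-monad for categories with terminal object, or categories with finite products, or categories with finite limits. Then the relative pseudomonad of presheaves $P$ over the inclusion $J\colon\mathbf{Cat}\to\mathbf{CAT}$ has a lifting to strict $S$-algebras, $\bar P\colon S\text{-}\mathrm{Alg}_{\mathbf{Cat}}\to S\text{-}\mathrm{Alg}_{\mathbf{CAT}}$.
   Context: $\mathbf{CAT}$ is the 2-category of locally small categories, $\mathbf{Cat}$ its full sub-2-category of small categories, $J$ the inclusion. The 2-monads. The strict algebras for $S$ are, respectively, locally small categories with a chosen terminal object; with chosen finite products (chosen terminal object and binary products); with chosen finite limits (chosen terminal object and pullbacks). Each restricts to a 2-monad on $\mathbf{Cat}$. $S\text{-}\mathrm{Alg}_{\mathbf{CAT}}$ (respectively $S\text{-}\mathrm{Alg}_{\mathbf{Cat}}$) is the 2-category of (small) strict algebras, pseudomorphisms and algebra 2-cells: a pseudomorphism $(A,a)\to(B,b)$ is a functor $f\colon A\to B$ with an invertible natural transformation $\bar f\colon b\,S(f)\to f\,a$ satisfying the usual two coherence axioms with the multiplication and unit of $S$; an algebra 2-cell is a natural transformation compatible with these. The relative pseudomonad of presheaves. For a small category $\mathbb{X}$, $P(\mathbb{X})=[\mathbb{X}^{\mathrm{op}},\mathbf{Set}]$, with unit the Yoneda embedding $\mathrm{y}_{\mathbb{X}}\colon\mathbb{X}\to P(\mathbb{X})$. For $F\colon\mathbb{X}\to P(\mathbb{Y})$, $F^*\colon P(\mathbb{X})\to P(\mathbb{Y})$ is the left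 Kan extension of $F$ along $\mathrm{y}_{\mathbb{X}}$, $F^*(p)(y)=\int^{x\in\mathbb{X}}F(x)(y)\times p(x)$, with canonical invertible $\eta_F\colon F\to F^*\mathrm{y}_{\mathbb{X}}$. The invertible 2-cells $\mu_{G,F}\colon(G^*F)^*\to G^*F^*$ and $\theta_{\mathbb{X}}\colon(\mathrm{y}_{\mathbb{X}})^*\to1_{P(\mathbb{X})}$ are the unique ones such that $(\mu_{G,F}\,\mathrm{y}_{\mathbb{X}})\cdot\eta_{G^*F}=G^*\eta_F$ and $(\theta_{\mathbb{X}}\,\mathrm{y}_{\mathbb{X}})\cdot\eta_{\mathrm{y}_{\mathbb{X}}}=1$. Lifting. A lifting of $P$ to strict algebras for $S$ consists of: a strict $S$-algebra structure on $P(\mathbb{A})$ for every $\mathbb{A}\in S\text{-}\mathrm{Alg}_{\mathbf{Cat}}$; a pseudomorphism structure on $F^*\colon P(\mathbb{A})\to P(\mathbb{B})$ for every pseudomorphism $F\colon\mathbb{A}\to P(\mathbb{B})$; a pseudomorphism structure on $\mathrm{y}_{\mathbb{A}}\colon\mathbb{A}\to P(\mathbb{A})$ for every $\mathbb{A}\in S\text{-}\mathrm{Alg}_{\mathbf{Cat}}$; such that $\mu_{G,F}$, $\eta_F$ (for all pseudomorphisms $F\colon\mathbb{A}\to P(\mathbb{B})$, $G\colon\mathbb{B}\to P(\mathbb{C})$) and $\theta_{\mathbb{A}}$ are algebra 2-cells. *)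

theory Defs
  imports "HOL-Library.FuncSet" "HOL-Library.Equipollence"
begin

section \<open>Universes\<close>

text \<open>
  A set is small if its cardinality is below that of the type \<open>'u\<close>, and the cardinality of \<open>'u\<close> is
  required to be an infinite regular strong limit. If it is uncountable, it is
  inaccessible, and the small subsets of \<open>'u\<close> with all functions between them form, up to
  equivalence, the category of sets of a Grothendieck universe. Uncountability is
  not required, so that the class has a provable instance in HOL (\<open>nat\<close>, with small = finite).
\<close>

definition small :: "'u itself \<Rightarrow> 'a set \<Rightarrow> bool" where
  "small U A \<longleftrightarrow> A \<prec> (UNIV :: 'u set)"

class universe =
  assumes infinite_universe: "infinite (UNIV :: 'a set)"
    and small_UN: "\<And>(A :: 'a set) (F :: 'a \<Rightarrow> 'a set).
      small TYPE('a) A \<Longrightarrow> (\<And>x. x \<in> A \<Longrightarrow> small TYPE('a) (F x)) \<Longrightarrow> small TYPE('a) (\<Union>x\<in>A. F x)"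
    and small_Pow: "\<And>A :: 'a set. small TYPE('a) A \<Longrightarrow> small TYPE('a) (Pow A)"

lemma small_nat_iff: "small TYPE(nat) A \<longleftrightarrow> finite A"
proof
  assume "small TYPE(nat) A"
  then show "finite A"
    unfolding small_def lesspoll_def
    by (meson eqpoll_sym infinite_le_lepoll lepoll_antisym)
next
  assume "finite A"
  then show "small TYPE(nat) A"
    unfolding small_def
    by (simp add: finite_lesspoll_infinite)
qed

instance nat :: universe
  by standard (auto simp: small_nat_iff)


section \<open>Categories, functors and natural transformations\<close>

record ('o, 'm) cat =
  Obj :: "'o set"
  Arr :: "'m set"
  Dom :: "'m \<Rightarrow> 'o"
  Cod :: "'m \<Rightarrow> 'o"
  Ide :: "'o \<Rightarrow> 'm"
  Cmp :: "'m \<Rightarrow> 'm \<Rightarrow> 'm"   \<comment> \<open>\<open>Cmp C g f\<close> is \<open>g\<close> after \<open>f\<close>\<close>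

definition hom :: "('o, 'm) cat \<Rightarrow> 'o \<Rightarrow> 'o \<Rightarrow> 'm set" where
  "hom C x y = {f \<in> Arr C. Dom C f = x \<and> Cod C f = y}"

locale category =
  fixes C :: "('o, 'm) cat"
  assumes dom_in: "f \<in> Arr C \<Longrightarrow> Dom C f \<in> Obj C"
    and cod_in: "f \<in> Arr C \<Longrightarrow> Cod C f \<in> Obj C"
    and ide_in: "x \<in> Obj C \<Longrightarrow> Ide C x \<in> hom C x x"
    and cmp_in: "f \<in> hom C x y \<Longrightarrow> g \<in> hom C y z \<Longrightarrow> Cmp C g f \<in> hom C x z"
    and cmp_ide: "f \<in> hom C x y \<Longrightarrow> Cmp C f (Ide C x) = f"
    and ide_cmp: "f \<in> hom C x y \<Longrightarrow> Cmp C (Ide C y) f = f"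
    and cmp_assoc: "f \<in> hom C x y \<Longrightarrow> g \<in> hom C y z \<Longrightarrow> h \<in> hom C z w \<Longrightarrow>
      Cmp C h (Cmp C g f) = Cmp C (Cmp C h g) f"

definition locally_small :: "'u itself \<Rightarrow> ('o, 'm) cat \<Rightarrow> bool" where
  "locally_small U C \<longleftrightarrow> (\<forall>x \<in> Obj C. \<forall>y \<in> Obj C. small U (hom C x y))"

text \<open>Every small category is isomorphic to one whose objects and arrows are elements of \<open>'u\<close>.\<close>

definition small_category :: "('u, 'u) cat \<Rightarrow> bool" where
  "small_category X \<longleftrightarrow> category X \<and> small TYPE('u) (Obj X) \<and> small TYPE('u) (Arr X)"

definition op :: "('o, 'm) cat \<Rightarrow> ('o, 'm) cat" where
  "op C = \<lparr>Obj = Obj C, Arr = Arr C, Dom = Cod C, Cod = Dom C, Ide = Ide C,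
           Cmp = (\<lambda>g f. Cmp C f g)\<rparr>"

definition is_iso :: "('o, 'm) cat \<Rightarrow> 'm \<Rightarrow> bool" where
  "is_iso C f \<longleftrightarrow> f \<in> Arr C \<and>
    (\<exists>g \<in> hom C (Cod C f) (Dom C f). Cmp C g f = Ide C (Dom C f) \<and> Cmp C f g = Ide C (Cod C f))"

text \<open>
  Functors and natural transformations carry their source and target. Their
  action is extensional, so that equality of functors and of natural transformations is
  equality in HOL.
\<close>

record ('o, 'm, 'p, 'n) ftr =
  Src :: "('o, 'm) cat"
  Tgt :: "('p, 'n) cat"
  FOb :: "'o \<Rightarrow> 'p"
  FAr :: "'m \<Rightarrow> 'n"

definition Fun :: "('o, 'm) cat \<Rightarrow> ('p, 'n) cat \<Rightarrow> ('o, 'm, 'p, 'n) ftr set" where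
  "Fun C D = {F. Src F = C \<and> Tgt F = D \<and> category C \<and> category D
    \<and> FOb F \<in> Obj C \<rightarrow>\<^sub>E Obj D \<and> FAr F \<in> Arr C \<rightarrow>\<^sub>E Arr D
    \<and> (\<forall>f \<in> Arr C. FAr F f \<in> hom D (FOb F (Dom C f)) (FOb F (Cod C f)))
    \<and> (\<forall>x \<in> Obj C. FAr F (Ide C x) = Ide D (FOb F x))
    \<and> (\<forall>f \<in> Arr C. \<forall>g \<in> Arr C. Cod C f = Dom C g \<longrightarrow>
          FAr F (Cmp C g f) = Cmp D (FAr F g) (FAr F f))}"

definition idf :: "('o, 'm) cat \<Rightarrow> ('o, 'm, 'o, 'm) ftr" where
  "idf C = \<lparr>Src = C, Tgt = C, FOb = (\<lambda>x\<in>Obj C. x), FAr = (\<lambda>f\<in>Arr C. f)\<rparr>"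

definition fcomp :: "('p, 'n, 'q, 'k) ftr \<Rightarrow> ('o, 'm, 'p, 'n) ftr \<Rightarrow> ('o, 'm, 'q, 'k) ftr"
    (infixr "\<circ>\<^sub>F" 75) where
  "G \<circ>\<^sub>F F = \<lparr>Src = Src F, Tgt = Tgt G,
             FOb = (\<lambda>x\<in>Obj (Src F). FOb G (FOb F x)),
             FAr = (\<lambda>f\<in>Arr (Src F). FAr G (FAr F f))\<rparr>"

record ('o, 'm, 'p, 'n) nattrans =
  NSrc :: "('o, 'm, 'p, 'n) ftr"
  NTgt :: "('o, 'm, 'p, 'n) ftr"
  NCmp :: "'o \<Rightarrow> 'n"

definition Nat :: "('o, 'm, 'p, 'n) ftr \<Rightarrow> ('o, 'm, 'p, 'n) ftr
    \<Rightarrow> ('o, 'm, 'p, 'n) nattrans set" where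
  "Nat F G = {\<alpha>. NSrc \<alpha> = F \<and> NTgt \<alpha> = G \<and> Src F = Src G \<and> Tgt F = Tgt G
    \<and> F \<in> Fun (Src F) (Tgt F) \<and> G \<in> Fun (Src G) (Tgt G)
    \<and> NCmp \<alpha> \<in> extensional (Obj (Src F))
    \<and> (\<forall>x \<in> Obj (Src F). NCmp \<alpha> x \<in> hom (Tgt F) (FOb F x) (FOb G x))
    \<and> (\<forall>f \<in> Arr (Src F). Cmp (Tgt F) (NCmp \<alpha> (Cod (Src F) f)) (FAr F f)
          = Cmp (Tgt F) (FAr G f) (NCmp \<alpha> (Dom (Src F) f)))}"

definition NatIso :: "('o, 'm, 'p, 'n) ftr \<Rightarrow> ('o, 'm, 'p, 'n) ftr
    \<Rightarrow> ('o, 'm, 'p, 'n) nattrans set" where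
  "NatIso F G = {\<alpha> \<in> Nat F G. \<forall>x \<in> Obj (Src F). is_iso (Tgt F) (NCmp \<alpha> x)}"

definition idn :: "('o, 'm, 'p, 'n) ftr \<Rightarrow> ('o, 'm, 'p, 'n) nattrans" where
  "idn F = \<lparr>NSrc = F, NTgt = F, NCmp = (\<lambda>x\<in>Obj (Src F). Ide (Tgt F) (FOb F x))\<rparr>"

definition vcomp :: "('o, 'm, 'p, 'n) nattrans \<Rightarrow> ('o, 'm, 'p, 'n) nattrans \<Rightarrow> ('o, 'm, 'p, 'n) nattrans"
    (infixr "\<cdot>\<^sub>N" 70) where
  "\<beta> \<cdot>\<^sub>N \<alpha> = \<lparr>NSrc = NSrc \<alpha>, NTgt = NTgt \<beta>,
    NCmp = (\<lambda>x\<in>Obj (Src (NSrc \<alpha>)). Cmp (Tgt (NSrc \<alpha>)) (NCmp \<beta> x) (NCmp \<alpha> x))\<rparr>"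

text \<open>Whiskering: \<open>\<alpha> \<triangleleft> F\<close> is \<open>\<alpha> F\<close> (precomposition) and \<open>G \<triangleright> \<alpha>\<close> is \<open>G \<alpha>\<close> (postcomposition).\<close>

definition whisker_pre :: "('p, 'n, 'q, 'k) nattrans \<Rightarrow> ('o, 'm, 'p, 'n) ftr \<Rightarrow> ('o, 'm, 'q, 'k) nattrans"
    (infix "\<triangleleft>" 76) where
  "\<alpha> \<triangleleft> F = \<lparr>NSrc = NSrc \<alpha> \<circ>\<^sub>F F, NTgt = NTgt \<alpha> \<circ>\<^sub>F F,
            NCmp = (\<lambda>x\<in>Obj (Src F). NCmp \<alpha> (FOb F x))\<rparr>"

definition whisker_post :: "('p, 'n, 'q, 'k) ftr \<Rightarrow> ('o, 'm, 'p, 'n) nattrans \<Rightarrow> ('o, 'm, 'q, 'k) nattrans"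
    (infix "\<triangleright>" 76) where
  "G \<triangleright> \<alpha> = \<lparr>NSrc = G \<circ>\<^sub>F NSrc \<alpha>, NTgt = G \<circ>\<^sub>F NTgt \<alpha>,
            NCmp = (\<lambda>x\<in>Obj (Src (NSrc \<alpha>)). FAr G (NCmp \<alpha> x))\<rparr>"

definition functor_category :: "('o, 'm) cat \<Rightarrow> ('p, 'n) cat
    \<Rightarrow> (('o, 'm, 'p, 'n) ftr, ('o, 'm, 'p, 'n) nattrans) cat" where
  "functor_category C D = \<lparr>Obj = Fun C D, Arr = (\<Union>F\<in>Fun C D. \<Union>G\<in>Fun C D. Nat F G),
     Dom = NSrc, Cod = NTgt, Ide = idn, Cmp = vcomp\<rparr>"


section \<open>The three 2-monads\<close>

text \<open>
  \<open>S\<close> sends a category \<open>A\<close> to the free category with chosen structure (of the given kind) on \<open>A\<close>;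
  it is the 2-monad of the forgetful 2-functor from categories with chosen structure and
  functors preserving that structure strictly, so its strict algebras are the
  categories with chosen structure. The free category is the syntactic one: terms for
  objects and arrows modulo provable equality.
\<close>

datatype limkind = TerminalObject | FiniteProducts | FiniteLimits

text \<open>
  In \<open>OPb X Y f g\<close> the arrows are \<open>f : X \<rightarrow> Z\<close> and \<open>g : Y \<rightarrow> Z\<close>; \<open>MPb1 X Y f g\<close> and \<open>MPb2 X Y f g\<close> are the
  projections of that pullback, and \<open>MLift X Y f g h k\<close> is the arrow into it induced by \<open>h\<close> and \<open>k\<close>.
\<close>

datatype ('o, 'm) otm =
    OGen 'o
  | OOne
  | OProd "('o, 'm) otm" "('o, 'm) otm"
  | OPb "('o, 'm) otm" "('o, 'm) otm" "('o, 'm) mtm" "('o, 'm) mtm"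
and ('o, 'm) mtm =
    MGen 'm
  | MId "('o, 'm) otm"
  | MComp "('o, 'm) mtm" "('o, 'm) mtm"
  | MBang "('o, 'm) otm"
  | MPr1 "('o, 'm) otm" "('o, 'm) otm"
  | MPr2 "('o, 'm) otm" "('o, 'm) otm"
  | MPair "('o, 'm) mtm" "('o, 'm) mtm"
  | MPb1 "('o, 'm) otm" "('o, 'm) otm" "('o, 'm) mtm" "('o, 'm) mtm"
  | MPb2 "('o, 'm) otm" "('o, 'm) otm" "('o, 'm) mtm" "('o, 'm) mtm"
  | MLift "('o, 'm) otm" "('o, 'm) otm" "('o, 'm) mtm" "('o, 'm) mtm" "('o, 'm) mtm" "('o, 'm) mtm"

text \<open>
  \<open>oeq K A X X'\<close> says that \<open>X\<close> and \<open>X'\<close> are well-formed and equal object terms over \<open>A\<close>, and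
  \<open>aeq K A X Y f f'\<close> that \<open>f\<close> and \<open>f'\<close> are well-formed and equal arrow terms \<open>X \<rightarrow> Y\<close>. Well-formedness is
  \<open>oeq K A X X\<close>, respectively \<open>aeq K A X Y f f\<close>.
\<close>

inductive oeq :: "limkind \<Rightarrow> ('o, 'm) cat \<Rightarrow> ('o, 'm) otm \<Rightarrow> ('o, 'm) otm \<Rightarrow> bool"
  and aeq :: "limkind \<Rightarrow> ('o, 'm) cat \<Rightarrow> ('o, 'm) otm \<Rightarrow> ('o, 'm) otm
    \<Rightarrow> ('o, 'm) mtm \<Rightarrow> ('o, 'm) mtm \<Rightarrow> bool"
  for K :: limkind and A :: "('o, 'm) cat"
where
  o_sym: "oeq K A X Y \<Longrightarrow> oeq K A Y X"
| o_trans: "oeq K A X Y \<Longrightarrow> oeq K A Y Z \<Longrightarrow> oeq K A X Z"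
| a_sym: "aeq K A X Y f g \<Longrightarrow> aeq K A X Y g f"
| a_trans: "aeq K A X Y f g \<Longrightarrow> aeq K A X Y g h \<Longrightarrow> aeq K A X Y f h"
| a_conv: "aeq K A X Y f g \<Longrightarrow> oeq K A X X' \<Longrightarrow> oeq K A Y Y' \<Longrightarrow> aeq K A X' Y' f g"
| a_id: "oeq K A X X' \<Longrightarrow> aeq K A X X (MId X) (MId X')"
| a_comp: "aeq K A X Y f f' \<Longrightarrow> aeq K A Y Z g g' \<Longrightarrow> aeq K A X Z (MComp g f) (MComp g' f')"
| a_comp_id: "aeq K A X Y f f \<Longrightarrow> aeq K A X Y (MComp f (MId X)) f"
| a_id_comp: "aeq K A X Y f f \<Longrightarrow> aeq K A X Y (MComp (MId Y) f) f"
| a_assoc: "aeq K A X Y f f \<Longrightarrow> aeq K A Y Z g g \<Longrightarrow> aeq K A Z W h h \<Longrightarrow>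
    aeq K A X W (MComp h (MComp g f)) (MComp (MComp h g) f)"
| o_gen: "x \<in> Obj A \<Longrightarrow> oeq K A (OGen x) (OGen x)"
| a_gen: "m \<in> Arr A \<Longrightarrow> aeq K A (OGen (Dom A m)) (OGen (Cod A m)) (MGen m) (MGen m)"
| a_gen_id: "x \<in> Obj A \<Longrightarrow> aeq K A (OGen x) (OGen x) (MGen (Ide A x)) (MId (OGen x))"
| a_gen_comp: "m \<in> Arr A \<Longrightarrow> n \<in> Arr A \<Longrightarrow> Cod A m = Dom A n \<Longrightarrow>
    aeq K A (OGen (Dom A m)) (OGen (Cod A n)) (MGen (Cmp A n m)) (MComp (MGen n) (MGen m))"
| o_one: "oeq K A OOne OOne"
| a_bang: "oeq K A X X' \<Longrightarrow> aeq K A X OOne (MBang X) (MBang X')"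
| a_bang_unique: "aeq K A X OOne f f \<Longrightarrow> aeq K A X OOne f (MBang X)"
| o_prod: "K = FiniteProducts \<Longrightarrow> oeq K A X X' \<Longrightarrow> oeq K A Y Y' \<Longrightarrow>
    oeq K A (OProd X Y) (OProd X' Y')"
| a_pr1: "K = FiniteProducts \<Longrightarrow> oeq K A X X' \<Longrightarrow> oeq K A Y Y' \<Longrightarrow>
    aeq K A (OProd X Y) X (MPr1 X Y) (MPr1 X' Y')"
| a_pr2: "K = FiniteProducts \<Longrightarrow> oeq K A X X' \<Longrightarrow> oeq K A Y Y' \<Longrightarrow>
    aeq K A (OProd X Y) Y (MPr2 X Y) (MPr2 X' Y')"
| a_pair: "K = FiniteProducts \<Longrightarrow> aeq K A W X h h' \<Longrightarrow> aeq K A W Y k k' \<Longrightarrow>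
    aeq K A W (OProd X Y) (MPair h k) (MPair h' k')"
| a_pr1_pair: "K = FiniteProducts \<Longrightarrow> aeq K A W X h h \<Longrightarrow> aeq K A W Y k k \<Longrightarrow>
    aeq K A W X (MComp (MPr1 X Y) (MPair h k)) h"
| a_pr2_pair: "K = FiniteProducts \<Longrightarrow> aeq K A W X h h \<Longrightarrow> aeq K A W Y k k \<Longrightarrow>
    aeq K A W Y (MComp (MPr2 X Y) (MPair h k)) k"
| a_pair_unique: "K = FiniteProducts \<Longrightarrow>
    oeq K A X X \<Longrightarrow> oeq K A Y Y \<Longrightarrow> aeq K A W (OProd X Y) u u \<Longrightarrow>
    aeq K A W (OProd X Y) u (MPair (MComp (MPr1 X Y) u) (MComp (MPr2 X Y) u))"
| o_pb: "K = FiniteLimits \<Longrightarrow> oeq K A X X' \<Longrightarrow> oeq K A Y Y' \<Longrightarrow>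
    aeq K A X Z f f' \<Longrightarrow> aeq K A Y Z g g' \<Longrightarrow> oeq K A (OPb X Y f g) (OPb X' Y' f' g')"
| a_pb1: "K = FiniteLimits \<Longrightarrow> oeq K A X X' \<Longrightarrow> oeq K A Y Y' \<Longrightarrow>
    aeq K A X Z f f' \<Longrightarrow> aeq K A Y Z g g' \<Longrightarrow>
    aeq K A (OPb X Y f g) X (MPb1 X Y f g) (MPb1 X' Y' f' g')"
| a_pb2: "K = FiniteLimits \<Longrightarrow> oeq K A X X' \<Longrightarrow> oeq K A Y Y' \<Longrightarrow>
    aeq K A X Z f f' \<Longrightarrow> aeq K A Y Z g g' \<Longrightarrow>
    aeq K A (OPb X Y f g) Y (MPb2 X Y f g) (MPb2 X' Y' f' g')"
| a_pb_square: "K = FiniteLimits \<Longrightarrow> aeq K A X Z f f \<Longrightarrow> aeq K A Y Z g g \<Longrightarrow>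
    aeq K A (OPb X Y f g) Z (MComp f (MPb1 X Y f g)) (MComp g (MPb2 X Y f g))"
| a_lift: "K = FiniteLimits \<Longrightarrow> oeq K A X X' \<Longrightarrow> oeq K A Y Y' \<Longrightarrow>
    aeq K A X Z f f' \<Longrightarrow> aeq K A Y Z g g' \<Longrightarrow> aeq K A W X h h' \<Longrightarrow> aeq K A W Y k k' \<Longrightarrow>
    aeq K A W Z (MComp f h) (MComp g k) \<Longrightarrow>
    aeq K A W (OPb X Y f g) (MLift X Y f g h k) (MLift X' Y' f' g' h' k')"
| a_pb1_lift: "K = FiniteLimits \<Longrightarrow>
    aeq K A X Z f f \<Longrightarrow> aeq K A Y Z g g \<Longrightarrow> aeq K A W X h h \<Longrightarrow> aeq K A W Y k k \<Longrightarrow>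
    aeq K A W Z (MComp f h) (MComp g k) \<Longrightarrow>
    aeq K A W X (MComp (MPb1 X Y f g) (MLift X Y f g h k)) h"
| a_pb2_lift: "K = FiniteLimits \<Longrightarrow>
    aeq K A X Z f f \<Longrightarrow> aeq K A Y Z g g \<Longrightarrow> aeq K A W X h h \<Longrightarrow> aeq K A W Y k k \<Longrightarrow>
    aeq K A W Z (MComp f h) (MComp g k) \<Longrightarrow>
    aeq K A W Y (MComp (MPb2 X Y f g) (MLift X Y f g h k)) k"
| a_lift_unique: "K = FiniteLimits \<Longrightarrow> aeq K A X Z f f \<Longrightarrow> aeq K A Y Z g g \<Longrightarrow>
    aeq K A W (OPb X Y f g) u u \<Longrightarrow> aeq K A W (OPb X Y f g) v v \<Longrightarrow>
    aeq K A W X (MComp (MPb1 X Y f g) u) (MComp (MPb1 X Y f g) v) \<Longrightarrow>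
    aeq K A W Y (MComp (MPb2 X Y f g) u) (MComp (MPb2 X Y f g) v) \<Longrightarrow>
    aeq K A W (OPb X Y f g) u v"

type_synonym ('o, 'm) sob = "('o, 'm) otm set"
type_synonym ('o, 'm) sar = "('o, 'm) otm set \<times> ('o, 'm) mtm set \<times> ('o, 'm) otm set"

definition ocl :: "limkind \<Rightarrow> ('o, 'm) cat \<Rightarrow> ('o, 'm) otm \<Rightarrow> ('o, 'm) sob" where
  "ocl K A X = {X'. oeq K A X X'}"

definition acl :: "limkind \<Rightarrow> ('o, 'm) cat \<Rightarrow> ('o, 'm) otm \<Rightarrow> ('o, 'm) otm \<Rightarrow> ('o, 'm) mtm
    \<Rightarrow> ('o, 'm) sar" where
  "acl K A X Y f = (ocl K A X, {f'. aeq K A X Y f f'}, ocl K A Y)"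

definition rep :: "'a set \<Rightarrow> 'a" where
  "rep c = (SOME x. x \<in> c)"

abbreviation sdom :: "('o, 'm) sar \<Rightarrow> ('o, 'm) sob" where "sdom \<phi> \<equiv> fst \<phi>"
abbreviation scls :: "('o, 'm) sar \<Rightarrow> ('o, 'm) mtm set" where "scls \<phi> \<equiv> fst (snd \<phi>)"
abbreviation scod :: "('o, 'm) sar \<Rightarrow> ('o, 'm) sob" where "scod \<phi> \<equiv> snd (snd \<phi>)"

definition S_cat :: "limkind \<Rightarrow> ('o, 'm) cat \<Rightarrow> (('o, 'm) sob, ('o, 'm) sar) cat" where
  "S_cat K A = \<lparr>Obj = {ocl K A X | X. oeq K A X X},
     Arr = {acl K A X Y f | X Y f. aeq K A X Y f f},
     Dom = (\<lambda>\<phi>. sdom \<phi>), Cod = (\<lambda>\<phi>. scod \<phi>),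
     Ide = (\<lambda>c. acl K A (rep c) (rep c) (MId (rep c))),
     Cmp = (\<lambda>\<psi> \<phi>. acl K A (rep (sdom \<phi>)) (rep (scod \<psi>)) (MComp (rep (scls \<psi>)) (rep (scls \<phi>))))\<rparr>"

definition S_functor :: "limkind \<Rightarrow> ('o, 'm, 'p, 'n) ftr
    \<Rightarrow> (('o, 'm) sob, ('o, 'm) sar, ('p, 'n) sob, ('p, 'n) sar) ftr" where
  "S_functor K F = \<lparr>Src = S_cat K (Src F), Tgt = S_cat K (Tgt F),
     FOb = (\<lambda>c\<in>Obj (S_cat K (Src F)). ocl K (Tgt F) (map_otm (FOb F) (FAr F) (rep c))),
     FAr = (\<lambda>\<phi>\<in>Arr (S_cat K (Src F)). acl K (Tgt F)
        (map_otm (FOb F) (FAr F) (rep (sdom \<phi>))) (map_otm (FOb F) (FAr F) (rep (scod \<phi>)))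
        (map_mtm (FOb F) (FAr F) (rep (scls \<phi>))))\<rparr>"

text \<open>The component at an object term of the image under \<open>S\<close> of a natural transformation \<open>\<alpha>\<close>: limits
  are functorial in their diagrams.\<close>

primrec S_component :: "('o, 'm, 'p, 'n) nattrans \<Rightarrow> ('o, 'm) otm \<Rightarrow> ('p, 'n) mtm" where
  "S_component \<alpha> (OGen x) = MGen (NCmp \<alpha> x)"
| "S_component \<alpha> OOne = MId OOne"
| "S_component \<alpha> (OProd X Y) =
    (let F = NSrc \<alpha>; FX = map_otm (FOb F) (FAr F) X; FY = map_otm (FOb F) (FAr F) Y
     in MPair (MComp (S_component \<alpha> X) (MPr1 FX FY)) (MComp (S_component \<alpha> Y) (MPr2 FX FY)))"
| "S_component \<alpha> (OPb X Y f g) =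
    (let F = NSrc \<alpha>; FX = map_otm (FOb F) (FAr F) X; FY = map_otm (FOb F) (FAr F) Y;
         Ff = map_mtm (FOb F) (FAr F) f; Fg = map_mtm (FOb F) (FAr F) g;
         G = NTgt \<alpha>; GX = map_otm (FOb G) (FAr G) X; GY = map_otm (FOb G) (FAr G) Y;
         Gf = map_mtm (FOb G) (FAr G) f; Gg = map_mtm (FOb G) (FAr G) g
     in MLift GX GY Gf Gg (MComp (S_component \<alpha> X) (MPb1 FX FY Ff Fg))
                          (MComp (S_component \<alpha> Y) (MPb2 FX FY Ff Fg)))"

definition S_nattrans :: "limkind \<Rightarrow> ('o, 'm, 'p, 'n) nattrans
    \<Rightarrow> (('o, 'm) sob, ('o, 'm) sar, ('p, 'n) sob, ('p, 'n) sar) nattrans" where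
  "S_nattrans K \<alpha> = \<lparr>NSrc = S_functor K (NSrc \<alpha>), NTgt = S_functor K (NTgt \<alpha>),
     NCmp = (\<lambda>c\<in>Obj (S_cat K (Src (NSrc \<alpha>))). acl K (Tgt (NSrc \<alpha>))
        (map_otm (FOb (NSrc \<alpha>)) (FAr (NSrc \<alpha>)) (rep c))
        (map_otm (FOb (NTgt \<alpha>)) (FAr (NTgt \<alpha>)) (rep c))
        (S_component \<alpha> (rep c)))\<rparr>"

definition S_unit :: "limkind \<Rightarrow> ('o, 'm) cat \<Rightarrow> ('o, 'm, ('o, 'm) sob, ('o, 'm) sar) ftr" where
  "S_unit K A = \<lparr>Src = A, Tgt = S_cat K A,
     FOb = (\<lambda>x\<in>Obj A. ocl K A (OGen x)),
     FAr = (\<lambda>m\<in>Arr A. acl K A (OGen (Dom A m)) (OGen (Cod A m)) (MGen m))\<rparr>"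

primrec flatten_o :: "(('o, 'm) sob, ('o, 'm) sar) otm \<Rightarrow> ('o, 'm) otm"
  and flatten_m :: "(('o, 'm) sob, ('o, 'm) sar) mtm \<Rightarrow> ('o, 'm) mtm" where
  "flatten_o (OGen c) = rep c"
| "flatten_o OOne = OOne"
| "flatten_o (OProd X Y) = OProd (flatten_o X) (flatten_o Y)"
| "flatten_o (OPb X Y f g) = OPb (flatten_o X) (flatten_o Y) (flatten_m f) (flatten_m g)"
| "flatten_m (MGen \<phi>) = rep (scls \<phi>)"
| "flatten_m (MId X) = MId (flatten_o X)"
| "flatten_m (MComp g f) = MComp (flatten_m g) (flatten_m f)"
| "flatten_m (MBang X) = MBang (flatten_o X)"
| "flatten_m (MPr1 X Y) = MPr1 (flatten_o X) (flatten_o Y)"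
| "flatten_m (MPr2 X Y) = MPr2 (flatten_o X) (flatten_o Y)"
| "flatten_m (MPair h k) = MPair (flatten_m h) (flatten_m k)"
| "flatten_m (MPb1 X Y f g) = MPb1 (flatten_o X) (flatten_o Y) (flatten_m f) (flatten_m g)"
| "flatten_m (MPb2 X Y f g) = MPb2 (flatten_o X) (flatten_o Y) (flatten_m f) (flatten_m g)"
| "flatten_m (MLift X Y f g h k) = MLift (flatten_o X) (flatten_o Y) (flatten_m f) (flatten_m g)
     (flatten_m h) (flatten_m k)"

definition S_mult :: "limkind \<Rightarrow> ('o, 'm) cat
    \<Rightarrow> ((('o, 'm) sob, ('o, 'm) sar) sob, (('o, 'm) sob, ('o, 'm) sar) sar,
        ('o, 'm) sob, ('o, 'm) sar) ftr" where
  "S_mult K A = \<lparr>Src = S_cat K (S_cat K A), Tgt = S_cat K A,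
     FOb = (\<lambda>c\<in>Obj (S_cat K (S_cat K A)). ocl K A (flatten_o (rep c))),
     FAr = (\<lambda>\<phi>\<in>Arr (S_cat K (S_cat K A)).
        acl K A (flatten_o (rep (sdom \<phi>))) (flatten_o (rep (scod \<phi>))) (flatten_m (rep (scls \<phi>))))\<rparr>"


section \<open>Strict algebras, pseudomorphisms and algebra 2-cells\<close>

type_synonym ('o, 'm) algebra =
  "('o, 'm) cat \<times> (('o, 'm) sob, ('o, 'm) sar, 'o, 'm) ftr"

definition strict_algebra :: "limkind \<Rightarrow> ('o, 'm) algebra \<Rightarrow> bool" where
  "strict_algebra K = (\<lambda>(A, a). category A \<and> a \<in> Fun (S_cat K A) A
     \<and> a \<circ>\<^sub>F S_unit K A = idf A \<and> a \<circ>\<^sub>F S_functor K a = a \<circ>\<^sub>F S_mult K A)"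

definition S_Alg_CAT :: "'u itself \<Rightarrow> limkind \<Rightarrow> ('o, 'm) algebra set" where
  "S_Alg_CAT U K = {\<AA>. strict_algebra K \<AA> \<and> locally_small U (fst \<AA>)}"

definition S_Alg_Cat :: "limkind \<Rightarrow> ('u, 'u) algebra set" where
  "S_Alg_Cat K = {\<AA>. strict_algebra K \<AA> \<and> small_category (fst \<AA>)}"

type_synonym ('o, 'm, 'p, 'n) pseudo =
  "('o, 'm, 'p, 'n) ftr \<times> (('o, 'm) sob, ('o, 'm) sar, 'p, 'n) nattrans"

definition pseudomorphisms :: "limkind \<Rightarrow> ('o, 'm) algebra \<Rightarrow> ('p, 'n) algebra
    \<Rightarrow> ('o, 'm, 'p, 'n) pseudo set" where
  "pseudomorphisms K = (\<lambda>(A, a) (B, b). {(f, f').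
      f \<in> Fun A B \<and> f' \<in> NatIso (b \<circ>\<^sub>F S_functor K f) (f \<circ>\<^sub>F a)
    \<and> f' \<triangleleft> S_unit K A = idn f
    \<and> f' \<triangleleft> S_mult K A = (f' \<triangleleft> S_functor K a) \<cdot>\<^sub>N (b \<triangleright> S_nattrans K f')})"

definition pcomp :: "limkind \<Rightarrow> ('p, 'n, 'q, 'k) pseudo \<Rightarrow> ('o, 'm, 'p, 'n) pseudo
    \<Rightarrow> ('o, 'm, 'q, 'k) pseudo" where
  "pcomp K = (\<lambda>(g, g') (f, f'). (g \<circ>\<^sub>F f, (g \<triangleright> f') \<cdot>\<^sub>N (g' \<triangleleft> S_functor K f)))"

definition pid :: "('o, 'm) algebra \<Rightarrow> ('o, 'm, 'o, 'm) pseudo" where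
  "pid = (\<lambda>(A, a). (idf A, idn a))"

definition algebra_2cells :: "limkind \<Rightarrow> ('o, 'm) algebra \<Rightarrow> ('p, 'n) algebra
    \<Rightarrow> ('o, 'm, 'p, 'n) pseudo \<Rightarrow> ('o, 'm, 'p, 'n) pseudo \<Rightarrow> ('o, 'm, 'p, 'n) nattrans set" where
  "algebra_2cells K = (\<lambda>(A, a) (B, b) (f, f') (g, g'). {\<alpha> \<in> Nat f g.
      g' \<cdot>\<^sub>N (b \<triangleright> S_nattrans K \<alpha>) = (\<alpha> \<triangleleft> a) \<cdot>\<^sub>N f'})"


section \<open>The relative pseudomonad of presheaves\<close>

type_synonym 'u setarr = "'u set \<times> ('u \<Rightarrow> 'u) \<times> 'u set"

abbreviation app :: "'u setarr \<Rightarrow> 'u \<Rightarrow> 'u" where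
  "app \<phi> \<equiv> fst (snd \<phi>)"


definition Set_cat :: "('u set, 'u setarr) cat" where
  "Set_cat = \<lparr>Obj = {A. small TYPE('u) A},
     Arr = {(A, f, B) | A f B. small TYPE('u) A \<and> small TYPE('u) B \<and> f \<in> A \<rightarrow>\<^sub>E B},
     Dom = (\<lambda>\<phi>. fst \<phi>), Cod = (\<lambda>\<phi>. snd (snd \<phi>)),
     Ide = (\<lambda>A. (A, (\<lambda>x\<in>A. x), A)),
     Cmp = (\<lambda>\<psi> \<phi>. (fst \<phi>, compose (fst \<phi>) (app \<psi>) (app \<phi>), snd (snd \<psi>)))\<rparr>"

type_synonym 'u presheaf = "('u, 'u, 'u set, 'u setarr) ftr"
type_synonym 'u pshmap = "('u, 'u, 'u set, 'u setarr) nattrans"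
type_synonym 'u profunctor = "('u, 'u, 'u presheaf, 'u pshmap) ftr"
type_synonym 'u pshfunctor = "('u presheaf, 'u pshmap, 'u presheaf, 'u pshmap) ftr"

definition psh :: "('u, 'u) cat \<Rightarrow> ('u presheaf, 'u pshmap) cat" where
  "psh X = functor_category (op X) Set_cat"

definition representable :: "('u, 'u) cat \<Rightarrow> 'u \<Rightarrow> 'u presheaf" where
  "representable X x = \<lparr>Src = op X, Tgt = Set_cat,
     FOb = (\<lambda>z\<in>Obj X. hom X z x),
     FAr = (\<lambda>h\<in>Arr X. (hom X (Cod X h) x, (\<lambda>k\<in>hom X (Cod X h) x. Cmp X k h), hom X (Dom X h) x))\<rparr>"

definition yoneda :: "('u, 'u) cat \<Rightarrow> 'u profunctor" where
  "yoneda X = \<lparr>Src = X, Tgt = psh X,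
     FOb = (\<lambda>x\<in>Obj X. representable X x),
     FAr = (\<lambda>m\<in>Arr X. \<lparr>NSrc = representable X (Dom X m), NTgt = representable X (Cod X m),
        NCmp = (\<lambda>z\<in>Obj X. (hom X z (Dom X m), (\<lambda>k\<in>hom X z (Dom X m). Cmp X m k), hom X z (Cod X m)))\<rparr>)\<rparr>"

text \<open>
  The coend of \<open>F(x)(y) \<times> p(x)\<close> over \<open>x\<close> is the quotient of the set of triples \<open>(x, s, t)\<close> with
  \<open>s \<in> F(x)(y)\<close> and \<open>t \<in> p(x)\<close> by the equivalence relation generated by
  \<open>(x, s, p(h)(t)) \<sim> (x', F(h)(s), t)\<close> for \<open>h : x \<rightarrow> x'\<close>. To make it a subset of \<open>'u\<close>, a class is
  represented by the code of a chosen member.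
\<close>

definition triples :: "'u profunctor \<Rightarrow> 'u presheaf \<Rightarrow> 'u \<Rightarrow> ('u \<times> 'u \<times> 'u) set" where
  "triples F p y = {(x, s, t). x \<in> Obj (Src F) \<and> s \<in> FOb (FOb F x) y \<and> t \<in> FOb p x}"

definition coend_step :: "'u profunctor \<Rightarrow> 'u presheaf \<Rightarrow> 'u \<Rightarrow> (('u \<times> 'u \<times> 'u) \<times> ('u \<times> 'u \<times> 'u)) set" where
  "coend_step F p y = {((Dom (Src F) h, s, app (FAr p h) t), (Cod (Src F) h, app (NCmp (FAr F h) y) s, t))
     | h s t. h \<in> Arr (Src F) \<and> s \<in> FOb (FOb F (Dom (Src F) h)) y \<and> t \<in> FOb p (Cod (Src F) h)}"

definition coend_equiv :: "'u profunctor \<Rightarrow> 'u presheaf \<Rightarrow> 'u \<Rightarrow> (('u \<times> 'u \<times> 'u) \<times> ('u \<times> 'u \<times> 'u)) set" where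
  "coend_equiv F p y = (coend_step F p y \<union> (coend_step F p y)\<inverse>)\<^sup>*"

definition pack :: "'u \<times> 'u \<times> 'u \<Rightarrow> 'u" where
  "pack = (SOME e. inj e)"

definition unpack :: "'u \<Rightarrow> 'u \<times> 'u \<times> 'u" where
  "unpack = inv pack"

definition coend_class :: "'u profunctor \<Rightarrow> 'u presheaf \<Rightarrow> 'u \<Rightarrow> 'u \<times> 'u \<times> 'u \<Rightarrow> 'u" where
  "coend_class F p y w = pack (rep (coend_equiv F p y `` {w}))"

definition coend :: "'u profunctor \<Rightarrow> 'u presheaf \<Rightarrow> 'u \<Rightarrow> 'u set" where
  "coend F p y = coend_class F p y ` triples F p y"

definition ext_ob :: "('u, 'u) cat \<Rightarrow> 'u profunctor \<Rightarrow> 'u presheaf \<Rightarrow> 'u presheaf" where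
  "ext_ob Y F p = \<lparr>Src = op Y, Tgt = Set_cat,
     FOb = (\<lambda>y\<in>Obj Y. coend F p y),
     FAr = (\<lambda>h\<in>Arr Y. (coend F p (Cod Y h),
        (\<lambda>e\<in>coend F p (Cod Y h). case unpack e of (x, s, t) \<Rightarrow>
           coend_class F p (Dom Y h) (x, app (FAr (FOb F x) h) s, t)),
        coend F p (Dom Y h)))\<rparr>"

definition ext_ar :: "('u, 'u) cat \<Rightarrow> 'u profunctor \<Rightarrow> 'u pshmap \<Rightarrow> 'u pshmap" where
  "ext_ar Y F \<alpha> = \<lparr>NSrc = ext_ob Y F (NSrc \<alpha>), NTgt = ext_ob Y F (NTgt \<alpha>),
     NCmp = (\<lambda>y\<in>Obj Y. (coend F (NSrc \<alpha>) y,
        (\<lambda>e\<in>coend F (NSrc \<alpha>) y. case unpack e of (x, s, t) \<Rightarrow>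
           coend_class F (NTgt \<alpha>) y (x, s, app (NCmp \<alpha> x) t)),
        coend F (NTgt \<alpha>) y))\<rparr>"

text \<open>\<open>ext Y F\<close> is \<open>F\<^sup>* : P(X) \<rightarrow> P(Y)\<close>, and \<open>eta Y F\<close> is \<open>\<eta>\<^sub>F\<close>, for \<open>F : X \<rightarrow> P(Y)\<close>.\<close>

definition ext :: "('u, 'u) cat \<Rightarrow> 'u profunctor \<Rightarrow> 'u pshfunctor" where
  "ext Y F = \<lparr>Src = psh (Src F), Tgt = psh Y,
     FOb = (\<lambda>p\<in>Obj (psh (Src F)). ext_ob Y F p),
     FAr = (\<lambda>\<alpha>\<in>Arr (psh (Src F)). ext_ar Y F \<alpha>)\<rparr>"

definition eta :: "('u, 'u) cat \<Rightarrow> 'u profunctor \<Rightarrow> ('u, 'u, 'u presheaf, 'u pshmap) nattrans" where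
  "eta Y F = \<lparr>NSrc = F, NTgt = ext Y F \<circ>\<^sub>F yoneda (Src F),
     NCmp = (\<lambda>x\<in>Obj (Src F).
       \<lparr>NSrc = FOb F x, NTgt = ext_ob Y F (representable (Src F) x),
        NCmp = (\<lambda>y\<in>Obj Y. (FOb (FOb F x) y,
          (\<lambda>s\<in>FOb (FOb F x) y. coend_class F (representable (Src F) x) y (x, s, Ide (Src F) x)),
          coend F (representable (Src F) x) y))\<rparr>)\<rparr>"

text \<open>Here \<open>F : X \<rightarrow> P(Y)\<close> and \<open>G : Y \<rightarrow> P(Z)\<close>.\<close>

definition mu :: "('u, 'u) cat \<Rightarrow> ('u, 'u) cat \<Rightarrow> 'u profunctor \<Rightarrow> 'u profunctor
    \<Rightarrow> ('u presheaf, 'u pshmap, 'u presheaf, 'u pshmap) nattrans" where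
  "mu Y Z G F = (THE m. m \<in> NatIso (ext Z (ext Z G \<circ>\<^sub>F F)) (ext Z G \<circ>\<^sub>F ext Y F)
     \<and> (m \<triangleleft> yoneda (Src F)) \<cdot>\<^sub>N eta Z (ext Z G \<circ>\<^sub>F F) = ext Z G \<triangleright> eta Y F)"

definition theta :: "('u, 'u) cat \<Rightarrow> ('u presheaf, 'u pshmap, 'u presheaf, 'u pshmap) nattrans" where
  "theta X = (THE t. t \<in> NatIso (ext X (yoneda X)) (idf (psh X))
     \<and> (t \<triangleleft> yoneda X) \<cdot>\<^sub>N eta X (yoneda X) = idn (yoneda X))"


section \<open>Liftings\<close>

type_synonym 'u psh_algebra = "('u presheaf, 'u pshmap) algebra"
type_synonym 'u psh_action =
  "(('u presheaf, 'u pshmap) sob, ('u presheaf, 'u pshmap) sar, 'u presheaf, 'u pshmap) ftr"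
type_synonym 'u prof_pseudo = "('u, 'u, 'u presheaf, 'u pshmap) pseudo"
type_synonym 'u prof_2cell = "(('u, 'u) sob, ('u, 'u) sar, 'u presheaf, 'u pshmap) nattrans"
type_synonym 'u ext_2cell =
  "(('u presheaf, 'u pshmap) sob, ('u presheaf, 'u pshmap) sar, 'u presheaf, 'u pshmap) nattrans"

definition lift_ob :: "(('u, 'u) algebra \<Rightarrow> 'u psh_action) \<Rightarrow> ('u, 'u) algebra \<Rightarrow> 'u psh_algebra" where
  "lift_ob alg \<AA> = (psh (fst \<AA>), alg \<AA>)"

definition lift_ext :: "(('u, 'u) algebra \<Rightarrow> ('u, 'u) algebra \<Rightarrow> 'u prof_pseudo \<Rightarrow> 'u ext_2cell)
    \<Rightarrow> ('u, 'u) algebra \<Rightarrow> ('u, 'u) algebra \<Rightarrow> 'u prof_pseudo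
    \<Rightarrow> ('u presheaf, 'u pshmap, 'u presheaf, 'u pshmap) pseudo" where
  "lift_ext es \<AA> \<BB> F = (ext (fst \<BB>) (fst F), es \<AA> \<BB> F)"

definition lift_yoneda :: "(('u, 'u) algebra \<Rightarrow> 'u prof_2cell) \<Rightarrow> ('u, 'u) algebra \<Rightarrow> 'u prof_pseudo" where
  "lift_yoneda ys \<AA> = (yoneda (fst \<AA>), ys \<AA>)"

text \<open>
  A lifting consists of the actions \<open>alg \<AA>\<close> on \<open>P(\<AA>)\<close>, the pseudomorphism structures \<open>es \<AA> \<BB> F\<close> on
  \<open>F\<^sup>*\<close> for pseudomorphisms \<open>F : \<AA> \<rightarrow> P(\<BB>)\<close> (\<open>F\<close> is a functor together with its structure 2-cell), and
  the pseudomorphism structures \<open>ys \<AA>\<close> on the Yoneda embeddings.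
\<close>

definition is_lifting :: "limkind \<Rightarrow> (('u, 'u) algebra \<Rightarrow> 'u psh_action)
    \<Rightarrow> (('u, 'u) algebra \<Rightarrow> ('u, 'u) algebra \<Rightarrow> 'u prof_pseudo \<Rightarrow> 'u ext_2cell)
    \<Rightarrow> (('u, 'u) algebra \<Rightarrow> 'u prof_2cell) \<Rightarrow> bool" where
  "is_lifting K alg es ys \<longleftrightarrow>
    (\<forall>\<AA> \<in> S_Alg_Cat K. lift_ob alg \<AA> \<in> S_Alg_CAT TYPE('u) K)
  \<and> (\<forall>\<AA> \<in> S_Alg_Cat K. \<forall>\<BB> \<in> S_Alg_Cat K. \<forall>F \<in> pseudomorphisms K \<AA> (lift_ob alg \<BB>).
       lift_ext es \<AA> \<BB> F \<in> pseudomorphisms K (lift_ob alg \<AA>) (lift_ob alg \<BB>))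
  \<and> (\<forall>\<AA> \<in> S_Alg_Cat K. lift_yoneda ys \<AA> \<in> pseudomorphisms K \<AA> (lift_ob alg \<AA>))
  \<and> (\<forall>\<AA> \<in> S_Alg_Cat K. \<forall>\<BB> \<in> S_Alg_Cat K. \<forall>\<CC> \<in> S_Alg_Cat K.
       \<forall>F \<in> pseudomorphisms K \<AA> (lift_ob alg \<BB>). \<forall>G \<in> pseudomorphisms K \<BB> (lift_ob alg \<CC>).
       mu (fst \<BB>) (fst \<CC>) (fst G) (fst F)
         \<in> algebra_2cells K (lift_ob alg \<AA>) (lift_ob alg \<CC>)
             (lift_ext es \<AA> \<CC> (pcomp K (lift_ext es \<BB> \<CC> G) F))
             (pcomp K (lift_ext es \<BB> \<CC> G) (lift_ext es \<AA> \<BB> F)))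
  \<and> (\<forall>\<AA> \<in> S_Alg_Cat K. \<forall>\<BB> \<in> S_Alg_Cat K. \<forall>F \<in> pseudomorphisms K \<AA> (lift_ob alg \<BB>).
       eta (fst \<BB>) (fst F)
         \<in> algebra_2cells K \<AA> (lift_ob alg \<BB>) F (pcomp K (lift_ext es \<AA> \<BB> F) (lift_yoneda ys \<AA>)))
  \<and> (\<forall>\<AA> \<in> S_Alg_Cat K.
       theta (fst \<AA>)
         \<in> algebra_2cells K (lift_ob alg \<AA>) (lift_ob alg \<AA>)
             (lift_ext es \<AA> \<AA> (lift_yoneda ys \<AA>)) (pid (lift_ob alg \<AA>)))"

end

theory Submission
  imports Defs
begin

text \<open>
  The 2-monad \<open>S\<close> is property-like. A functor \<open>G\<close> out of the free category \<open>S_cat K A\<close> that sends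
  the chosen squares to limits is a right Kan extension along the unit: every natural family of
  arrows into \<open>G\<close> on generators extends uniquely to a transformation into \<open>G\<close>. Hence
  a functor carries a pseudomorphism structure iff it preserves the limits in question; the
  structure is then unique, its multiplication axiom is automatic, and every natural transformation
  between pseudomorphisms is an algebra 2-cell.

  What remains is about limits. Presheaf categories have pointwise chosen limits, which make them
  strict algebras by evaluation of terms, and the Yoneda embedding preserves limits. If \<open>F\<close> preserves the
  limits, then \<open>F(-)(y)\<close> is connected, sifted or flat respectively, so that the coend
  defining \<open>F\<^sup>*\<close> commutes with them. The transformations \<open>\<mu>\<close> and \<open>\<theta>\<close> are unique because \<open>F\<^sup>* p\<close> is generated
  by images of the elements of \<open>F\<^sup>*\<close> on representables.
\<close>

section \<open>Functors and natural transformations\<close>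

text \<open>Chosen limits are never computed with. They are compared only through universal
  properties, and equations between 2-cells are checked on generators, where all structure cells are
  identities. This is why one argument serves the three kinds of limit. The obstacle is the free
  category. Its object terms contain arrow terms, through pullbacks of cospans, and both are taken
  modulo derivable equality. A component at a pullback makes sense only once naturality at the two
  arrows of the cospan is known. A transformation can therefore be built neither on classes nor on
  objects first: it is defined by recursion on raw terms, and its typing, invariance and naturality
  are proved together along derivations. A second gap concerns the algebras. A strict algebra is
  given by equations, which do not say that its action sends formal limits to limits. The reason is
  that \<open>S\<close> is colax idempotent: the action is right adjoint to the unit of
  \<open>S\<close>, and the unit of this adjunction is an identity.\<close>

lemma homD: "f \<in> hom C x y \<Longrightarrow> f \<in> Arr C \<and> Dom C f = x \<and> Cod C f = y"
  by (simp add: hom_def)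

lemma (in category) hom_Obj: "f \<in> hom C x y \<Longrightarrow> x \<in> Obj C \<and> y \<in> Obj C"
  using dom_in cod_in by (auto simp: hom_def)

lemma Arr_hom: "f \<in> Arr C \<Longrightarrow> f \<in> hom C (Dom C f) (Cod C f)"
  by (simp add: hom_def)

lemma FunI:
  assumes "Src F = C" "Tgt F = D" "category C" "category D"
    and "FOb F \<in> extensional (Obj C)" "FAr F \<in> extensional (Arr C)"
    and "\<And>x. x \<in> Obj C \<Longrightarrow> FOb F x \<in> Obj D"
    and "\<And>x y f. f \<in> hom C x y \<Longrightarrow> FAr F f \<in> hom D (FOb F x) (FOb F y)"
    and "\<And>x. x \<in> Obj C \<Longrightarrow> FAr F (Ide C x) = Ide D (FOb F x)"
    and "\<And>x y z f g. f \<in> hom C x y \<Longrightarrow> g \<in> hom C y z \<Longrightarrow> FAr F (Cmp C g f) = Cmp D (FAr F g) (FAr F f)"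
  shows "F \<in> Fun C D"
proof -
  have "FAr F f \<in> hom D (FOb F (Dom C f)) (FOb F (Cod C f))" if "f \<in> Arr C" for f
    using assms(8) Arr_hom[OF that] by blast
  moreover have "FAr F (Cmp C g f) = Cmp D (FAr F g) (FAr F f)"
    if "f \<in> Arr C" "g \<in> Arr C" "Cod C f = Dom C g" for f g
    using assms(10)[of f "Dom C f" "Cod C f" g "Cod C g"] that by (simp add: hom_def)
  ultimately show ?thesis
    using assms by (auto simp: Fun_def PiE_iff dest: homD)
qed

section \<open>Functors, composites and identities\<close>

context
  fixes F C D assumes F: "F \<in> Fun C D"
begin

lemma Fun_Src: "Src F = C" and Fun_Tgt: "Tgt F = D"
  and Fun_cat: "category C" "category D"
  using F by (auto simp: Fun_def)

lemma Fun_Ob: "x \<in> Obj C \<Longrightarrow> FOb F x \<in> Obj D"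
  using F by (auto simp: Fun_def)

lemma Fun_hom: "f \<in> hom C x y \<Longrightarrow> FAr F f \<in> hom D (FOb F x) (FOb F y)"
  using F by (auto simp: Fun_def hom_def)

lemma Fun_Arr: "f \<in> Arr C \<Longrightarrow> FAr F f \<in> Arr D"
  using F by (auto simp: Fun_def hom_def)

lemma Fun_Ide: "x \<in> Obj C \<Longrightarrow> FAr F (Ide C x) = Ide D (FOb F x)"
  using F by (auto simp: Fun_def)

lemma Fun_Cmp: "f \<in> hom C x y \<Longrightarrow> g \<in> hom C y z \<Longrightarrow> FAr F (Cmp C g f) = Cmp D (FAr F g) (FAr F f)"
  using F by (auto simp: Fun_def hom_def)

lemma Fun_extensional: "FOb F \<in> extensional (Obj C)" "FAr F \<in> extensional (Arr C)"
  using F by (auto simp: Fun_def PiE_iff)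

end

lemma Fun_eqI:
  assumes "F \<in> Fun C D" "G \<in> Fun C D"
    and "\<And>x. x \<in> Obj C \<Longrightarrow> FOb F x = FOb G x"
    and "\<And>f. f \<in> Arr C \<Longrightarrow> FAr F f = FAr G f"
  shows "F = G"
proof -
  have "FOb F = FOb G"
    using assms(3) Fun_extensional(1)[OF assms(1)] Fun_extensional(1)[OF assms(2)]
    by (auto intro: extensionalityI)
  moreover have "FAr F = FAr G"
    using assms(4) Fun_extensional(2)[OF assms(1)] Fun_extensional(2)[OF assms(2)]
    by (auto intro: extensionalityI)
  ultimately show ?thesis
    using Fun_Src[OF assms(1)] Fun_Src[OF assms(2)] Fun_Tgt[OF assms(1)] Fun_Tgt[OF assms(2)]
    by (cases F; cases G) auto
qed

lemma idf_Fun: assumes C: "category C" shows "idf C \<in> Fun C C"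
proof (rule FunI)
  show "FAr (idf C) (Cmp C g f) = Cmp C (FAr (idf C) g) (FAr (idf C) f)"
    if "f \<in> hom C x y" "g \<in> hom C y z" for x y z f g
    using category.cmp_in[OF C that] that by (simp add: idf_def hom_def)
  show "FAr (idf C) f \<in> hom C (FOb (idf C) x) (FOb (idf C) y)" if "f \<in> hom C x y" for x y f
    using category.hom_Obj[OF C that] that by (simp add: idf_def hom_def)
  show "FAr (idf C) (Ide C x) = Ide C (FOb (idf C) x)" if "x \<in> Obj C" for x
    using category.ide_in[OF C that] that by (simp add: idf_def hom_def)
qed (use C in \<open>auto simp: idf_def\<close>)

lemma fcomp_Fun:
  assumes F: "F \<in> Fun C D" and G: "G \<in> Fun D E"
  shows "G \<circ>\<^sub>F F \<in> Fun C E"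
proof (rule FunI)
  have C: "category C" using F by (rule Fun_cat)
  show "category C" by fact
  show "category E" using Fun_cat[OF G] by simp
  show "FAr (G \<circ>\<^sub>F F) f \<in> hom E (FOb (G \<circ>\<^sub>F F) x) (FOb (G \<circ>\<^sub>F F) y)" if "f \<in> hom C x y" for f x y
    using that category.hom_Obj[OF C that] Fun_hom[OF G Fun_hom[OF F that]]
    by (auto simp: fcomp_def Fun_Src[OF F] dest: homD)
  show "FAr (G \<circ>\<^sub>F F) (Ide C x) = Ide E (FOb (G \<circ>\<^sub>F F) x)" if "x \<in> Obj C" for x
    using that category.ide_in[OF C that] Fun_Ob[OF F]
    by (auto simp: fcomp_def Fun_Src[OF F] Fun_Ide[OF F] Fun_Ide[OF G] dest: homD)
  show "FAr (G \<circ>\<^sub>F F) (Cmp C g f) = Cmp E (FAr (G \<circ>\<^sub>F F) g) (FAr (G \<circ>\<^sub>F F) f)"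
    if "f \<in> hom C x y" "g \<in> hom C y z" for f g x y z
    using that category.cmp_in[OF C that] Fun_Cmp[OF G Fun_hom[OF F that(1)] Fun_hom[OF F that(2)]]
    by (auto simp: fcomp_def Fun_Src[OF F] Fun_Cmp[OF F that] dest: homD)
qed (use Fun_Ob[OF F] Fun_Ob[OF G] in \<open>auto simp: fcomp_def Fun_Src[OF F] Fun_Tgt[OF G]\<close>)

lemma fcomp_FOb: "F \<in> Fun C D \<Longrightarrow> x \<in> Obj C \<Longrightarrow> FOb (G \<circ>\<^sub>F F) x = FOb G (FOb F x)"
  by (simp add: fcomp_def Fun_Src)

lemma fcomp_FAr: "F \<in> Fun C D \<Longrightarrow> f \<in> Arr C \<Longrightarrow> FAr (G \<circ>\<^sub>F F) f = FAr G (FAr F f)"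
  by (simp add: fcomp_def Fun_Src)

lemma fcomp_assoc:
  assumes "F \<in> Fun B C" "G \<in> Fun C D" "H \<in> Fun D E"
  shows "H \<circ>\<^sub>F (G \<circ>\<^sub>F F) = (H \<circ>\<^sub>F G) \<circ>\<^sub>F F"
  using assms Fun_Ob[OF assms(1)] Fun_Arr[OF assms(1)]
  by (auto simp: fcomp_def Fun_Src)

lemma fcomp_idf:
  assumes "F \<in> Fun C D" shows "F \<circ>\<^sub>F idf C = F" "idf D \<circ>\<^sub>F F = F"
proof -
  have *: "idf C \<in> Fun C C" "idf D \<in> Fun D D" using Fun_cat[OF assms] idf_Fun by auto
  show "F \<circ>\<^sub>F idf C = F"
    by (rule Fun_eqI[OF fcomp_Fun[OF *(1) assms] assms]) (auto simp: fcomp_def idf_def)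
  show "idf D \<circ>\<^sub>F F = F"
    by (rule Fun_eqI[OF fcomp_Fun[OF assms *(2)] assms])
      (use Fun_Ob[OF assms] Fun_Arr[OF assms] in \<open>auto simp: fcomp_def idf_def Fun_Src[OF assms]\<close>)
qed

section \<open>Natural transformations and whiskering\<close>

definition natural :: "('o, 'm, 'p, 'n) ftr \<Rightarrow> ('o, 'm, 'p, 'n) ftr \<Rightarrow> ('o \<Rightarrow> 'n) \<Rightarrow> bool" where
  "natural F G c \<longleftrightarrow> (\<forall>x \<in> Obj (Src F). c x \<in> hom (Tgt F) (FOb F x) (FOb G x))
    \<and> (\<forall>f x y. f \<in> hom (Src F) x y \<longrightarrow> Cmp (Tgt F) (c y) (FAr F f) = Cmp (Tgt F) (FAr G f) (c x))"

lemma Nat_iff: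
  assumes "F \<in> Fun C D" "G \<in> Fun C D"
  shows "\<alpha> \<in> Nat F G \<longleftrightarrow> NSrc \<alpha> = F \<and> NTgt \<alpha> = G \<and> NCmp \<alpha> \<in> extensional (Obj C) \<and> natural F G (NCmp \<alpha>)"
  using assms Fun_Src[OF assms(1)] Fun_Src[OF assms(2)] Fun_Tgt[OF assms(1)] Fun_Tgt[OF assms(2)]
  by (auto simp: Nat_def natural_def hom_def)

lemma Nat_Fun:
  assumes "\<alpha> \<in> Nat F G"
  shows "F \<in> Fun (Src F) (Tgt F)" "G \<in> Fun (Src F) (Tgt F)" "Src G = Src F" "Tgt G = Tgt F"
    "NSrc \<alpha> = F" "NTgt \<alpha> = G"
  using assms by (auto simp: Nat_def)

lemma Nat_hom: "\<alpha> \<in> Nat F G \<Longrightarrow> F \<in> Fun C D \<Longrightarrow> x \<in> Obj C \<Longrightarrow> NCmp \<alpha> x \<in> hom D (FOb F x) (FOb G x)"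
  using Fun_Src[of F C D] Fun_Tgt[of F C D] by (auto simp: Nat_def)

lemma Nat_nat: "\<alpha> \<in> Nat F G \<Longrightarrow> F \<in> Fun C D \<Longrightarrow> f \<in> hom C x y \<Longrightarrow>
    Cmp D (NCmp \<alpha> y) (FAr F f) = Cmp D (FAr G f) (NCmp \<alpha> x)"
  using Fun_Src[of F C D] Fun_Tgt[of F C D] by (auto simp: Nat_def hom_def)

lemma NatI:
  assumes "NSrc \<alpha> = F" "NTgt \<alpha> = G" "F \<in> Fun C D" "G \<in> Fun C D" "NCmp \<alpha> \<in> extensional (Obj C)"
    and "\<And>x. x \<in> Obj C \<Longrightarrow> NCmp \<alpha> x \<in> hom D (FOb F x) (FOb G x)"
    and "\<And>f x y. f \<in> hom C x y \<Longrightarrow> Cmp D (NCmp \<alpha> y) (FAr F f) = Cmp D (FAr G f) (NCmp \<alpha> x)"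
  shows "\<alpha> \<in> Nat F G"
  using assms by (auto simp: Nat_iff[OF assms(3,4)] natural_def Fun_Src[OF assms(3)] Fun_Tgt[OF assms(3)])

lemma Nat_eqI:
  assumes "\<alpha> \<in> Nat F G" "\<beta> \<in> Nat F G" "F \<in> Fun C D" "\<And>x. x \<in> Obj C \<Longrightarrow> NCmp \<alpha> x = NCmp \<beta> x"
  shows "\<alpha> = \<beta>"
proof -
  have "NCmp \<alpha> = NCmp \<beta>"
    by (rule extensionalityI[where A = "Obj C"]) (use assms Fun_Src[OF assms(3)] in \<open>auto simp: Nat_def\<close>)
  with assms(1,2) show ?thesis by (cases \<alpha>; cases \<beta>) (auto simp: Nat_def)
qed

lemma idn_Nat:
  assumes F: "F \<in> Fun C D" shows "idn F \<in> Nat F F"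
proof (rule NatI[OF _ _ F F])
  have D: "category D" using Fun_cat[OF F] by simp
  show "NCmp (idn F) x \<in> hom D (FOb F x) (FOb F x)" if "x \<in> Obj C" for x
    using that Fun_Ob[OF F that] D by (simp add: idn_def Fun_Src[OF F] Fun_Tgt[OF F] category.ide_in)
  show "Cmp D (NCmp (idn F) y) (FAr F f) = Cmp D (FAr F f) (NCmp (idn F) x)" if "f \<in> hom C x y" for f x y
  proof -
    have "x \<in> Obj C" "y \<in> Obj C" using category.hom_Obj[OF Fun_cat(1)[OF F] that] by auto
    then show ?thesis
      using category.ide_cmp[OF D Fun_hom[OF F that]] category.cmp_ide[OF D Fun_hom[OF F that]]
      by (simp add: idn_def Fun_Src[OF F] Fun_Tgt[OF F])
  qed
qed (auto simp: idn_def Fun_Src[OF F])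

lemma idn_NCmp: "F \<in> Fun C D \<Longrightarrow> x \<in> Obj C \<Longrightarrow> NCmp (idn F) x = Ide D (FOb F x)"
  by (simp add: idn_def Fun_Src Fun_Tgt)

lemma vcomp_Nat:
  assumes "\<alpha> \<in> Nat F G" "\<beta> \<in> Nat G H" shows "\<beta> \<cdot>\<^sub>N \<alpha> \<in> Nat F H"
proof -
  define C D where "C = Src F" and "D = Tgt F"
  have F: "F \<in> Fun C D" and G: "G \<in> Fun C D" and H: "H \<in> Fun C D" and s: "NSrc \<alpha> = F" "NTgt \<beta> = H"
    using assms by (auto simp: Nat_def C_def D_def)
  have D: "category D" and C: "category C" using Fun_cat[OF F] by auto
  note n = Nat_hom[OF assms(1) F] Nat_hom[OF assms(2) G]
  show ?thesis
  proof (rule NatI[OF _ _ F H])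
    show "NCmp (\<beta> \<cdot>\<^sub>N \<alpha>) x \<in> hom D (FOb F x) (FOb H x)" if "x \<in> Obj C" for x
      using that n[OF that] D by (auto simp: vcomp_def s Fun_Src[OF F] Fun_Tgt[OF F] intro: category.cmp_in)
    show "Cmp D (NCmp (\<beta> \<cdot>\<^sub>N \<alpha>) y) (FAr F f) = Cmp D (FAr H f) (NCmp (\<beta> \<cdot>\<^sub>N \<alpha>) x)"
      if f: "f \<in> hom C x y" for f x y
    proof -
      have xy: "x \<in> Obj C" "y \<in> Obj C" using category.hom_Obj[OF C f] by auto
      have "Cmp D (Cmp D (NCmp \<beta> y) (NCmp \<alpha> y)) (FAr F f) = Cmp D (NCmp \<beta> y) (Cmp D (NCmp \<alpha> y) (FAr F f))"
        using category.cmp_assoc[OF D Fun_hom[OF F f] n[OF xy(2)]] by simp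
      also have "\<dots> = Cmp D (Cmp D (NCmp \<beta> y) (FAr G f)) (NCmp \<alpha> x)"
        using category.cmp_assoc[OF D n(1)[OF xy(1)] Fun_hom[OF G f] n(2)[OF xy(2)]]
        by (simp add: Nat_nat[OF assms(1) F f])
      also have "\<dots> = Cmp D (FAr H f) (Cmp D (NCmp \<beta> x) (NCmp \<alpha> x))"
        using category.cmp_assoc[OF D n[OF xy(1)] Fun_hom[OF H f]]
        by (simp add: Nat_nat[OF assms(2) G f])
      finally show ?thesis using xy by (simp add: vcomp_def s Fun_Src[OF F] Fun_Tgt[OF F])
    qed
  qed (auto simp: vcomp_def s Fun_Src[OF F])
qed

lemma vcomp_NCmp: "\<alpha> \<in> Nat F G \<Longrightarrow> F \<in> Fun C D \<Longrightarrow> x \<in> Obj C \<Longrightarrow>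
    NCmp (\<beta> \<cdot>\<^sub>N \<alpha>) x = Cmp D (NCmp \<beta> x) (NCmp \<alpha> x)"
  using Fun_Src[of F C D] Fun_Tgt[of F C D] Nat_Fun(5)[of \<alpha> F G] by (simp add: vcomp_def)

lemma whisker_pre_Nat:
  assumes a: "\<alpha> \<in> Nat G H" and F: "F \<in> Fun B C" and G: "G \<in> Fun C D"
  shows "\<alpha> \<triangleleft> F \<in> Nat (G \<circ>\<^sub>F F) (H \<circ>\<^sub>F F)"
proof -
  have H: "H \<in> Fun C D" using Nat_Fun[OF a] G by (simp add: Fun_Src[OF G] Fun_Tgt[OF G])
  have B: "category B" using Fun_cat[OF F] by simp
  show ?thesis
  proof (rule NatI[OF _ _ fcomp_Fun[OF F G] fcomp_Fun[OF F H]])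
    show "Cmp D (NCmp (\<alpha> \<triangleleft> F) y) (FAr (G \<circ>\<^sub>F F) f) = Cmp D (FAr (H \<circ>\<^sub>F F) f) (NCmp (\<alpha> \<triangleleft> F) x)"
      if f: "f \<in> hom B x y" for f x y
      using category.hom_Obj[OF B f] homD[OF f] Nat_nat[OF a G Fun_hom[OF F f]]
      by (simp add: whisker_pre_def Fun_Src[OF F] fcomp_FAr[OF F])
    show "NCmp (\<alpha> \<triangleleft> F) x \<in> hom D (FOb (G \<circ>\<^sub>F F) x) (FOb (H \<circ>\<^sub>F F) x)" if "x \<in> Obj B" for x
      using that Nat_hom[OF a G Fun_Ob[OF F that]]
      by (simp add: whisker_pre_def Fun_Src[OF F] fcomp_FOb[OF F])
  qed (use Nat_Fun[OF a] in \<open>auto simp: whisker_pre_def Fun_Src[OF F]\<close>)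
qed

lemma whisker_pre_NCmp: "F \<in> Fun B C \<Longrightarrow> x \<in> Obj B \<Longrightarrow> NCmp (\<alpha> \<triangleleft> F) x = NCmp \<alpha> (FOb F x)"
  by (simp add: whisker_pre_def Fun_Src)

lemma whisker_post_Nat:
  assumes a: "\<alpha> \<in> Nat F G" and F: "F \<in> Fun B C" and H: "H \<in> Fun C D"
  shows "H \<triangleright> \<alpha> \<in> Nat (H \<circ>\<^sub>F F) (H \<circ>\<^sub>F G)"
proof -
  have G: "G \<in> Fun B C" using Nat_Fun[OF a] by (simp add: Fun_Src[OF F] Fun_Tgt[OF F])
  have B: "category B" using Fun_cat[OF F] by simp
  have s: "NSrc \<alpha> = F" "NTgt \<alpha> = G" using Nat_Fun[OF a] by auto
  show ?thesis
  proof (rule NatI[OF _ _ fcomp_Fun[OF F H] fcomp_Fun[OF G H]])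
    show "Cmp D (NCmp (H \<triangleright> \<alpha>) y) (FAr (H \<circ>\<^sub>F F) f) = Cmp D (FAr (H \<circ>\<^sub>F G) f) (NCmp (H \<triangleright> \<alpha>) x)"
      if f: "f \<in> hom B x y" for f x y
    proof -
      have xy: "x \<in> Obj B" "y \<in> Obj B" using category.hom_Obj[OF B f] by auto
      have "FAr H (Cmp C (NCmp \<alpha> y) (FAr F f)) = FAr H (Cmp C (FAr G f) (NCmp \<alpha> x))"
        by (simp add: Nat_nat[OF a F f])
      then show ?thesis
        using xy homD[OF f] Fun_Cmp[OF H Fun_hom[OF F f] Nat_hom[OF a F xy(2)]]
          Fun_Cmp[OF H Nat_hom[OF a F xy(1)] Fun_hom[OF G f]]
        by (simp add: whisker_post_def s Fun_Src[OF F] fcomp_FAr[OF F] fcomp_FAr[OF G])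
    qed
    show "NCmp (H \<triangleright> \<alpha>) x \<in> hom D (FOb (H \<circ>\<^sub>F F) x) (FOb (H \<circ>\<^sub>F G) x)" if "x \<in> Obj B" for x
      using that Fun_hom[OF H Nat_hom[OF a F that]]
      by (simp add: whisker_post_def s Fun_Src[OF F] fcomp_FOb[OF F] fcomp_FOb[OF G])
  qed (auto simp: whisker_post_def s Fun_Src[OF F])
qed

lemma whisker_post_NCmp: "\<alpha> \<in> Nat F G \<Longrightarrow> F \<in> Fun B C \<Longrightarrow> x \<in> Obj B \<Longrightarrow> NCmp (H \<triangleright> \<alpha>) x = FAr H (NCmp \<alpha> x)"
  using Fun_Src[of F B C] Nat_Fun(5)[of \<alpha> F G] by (simp add: whisker_post_def)

section \<open>Isomorphisms and invertible transformations\<close>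

lemma (in category) is_iso_iff: "f \<in> hom C x y \<Longrightarrow>
    is_iso C f \<longleftrightarrow> (\<exists>g \<in> hom C y x. Cmp C g f = Ide C x \<and> Cmp C f g = Ide C y)"
  by (auto simp: is_iso_def hom_def)

lemma (in category) cmp_assoc4:
  assumes "f \<in> hom C x y" "g \<in> hom C y z" "h \<in> hom C z w" "k \<in> hom C w v"
  shows "Cmp C (Cmp C k h) (Cmp C g f) = Cmp C k (Cmp C (Cmp C h g) f)"
  using cmp_assoc[OF cmp_in[OF assms(1,2)] assms(3,4)] cmp_assoc[OF assms(1,2,3)] by simp

lemma (in category) is_iso_cmp:
  assumes "f \<in> hom C x y" "g \<in> hom C y z" "is_iso C f" "is_iso C g" shows "is_iso C (Cmp C g f)"
proof -
  obtain f' where f': "f' \<in> hom C y x" "Cmp C f' f = Ide C x" "Cmp C f f' = Ide C y"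
    using assms is_iso_iff by blast
  obtain g' where g': "g' \<in> hom C z y" "Cmp C g' g = Ide C y" "Cmp C g g' = Ide C z"
    using assms is_iso_iff by blast
  have "Cmp C (Cmp C f' g') (Cmp C g f) = Cmp C f' (Cmp C (Cmp C g' g) f)"
    by (rule cmp_assoc4[OF assms(1,2) g'(1) f'(1)])
  moreover have "Cmp C (Cmp C g f) (Cmp C f' g') = Cmp C g (Cmp C (Cmp C f f') g')"
    by (rule cmp_assoc4[OF g'(1) f'(1) assms(1,2)])
  ultimately have "Cmp C (Cmp C f' g') (Cmp C g f) = Ide C x" "Cmp C (Cmp C g f) (Cmp C f' g') = Ide C z"
    using f' g' ide_cmp[OF assms(1)] ide_cmp[OF g'(1)] by simp_all
  then show ?thesis
    using is_iso_iff[OF cmp_in[OF assms(1,2)]] cmp_in[OF g'(1) f'(1)] by blast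
qed

lemma (in category) is_iso_ide: "x \<in> Obj C \<Longrightarrow> is_iso C (Ide C x)"
  using ide_in[of x] is_iso_iff[OF ide_in[of x]] cmp_ide[OF ide_in[of x]] by blast

lemma Fun_iso:
  assumes F: "F \<in> Fun C D" and f: "f \<in> hom C x y" "is_iso C f" shows "is_iso D (FAr F f)"
proof -
  have C: "category C" and D: "category D" using Fun_cat[OF F] by auto
  obtain g where g: "g \<in> hom C y x" "Cmp C g f = Ide C x" "Cmp C f g = Ide C y"
    using f category.is_iso_iff[OF C f(1)] by blast
  have "Cmp D (FAr F g) (FAr F f) = Ide D (FOb F x)" "Cmp D (FAr F f) (FAr F g) = Ide D (FOb F y)"
    using Fun_Cmp[OF F f(1) g(1)] Fun_Cmp[OF F g(1) f(1)] g category.hom_Obj[OF C f(1)]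
    by (auto simp: Fun_Ide[OF F])
  then show ?thesis
    using category.is_iso_iff[OF D Fun_hom[OF F f(1)]] Fun_hom[OF F g(1)] by blast
qed

lemma idn_NatIso: assumes F: "F \<in> Fun C D" shows "idn F \<in> NatIso F F"
proof -
  have "is_iso D (NCmp (idn F) x)" if "x \<in> Obj C" for x
    using that Fun_Ob[OF F that] Fun_cat[OF F]
    by (simp add: idn_def Fun_Src[OF F] Fun_Tgt[OF F] category.is_iso_ide)
  then show ?thesis
    using idn_Nat[OF F] by (auto simp: NatIso_def Fun_Src[OF F] Fun_Tgt[OF F])
qed

lemma NatIso_iff: "F \<in> Fun C D \<Longrightarrow> \<alpha> \<in> NatIso F G \<longleftrightarrow> \<alpha> \<in> Nat F G \<and> (\<forall>x\<in>Obj C. is_iso D (NCmp \<alpha> x))"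
  using Fun_Src[of F C D] Fun_Tgt[of F C D] by (auto simp: NatIso_def)

lemma vcomp_NatIso:
  assumes a: "\<alpha> \<in> NatIso F G" and b: "\<beta> \<in> NatIso G H" and F: "F \<in> Fun C D"
  shows "\<beta> \<cdot>\<^sub>N \<alpha> \<in> NatIso F H"
proof -
  have G: "G \<in> Fun C D" using a Nat_Fun[of \<alpha> F G] F by (simp add: NatIso_def Fun_Src[OF F] Fun_Tgt[OF F])
  have ab: "\<alpha> \<in> Nat F G" "\<beta> \<in> Nat G H" using a b by (auto simp: NatIso_def)
  have "is_iso D (NCmp (\<beta> \<cdot>\<^sub>N \<alpha>) x)" if "x \<in> Obj C" for x
    using category.is_iso_cmp[OF Fun_cat(2)[OF F] Nat_hom[OF ab(1) F that] Nat_hom[OF ab(2) G that]] a b that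
    by (simp add: vcomp_NCmp[OF ab(1) F that] NatIso_iff[OF F] NatIso_iff[OF G])
  then show ?thesis using vcomp_Nat[OF ab] by (simp add: NatIso_iff[OF F])
qed

lemma whisker_pre_NatIso:
  assumes a: "\<alpha> \<in> NatIso G H" and F: "F \<in> Fun B C" and G: "G \<in> Fun C D"
  shows "\<alpha> \<triangleleft> F \<in> NatIso (G \<circ>\<^sub>F F) (H \<circ>\<^sub>F F)"
proof -
  have a': "\<alpha> \<in> Nat G H" using a by (simp add: NatIso_def)
  have "is_iso D (NCmp (\<alpha> \<triangleleft> F) x)" if x: "x \<in> Obj B" for x
    using a Fun_Ob[OF F x] by (simp add: whisker_pre_NCmp[OF F x] NatIso_iff[OF G])
  then show ?thesis using whisker_pre_Nat[OF a' F G] by (simp add: NatIso_iff[OF fcomp_Fun[OF F G]])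
qed

lemma whisker_post_NatIso:
  assumes a: "\<alpha> \<in> NatIso F G" and F: "F \<in> Fun B C" and H: "H \<in> Fun C D"
  shows "H \<triangleright> \<alpha> \<in> NatIso (H \<circ>\<^sub>F F) (H \<circ>\<^sub>F G)"
proof -
  have a': "\<alpha> \<in> Nat F G" using a by (simp add: NatIso_def)
  have "is_iso D (NCmp (H \<triangleright> \<alpha>) x)" if x: "x \<in> Obj B" for x
    using Fun_iso[OF H Nat_hom[OF a' F x]] a x by (simp add: whisker_post_NCmp[OF a' F x] NatIso_iff[OF F])
  then show ?thesis using whisker_post_Nat[OF a' F H] by (simp add: NatIso_iff[OF fcomp_Fun[OF F H]])
qed

section \<open>Functor categories\<close>

lemma functor_category_hom:
  "\<alpha> \<in> hom (functor_category C D) F G \<longleftrightarrow> F \<in> Fun C D \<and> G \<in> Fun C D \<and> \<alpha> \<in> Nat F G"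
proof -
  have "NSrc \<alpha> = F' \<and> NTgt \<alpha> = G'" if "\<alpha> \<in> Nat F' G'" for F' G'
    using Nat_Fun[OF that] by simp
  then show ?thesis unfolding functor_category_def hom_def by auto
qed

lemma category_functor_category: "category (functor_category C D)"
proof
  fix f g h x y z w
  show "Dom (functor_category C D) f \<in> Obj (functor_category C D)"
    "Cod (functor_category C D) f \<in> Obj (functor_category C D)" if "f \<in> Arr (functor_category C D)"
    using that unfolding functor_category_def by (auto dest: Nat_Fun(5) Nat_Fun(6))
  show "Ide (functor_category C D) x \<in> hom (functor_category C D) x x" if "x \<in> Obj (functor_category C D)"
    using that idn_Nat[of x C D] functor_category_hom[of "idn x" C D x x]
    by (simp add: functor_category_def)
  assume f: "f \<in> hom (functor_category C D) x y"
  then have fx: "f \<in> Nat x y" "x \<in> Fun C D" "y \<in> Fun C D" by (auto simp: functor_category_hom)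
  have D: "category D" using Fun_cat[OF fx(2)] by simp
  have f0: "Cmp (functor_category C D) = vcomp" "Ide (functor_category C D) = idn"
    by (auto simp: functor_category_def)
  show "Cmp (functor_category C D) f (Ide (functor_category C D) x) = f" unfolding f0
    by (rule Nat_eqI[OF vcomp_Nat[OF idn_Nat[OF fx(2)] fx(1)] fx(1,2)])
      (simp add: vcomp_NCmp[OF idn_Nat[OF fx(2)] fx(2)] idn_NCmp[OF fx(2)]
        category.cmp_ide[OF D Nat_hom[OF fx(1,2)]])
  show "Cmp (functor_category C D) (Ide (functor_category C D) y) f = f" unfolding f0
    by (rule Nat_eqI[OF vcomp_Nat[OF fx(1) idn_Nat[OF fx(3)]] fx(1,2)])
      (simp add: vcomp_NCmp[OF fx(1,2)] idn_NCmp[OF fx(3)]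
        category.ide_cmp[OF D Nat_hom[OF fx(1,2)]])
  assume g: "g \<in> hom (functor_category C D) y z"
  then have gx: "g \<in> Nat y z" "z \<in> Fun C D" by (auto simp: functor_category_hom)
  show "Cmp (functor_category C D) g f \<in> hom (functor_category C D) x z"
    using vcomp_Nat[OF fx(1) gx(1)] fx gx by (simp add: functor_category_hom f0)
  assume h: "h \<in> hom (functor_category C D) z w"
  then have hx: "h \<in> Nat z w" "w \<in> Fun C D" by (auto simp: functor_category_hom)
  show "Cmp (functor_category C D) h (Cmp (functor_category C D) g f)
      = Cmp (functor_category C D) (Cmp (functor_category C D) h g) f" unfolding f0
  proof (rule Nat_eqI[OF vcomp_Nat[OF vcomp_Nat[OF fx(1) gx(1)] hx(1)]
        vcomp_Nat[OF fx(1) vcomp_Nat[OF gx(1) hx(1)]] fx(2)])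
    fix u assume u: "u \<in> Obj C"
    show "NCmp (h \<cdot>\<^sub>N g \<cdot>\<^sub>N f) u = NCmp ((h \<cdot>\<^sub>N g) \<cdot>\<^sub>N f) u"
      using category.cmp_assoc[OF D Nat_hom[OF fx(1,2) u] Nat_hom[OF gx(1) fx(3) u] Nat_hom[OF hx(1) gx(2) u]]
      by (simp add: vcomp_NCmp[OF vcomp_Nat[OF fx(1) gx(1)] fx(2) u] vcomp_NCmp[OF fx(1,2) u]
          vcomp_NCmp[OF gx(1) fx(3) u])
  qed
qed

section \<open>Free categories with limits\<close>

lemma oeq_refl: "oeq K A X Y \<Longrightarrow> oeq K A X X" "oeq K A X Y \<Longrightarrow> oeq K A Y Y"
  by (blast intro: o_sym o_trans)+

lemma aeq_refl: "aeq K A X Y f g \<Longrightarrow> aeq K A X Y f f" "aeq K A X Y f g \<Longrightarrow> aeq K A X Y g g"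
  by (blast intro: a_sym a_trans)+

text \<open>The presupposition of the arrow judgement: source and target of a derivable equation are
  well-formed. The two judgements share one induction, so the object judgement needs a statement
  too, and \<open>True\<close> fills that place.\<close>

lemma oeq_aeq_wf:
  assumes A: "category A"
  shows "oeq K A X X' \<Longrightarrow> True"
    and "aeq K A X Y f f' \<Longrightarrow> oeq K A X X \<and> oeq K A Y Y"
proof (induction rule: oeq_aeq.inducts)
  case (a_gen m)
  then show ?case using category.dom_in[OF A] category.cod_in[OF A] by (blast intro: o_gen)
next
  case (a_gen_comp m n)
  then show ?case using category.dom_in[OF A] category.cod_in[OF A] by (blast intro: o_gen)
qed (blast intro: oeq_aeq.intros oeq_refl)+

lemmas aeq_wf = oeq_aeq_wf(2)

text \<open>Functors are constrained only on the objects and arrows of \<open>A\<close>. Since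
  derivable terms mention no other generators, two maps that agree on \<open>A\<close> have the same
  effect on well-formed terms.\<close>

lemma oeq_aeq_gens:
  assumes A: "category A"
  shows "oeq K A X X' \<Longrightarrow> set1_otm X \<subseteq> Obj A \<and> set2_otm X \<subseteq> Arr A \<and> set1_otm X' \<subseteq> Obj A \<and> set2_otm X' \<subseteq> Arr A"
    and "aeq K A X Y f f' \<Longrightarrow> set1_mtm f \<subseteq> Obj A \<and> set2_mtm f \<subseteq> Arr A \<and> set1_mtm f' \<subseteq> Obj A \<and> set2_mtm f' \<subseteq> Arr A
      \<and> set1_otm X \<subseteq> Obj A \<and> set2_otm X \<subseteq> Arr A \<and> set1_otm Y \<subseteq> Obj A \<and> set2_otm Y \<subseteq> Arr A"
proof (induction rule: oeq_aeq.inducts)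
  case (a_gen m)
  then show ?case using category.dom_in[OF A] category.cod_in[OF A] by auto
next
  case (a_gen_id m)
  then show ?case using category.ide_in[OF A, of m] by (auto dest: homD)
next
  case (a_gen_comp m n)
  then show ?case
    using category.dom_in[OF A] category.cod_in[OF A] category.cmp_in[OF A, of m "Dom A m" "Cod A m" n "Cod A n"]
    by (auto simp: hom_def)
qed simp_all

text \<open>The clause for \<open>OPb\<close> recovers the codomain of the cospan, which the term does not record.\<close>

primrec wf_parts :: "limkind \<Rightarrow> ('o, 'm) cat \<Rightarrow> ('o, 'm) otm \<Rightarrow> bool" where
  "wf_parts K A (OGen x) = (x \<in> Obj A)"
| "wf_parts K A OOne = True"
| "wf_parts K A (OProd X Y) = (K = FiniteProducts \<and> oeq K A X X \<and> oeq K A Y Y)"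
| "wf_parts K A (OPb X Y f g) = (K = FiniteLimits \<and> (\<exists>Z. aeq K A X Z f f \<and> aeq K A Y Z g g))"

text \<open>A derivation of well-formedness may end in symmetry or transitivity, so the parts of a
  term cannot be read off its last rule. Instead the property of having well-formed parts is shown
  to hold on both sides of every derivable equation.\<close>

lemma oeq_wf_parts:
  assumes A: "category A"
  shows "oeq K A X X' \<Longrightarrow> wf_parts K A X \<and> wf_parts K A X'" and "aeq K A X Y f f' \<Longrightarrow> True"
proof (induction rule: oeq_aeq.inducts)
  case (o_pb X X' Y Y' Z f f' g g')
  then have "aeq K A X' Z f' f'" "aeq K A Y' Z g' g'" "aeq K A X Z f f" "aeq K A Y Z g g"
    using a_conv[OF aeq_refl(2) o_pb(2)] a_conv[OF aeq_refl(2) o_pb(4)] aeq_wf[OF A] aeq_refl by blast+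
  then show ?case using o_pb by auto
qed (auto intro: oeq_refl)

lemma oeq_OProdD:
  assumes "category A" "oeq K A (OProd X Y) (OProd X Y)"
  shows "K = FiniteProducts" "oeq K A X X" "oeq K A Y Y"
  using oeq_wf_parts(1)[OF assms] by auto

lemma oeq_OPbE:
  assumes "category A" "oeq K A (OPb X Y f g) (OPb X Y f g)"
  obtains Z where "K = FiniteLimits" "aeq K A X Z f f" "aeq K A Y Z g g"
  using oeq_wf_parts(1)[OF assms] by auto

subsection \<open>Classes\<close>

lemma ocl_eq_iff: "oeq K A X X \<Longrightarrow> ocl K A X = ocl K A Y \<longleftrightarrow> oeq K A X Y"
  unfolding ocl_def by (blast intro: o_sym o_trans)

lemma ocl_eqI: "oeq K A X Y \<Longrightarrow> ocl K A X = ocl K A Y"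
  using ocl_eq_iff[OF oeq_refl(1)] by blast

lemma rep_ocl: "oeq K A X X \<Longrightarrow> oeq K A X (rep (ocl K A X))"
  unfolding rep_def ocl_def by (metis mem_Collect_eq someI)

lemma acl_sel [simp]: "sdom (acl K A X Y f) = ocl K A X" "scod (acl K A X Y f) = ocl K A Y"
  "scls (acl K A X Y f) = {f'. aeq K A X Y f f'}"
  by (simp_all add: acl_def)

lemma rep_acl: "aeq K A X Y f f \<Longrightarrow> aeq K A X Y f (rep {f'. aeq K A X Y f f'})"
  unfolding rep_def by (metis mem_Collect_eq someI)

lemma acl_eqI:
  assumes "aeq K A X Y f f'" "oeq K A X X'" "oeq K A Y Y'"
  shows "acl K A X Y f = acl K A X' Y' f'"
proof -
  have "aeq K A X Y f h \<longleftrightarrow> aeq K A X' Y' f' h" for h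
    using assms by (blast intro: a_sym a_trans a_conv o_sym)
  then show ?thesis by (auto simp: acl_def ocl_eqI[OF assms(2)] ocl_eqI[OF assms(3)])
qed

lemma acl_eqI': "category A \<Longrightarrow> aeq K A X Y f f' \<Longrightarrow> acl K A X Y f = acl K A X Y f'"
  by (meson acl_eqI aeq_wf)

lemma acl_eqD: "acl K A X Y f = acl K A X Y f' \<Longrightarrow> aeq K A X Y f f \<Longrightarrow> aeq K A X Y f f'"
  unfolding acl_def by (auto intro: a_sym)

lemma ocl_Obj: "oeq K A X X \<Longrightarrow> ocl K A X \<in> Obj (S_cat K A)"
  by (auto simp: S_cat_def)

lemma S_cat_ObjE:
  assumes "c \<in> Obj (S_cat K A)" obtains X where "c = ocl K A X" "oeq K A X X"
  using assms by (auto simp: S_cat_def)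

lemma S_cat_ArrE:
  assumes "\<phi> \<in> Arr (S_cat K A)" obtains X Y f where "\<phi> = acl K A X Y f" "aeq K A X Y f f"
  using assms by (auto simp: S_cat_def)

lemma acl_hom: "aeq K A X Y f f \<Longrightarrow> acl K A X Y f \<in> hom (S_cat K A) (ocl K A X) (ocl K A Y)"
  by (auto simp: S_cat_def hom_def)

lemma acl_Arr: "aeq K A X Y f f \<Longrightarrow> acl K A X Y f \<in> Arr (S_cat K A)"
  by (auto simp: S_cat_def)

context
  fixes K :: limkind and A :: "('o, 'm) cat"
  assumes A: "category A"
begin

text \<open>An arrow of the free category comes with representatives of its own for source and
  target; \<open>a_conv\<close> moves its term to the prescribed ones.\<close>

lemma S_cat_homE:
  assumes "\<phi> \<in> hom (S_cat K A) (ocl K A X) (ocl K A Y)" "oeq K A X X" "oeq K A Y Y"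
  obtains f where "\<phi> = acl K A X Y f" "aeq K A X Y f f"
proof -
  obtain X' Y' f where f: "\<phi> = acl K A X' Y' f" "aeq K A X' Y' f f"
  proof -
    have "\<phi> \<in> Arr (S_cat K A)" using assms(1) by (simp add: hom_def)
    from this show thesis by (rule S_cat_ArrE) (rule that)
  qed
  have "ocl K A X = ocl K A X'" "ocl K A Y = ocl K A Y'"
    using homD[OF assms(1)] by (auto simp: f S_cat_def)
  then have XY: "oeq K A X' X" "oeq K A Y' Y"
    using ocl_eq_iff[OF assms(2)] ocl_eq_iff[OF assms(3)] by (auto intro: o_sym)
  show ?thesis
    by (rule that[of f]) (use f(1) acl_eqI[OF f(2) XY] a_conv[OF f(2) XY] in auto)
qed

lemma S_cat_Ide: "oeq K A X X \<Longrightarrow> Ide (S_cat K A) (ocl K A X) = acl K A X X (MId X)"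
  using acl_eqI[OF a_id[OF o_sym[OF rep_ocl]] o_sym[OF rep_ocl] o_sym[OF rep_ocl]] by (simp add: S_cat_def)

lemma S_cat_Cmp:
  assumes "aeq K A X Y f f" "aeq K A Y Z g g"
  shows "Cmp (S_cat K A) (acl K A Y Z g) (acl K A X Y f) = acl K A X Z (MComp g f)"
proof -
  have X: "oeq K A X (rep (ocl K A X))" and Z: "oeq K A Z (rep (ocl K A Z))"
    using rep_ocl aeq_wf[OF A] assms by blast+
  show ?thesis
    unfolding S_cat_def
    using acl_eqI[OF a_comp[OF rep_acl[OF assms(1)] rep_acl[OF assms(2)]] X Z] by simp
qed

lemma category_S_cat: "category (S_cat K A)"
proof
  fix \<phi> \<psi> \<chi> c d e b
  show "Dom (S_cat K A) \<phi> \<in> Obj (S_cat K A)" "Cod (S_cat K A) \<phi> \<in> Obj (S_cat K A)"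
    if "\<phi> \<in> Arr (S_cat K A)"
    using that aeq_wf[OF A] by (auto simp: S_cat_def)
  show "Ide (S_cat K A) c \<in> hom (S_cat K A) c c" if "c \<in> Obj (S_cat K A)"
    using that acl_hom[OF a_id] by (auto elim!: S_cat_ObjE simp: S_cat_Ide)
  have Ob: "\<exists>X Y. x = ocl K A X \<and> y = ocl K A Y \<and> oeq K A X X \<and> oeq K A Y Y"
    if \<theta>: "\<theta> \<in> hom (S_cat K A) x y" for \<theta> x y
  proof -
    obtain X Y f where f: "\<theta> = acl K A X Y f" "aeq K A X Y f f"
    proof -
      have "\<theta> \<in> Arr (S_cat K A)" using \<theta> by (simp add: hom_def)
      from this show thesis by (rule S_cat_ArrE) (rule that)
    qed
    then have "x = ocl K A X" "y = ocl K A Y" using homD[OF \<theta>] by (auto simp: S_cat_def)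
    then show ?thesis using aeq_wf[OF A f(2)] by blast
  qed
  assume \<phi>: "\<phi> \<in> hom (S_cat K A) c d"
  obtain X Y where XY: "c = ocl K A X" "d = ocl K A Y" "oeq K A X X" "oeq K A Y Y" using Ob[OF \<phi>] by auto
  obtain f where f: "\<phi> = acl K A X Y f" "aeq K A X Y f f" using S_cat_homE \<phi> XY by metis
  show "Cmp (S_cat K A) \<phi> (Ide (S_cat K A) c) = \<phi>" "Cmp (S_cat K A) (Ide (S_cat K A) d) \<phi> = \<phi>"
    using S_cat_Cmp[OF a_id[OF XY(3)] f(2)] S_cat_Cmp[OF f(2) a_id[OF XY(4)]]
      acl_eqI'[OF A a_comp_id[OF f(2)]] acl_eqI'[OF A a_id_comp[OF f(2)]]
    by (simp_all add: f XY S_cat_Ide)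
  assume \<psi>: "\<psi> \<in> hom (S_cat K A) d e"
  obtain Z where Z: "e = ocl K A Z" "oeq K A Z Z" using Ob[OF \<psi>] by auto
  obtain g where g: "\<psi> = acl K A Y Z g" "aeq K A Y Z g g" using S_cat_homE \<psi> XY Z by metis
  show "Cmp (S_cat K A) \<psi> \<phi> \<in> hom (S_cat K A) c e"
    using acl_hom[OF a_comp[OF f(2) g(2)]] by (simp add: f g XY Z S_cat_Cmp)
  assume \<chi>: "\<chi> \<in> hom (S_cat K A) e b"
  obtain W where W: "b = ocl K A W" "oeq K A W W" using Ob[OF \<chi>] by auto
  obtain h where h: "\<chi> = acl K A Z W h" "aeq K A Z W h h" using S_cat_homE \<chi> Z W by metis
  show "Cmp (S_cat K A) \<chi> (Cmp (S_cat K A) \<psi> \<phi>) = Cmp (S_cat K A) (Cmp (S_cat K A) \<chi> \<psi>) \<phi>"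
    using S_cat_Cmp[OF f(2) g(2)] S_cat_Cmp[OF g(2) h(2)] S_cat_Cmp[OF a_comp[OF f(2) g(2)] h(2)]
      S_cat_Cmp[OF f(2) a_comp[OF g(2) h(2)]] acl_eqI'[OF A a_assoc[OF f(2) g(2) h(2)]]
    by (simp add: f g h)
qed

end

text \<open>Functoriality may be tested on terms: composable classes can be represented over a
  common middle term, so no choice of representatives enters the hypotheses.\<close>

lemma S_cat_FunI:
  assumes A: "category A" and D: "category D" and H: "Src H = S_cat K A" "Tgt H = D"
    "FOb H \<in> extensional (Obj (S_cat K A))" "FAr H \<in> extensional (Arr (S_cat K A))"
    and ob: "\<And>X. oeq K A X X \<Longrightarrow> FOb H (ocl K A X) \<in> Obj D"
    and ar: "\<And>X Y f. aeq K A X Y f f \<Longrightarrow> FAr H (acl K A X Y f) \<in> hom D (FOb H (ocl K A X)) (FOb H (ocl K A Y))"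
    and ide: "\<And>X. oeq K A X X \<Longrightarrow> FAr H (acl K A X X (MId X)) = Ide D (FOb H (ocl K A X))"
    and cmp: "\<And>X Y Z f g. aeq K A X Y f f \<Longrightarrow> aeq K A Y Z g g \<Longrightarrow>
      FAr H (acl K A X Z (MComp g f)) = Cmp D (FAr H (acl K A Y Z g)) (FAr H (acl K A X Y f))"
  shows "H \<in> Fun (S_cat K A) D"
proof (rule FunI[OF H(1,2) category_S_cat[OF A] D H(3,4)])
  show "FOb H c \<in> Obj D" if "c \<in> Obj (S_cat K A)" for c
    using that by (rule S_cat_ObjE) (simp add: ob)
  show "FAr H (Ide (S_cat K A) c) = Ide D (FOb H c)" if "c \<in> Obj (S_cat K A)" for c
    using that by (rule S_cat_ObjE) (simp add: S_cat_Ide[OF A] ide)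
  fix \<phi> \<psi> c d e assume \<phi>: "\<phi> \<in> hom (S_cat K A) c d"
  obtain X Y where XY: "c = ocl K A X" "oeq K A X X" "d = ocl K A Y" "oeq K A Y Y"
    using category.hom_Obj[OF category_S_cat[OF A] \<phi>] by (auto elim!: S_cat_ObjE)
  obtain f where f: "\<phi> = acl K A X Y f" "aeq K A X Y f f"
    using \<phi> unfolding XY by (rule S_cat_homE[OF A _ XY(2,4)])
  show "FAr H \<phi> \<in> hom D (FOb H c) (FOb H d)" unfolding XY f by (rule ar[OF f(2)])
  assume \<psi>: "\<psi> \<in> hom (S_cat K A) d e"
  obtain Z where Z: "e = ocl K A Z" "oeq K A Z Z"
    using category.hom_Obj[OF category_S_cat[OF A] \<psi>] by (auto elim!: S_cat_ObjE)
  obtain g where g: "\<psi> = acl K A Y Z g" "aeq K A Y Z g g"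
    using \<psi> unfolding XY Z by (rule S_cat_homE[OF A _ XY(4) Z(2)])
  show "FAr H (Cmp (S_cat K A) \<psi> \<phi>) = Cmp D (FAr H \<psi>) (FAr H \<phi>)"
    unfolding f g S_cat_Cmp[OF A f(2) g(2)] by (rule cmp[OF f(2) g(2)])
qed

section \<open>Functors on the free category, read on terms\<close>

definition Tob where "Tob K A H X = FOb H (ocl K A X)"
text \<open>Source and target are arguments because an arrow class is a triple formed with their
  classes.\<close>

definition Tar where "Tar K A H X Y f = FAr H (acl K A X Y f)"

context
  fixes K :: limkind and A :: "('o, 'm) cat" and D :: "('p, 'n) cat" and H
  assumes A: "category A" and H: "H \<in> Fun (S_cat K A) D"
begin

lemma Tob_Obj: "oeq K A X X \<Longrightarrow> Tob K A H X \<in> Obj D"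
  by (simp add: Tob_def Fun_Ob[OF H] ocl_Obj)

lemma Tob_cong: "oeq K A X X' \<Longrightarrow> Tob K A H X = Tob K A H X'"
  by (simp add: Tob_def ocl_eqI)

lemma Tar_hom: "aeq K A X Y f f \<Longrightarrow> Tar K A H X Y f \<in> hom D (Tob K A H X) (Tob K A H Y)"
  by (simp add: Tar_def Tob_def Fun_hom[OF H] acl_hom)

lemma Tar_cong:
  "aeq K A X Y f f' \<Longrightarrow> oeq K A X X' \<Longrightarrow> oeq K A Y Y' \<Longrightarrow> Tar K A H X Y f = Tar K A H X' Y' f'"
  by (simp add: Tar_def acl_eqI)

lemma Tar_cong': "aeq K A X Y f f' \<Longrightarrow> Tar K A H X Y f = Tar K A H X Y f'"
  by (simp add: Tar_def acl_eqI'[OF A])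

lemma Tar_id: "oeq K A X X \<Longrightarrow> Tar K A H X X (MId X) = Ide D (Tob K A H X)"
  using Fun_Ide[OF H ocl_Obj] by (simp add: Tar_def Tob_def S_cat_Ide[OF A])

lemma Tar_comp: "aeq K A X Y f f \<Longrightarrow> aeq K A Y Z g g \<Longrightarrow>
    Tar K A H X Z (MComp g f) = Cmp D (Tar K A H Y Z g) (Tar K A H X Y f)"
  using Fun_Cmp[OF H acl_hom acl_hom] by (simp add: Tar_def S_cat_Cmp[OF A, symmetric])

end

subsection \<open>Substitution\<close>

primrec sub_o :: "('o \<Rightarrow> ('p, 'n) otm) \<Rightarrow> ('m \<Rightarrow> ('p, 'n) mtm) \<Rightarrow> ('o, 'm) otm \<Rightarrow> ('p, 'n) otm"
  and sub_m :: "('o \<Rightarrow> ('p, 'n) otm) \<Rightarrow> ('m \<Rightarrow> ('p, 'n) mtm) \<Rightarrow> ('o, 'm) mtm \<Rightarrow> ('p, 'n) mtm" where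
  "sub_o \<sigma> \<tau> (OGen x) = \<sigma> x"
| "sub_o \<sigma> \<tau> OOne = OOne"
| "sub_o \<sigma> \<tau> (OProd X Y) = OProd (sub_o \<sigma> \<tau> X) (sub_o \<sigma> \<tau> Y)"
| "sub_o \<sigma> \<tau> (OPb X Y f g) = OPb (sub_o \<sigma> \<tau> X) (sub_o \<sigma> \<tau> Y) (sub_m \<sigma> \<tau> f) (sub_m \<sigma> \<tau> g)"
| "sub_m \<sigma> \<tau> (MGen m) = \<tau> m"
| "sub_m \<sigma> \<tau> (MId X) = MId (sub_o \<sigma> \<tau> X)"
| "sub_m \<sigma> \<tau> (MComp g f) = MComp (sub_m \<sigma> \<tau> g) (sub_m \<sigma> \<tau> f)"
| "sub_m \<sigma> \<tau> (MBang X) = MBang (sub_o \<sigma> \<tau> X)"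
| "sub_m \<sigma> \<tau> (MPr1 X Y) = MPr1 (sub_o \<sigma> \<tau> X) (sub_o \<sigma> \<tau> Y)"
| "sub_m \<sigma> \<tau> (MPr2 X Y) = MPr2 (sub_o \<sigma> \<tau> X) (sub_o \<sigma> \<tau> Y)"
| "sub_m \<sigma> \<tau> (MPair h k) = MPair (sub_m \<sigma> \<tau> h) (sub_m \<sigma> \<tau> k)"
| "sub_m \<sigma> \<tau> (MPb1 X Y f g) = MPb1 (sub_o \<sigma> \<tau> X) (sub_o \<sigma> \<tau> Y) (sub_m \<sigma> \<tau> f) (sub_m \<sigma> \<tau> g)"
| "sub_m \<sigma> \<tau> (MPb2 X Y f g) = MPb2 (sub_o \<sigma> \<tau> X) (sub_o \<sigma> \<tau> Y) (sub_m \<sigma> \<tau> f) (sub_m \<sigma> \<tau> g)"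
| "sub_m \<sigma> \<tau> (MLift X Y f g h k) = MLift (sub_o \<sigma> \<tau> X) (sub_o \<sigma> \<tau> Y) (sub_m \<sigma> \<tau> f) (sub_m \<sigma> \<tau> g)
     (sub_m \<sigma> \<tau> h) (sub_m \<sigma> \<tau> k)"

text \<open>Each rule is stable under substitution, and the rules for generators ask only that the
  substituted terms satisfy the category laws up to derivable equality. The action of
  \<open>S\<close> on functors and its multiplication are both instances.\<close>

lemma oeq_aeq_sub:
  assumes ob: "\<And>x. x \<in> Obj A \<Longrightarrow> oeq K B (\<sigma> x) (\<sigma> x)"
    and ar: "\<And>m. m \<in> Arr A \<Longrightarrow> aeq K B (\<sigma> (Dom A m)) (\<sigma> (Cod A m)) (\<tau> m) (\<tau> m)"
    and ide: "\<And>x. x \<in> Obj A \<Longrightarrow> aeq K B (\<sigma> x) (\<sigma> x) (\<tau> (Ide A x)) (MId (\<sigma> x))"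
    and cmp: "\<And>m n. m \<in> Arr A \<Longrightarrow> n \<in> Arr A \<Longrightarrow> Cod A m = Dom A n \<Longrightarrow>
      aeq K B (\<sigma> (Dom A m)) (\<sigma> (Cod A n)) (\<tau> (Cmp A n m)) (MComp (\<tau> n) (\<tau> m))"
  shows "oeq K A X X' \<Longrightarrow> oeq K B (sub_o \<sigma> \<tau> X) (sub_o \<sigma> \<tau> X')"
    and "aeq K A X Y f f' \<Longrightarrow> aeq K B (sub_o \<sigma> \<tau> X) (sub_o \<sigma> \<tau> Y) (sub_m \<sigma> \<tau> f) (sub_m \<sigma> \<tau> f')"
proof (induction rule: oeq_aeq.inducts)
  case (a_sym X Y f g) then show ?case by (blast intro: oeq_aeq.a_sym)
next
  case (o_sym X Y) then show ?case by (blast intro: oeq_aeq.o_sym)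
next
  case (o_trans X Y) then show ?case by (blast intro: oeq_aeq.o_trans)
next
  case (a_trans X Y) then show ?case by (blast intro: oeq_aeq.a_trans)
next
  case (a_conv X Y) then show ?case by (blast intro: oeq_aeq.a_conv)
next
  case (a_gen_comp m n) then show ?case using cmp[OF a_gen_comp] by simp
qed (simp_all add: ob ar ide, (rule oeq_aeq.intros; (assumption | rule refl))+)

lemma map_tm_sub:
  fixes X :: "('o, 'm) otm" and f :: "('o, 'm) mtm"
  shows "map_otm F G X = sub_o (OGen \<circ> F) (MGen \<circ> G) X"
  "map_mtm F G f = sub_m (OGen \<circ> F) (MGen \<circ> G) f"
  by (induction X and f) auto

lemma flatten_sub:
  fixes T :: "(('o, 'm) sob, ('o, 'm) sar) otm" and t :: "(('o, 'm) sob, ('o, 'm) sar) mtm"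
  shows
  "flatten_o T = sub_o rep (rep \<circ> scls) T"
  "flatten_m t = sub_m rep (rep \<circ> scls) t"
  by (induction T and t) auto

subsection \<open>The 2-monad\<close>

abbreviation map_o where "map_o F \<equiv> map_otm (FOb F) (FAr F)"
abbreviation map_m where "map_m F \<equiv> map_mtm (FOb F) (FAr F)"

lemma map_sound:
  assumes F: "F \<in> Fun A B"
  shows "oeq K A X X' \<Longrightarrow> oeq K B (map_o F X) (map_o F X')"
    and "aeq K A X Y f f' \<Longrightarrow> aeq K B (map_o F X) (map_o F Y) (map_m F f) (map_m F f')"
proof -
  have ob: "oeq K B (OGen (FOb F x)) (OGen (FOb F x))" if "x \<in> Obj A" for x
    using Fun_Ob[OF F that] by (rule o_gen)
  have ar: "aeq K B (OGen (FOb F (Dom A m))) (OGen (FOb F (Cod A m))) (MGen (FAr F m)) (MGen (FAr F m))"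
    if "m \<in> Arr A" for m
    using a_gen[OF Fun_Arr[OF F that]] homD[OF Fun_hom[OF F Arr_hom[OF that]]] by auto
  have ide: "aeq K B (OGen (FOb F x)) (OGen (FOb F x)) (MGen (FAr F (Ide A x))) (MId (OGen (FOb F x)))"
    if "x \<in> Obj A" for x
    using a_gen_id[OF Fun_Ob[OF F that]] by (simp add: Fun_Ide[OF F that])
  have cmp: "aeq K B (OGen (FOb F (Dom A m))) (OGen (FOb F (Cod A n))) (MGen (FAr F (Cmp A n m)))
      (MComp (MGen (FAr F n)) (MGen (FAr F m)))"
    if mn: "m \<in> Arr A" "n \<in> Arr A" "Cod A m = Dom A n" for m n
  proof -
    have "FAr F (Cmp A n m) = Cmp B (FAr F n) (FAr F m)"
      using Fun_Cmp[OF F Arr_hom[OF mn(1)], of n "Cod A n"] mn by (simp add: hom_def)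
    moreover have "FAr F m \<in> hom B (FOb F (Dom A m)) (FOb F (Cod A m))"
      "FAr F n \<in> hom B (FOb F (Dom A n)) (FOb F (Cod A n))"
      using Fun_hom[OF F Arr_hom[OF mn(1)]] Fun_hom[OF F Arr_hom[OF mn(2)]] by auto
    ultimately show ?thesis
      using a_gen_comp[of "FAr F m" B "FAr F n" K] mn(3) by (auto simp: hom_def)
  qed
  note * = oeq_aeq_sub[where A = A and \<sigma> = "OGen \<circ> FOb F" and \<tau> = "MGen \<circ> FAr F" and B = B and K = K,
      unfolded o_def, OF ob ar ide cmp]
  show "oeq K A X X' \<Longrightarrow> oeq K B (map_o F X) (map_o F X')"
    unfolding map_tm_sub o_def by (rule *(1))
  show "aeq K A X Y f f' \<Longrightarrow> aeq K B (map_o F X) (map_o F Y) (map_m F f) (map_m F f')"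
    unfolding map_tm_sub o_def by (rule *(2))
qed

context
  fixes F :: "('o, 'm, 'p, 'n) ftr" and A B
  assumes F: "F \<in> Fun A B"
begin

lemma S_functor_ocl: "oeq K A X X \<Longrightarrow> FOb (S_functor K F) (ocl K A X) = ocl K B (map_o F X)"
  using ocl_eqI[OF o_sym[OF map_sound(1)[OF F rep_ocl]]]
  by (simp add: S_functor_def Fun_Src[OF F] Fun_Tgt[OF F] ocl_Obj)

lemma S_functor_acl:
  assumes f: "aeq K A X Y f f"
  shows "FAr (S_functor K F) (acl K A X Y f) = acl K B (map_o F X) (map_o F Y) (map_m F f)"
proof -
  note wf = aeq_wf[OF Fun_cat(1)[OF F] f]
  have r: "oeq K A X (rep (ocl K A X))" "oeq K A Y (rep (ocl K A Y))" using wf rep_ocl by blast+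
  show ?thesis
    using acl_eqI[OF map_sound(2)[OF F rep_acl[OF f]] map_sound(1)[OF F r(1)] map_sound(1)[OF F r(2)]]
    by (simp add: S_functor_def Fun_Src[OF F] Fun_Tgt[OF F] acl_Arr[OF f])
qed

lemma S_functor_Fun: "S_functor K F \<in> Fun (S_cat K A) (S_cat K B)"
proof (rule S_cat_FunI[OF Fun_cat(1)[OF F] category_S_cat[OF Fun_cat(2)[OF F]]])
  note B = Fun_cat(2)[OF F] and wf = aeq_wf[OF Fun_cat(1)[OF F]]
  show "FOb (S_functor K F) (ocl K A X) \<in> Obj (S_cat K B)" if "oeq K A X X" for X
    using ocl_Obj[OF map_sound(1)[OF F that]] by (simp add: S_functor_ocl that)
  show "FAr (S_functor K F) (acl K A X Y f) \<in> hom (S_cat K B) (FOb (S_functor K F) (ocl K A X)) (FOb (S_functor K F) (ocl K A Y))"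
    if "aeq K A X Y f f" for X Y f
    using acl_hom[OF map_sound(2)[OF F that]] wf[OF that] by (simp add: S_functor_acl that S_functor_ocl)
  show "FAr (S_functor K F) (acl K A X X (MId X)) = Ide (S_cat K B) (FOb (S_functor K F) (ocl K A X))" if "oeq K A X X" for X
    using S_cat_Ide[OF B map_sound(1)[OF F that]] by (simp add: S_functor_acl[OF a_id[OF that]] S_functor_ocl that)
  show "FAr (S_functor K F) (acl K A X Z (MComp g f)) =
      Cmp (S_cat K B) (FAr (S_functor K F) (acl K A Y Z g)) (FAr (S_functor K F) (acl K A X Y f))"
    if f: "aeq K A X Y f f" and g: "aeq K A Y Z g g" for X Y Z f g
    using S_cat_Cmp[OF B map_sound(2)[OF F f] map_sound(2)[OF F g]]
    by (simp add: S_functor_acl[OF f] S_functor_acl[OF g] S_functor_acl[OF a_comp[OF f g]])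
qed (auto simp: S_functor_def Fun_Src[OF F] Fun_Tgt[OF F])

end

lemma S_cat_Fun_eqI:
  assumes "H \<in> Fun (S_cat K A) D" "G \<in> Fun (S_cat K A) D"
    and "\<And>X. oeq K A X X \<Longrightarrow> FOb H (ocl K A X) = FOb G (ocl K A X)"
    and "\<And>X Y f. aeq K A X Y f f \<Longrightarrow> FAr H (acl K A X Y f) = FAr G (acl K A X Y f)"
  shows "H = G"
  by (rule Fun_eqI[OF assms(1,2)]) (auto elim!: S_cat_ObjE S_cat_ArrE simp: assms(3,4))

lemma map_tm_cong:
  assumes "category A"
    and "\<And>x. x \<in> Obj A \<Longrightarrow> F x = F' x" "\<And>m. m \<in> Arr A \<Longrightarrow> G m = G' m"
  shows "oeq K A X X \<Longrightarrow> map_otm F G X = map_otm F' G' X"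
    and "aeq K A X Y f f \<Longrightarrow> map_mtm F G f = map_mtm F' G' f"
proof -
  show "map_otm F G X = map_otm F' G' X" if "oeq K A X X"
    using oeq_aeq_gens(1)[OF assms(1) that] assms(2,3) by (intro otm.map_cong0) blast+
  show "map_mtm F G f = map_mtm F' G' f" if "aeq K A X Y f f"
    using oeq_aeq_gens(2)[OF assms(1) that] assms(2,3) by (intro mtm.map_cong0) blast+
qed

lemma map_o_fcomp:
  assumes F: "F \<in> Fun A B"
  shows "oeq K A X X \<Longrightarrow> map_o (G \<circ>\<^sub>F F) X = map_o G (map_o F X)"
    and "aeq K A X Y f f \<Longrightarrow> map_m (G \<circ>\<^sub>F F) f = map_m G (map_m F f)"
  using map_tm_cong[OF Fun_cat(1)[OF F], of "FOb (G \<circ>\<^sub>F F)" "FOb G \<circ> FOb F" "FAr (G \<circ>\<^sub>F F)" "FAr G \<circ> FAr F"]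
  by (simp_all add: fcomp_FOb[OF F] fcomp_FAr[OF F] otm.map_comp mtm.map_comp)

lemma S_functor_fcomp:
  assumes F: "F \<in> Fun A B" and G: "G \<in> Fun B C"
  shows "S_functor K (G \<circ>\<^sub>F F) = S_functor K G \<circ>\<^sub>F S_functor K F"
proof (rule S_cat_Fun_eqI[OF S_functor_Fun[OF fcomp_Fun[OF F G]]
        fcomp_Fun[OF S_functor_Fun[OF F] S_functor_Fun[OF G]]])
  show "FAr (S_functor K (G \<circ>\<^sub>F F)) (acl K A X Y f) = FAr (S_functor K G \<circ>\<^sub>F S_functor K F) (acl K A X Y f)"
    if "aeq K A X Y f f" for X Y f using that aeq_wf[OF Fun_cat(1)[OF F] that]
    by (simp add: fcomp_FAr[OF S_functor_Fun[OF F] acl_Arr] map_o_fcomp(1)[OF F, of K X]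
      map_o_fcomp(1)[OF F, of K Y] map_o_fcomp(2)[OF F, of K X Y f]
      S_functor_acl[OF fcomp_Fun[OF F G]] S_functor_acl[OF F] S_functor_acl[OF G map_sound(2)[OF F]])
qed (simp_all add: fcomp_FOb[OF S_functor_Fun[OF F] ocl_Obj]
      S_functor_ocl[OF fcomp_Fun[OF F G]] S_functor_ocl[OF F] S_functor_ocl[OF G map_sound(1)[OF F]] map_o_fcomp[OF F])

lemma S_functor_idf:
  assumes A: "category A" shows "S_functor K (idf A) = idf (S_cat K A)"
proof -
  have "map_o (idf A) X = X" if "oeq K A X X" for X
    using map_tm_cong(1)[OF A, of "FOb (idf A)" id "FAr (idf A)" id K X] that by (simp add: idf_def otm.map_id)
  moreover have "map_m (idf A) f = f" if "aeq K A X Y f f" for X Y f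
    using map_tm_cong(2)[OF A, of "FOb (idf A)" id "FAr (idf A)" id K X Y f] that by (simp add: idf_def mtm.map_id)
  moreover have "oeq K A X X" "oeq K A Y Y" if "aeq K A X Y f f" for X Y f
    using aeq_wf[OF A that] by auto
  ultimately show ?thesis
    by (intro S_cat_Fun_eqI[OF S_functor_Fun[OF idf_Fun[OF A]] idf_Fun[OF category_S_cat[OF A]]])
      (simp_all add: S_functor_ocl[OF idf_Fun[OF A]] S_functor_acl[OF idf_Fun[OF A]], auto simp: idf_def ocl_Obj acl_Arr)
qed

section \<open>Unit and multiplication\<close>

lemma S_unit_Fun: assumes A: "category A" shows "S_unit K A \<in> Fun A (S_cat K A)"
proof (rule FunI)
  show "category (S_cat K A)" using A by (rule category_S_cat)
  show "FAr (S_unit K A) f \<in> hom (S_cat K A) (FOb (S_unit K A) x) (FOb (S_unit K A) y)"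
    if "f \<in> hom A x y" for f x y
    using that category.hom_Obj[OF A that] acl_hom[OF a_gen[of f A]] by (auto simp: S_unit_def hom_def[of A])
  show "FAr (S_unit K A) (Ide A x) = Ide (S_cat K A) (FOb (S_unit K A) x)" if "x \<in> Obj A" for x
    using that category.ide_in[OF A that] acl_eqI'[OF A a_gen_id[OF that]]
    by (simp add: S_unit_def hom_def S_cat_Ide[OF A o_gen])
  show "FAr (S_unit K A) (Cmp A g f) = Cmp (S_cat K A) (FAr (S_unit K A) g) (FAr (S_unit K A) f)"
    if "f \<in> hom A x y" "g \<in> hom A y z" for f g x y z
  proof -
    have fg: "f \<in> Arr A" "g \<in> Arr A" "Cod A f = Dom A g" "x = Dom A f" "z = Cod A g" "Cmp A g f \<in> hom A x z"
      using that category.cmp_in[OF A that] by (auto simp: hom_def)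
    show ?thesis
      using S_cat_Cmp[OF A a_gen[OF fg(1)] a_gen[OF fg(2), of K, folded fg(3)]]
        acl_eqI'[OF A a_gen_comp[OF fg(1,2,3)], of K] fg
      by (simp add: S_unit_def hom_def)
  qed
qed (use A in \<open>auto simp: S_unit_def intro: ocl_Obj o_gen\<close>)

lemma S_unit_FOb: "x \<in> Obj A \<Longrightarrow> FOb (S_unit K A) x = ocl K A (OGen x)"
  by (simp add: S_unit_def)

lemma S_unit_FAr: "m \<in> Arr A \<Longrightarrow> FAr (S_unit K A) m = acl K A (OGen (Dom A m)) (OGen (Cod A m)) (MGen m)"
  by (simp add: S_unit_def)

text \<open>Flattening substitutes chosen representatives for classes. The representatives satisfy
  the category laws only up to derivable equality, which is all that \<open>oeq_aeq_sub\<close>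
  asks.\<close>

lemma flatten_sound:
  fixes K :: limkind and A :: "('o, 'm) cat"
  assumes A: "category A"
  shows "oeq K (S_cat K A) X X' \<Longrightarrow> oeq K A (flatten_o X) (flatten_o X')"
    and "aeq K (S_cat K A) X Y f f' \<Longrightarrow> aeq K A (flatten_o X) (flatten_o Y) (flatten_m f) (flatten_m f')"
proof -
  have r: "oeq K A (rep (ocl K A X)) X" if "oeq K A X X" for X using rep_ocl[OF that] by (rule o_sym)
  have ra: "aeq K A (rep (ocl K A X)) (rep (ocl K A Y)) f (rep {f'. aeq K A X Y f f'})"
    if f: "aeq K A X Y f f" for X Y f
    using a_conv[OF rep_acl[OF f]] aeq_wf[OF A f] rep_ocl by blast
  have ob: "oeq K A (rep c) (rep c)" if "c \<in> Obj (S_cat K A)" for c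
    using \<open>c \<in> _\<close> by (rule S_cat_ObjE) (use oeq_refl(1)[OF r] in simp)
  have ar: "aeq K A (rep (Dom (S_cat K A) m)) (rep (Cod (S_cat K A) m)) (rep (scls m)) (rep (scls m))"
    if "m \<in> Arr (S_cat K A)" for m
  proof -
    obtain X Y f where f: "m = acl K A X Y f" "aeq K A X Y f f" using \<open>m \<in> _\<close> by (rule S_cat_ArrE)
    then show ?thesis using aeq_refl(2)[OF ra[OF f(2)]] by (simp add: S_cat_def)
  qed
  have ide: "aeq K A (rep c) (rep c) (rep (scls (Ide (S_cat K A) c))) (MId (rep c))" if "c \<in> Obj (S_cat K A)" for c
    using a_sym[OF rep_acl[OF a_id[OF ob[OF that]]]] by (simp add: S_cat_def)
  have cmp: "aeq K A (rep (Dom (S_cat K A) m)) (rep (Cod (S_cat K A) n)) (rep (scls (Cmp (S_cat K A) n m)))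
      (MComp (rep (scls n)) (rep (scls m)))"
    if mn: "m \<in> Arr (S_cat K A)" "n \<in> Arr (S_cat K A)" "Cod (S_cat K A) m = Dom (S_cat K A) n" for m n
  proof -
    have "aeq K A (rep (sdom m)) (rep (scod m)) (rep (scls m)) (rep (scls m))"
      "aeq K A (rep (sdom n)) (rep (scod n)) (rep (scls n)) (rep (scls n))" "scod m = sdom n"
      using ar[OF mn(1)] ar[OF mn(2)] mn(3) by (auto simp: S_cat_def)
    from a_sym[OF rep_acl[OF a_comp[OF this(1) this(2)[folded this(3)]]]]
    show ?thesis by (simp add: S_cat_def)
  qed
  note * = oeq_aeq_sub[where A = "S_cat K A" and \<sigma> = "rep" and \<tau> = "rep \<circ> scls" and B = A and K = K,
      unfolded o_def, OF ob ar ide cmp]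
  show "oeq K (S_cat K A) X X' \<Longrightarrow> oeq K A (flatten_o X) (flatten_o X')"
    unfolding flatten_sub o_def by (rule *(1))
  show "aeq K (S_cat K A) X Y f f' \<Longrightarrow> aeq K A (flatten_o X) (flatten_o Y) (flatten_m f) (flatten_m f')"
    unfolding flatten_sub o_def by (rule *(2))
qed

context
  fixes K :: limkind and A :: "('o, 'm) cat"
  assumes A: "category A"
begin

lemma S_mult_ocl: "oeq K (S_cat K A) X X \<Longrightarrow>
    FOb (S_mult K A) (ocl K (S_cat K A) X) = ocl K A (flatten_o X)"
  using ocl_eqI[OF o_sym[OF flatten_sound(1)[OF A rep_ocl]]] by (simp add: S_mult_def ocl_Obj)

lemma S_mult_acl:
  assumes f: "aeq K (S_cat K A) X Y f f"
  shows "FAr (S_mult K A) (acl K (S_cat K A) X Y f) = acl K A (flatten_o X) (flatten_o Y) (flatten_m f)"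
proof -
  have r: "oeq K (S_cat K A) X (rep (ocl K (S_cat K A) X))" "oeq K (S_cat K A) Y (rep (ocl K (S_cat K A) Y))"
    using aeq_wf[OF category_S_cat[OF A] f] rep_ocl by blast+
  show ?thesis
    using acl_eqI[OF flatten_sound(2)[OF A rep_acl[OF f]] flatten_sound(1)[OF A r(1)] flatten_sound(1)[OF A r(2)]]
    by (simp add: S_mult_def acl_Arr[OF f])
qed

lemma S_mult_Fun: "S_mult K A \<in> Fun (S_cat K (S_cat K A)) (S_cat K A)"
proof (rule S_cat_FunI[OF category_S_cat[OF A] category_S_cat[OF A]])
  let ?SA = "S_cat K A" and ?m = "S_mult K A"
  note wf = aeq_wf[OF category_S_cat[OF A]]
  show "FOb ?m (ocl K ?SA X) \<in> Obj ?SA" if "oeq K ?SA X X" for X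
    using ocl_Obj[OF flatten_sound(1)[OF A that]] by (simp add: S_mult_ocl that)
  show "FAr ?m (acl K ?SA X Y f) \<in> hom ?SA (FOb ?m (ocl K ?SA X)) (FOb ?m (ocl K ?SA Y))" if "aeq K ?SA X Y f f" for X Y f
    using acl_hom[OF flatten_sound(2)[OF A that]] wf[OF that] by (simp add: S_mult_acl that S_mult_ocl)
  show "FAr ?m (acl K ?SA X X (MId X)) = Ide ?SA (FOb ?m (ocl K ?SA X))" if "oeq K ?SA X X" for X
    using S_cat_Ide[OF A flatten_sound(1)[OF A that]] by (simp add: S_mult_acl[OF a_id[OF that]] S_mult_ocl that)
  show "FAr ?m (acl K ?SA X Z (MComp g f)) = Cmp ?SA (FAr ?m (acl K ?SA Y Z g)) (FAr ?m (acl K ?SA X Y f))"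
    if f: "aeq K ?SA X Y f f" and g: "aeq K ?SA Y Z g g" for X Y Z f g
    using S_cat_Cmp[OF A flatten_sound(2)[OF A f] flatten_sound(2)[OF A g]]
    by (simp add: S_mult_acl[OF f] S_mult_acl[OF g] S_mult_acl[OF a_comp[OF f g]])
qed (auto simp: S_mult_def)

text \<open>This unit law lets the free category with \<open>S_mult\<close> count as an
  \<open>action\<close>, so that the multiplication axiom of a pseudomorphism can be read as a
  2-cell condition over it.\<close>

lemma S_mult_unit: "S_mult K A \<circ>\<^sub>F S_unit K (S_cat K A) = idf (S_cat K A)"
proof -
  have SA: "category (S_cat K A)" using A by (rule category_S_cat)
  note U = S_unit_Fun[OF SA, of K]
  have r: "oeq K A (rep (ocl K A X)) X" if "oeq K A X X" for X using rep_ocl[OF that] by (rule o_sym)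
  have d: "Dom (S_cat K A) (acl K A X Y f) = ocl K A X" "Cod (S_cat K A) (acl K A X Y f) = ocl K A Y" for X Y f
    by (simp_all add: S_cat_def)
  show ?thesis
  proof (rule S_cat_Fun_eqI[OF fcomp_Fun[OF U S_mult_Fun] idf_Fun[OF SA]])
    fix X assume X: "oeq K A X X"
    then have "ocl K A X \<in> Obj (S_cat K A)" by (rule ocl_Obj)
    then show "FOb (S_mult K A \<circ>\<^sub>F S_unit K (S_cat K A)) (ocl K A X) = FOb (idf (S_cat K A)) (ocl K A X)"
      using S_mult_ocl[OF o_gen, of "ocl K A X"] ocl_eqI[OF r[OF X]]
      by (simp add: fcomp_FOb[OF U] idf_def S_unit_FOb)
  next
    fix X Y f assume f: "aeq K A X Y f f"
    then have m: "acl K A X Y f \<in> Arr (S_cat K A)" by (rule acl_Arr)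
    have X: "oeq K A X X" and Y: "oeq K A Y Y" using aeq_wf[OF A f] by auto
    have "acl K A (rep (ocl K A X)) (rep (ocl K A Y)) (rep {f'. aeq K A X Y f f'}) = acl K A X Y f"
      using acl_eqI[OF rep_acl[OF f] rep_ocl[OF X] rep_ocl[OF Y]] by simp
    then show "FAr (S_mult K A \<circ>\<^sub>F S_unit K (S_cat K A)) (acl K A X Y f) = FAr (idf (S_cat K A)) (acl K A X Y f)"
      using S_mult_acl[OF a_gen[OF m]] m d[of X Y f]
      by (simp add: fcomp_FAr[OF U] idf_def S_unit_FAr)
  qed
qed

end

context
  fixes a :: "(('o, 'm) sob, ('o, 'm) sar, 'p, 'n) ftr" and K A D
  assumes a: "a \<in> Fun (S_cat K A) D" and A: "category A"
begin

lemma Tob_S_functor: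
  assumes "F \<in> Fun B A" "oeq K B X X"
  shows "Tob K B (a \<circ>\<^sub>F S_functor K F) X = Tob K A a (map_o F X)"
  by (simp add: Tob_def fcomp_FOb[OF S_functor_Fun[OF assms(1)] ocl_Obj[OF assms(2)]] S_functor_ocl[OF assms])

lemma Tar_S_functor:
  assumes "F \<in> Fun B A" "aeq K B X Y f f"
  shows "Tar K B (a \<circ>\<^sub>F S_functor K F) X Y f = Tar K A a (map_o F X) (map_o F Y) (map_m F f)"
  by (simp add: Tar_def fcomp_FAr[OF S_functor_Fun[OF assms(1)] acl_Arr[OF assms(2)]] S_functor_acl[OF assms])

lemma Tar_S_mult:
  assumes "aeq K (S_cat K A) X Y f f"
  shows "Tar K (S_cat K A) (a \<circ>\<^sub>F S_mult K A) X Y f = Tar K A a (flatten_o X) (flatten_o Y) (flatten_m f)"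
  by (simp add: Tar_def fcomp_FAr[OF S_mult_Fun[OF A] acl_Arr[OF assms]] S_mult_acl[OF A assms])

lemma Tob_S_unit: "x \<in> Obj A \<Longrightarrow> Tob K A a (OGen x) = FOb (a \<circ>\<^sub>F S_unit K A) x"
  by (simp add: Tob_def fcomp_FOb[OF S_unit_Fun[OF A]] S_unit_FOb)

lemma Tar_S_unit: "m \<in> hom A x y \<Longrightarrow> Tar K A a (OGen x) (OGen y) (MGen m) = FAr (a \<circ>\<^sub>F S_unit K A) m"
  using fcomp_FAr[OF S_unit_Fun[OF A, of K], of m a] by (auto simp: hom_def Tar_def S_unit_FAr)

end

section \<open>Limit-preserving functors out of free categories\<close>

definition is_term :: "('o, 'm) cat \<Rightarrow> 'o \<Rightarrow> bool" where
  "is_term C t \<longleftrightarrow> t \<in> Obj C \<and> (\<forall>x \<in> Obj C. \<exists>!u. u \<in> hom C x t)"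

definition is_pb :: "('o, 'm) cat \<Rightarrow> 'm \<Rightarrow> 'm \<Rightarrow> 'm \<Rightarrow> 'm \<Rightarrow> bool" where
  "is_pb C f g p1 p2 \<longleftrightarrow> {f, g, p1, p2} \<subseteq> Arr C \<and> Cod C f = Cod C g \<and> Dom C p1 = Dom C p2
    \<and> Cod C p1 = Dom C f \<and> Cod C p2 = Dom C g \<and> Cmp C f p1 = Cmp C g p2
    \<and> (\<forall>w h k. h \<in> hom C w (Dom C f) \<longrightarrow> k \<in> hom C w (Dom C g) \<longrightarrow> Cmp C f h = Cmp C g k \<longrightarrow>
        (\<exists>!u. u \<in> hom C w (Dom C p1) \<and> Cmp C p1 u = h \<and> Cmp C p2 u = k))"

lemma is_termD: "is_term C t \<Longrightarrow> u \<in> hom C x t \<Longrightarrow> v \<in> hom C x t \<Longrightarrow> category C \<Longrightarrow> u = v"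
  unfolding is_term_def using category.hom_Obj by metis

lemma is_pbI:
  assumes "f \<in> hom C x z" "g \<in> hom C y z" "p1 \<in> hom C p x" "p2 \<in> hom C p y" "Cmp C f p1 = Cmp C g p2"
    and "\<And>w h k. h \<in> hom C w x \<Longrightarrow> k \<in> hom C w y \<Longrightarrow> Cmp C f h = Cmp C g k \<Longrightarrow>
        \<exists>u. u \<in> hom C w p \<and> Cmp C p1 u = h \<and> Cmp C p2 u = k"
    and "\<And>w u v. u \<in> hom C w p \<Longrightarrow> v \<in> hom C w p \<Longrightarrow> Cmp C p1 u = Cmp C p1 v \<Longrightarrow> Cmp C p2 u = Cmp C p2 v \<Longrightarrow> u = v"
  shows "is_pb C f g p1 p2"
proof -
  have *: "Dom C f = x" "Dom C g = y" "Dom C p1 = p" using assms by (auto simp: hom_def)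
  have "\<exists>!u. u \<in> hom C w p \<and> Cmp C p1 u = h \<and> Cmp C p2 u = k"
    if "h \<in> hom C w x" "k \<in> hom C w y" "Cmp C f h = Cmp C g k" for w h k
    using assms(6)[OF that] assms(7) by metis
  with * assms(1-5) show ?thesis unfolding is_pb_def * by (auto simp: hom_def)
qed

lemma is_pbD:
  assumes "is_pb C f g p1 p2"
  obtains x y z p where "f \<in> hom C x z" "g \<in> hom C y z" "p1 \<in> hom C p x" "p2 \<in> hom C p y" "Cmp C f p1 = Cmp C g p2"
  using assms by (auto simp: is_pb_def hom_def)

lemma is_pb_ex1:
  assumes "is_pb C f g p1 p2" "p1 \<in> hom C p x" "p2 \<in> hom C p y"
    "h \<in> hom C w x" "k \<in> hom C w y" "Cmp C f h = Cmp C g k"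
  shows "\<exists>!u. u \<in> hom C w p \<and> Cmp C p1 u = h \<and> Cmp C p2 u = k"
proof -
  have "Dom C f = x" "Dom C g = y" "Dom C p1 = p" using assms by (auto simp: is_pb_def hom_def)
  with assms show ?thesis unfolding is_pb_def by blast
qed

lemma is_pb_unique:
  assumes pb: "is_pb C f g p1 p2" and C: "category C" and p: "p1 \<in> hom C p x"
    and uv: "u \<in> hom C w p" "v \<in> hom C w p" "Cmp C p1 u = Cmp C p1 v" "Cmp C p2 u = Cmp C p2 v"
  shows "u = v"
proof -
  obtain x' y z p' where h: "f \<in> hom C x' z" "g \<in> hom C y z" "p1 \<in> hom C p' x'" "p2 \<in> hom C p' y"
    "Cmp C f p1 = Cmp C g p2" using is_pbD[OF pb] .
  have [simp]: "x' = x" "p' = p" using p h(3) by (auto simp: hom_def)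
  have "Cmp C f (Cmp C p1 u) = Cmp C g (Cmp C p2 u)"
    using category.cmp_assoc[OF C uv(1) _ h(1)] category.cmp_assoc[OF C uv(1) _ h(2)] h p by auto
  from is_pb_ex1[OF pb p _ category.cmp_in[OF C uv(1) p] category.cmp_in[OF C uv(1)] this] h(4)
  show ?thesis using uv by auto
qed

lemma is_term_iso:
  assumes C: "category C" and t: "is_term C t" and e: "e \<in> hom C t t'" "is_iso C e"
  shows "is_term C t'"
  unfolding is_term_def
proof (intro conjI ballI ex_ex1I)
  obtain e' where e': "e' \<in> hom C t' t" "Cmp C e e' = Ide C t'"
    using e category.is_iso_iff[OF C e(1)] by blast
  show "t' \<in> Obj C" using category.hom_Obj[OF C e(1)] by simp
  show "\<exists>u. u \<in> hom C x t'" if "x \<in> Obj C" for x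
    using t that category.cmp_in[OF C _ e(1)] unfolding is_term_def by blast
  fix x u v assume u: "u \<in> hom C x t'" and v: "v \<in> hom C x t'"
  have "Cmp C e' u = Cmp C e' v"
    using is_termD[OF t category.cmp_in[OF C u e'(1)] category.cmp_in[OF C v e'(1)] C] .
  then have "Cmp C (Cmp C e e') u = Cmp C (Cmp C e e') v"
    using category.cmp_assoc[OF C u e'(1) e(1)] category.cmp_assoc[OF C v e'(1) e(1)] by simp
  then show "u = v" using category.ide_cmp[OF C u] category.ide_cmp[OF C v] e'(2) by simp
qed

lemma is_pb_iso:
  assumes C: "category C" and pb: "is_pb C f g p1 p2"
    and h: "f \<in> hom C x z" "g \<in> hom C y z" "p1 \<in> hom C p x" "p2 \<in> hom C p y"
    and h': "f' \<in> hom C x' z'" "g' \<in> hom C y' z'" "p1' \<in> hom C p' x'" "p2' \<in> hom C p' y'"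
      "Cmp C f' p1' = Cmp C g' p2'"
    and i: "a \<in> hom C x x'" "b \<in> hom C y y'" "c \<in> hom C z z'" "e \<in> hom C p p'"
      "is_iso C a" "is_iso C b" "is_iso C c" "is_iso C e"
    and s: "Cmp C f' a = Cmp C c f" "Cmp C g' b = Cmp C c g" "Cmp C p1' e = Cmp C a p1" "Cmp C p2' e = Cmp C b p2"
  shows "is_pb C f' g' p1' p2'"
proof (rule is_pbI[OF h'])
  note ass = category.cmp_assoc[OF C] and cin = category.cmp_in[OF C]
  have inv: "\<exists>a' \<in> hom C v u. Cmp C a' a = Ide C u \<and> Cmp C a a' = Ide C v" if "a \<in> hom C u v" "is_iso C a" for a u v
    using that category.is_iso_iff[OF C that(1)] by blast
  obtain a' where a': "a' \<in> hom C x' x" "Cmp C a' a = Ide C x" "Cmp C a a' = Ide C x'" using inv i(1,5) by blast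
  obtain b' where b': "b' \<in> hom C y' y" "Cmp C b' b = Ide C y" "Cmp C b b' = Ide C y'" using inv i(2,6) by blast
  obtain c' where c': "c' \<in> hom C z' z" "Cmp C c' c = Ide C z" "Cmp C c c' = Ide C z'" using inv i(3,7) by blast
  obtain e' where e': "e' \<in> hom C p' p" "Cmp C e' e = Ide C p" "Cmp C e e' = Ide C p'" using inv i(4,8) by blast
  have can: "Cmp C q (Cmp C q' t) = t" if "q \<in> hom C u v" "q' \<in> hom C v u" "Cmp C q q' = Ide C v" "t \<in> hom C w v"
    for q q' t u v w
    using ass[OF that(4,2,1)] category.ide_cmp[OF C that(4)] that(3) by simp
  \<comment> \<open>A commuting square with invertible sides \<open>q\<close> and \<open>r\<close>
    still commutes with these sides inverted. It is applied to both arrows of the cospan and to both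
    projections.\<close>
  have inv_sq: "Cmp C q' f2 = Cmp C f1 r'"
    if "q \<in> hom C v v'" "r \<in> hom C u u'" "q' \<in> hom C v' v" "r' \<in> hom C u' u" "f1 \<in> hom C u v" "f2 \<in> hom C u' v'"
      "Cmp C q' q = Ide C v" "Cmp C r r' = Ide C u'" "Cmp C f2 r = Cmp C q f1"
    for q r q' r' f1 f2 u u' v v'
  proof -
    have "Cmp C q' f2 = Cmp C q' (Cmp C f2 (Cmp C r r'))"
      using that(8) category.cmp_ide[OF C that(6)] by simp
    also have "\<dots> = Cmp C q' (Cmp C q (Cmp C f1 r'))"
      using ass[OF that(4) that(2) that(6)] ass[OF that(4) that(5) that(1)] that(9) by simp
    also have "\<dots> = Cmp C f1 r'" by (rule can[OF that(3,1,7) cin[OF that(4,5)]])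
    finally show ?thesis .
  qed
  note sf = inv_sq[OF i(3) i(1) c'(1) a'(1) h(1) h'(1) c'(2) a'(3) s(1)]
    and coproj = inv_sq[OF i(3) i(2) c'(1) b'(1) h(2) h'(2) c'(2) b'(3) s(2)]
  {
    fix w k l assume k: "k \<in> hom C w x'" and l: "l \<in> hom C w y'" and kl: "Cmp C f' k = Cmp C g' l"
    have "Cmp C f (Cmp C a' k) = Cmp C c' (Cmp C f' k)"
      using ass[OF k a'(1) h(1)] ass[OF k h'(1) c'(1)] sf by simp
    moreover have "Cmp C g (Cmp C b' l) = Cmp C c' (Cmp C g' l)"
      using ass[OF l b'(1) h(2)] ass[OF l h'(2) c'(1)] coproj by simp
    ultimately have "Cmp C f (Cmp C a' k) = Cmp C g (Cmp C b' l)" using kl by simp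
    with is_pb_ex1[OF pb h(3,4) cin[OF k a'(1)] cin[OF l b'(1)]] obtain u where
      u: "u \<in> hom C w p" "Cmp C p1 u = Cmp C a' k" "Cmp C p2 u = Cmp C b' l" by blast
    have "Cmp C p1' (Cmp C e u) = Cmp C a (Cmp C p1 u)" "Cmp C p2' (Cmp C e u) = Cmp C b (Cmp C p2 u)"
      using ass[OF u(1) i(4) h'(3)] ass[OF u(1) h(3) i(1)] ass[OF u(1) i(4) h'(4)] ass[OF u(1) h(4) i(2)] s by simp_all
    then have "Cmp C p1' (Cmp C e u) = k" "Cmp C p2' (Cmp C e u) = l"
      using can[OF i(1) a'(1,3) k] can[OF i(2) b'(1,3) l] u by simp_all
    then show "\<exists>u. u \<in> hom C w p' \<and> Cmp C p1' u = k \<and> Cmp C p2' u = l"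
      using cin[OF u(1) i(4)] by blast
  next
    fix w u v assume u: "u \<in> hom C w p'" and v: "v \<in> hom C w p'"
      and uv: "Cmp C p1' u = Cmp C p1' v" "Cmp C p2' u = Cmp C p2' v"
    note s1 = inv_sq[OF i(1) i(4) a'(1) e'(1) h(3) h'(3) a'(2) e'(3) s(3)]
      and s2 = inv_sq[OF i(2) i(4) b'(1) e'(1) h(4) h'(4) b'(2) e'(3) s(4)]
    have "Cmp C p1 (Cmp C e' t) = Cmp C a' (Cmp C p1' t)" "Cmp C p2 (Cmp C e' t) = Cmp C b' (Cmp C p2' t)"
      if "t \<in> hom C w p'" for t
      using ass[OF that e'(1) h(3)] ass[OF that e'(1) h(4)] ass[OF that h'(3) a'(1)] ass[OF that h'(4) b'(1)] s1 s2
      by simp_all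
    then have "Cmp C e' u = Cmp C e' v"
      using is_pb_unique[OF pb C h(3) cin[OF u e'(1)] cin[OF v e'(1)]] u v uv by simp
    then show "u = v" using can[OF i(4) e'(1,3) u] can[OF i(4) e'(1,3) v] by metis
  }
qed

text \<open>A functor \<open>a\<close> with a left adjoint \<open>r\<close> whose unit is an identity preserves limits.\<close>

context
  fixes S :: "('o, 'm) cat" and A :: "('p, 'n) cat" and a r c
  assumes a: "a \<in> Fun S A" and r: "r \<in> Fun A S" and ar: "a \<circ>\<^sub>F r = idf A"
    and c: "c \<in> Nat (r \<circ>\<^sub>F a) (idf S)" and ac: "\<And>X. X \<in> Obj S \<Longrightarrow> FAr a (NCmp c X) = Ide A (FOb a X)"
begin

lemma right_adjoint_facts:
  shows "x \<in> Obj A \<Longrightarrow> FOb a (FOb r x) = x" "m \<in> Arr A \<Longrightarrow> FAr a (FAr r m) = m"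
    and "X \<in> Obj S \<Longrightarrow> NCmp c X \<in> hom S (FOb r (FOb a X)) X"
    and "f \<in> hom S X Y \<Longrightarrow> Cmp S (NCmp c Y) (FAr r (FAr a f)) = Cmp S f (NCmp c X)"
proof -
  have S: "category S" using Fun_cat[OF a] by simp
  show "FOb a (FOb r x) = x" if "x \<in> Obj A"
    using fcomp_FOb[OF r that, of a] that by (simp add: ar) (simp add: idf_def)
  show "FAr a (FAr r m) = m" if "m \<in> Arr A"
    using fcomp_FAr[OF r that, of a] that by (simp add: ar) (simp add: idf_def)
  show "NCmp c X \<in> hom S (FOb r (FOb a X)) X" if "X \<in> Obj S"
    using Nat_hom[OF c fcomp_Fun[OF a r] that] that by (simp add: fcomp_FOb[OF a] idf_def)
  show "Cmp S (NCmp c Y) (FAr r (FAr a f)) = Cmp S f (NCmp c X)" if "f \<in> hom S X Y"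
    using Nat_nat[OF c fcomp_Fun[OF a r] that] homD[OF that] by (simp add: fcomp_FAr[OF a] idf_def)
qed

text \<open>The transpose of \<open>h\<close> is the counit after \<open>r h\<close>. Since
  \<open>a r\<close> is the identity and \<open>a\<close> sends the counit to identities,
  \<open>a\<close> recovers \<open>h\<close>. So arrows into \<open>a X\<close> form, naturally in
  \<open>X\<close>, a retract of the arrows from \<open>r w\<close> to \<open>X\<close>, and
  existence and uniqueness of mediating arrows pass along this retraction.\<close>

lemma right_adjoint_transpose:
  assumes X: "X \<in> Obj S" and h: "h \<in> hom A w (FOb a X)"
  shows "Cmp S (NCmp c X) (FAr r h) \<in> hom S (FOb r w) X" "FAr a (Cmp S (NCmp c X) (FAr r h)) = h"
    and "f \<in> hom S X Y \<Longrightarrow> Cmp S f (Cmp S (NCmp c X) (FAr r h)) = Cmp S (NCmp c Y) (FAr r (Cmp A (FAr a f) h))"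
proof -
  have S: "category S" and A: "category A" using Fun_cat[OF a] by simp_all
  note rh = Fun_hom[OF r h] and cX = right_adjoint_facts(3)[OF X]
  show "Cmp S (NCmp c X) (FAr r h) \<in> hom S (FOb r w) X" by (rule category.cmp_in[OF S rh cX])
  have "FAr a (Cmp S (NCmp c X) (FAr r h)) = Cmp A (Ide A (FOb a X)) h"
    using Fun_Cmp[OF a rh cX] ac[OF X] right_adjoint_facts(2) h by (simp add: hom_def)
  then show "FAr a (Cmp S (NCmp c X) (FAr r h)) = h" using category.ide_cmp[OF A h] by simp
  show "Cmp S f (Cmp S (NCmp c X) (FAr r h)) = Cmp S (NCmp c Y) (FAr r (Cmp A (FAr a f) h))"
    if f: "f \<in> hom S X Y"
  proof -
    have Y: "Y \<in> Obj S" using category.hom_Obj[OF S f] by simp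
    have "Cmp S f (Cmp S (NCmp c X) (FAr r h)) = Cmp S (Cmp S (NCmp c Y) (FAr r (FAr a f))) (FAr r h)"
      using category.cmp_assoc[OF S rh cX f] right_adjoint_facts(4)[OF f] by simp
    also have "\<dots> = Cmp S (NCmp c Y) (Cmp S (FAr r (FAr a f)) (FAr r h))"
      using category.cmp_assoc[OF S rh Fun_hom[OF r Fun_hom[OF a f]] right_adjoint_facts(3)[OF Y]] by simp
    finally show ?thesis using Fun_Cmp[OF r h Fun_hom[OF a f]] by simp
  qed
qed

lemma right_adjoint_is_term:
  assumes t: "is_term S t" shows "is_term A (FOb a t)"
  unfolding is_term_def
proof (intro conjI ballI ex_ex1I)
  have S: "category S" using Fun_cat[OF a] by simp
  have tO: "t \<in> Obj S" using t by (simp add: is_term_def)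
  then show "FOb a t \<in> Obj A" by (rule Fun_Ob[OF a])
  show "\<exists>u. u \<in> hom A x (FOb a t)" if x: "x \<in> Obj A" for x
  proof -
    obtain u where "u \<in> hom S (FOb r x) t" using t Fun_Ob[OF r x] unfolding is_term_def by blast
    then show ?thesis using Fun_hom[OF a] right_adjoint_facts(1)[OF x] by metis
  qed
  show "u = v" if "u \<in> hom A x (FOb a t)" "v \<in> hom A x (FOb a t)" for x u v
    using is_termD[OF t right_adjoint_transpose(1)[OF tO that(1)] right_adjoint_transpose(1)[OF tO that(2)] S]
      right_adjoint_transpose(2)[OF tO that(1)] right_adjoint_transpose(2)[OF tO that(2)] by metis
qed

lemma right_adjoint_is_pb:
  assumes pb: "is_pb S f g p1 p2" shows "is_pb A (FAr a f) (FAr a g) (FAr a p1) (FAr a p2)"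
proof -
  have S: "category S" and A: "category A" using Fun_cat[OF a] by simp_all
  obtain x y z p where h: "f \<in> hom S x z" "g \<in> hom S y z" "p1 \<in> hom S p x" "p2 \<in> hom S p y"
    "Cmp S f p1 = Cmp S g p2" using is_pbD[OF pb] .
  have O: "x \<in> Obj S" "y \<in> Obj S" "p \<in> Obj S" using category.hom_Obj[OF S] h by blast+
  show ?thesis
  proof (rule is_pbI[OF Fun_hom[OF a h(1)] Fun_hom[OF a h(2)] Fun_hom[OF a h(3)] Fun_hom[OF a h(4)]])
    show "Cmp A (FAr a f) (FAr a p1) = Cmp A (FAr a g) (FAr a p2)"
      using Fun_Cmp[OF a h(3,1)] Fun_Cmp[OF a h(4,2)] h(5) by simp
  next
    fix w k l assume k: "k \<in> hom A w (FOb a x)" and l: "l \<in> hom A w (FOb a y)"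
      and kl: "Cmp A (FAr a f) k = Cmp A (FAr a g) l"
    then have w: "w \<in> Obj A" using category.hom_Obj[OF A] by blast
    have "Cmp S f (Cmp S (NCmp c x) (FAr r k)) = Cmp S g (Cmp S (NCmp c y) (FAr r l))"
      using right_adjoint_transpose(3)[OF O(1) k h(1)] right_adjoint_transpose(3)[OF O(2) l h(2)] kl by simp
    with is_pb_ex1[OF pb h(3,4) right_adjoint_transpose(1)[OF O(1) k] right_adjoint_transpose(1)[OF O(2) l]] obtain u where
      u: "u \<in> hom S (FOb r w) p" "Cmp S p1 u = Cmp S (NCmp c x) (FAr r k)" "Cmp S p2 u = Cmp S (NCmp c y) (FAr r l)"
      by blast
    have "Cmp A (FAr a p1) (FAr a u) = k" "Cmp A (FAr a p2) (FAr a u) = l"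
      using Fun_Cmp[OF a u(1) h(3)] Fun_Cmp[OF a u(1) h(4)] u right_adjoint_transpose(2)[OF O(1) k] right_adjoint_transpose(2)[OF O(2) l]
      by simp_all
    then show "\<exists>u. u \<in> hom A w (FOb a p) \<and> Cmp A (FAr a p1) u = k \<and> Cmp A (FAr a p2) u = l"
      using Fun_hom[OF a u(1)] right_adjoint_facts(1)[OF w] by auto
  next
    fix w u v assume u: "u \<in> hom A w (FOb a p)" and v: "v \<in> hom A w (FOb a p)"
      and uv: "Cmp A (FAr a p1) u = Cmp A (FAr a p1) v" "Cmp A (FAr a p2) u = Cmp A (FAr a p2) v"
    have "Cmp S (NCmp c p) (FAr r u) = Cmp S (NCmp c p) (FAr r v)"
      by (rule is_pb_unique[OF pb S h(3) right_adjoint_transpose(1)[OF O(3) u] right_adjoint_transpose(1)[OF O(3) v]])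
        (simp_all add: right_adjoint_transpose(3)[OF O(3) u h(3)] right_adjoint_transpose(3)[OF O(3) u h(4)]
          right_adjoint_transpose(3)[OF O(3) v h(3)] right_adjoint_transpose(3)[OF O(3) v h(4)] uv)
    then show "u = v" using right_adjoint_transpose(2)[OF O(3) u] right_adjoint_transpose(2)[OF O(3) v] by metis
  qed
qed

end

text \<open>A binary product is treated as the pullback over the terminal object.\<close>

definition sq :: "limkind \<Rightarrow> ('o, 'm) cat \<Rightarrow> ('o, 'm) otm \<Rightarrow> ('o, 'm) otm \<Rightarrow> ('o, 'm) otm
    \<Rightarrow> ('o, 'm) mtm \<Rightarrow> ('o, 'm) mtm \<Rightarrow> ('o, 'm) otm \<Rightarrow> ('o, 'm) mtm \<Rightarrow> ('o, 'm) mtm \<Rightarrow> bool" where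
  "sq K A X Y Z f g P p1 p2 \<longleftrightarrow>
    K = FiniteProducts \<and> oeq K A X X \<and> oeq K A Y Y \<and> Z = OOne \<and> f = MBang X \<and> g = MBang Y
      \<and> P = OProd X Y \<and> p1 = MPr1 X Y \<and> p2 = MPr2 X Y
  \<or> K = FiniteLimits \<and> aeq K A X Z f f \<and> aeq K A Y Z g g
      \<and> P = OPb X Y f g \<and> p1 = MPb1 X Y f g \<and> p2 = MPb2 X Y f g"

lemma sq_wf:
  assumes A: "category A" and s: "sq K A X Y Z f g P p1 p2"
  shows "oeq K A X X" "oeq K A Y Y" "oeq K A Z Z" "oeq K A P P" "aeq K A X Z f f" "aeq K A Y Z g g"
    "aeq K A P X p1 p1" "aeq K A P Y p2 p2" "aeq K A P Z (MComp f p1) (MComp g p2)"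
proof -
  consider (p) "K = FiniteProducts" "oeq K A X X" "oeq K A Y Y" "Z = OOne" "f = MBang X" "g = MBang Y"
      "P = OProd X Y" "p1 = MPr1 X Y" "p2 = MPr2 X Y"
    | (l) "K = FiniteLimits" "aeq K A X Z f f" "aeq K A Y Z g g" "P = OPb X Y f g" "p1 = MPb1 X Y f g" "p2 = MPb2 X Y f g"
    using s unfolding sq_def by auto
  then have "oeq K A X X \<and> oeq K A Y Y \<and> oeq K A Z Z \<and> aeq K A X Z f f \<and> aeq K A Y Z g g \<and>
    aeq K A P X p1 p1 \<and> aeq K A P Y p2 p2 \<and> aeq K A P Z (MComp f p1) (MComp g p2)"
  proof cases
    case p
    \<comment> \<open>Both composites end in \<open>OOne\<close>, so each equals the canonical arrow
      out of the product.\<close>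
    then show ?thesis
      using a_bang_unique[OF a_comp[OF a_pr1 a_bang, of K A X X Y Y X]]
        a_bang_unique[OF a_comp[OF a_pr2 a_bang, of K A X X Y Y Y]]
      by (blast intro: o_one a_bang a_pr1 a_pr2 a_sym a_trans)
  next
    case l
    with aeq_wf[OF A l(2)] aeq_wf[OF A l(3)] show ?thesis
      by (blast intro: a_pb1 a_pb2 a_pb_square)
  qed
  then show "oeq K A X X" "oeq K A Y Y" "oeq K A Z Z" "oeq K A P P" "aeq K A X Z f f" "aeq K A Y Z g g"
    "aeq K A P X p1 p1" "aeq K A P Y p2 p2" "aeq K A P Z (MComp f p1) (MComp g p2)"
    using aeq_wf[OF A] by blast+
qed

lemma sq_OProd: "category A \<Longrightarrow> oeq K A (OProd X Y) (OProd X Y) \<Longrightarrow>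
    sq K A X Y OOne (MBang X) (MBang Y) (OProd X Y) (MPr1 X Y) (MPr2 X Y)"
  using oeq_OProdD[of A K X Y] by (simp add: sq_def)

text \<open>The functors out of the free category that send formal limits to limits. For
  \<open>TerminalObject\<close> there are no squares \<open>sq\<close>, so one definition covers the
  three kinds.\<close>

definition KLim :: "limkind \<Rightarrow> ('o, 'm) cat \<Rightarrow> ('p, 'n) cat \<Rightarrow> (('o, 'm) sob, ('o, 'm) sar, 'p, 'n) ftr \<Rightarrow> bool" where
  "KLim K A D G \<longleftrightarrow> is_term D (Tob K A G OOne) \<and> (\<forall>X Y Z f g P p1 p2. sq K A X Y Z f g P p1 p2 \<longrightarrow>
     is_pb D (Tar K A G X Z f) (Tar K A G Y Z g) (Tar K A G P X p1) (Tar K A G P Y p2))"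

lemma KLimD:
  assumes "KLim K A D G"
  shows "is_term D (Tob K A G OOne)" and "sq K A X Y Z f g P p1 p2 \<Longrightarrow>
     is_pb D (Tar K A G X Z f) (Tar K A G Y Z g) (Tar K A G P X p1) (Tar K A G P Y p2)"
  using assms by (auto simp: KLim_def)

text \<open>The existence, computation and uniqueness rules of the term calculus are the universal
  properties, read on classes.\<close>

lemma KLim_free:
  assumes A: "category A" shows "KLim K A (S_cat K A) (idf (S_cat K A))"
proof -
  let ?S = "S_cat K A"
  have S: "category ?S" using A by (rule category_S_cat)
  have To: "Tob K A (idf ?S) X = ocl K A X" if "oeq K A X X" for X
    using ocl_Obj[OF that] by (simp add: Tob_def idf_def)
  have Ta: "Tar K A (idf ?S) X Y f = acl K A X Y f" if "aeq K A X Y f f" for X Y f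
    using acl_Arr[OF that] by (simp add: Tar_def idf_def)
  have "is_term ?S (ocl K A OOne)"
    unfolding is_term_def
  proof (intro conjI ballI ex_ex1I)
    show "ocl K A OOne \<in> Obj ?S" by (rule ocl_Obj[OF o_one])
    fix c assume "c \<in> Obj ?S"
    then obtain X where X: "c = ocl K A X" "oeq K A X X" by (rule S_cat_ObjE)
    show "\<exists>u. u \<in> hom ?S c (ocl K A OOne)" using acl_hom[OF a_bang[OF X(2)]] X by blast
    have "u = acl K A X OOne (MBang X)" if u: "u \<in> hom ?S c (ocl K A OOne)" for u
    proof -
      obtain f where "u = acl K A X OOne f" "aeq K A X OOne f f"
        using u unfolding X by (rule S_cat_homE[OF A _ X(2) o_one])
      then show ?thesis using acl_eqI'[OF A a_bang_unique] by simp
    qed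
    then show "u = v" if "u \<in> hom ?S c (ocl K A OOne)" "v \<in> hom ?S c (ocl K A OOne)" for u v using that by metis
  qed
  moreover have "is_pb ?S (acl K A X Z f) (acl K A Y Z g) (acl K A P X p1) (acl K A P Y p2)"
    if s: "sq K A X Y Z f g P p1 p2" for X Y Z f g P p1 p2
  proof -
    note wf = sq_wf[OF A s]
    show ?thesis
    proof (rule is_pbI[OF acl_hom[OF wf(5)] acl_hom[OF wf(6)] acl_hom[OF wf(7)] acl_hom[OF wf(8)]])
      show "Cmp ?S (acl K A X Z f) (acl K A P X p1) = Cmp ?S (acl K A Y Z g) (acl K A P Y p2)"
        using S_cat_Cmp[OF A wf(7,5)] S_cat_Cmp[OF A wf(8,6)] acl_eqI'[OF A wf(9)] by simp
    next
      fix w \<phi> \<psi> assume \<phi>: "\<phi> \<in> hom ?S w (ocl K A X)" and \<psi>: "\<psi> \<in> hom ?S w (ocl K A Y)"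
        and eq: "Cmp ?S (acl K A X Z f) \<phi> = Cmp ?S (acl K A Y Z g) \<psi>"
      obtain W where W: "w = ocl K A W" "oeq K A W W"
        using category.hom_Obj[OF S \<phi>] by (auto elim: S_cat_ObjE)
      obtain h where h: "\<phi> = acl K A W X h" "aeq K A W X h h"
        using \<phi> unfolding W by (rule S_cat_homE[OF A _ W(2) wf(1)])
      obtain k where k: "\<psi> = acl K A W Y k" "aeq K A W Y k k"
        using \<psi> unfolding W by (rule S_cat_homE[OF A _ W(2) wf(2)])
      have hk: "aeq K A W Z (MComp f h) (MComp g k)"
        using eq S_cat_Cmp[OF A h(2) wf(5)] S_cat_Cmp[OF A k(2) wf(6)] acl_eqD a_comp[OF h(2) wf(5)]
        by (simp add: h k)
      have "\<exists>u. aeq K A W P u u \<and> aeq K A W X (MComp p1 u) h \<and> aeq K A W Y (MComp p2 u) k"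
      proof (cases "K = FiniteProducts")
        case True
        then have "P = OProd X Y" "p1 = MPr1 X Y" "p2 = MPr2 X Y" using s by (auto simp: sq_def)
        then show ?thesis
          using a_pair[OF True h(2) k(2)] a_pr1_pair[OF True h(2) k(2)] a_pr2_pair[OF True h(2) k(2)] by blast
      next
        case False
        then have "K = FiniteLimits" "P = OPb X Y f g" "p1 = MPb1 X Y f g" "p2 = MPb2 X Y f g"
          using s by (auto simp: sq_def)
        then show ?thesis
          using a_lift[OF _ wf(1,2,5,6) h(2) k(2) hk] a_pb1_lift[OF _ wf(5,6) h(2) k(2) hk]
            a_pb2_lift[OF _ wf(5,6) h(2) k(2) hk] by blast
      qed
      then obtain u where u: "aeq K A W P u u" "aeq K A W X (MComp p1 u) h" "aeq K A W Y (MComp p2 u) k" by blast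
      show "\<exists>u. u \<in> hom ?S w (ocl K A P) \<and> Cmp ?S (acl K A P X p1) u = \<phi> \<and> Cmp ?S (acl K A P Y p2) u = \<psi>"
        using acl_hom[OF u(1)] S_cat_Cmp[OF A u(1) wf(7)] S_cat_Cmp[OF A u(1) wf(8)]
          acl_eqI'[OF A u(2)] acl_eqI'[OF A u(3)]
        by (intro exI[of _ "acl K A W P u"]) (simp add: W h k)
    next
      fix w \<phi> \<psi> assume \<phi>: "\<phi> \<in> hom ?S w (ocl K A P)" and \<psi>: "\<psi> \<in> hom ?S w (ocl K A P)"
        and eq: "Cmp ?S (acl K A P X p1) \<phi> = Cmp ?S (acl K A P X p1) \<psi>"
          "Cmp ?S (acl K A P Y p2) \<phi> = Cmp ?S (acl K A P Y p2) \<psi>"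
      obtain W where W: "w = ocl K A W" "oeq K A W W"
        using category.hom_Obj[OF S \<phi>] by (auto elim: S_cat_ObjE)
      obtain u where u: "\<phi> = acl K A W P u" "aeq K A W P u u"
        using \<phi> unfolding W by (rule S_cat_homE[OF A _ W(2) wf(4)])
      obtain v where v: "\<psi> = acl K A W P v" "aeq K A W P v v"
        using \<psi> unfolding W by (rule S_cat_homE[OF A _ W(2) wf(4)])
      have uv: "aeq K A W X (MComp p1 u) (MComp p1 v)" "aeq K A W Y (MComp p2 u) (MComp p2 v)"
        using eq S_cat_Cmp[OF A u(2) wf(7)] S_cat_Cmp[OF A v(2) wf(7)] S_cat_Cmp[OF A u(2) wf(8)]
          S_cat_Cmp[OF A v(2) wf(8)] acl_eqD a_comp[OF u(2) wf(7)] a_comp[OF u(2) wf(8)]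
        by (simp_all add: u v)
      have "aeq K A W P u v"
      proof (cases "K = FiniteProducts")
        case True
        then have *: "P = OProd X Y" "p1 = MPr1 X Y" "p2 = MPr2 X Y" using s by (auto simp: sq_def)
        \<comment> \<open>Both \<open>u\<close> and \<open>v\<close> are pairings of their own
          projections, and these projections agree.\<close>
        show ?thesis
          using a_trans[OF a_pair_unique[OF True wf(1,2) u(2)[unfolded *]]
              a_trans[OF a_pair[OF True uv[unfolded *]] a_sym[OF a_pair_unique[OF True wf(1,2) v(2)[unfolded *]]]]]
          by (simp add: *)
      next
        case False
        then have *: "K = FiniteLimits" "P = OPb X Y f g" "p1 = MPb1 X Y f g" "p2 = MPb2 X Y f g"
          using s by (auto simp: sq_def)
        show ?thesis
          using a_lift_unique[OF *(1) wf(5,6)] u v uv unfolding * by blast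
      qed
      then show "\<phi> = \<psi>" using acl_eqI'[OF A] by (simp add: u v)
    qed
  qed
  ultimately show ?thesis
    unfolding KLim_def using To[OF o_one] sq_wf[OF A] Ta by simp
qed

lemma sq_map:
  assumes F: "F \<in> Fun A B" and s: "sq K A X Y Z f g P p1 p2"
  shows "sq K B (map_o F X) (map_o F Y) (map_o F Z) (map_m F f) (map_m F g) (map_o F P) (map_m F p1) (map_m F p2)"
  using s map_sound[OF F] unfolding sq_def by auto

text \<open>The image of a formal square under \<open>S_functor\<close> is again a formal square, on
  the nose.\<close>

lemma KLim_S_functor:
  assumes b: "b \<in> Fun (S_cat K B) D" and F: "F \<in> Fun A B" and k: "KLim K B D b"
  shows "KLim K A D (b \<circ>\<^sub>F S_functor K F)"
proof -
  have A: "category A" and B: "category B" using Fun_cat[OF F] by auto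
  note To = Tob_S_functor[OF b B F] and Ta = Tar_S_functor[OF b B F]
  show ?thesis
    unfolding KLim_def
  proof (intro conjI allI impI)
    show "is_term D (Tob K A (b \<circ>\<^sub>F S_functor K F) OOne)" using KLimD(1)[OF k] To[OF o_one] by simp
    show "is_pb D (Tar K A (b \<circ>\<^sub>F S_functor K F) X Z f) (Tar K A (b \<circ>\<^sub>F S_functor K F) Y Z g)
        (Tar K A (b \<circ>\<^sub>F S_functor K F) P X p1) (Tar K A (b \<circ>\<^sub>F S_functor K F) P Y p2)"
      if s: "sq K A X Y Z f g P p1 p2" for X Y Z f g P p1 p2
      using KLimD(2)[OF k sq_map[OF F s]] sq_wf[OF A s] Ta by simp
  qed
qed

lemma KLim_iso:
  assumes A: "category A" and e: "e \<in> NatIso H G" and H: "H \<in> Fun (S_cat K A) D" and k: "KLim K A D H"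
  shows "KLim K A D G"
proof -
  have e': "e \<in> Nat H G" using e by (simp add: NatIso_def)
  have G: "G \<in> Fun (S_cat K A) D" using Nat_Fun[OF e'] by (simp add: Fun_Src[OF H] Fun_Tgt[OF H])
  have D: "category D" using Fun_cat[OF H] by simp
  have eh: "NCmp e (ocl K A X) \<in> hom D (Tob K A H X) (Tob K A G X)" "is_iso D (NCmp e (ocl K A X))"
    if "oeq K A X X" for X
    using Nat_hom[OF e' H ocl_Obj[OF that]] e ocl_Obj[OF that] by (auto simp: Tob_def NatIso_iff[OF H])
  have en: "Cmp D (Tar K A G X Y f) (NCmp e (ocl K A X)) = Cmp D (NCmp e (ocl K A Y)) (Tar K A H X Y f)"
    if "aeq K A X Y f f" for X Y f
    using Nat_nat[OF e' H acl_hom[OF that]] by (simp add: Tar_def)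
  note Hh = Tar_hom[OF A H] and Gh = Tar_hom[OF A G]
  show ?thesis
    unfolding KLim_def
  proof (intro conjI allI impI)
    show "is_term D (Tob K A G OOne)" by (rule is_term_iso[OF D KLimD(1)[OF k] eh[OF o_one]])
    fix X Y Z f g P p1 p2 assume s: "sq K A X Y Z f g P p1 p2"
    note wf = sq_wf[OF A s]
    have "Cmp D (Tar K A G X Z f) (Tar K A G P X p1) = Cmp D (Tar K A G Y Z g) (Tar K A G P Y p2)"
      using Tar_comp[OF A G wf(7,5)] Tar_comp[OF A G wf(8,6)] Tar_cong'[OF A G wf(9)] by simp
    then show "is_pb D (Tar K A G X Z f) (Tar K A G Y Z g) (Tar K A G P X p1) (Tar K A G P Y p2)"
      by (rule is_pb_iso[OF D KLimD(2)[OF k s] Hh[OF wf(5)] Hh[OF wf(6)] Hh[OF wf(7)] Hh[OF wf(8)]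
          Gh[OF wf(5)] Gh[OF wf(6)] Gh[OF wf(7)] Gh[OF wf(8)] _
          eh(1)[OF wf(1)] eh(1)[OF wf(2)] eh(1)[OF wf(3)] eh(1)[OF wf(4)]
          eh(2)[OF wf(1)] eh(2)[OF wf(2)] eh(2)[OF wf(3)] eh(2)[OF wf(4)]
          en[OF wf(5)] en[OF wf(6)] en[OF wf(7)] en[OF wf(8)]])
  qed
qed

section \<open>Extending natural transformations along the unit\<close>

text \<open>Uniqueness half of the Kan extension property. At a formal limit, naturality against the
  projections expresses the component of either transformation through components at smaller terms,
  and the image of the square under \<open>G\<close> is a limit.\<close>

lemma Nat_gen_eqI:
  assumes A: "category A" and H: "H \<in> Fun (S_cat K A) D" and k: "KLim K A D G"
    and c: "c \<in> Nat H G" and d: "d \<in> Nat H G"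
    and eq: "\<And>x. x \<in> Obj A \<Longrightarrow> NCmp c (ocl K A (OGen x)) = NCmp d (ocl K A (OGen x))"
  shows "c = d"
proof (rule Nat_eqI[OF c d H])
  have G: "G \<in> Fun (S_cat K A) D" using Nat_Fun[OF c] by (simp add: Fun_Src[OF H] Fun_Tgt[OF H])
  have D: "category D" using Fun_cat[OF H] by simp
  note ch = Nat_hom[OF c H ocl_Obj] and dh = Nat_hom[OF d H ocl_Obj]
  have step: "NCmp c (ocl K A P) = NCmp d (ocl K A P)"
    if s: "sq K A X Y Z f g P p1 p2" and X: "NCmp c (ocl K A X) = NCmp d (ocl K A X)"
      and Y: "NCmp c (ocl K A Y) = NCmp d (ocl K A Y)" for X Y Z f g P p1 p2
  proof -
    note wf = sq_wf[OF A s]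
    have "Cmp D (Tar K A G P X p1) (NCmp c (ocl K A P)) = Cmp D (Tar K A G P X p1) (NCmp d (ocl K A P))"
      "Cmp D (Tar K A G P Y p2) (NCmp c (ocl K A P)) = Cmp D (Tar K A G P Y p2) (NCmp d (ocl K A P))"
      using Nat_nat[OF c H acl_hom[OF wf(7)]] Nat_nat[OF d H acl_hom[OF wf(7)]]
        Nat_nat[OF c H acl_hom[OF wf(8)]] Nat_nat[OF d H acl_hom[OF wf(8)]] X Y
      by (simp_all add: Tar_def)
    then show ?thesis
      using is_pb_unique[OF KLimD(2)[OF k s] D Tar_hom[OF A G wf(7)]] ch[OF wf(4)] dh[OF wf(4)]
      by (simp add: Tob_def)
  qed
  fix x assume "x \<in> Obj (S_cat K A)"
  then obtain X where X: "x = ocl K A X" "oeq K A X X" by (rule S_cat_ObjE)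
  \<comment> \<open>Object and arrow terms are mutually recursive datatypes; the arrow half of the
    induction only has to be present.\<close>
  have "oeq K A X X \<Longrightarrow> NCmp c (ocl K A X) = NCmp d (ocl K A X)" and True for f :: "('a, 'b) mtm"
  proof (induction X and f)
    case (OGen x)
    then show ?case using oeq_wf_parts(1)[OF A OGen] eq by simp
  next
    case OOne
    then show ?case
      using is_termD[OF KLimD(1)[OF k, unfolded Tob_def] ch[OF o_one] dh[OF o_one] D] by simp
  next
    case (OProd X Y)
    then show ?case using step[OF sq_OProd[OF A]] oeq_OProdD[OF A, of K X Y] by blast
  next
    case (OPb X Y f g)
    then obtain Z where "K = FiniteLimits" "aeq K A X Z f f" "aeq K A Y Z g g" by (elim oeq_OPbE[OF A])
    then show ?case
      using step[of X Y Z f g "OPb X Y f g" "MPb1 X Y f g" "MPb2 X Y f g"] OPb aeq_wf[OF A] by (simp add: sq_def)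
  qed simp_all
  then show "NCmp c x = NCmp d x" using X by simp
qed

text \<open>Classes offer no recursion, so the component is defined on raw terms. At each formal
  limit it is described as the mediating arrow; that such an arrow exists is proved afterwards, for
  well-formed terms.\<close>

primrec ext_cmp where
  "ext_cmp K A D H G \<alpha> (OGen x) = \<alpha> x"
| "ext_cmp K A D H G \<alpha> OOne = (THE u. u \<in> hom D (Tob K A H OOne) (Tob K A G OOne))"
| "ext_cmp K A D H G \<alpha> (OProd X Y) = (THE u. u \<in> hom D (Tob K A H (OProd X Y)) (Tob K A G (OProd X Y)) \<and>
     Cmp D (Tar K A G (OProd X Y) X (MPr1 X Y)) u
       = Cmp D (ext_cmp K A D H G \<alpha> X) (Tar K A H (OProd X Y) X (MPr1 X Y)) \<and>
     Cmp D (Tar K A G (OProd X Y) Y (MPr2 X Y)) u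
       = Cmp D (ext_cmp K A D H G \<alpha> Y) (Tar K A H (OProd X Y) Y (MPr2 X Y)))"
| "ext_cmp K A D H G \<alpha> (OPb X Y f g) = (THE u. u \<in> hom D (Tob K A H (OPb X Y f g)) (Tob K A G (OPb X Y f g)) \<and>
     Cmp D (Tar K A G (OPb X Y f g) X (MPb1 X Y f g)) u
       = Cmp D (ext_cmp K A D H G \<alpha> X) (Tar K A H (OPb X Y f g) X (MPb1 X Y f g)) \<and>
     Cmp D (Tar K A G (OPb X Y f g) Y (MPb2 X Y f g)) u
       = Cmp D (ext_cmp K A D H G \<alpha> Y) (Tar K A H (OPb X Y f g) Y (MPb2 X Y f g)))"

locale unit_extension =
  fixes K :: limkind and A :: "('o, 'm) cat" and D :: "('p, 'n) cat" and H G \<alpha>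
  assumes A: "category A" and H: "H \<in> Fun (S_cat K A) D" and G: "G \<in> Fun (S_cat K A) D"
    and k: "KLim K A D G"
    and \<alpha>: "\<And>x. x \<in> Obj A \<Longrightarrow> \<alpha> x \<in> hom D (Tob K A H (OGen x)) (Tob K A G (OGen x))"
    and \<alpha>_nat: "\<And>m x y. m \<in> hom A x y \<Longrightarrow> Cmp D (\<alpha> y) (Tar K A H (OGen x) (OGen y) (MGen m))
      = Cmp D (Tar K A G (OGen x) (OGen y) (MGen m)) (\<alpha> x)"
begin

abbreviation "cmpt \<equiv> ext_cmp K A D H G \<alpha>"
abbreviation "Ho \<equiv> Tob K A H"
abbreviation "Ha \<equiv> Tar K A H"
abbreviation "Go \<equiv> Tob K A G"
abbreviation "Ga \<equiv> Tar K A G"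

definition ok where "ok X \<longleftrightarrow> cmpt X \<in> hom D (Ho X) (Go X)"
text \<open>Typing of the components at both ends is part of the notion because the rules for
  arrows, such as composition, have no premises on objects from which an induction could obtain
  it.\<close>

definition nat_at where "nat_at X Y f \<longleftrightarrow> ok X \<and> ok Y \<and> Cmp D (cmpt Y) (Ha X Y f) = Cmp D (Ga X Y f) (cmpt X)"

lemma category_D: "category D" using Fun_cat[OF H] by simp

lemmas D_assoc = category.cmp_assoc[OF category_D]

lemma nat_at_eq: "nat_at X Y f \<Longrightarrow> aeq K A X Y f f' \<Longrightarrow> nat_at X Y f'"
  unfolding nat_at_def using Tar_cong'[OF A H] Tar_cong'[OF A G] by simp

lemma nat_at_comp:
  assumes f: "nat_at X Y f" "aeq K A X Y f f" and g: "nat_at Y Z g" "aeq K A Y Z g g"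
  shows "nat_at X Z (MComp g f)"
proof -
  note h = Tar_hom[OF A H f(2)] Tar_hom[OF A H g(2)] Tar_hom[OF A G f(2)] Tar_hom[OF A G g(2)]
  have c: "cmpt X \<in> hom D (Ho X) (Go X)" "cmpt Y \<in> hom D (Ho Y) (Go Y)" "cmpt Z \<in> hom D (Ho Z) (Go Z)"
    using f g by (auto simp: nat_at_def ok_def)
  show ?thesis
    using f(1) g(1) D_assoc[OF h(1,2) c(3)] D_assoc[OF h(1) c(2) h(4)] D_assoc[OF c(1) h(3,4)]
    by (simp add: nat_at_def Tar_comp[OF A H f(2) g(2)] Tar_comp[OF A G f(2) g(2)])
qed

lemma ok_OOne: "ok OOne"
proof -
  have "\<exists>!u. u \<in> hom D (Ho OOne) (Go OOne)"
    using KLimD(1)[OF k] Tob_Obj[OF A H o_one] by (simp add: is_term_def)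
  from theI'[OF this] show ?thesis by (simp add: ok_def)
qed

lemma nat_at_OOne: assumes "ok X" "aeq K A X OOne f f" shows "nat_at X OOne f"
proof -
  have "Cmp D (cmpt OOne) (Ha X OOne f) = Cmp D (Ga X OOne f) (cmpt X)"
    by (rule is_termD[OF KLimD(1)[OF k]
          category.cmp_in[OF category_D Tar_hom[OF A H assms(2)] ok_OOne[unfolded ok_def]]
          category.cmp_in[OF category_D assms(1)[unfolded ok_def] Tar_hom[OF A G assms(2)]] category_D])
  then show ?thesis using assms ok_OOne by (simp add: nat_at_def)
qed

lemma ext_cmp_sq:
  assumes "sq K A X Y Z f g P p1 p2"
  shows "cmpt P = (THE u. u \<in> hom D (Ho P) (Go P) \<and>
     Cmp D (Ga P X p1) u = Cmp D (cmpt X) (Ha P X p1) \<and> Cmp D (Ga P Y p2) u = Cmp D (cmpt Y) (Ha P Y p2))"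
  using assms unfolding sq_def by auto

text \<open>Naturality at the cospan \<open>f\<close>, \<open>g\<close> turns the two composites of
  projections with components into a cone over its image under \<open>G\<close>. The mediating arrow
  of this cone is the component at \<open>P\<close>, and its two equations are naturality at the
  projections.\<close>

lemma nat_at_sq:
  assumes s: "sq K A X Y Z f g P p1 p2" and f: "nat_at X Z f" and g: "nat_at Y Z g"
  shows "nat_at P X p1" "nat_at P Y p2"
proof -
  note wf = sq_wf[OF A s]
  have c: "cmpt X \<in> hom D (Ho X) (Go X)" "cmpt Y \<in> hom D (Ho Y) (Go Y)" "cmpt Z \<in> hom D (Ho Z) (Go Z)"
    using f g by (auto simp: nat_at_def ok_def)
  note Hh = Tar_hom[OF A H] and Gh = Tar_hom[OF A G]
  have "Cmp D (Ga X Z f) (Cmp D (cmpt X) (Ha P X p1)) = Cmp D (cmpt Z) (Ha P Z (MComp f p1))"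
    using f D_assoc[OF Hh[OF wf(7)] c(1) Gh[OF wf(5)]] D_assoc[OF Hh[OF wf(7)] Hh[OF wf(5)] c(3)]
    by (simp add: nat_at_def Tar_comp[OF A H wf(7,5)])
  moreover have "Cmp D (Ga Y Z g) (Cmp D (cmpt Y) (Ha P Y p2)) = Cmp D (cmpt Z) (Ha P Z (MComp g p2))"
    using g D_assoc[OF Hh[OF wf(8)] c(2) Gh[OF wf(6)]] D_assoc[OF Hh[OF wf(8)] Hh[OF wf(6)] c(3)]
    by (simp add: nat_at_def Tar_comp[OF A H wf(8,6)])
  ultimately have "\<exists>!u. u \<in> hom D (Ho P) (Go P) \<and>
     Cmp D (Ga P X p1) u = Cmp D (cmpt X) (Ha P X p1) \<and> Cmp D (Ga P Y p2) u = Cmp D (cmpt Y) (Ha P Y p2)"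
    using Tar_cong'[OF A H wf(9)] category.cmp_in[OF category_D Hh[OF wf(7)] c(1)]
      category.cmp_in[OF category_D Hh[OF wf(8)] c(2)]
    by (intro is_pb_ex1[OF KLimD(2)[OF k s] Gh[OF wf(7)] Gh[OF wf(8)]]) simp_all
  from theI'[OF this] show "nat_at P X p1" "nat_at P Y p2"
    using c by (auto simp: nat_at_def ok_def ext_cmp_sq[OF s, symmetric])
qed

text \<open>The projections are jointly monic after \<open>G\<close>, so naturality at an arrow into
  \<open>P\<close> may be tested after composing with them.\<close>

lemma nat_at_into:
  assumes s: "sq K A X Y Z f g P p1 p2" and p: "nat_at P X p1" "nat_at P Y p2" and u: "aeq K A W P u u"
    and pu: "nat_at W X (MComp p1 u)" "nat_at W Y (MComp p2 u)"
  shows "nat_at W P u"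
proof -
  note wf = sq_wf[OF A s]
  note Hh = Tar_hom[OF A H] and Gh = Tar_hom[OF A G]
  have c: "cmpt P \<in> hom D (Ho P) (Go P)" "cmpt W \<in> hom D (Ho W) (Go W)" "cmpt X \<in> hom D (Ho X) (Go X)"
    "cmpt Y \<in> hom D (Ho Y) (Go Y)"
    using p pu by (auto simp: nat_at_def ok_def)
  have *: "Cmp D (Ga P X p1) (Cmp D (cmpt P) (Ha W P u)) = Cmp D (Ga P X p1) (Cmp D (Ga W P u) (cmpt W))"
    using p(1) pu(1) D_assoc[OF Hh[OF u] c(1) Gh[OF wf(7)]] D_assoc[OF c(2) Gh[OF u] Gh[OF wf(7)]]
      D_assoc[OF Hh[OF u] Hh[OF wf(7)] c(3)]
    by (simp add: nat_at_def Tar_comp[OF A H u wf(7)] Tar_comp[OF A G u wf(7)])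
  have **: "Cmp D (Ga P Y p2) (Cmp D (cmpt P) (Ha W P u)) = Cmp D (Ga P Y p2) (Cmp D (Ga W P u) (cmpt W))"
    using p(2) pu(2) D_assoc[OF Hh[OF u] c(1) Gh[OF wf(8)]] D_assoc[OF c(2) Gh[OF u] Gh[OF wf(8)]]
      D_assoc[OF Hh[OF u] Hh[OF wf(8)] c(4)]
    by (simp add: nat_at_def Tar_comp[OF A H u wf(8)] Tar_comp[OF A G u wf(8)])
  have "Cmp D (cmpt P) (Ha W P u) = Cmp D (Ga W P u) (cmpt W)"
    by (rule is_pb_unique[OF KLimD(2)[OF k s] category_D Gh[OF wf(7)] category.cmp_in[OF category_D Hh[OF u] c(1)]
          category.cmp_in[OF category_D c(2) Gh[OF u]] * **])
  then show ?thesis using p pu by (simp add: nat_at_def)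
qed

lemma nat_at_cong:
  assumes "nat_at X Y f" "aeq K A X Y f f" "oeq K A X X'" "oeq K A Y Y'" "cmpt X = cmpt X'" "cmpt Y = cmpt Y'"
  shows "nat_at X' Y' f"
  using assms Tob_cong[OF A H assms(3)] Tob_cong[OF A H assms(4)] Tob_cong[OF A G assms(3)] Tob_cong[OF A G assms(4)]
    Tar_cong[OF A H assms(2-4)] Tar_cong[OF A G assms(2-4)]
  by (simp add: nat_at_def ok_def)

lemma ok_cong: "ok X \<Longrightarrow> oeq K A X X' \<Longrightarrow> cmpt X = cmpt X' \<Longrightarrow> ok X'"
  using Tob_cong[OF A H] Tob_cong[OF A G] by (simp add: ok_def)

lemma nat_at_id:
  assumes X: "oeq K A X X" and ok: "ok X" shows "nat_at X X (MId X)"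
  using ok category.cmp_ide[OF category_D] category.ide_cmp[OF category_D]
  by (simp add: nat_at_def ok_def Tar_id[OF A H X] Tar_id[OF A G X])

text \<open>The claims cannot be separated. The component at a pullback exists only when its cospan
  is known to be natural, and naturality at a converted arrow requires equal object terms to have
  equal components. Hence a single induction over derivations.\<close>

lemma ext_cmp_natural:
  shows "oeq K A X X' \<Longrightarrow> ok X \<and> cmpt X = cmpt X'"
    and "aeq K A X Y f f' \<Longrightarrow> nat_at X Y f"
proof (induction rule: oeq_aeq.inducts)
  case (o_sym X Y) then show ?case using ok_cong by metis
next
  case (o_trans X Y Z) then show ?case by simp
next
  case (a_sym X Y f g) then show ?case using nat_at_eq by blast
next
  case (a_trans X Y f g h) then show ?case by simp
next
  case (a_conv X Y f g X' Y') then show ?case using nat_at_cong aeq_refl(1) by blast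
next
  case (a_id X X') then show ?case using nat_at_id oeq_refl(1) by blast
next
  case (a_comp X Y f f' Z g g') then show ?case using nat_at_comp aeq_refl(1) by blast
next
  case (a_comp_id X Y f) then show ?case using nat_at_eq a_sym[OF oeq_aeq.a_comp_id] by blast
next
  case (a_id_comp X Y f) then show ?case using nat_at_eq a_sym[OF oeq_aeq.a_id_comp] by blast
next
  case (a_assoc X Y f Z g W h) then show ?case using nat_at_comp a_comp by blast
next
  case (o_gen x) then show ?case using \<alpha> by (simp add: ok_def)
next
  case (a_gen m)
  then show ?case
    using \<alpha>_nat[OF Arr_hom] \<alpha> category.dom_in[OF A] category.cod_in[OF A] by (simp add: nat_at_def ok_def)
next
  case (a_gen_id x)
  then show ?case using \<alpha>_nat[OF category.ide_in[OF A]] \<alpha> by (simp add: nat_at_def ok_def)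
next
  case (a_gen_comp m n)
  then have "Cmp A n m \<in> hom A (Dom A m) (Cod A n)"
    using category.cmp_in[OF A, of m "Dom A m" "Cod A m" n] by (simp add: hom_def)
  then show ?case
    using \<alpha>_nat \<alpha> a_gen_comp category.dom_in[OF A] category.cod_in[OF A] by (simp add: nat_at_def ok_def)
next
  case o_one then show ?case using ok_OOne by simp
next
  case (a_bang X X') then show ?case using nat_at_OOne oeq_aeq.a_bang oeq_refl(1) by blast
next
  case (a_bang_unique X f) then show ?case by simp
next
  case (o_prod X X' Y Y')
  have s: "sq K A X Y OOne (MBang X) (MBang Y) (OProd X Y) (MPr1 X Y) (MPr2 X Y)"
    using o_prod oeq_refl(1) by (simp add: sq_def) blast
  have "nat_at X OOne (MBang X)" "nat_at Y OOne (MBang Y)" using o_prod nat_at_OOne a_bang oeq_refl(1) by blast+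
  then have "ok (OProd X Y)" using nat_at_sq[OF s] by (simp add: nat_at_def)
  moreover note e = oeq_aeq.o_prod[OF o_prod(1,2,4)]
    oeq_aeq.a_pr1[OF o_prod(1,2,4)] oeq_aeq.a_pr2[OF o_prod(1,2,4)]
  \<comment> \<open>Equal terms have the same image under \<open>H\<close> and \<open>G\<close>, so
    the two definite descriptions pose literally the same condition.\<close>
  then have "cmpt (OProd X Y) = cmpt (OProd X' Y')"
    using o_prod(3,5) Tob_cong[OF A H e(1)] Tob_cong[OF A G e(1)]
      Tar_cong[OF A H e(2) e(1) o_prod(2)] Tar_cong[OF A G e(2) e(1) o_prod(2)]
      Tar_cong[OF A H e(3) e(1) o_prod(4)] Tar_cong[OF A G e(3) e(1) o_prod(4)]
    by simp
  ultimately show ?case by simp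
next
  case (a_pr1 X X' Y Y')
  have s: "sq K A X Y OOne (MBang X) (MBang Y) (OProd X Y) (MPr1 X Y) (MPr2 X Y)"
    using a_pr1 oeq_refl(1) by (simp add: sq_def) blast
  have "nat_at X OOne (MBang X)" "nat_at Y OOne (MBang Y)" using a_pr1 nat_at_OOne a_bang oeq_refl(1) by blast+
  then show ?case using nat_at_sq[OF s] by simp
next
  case (a_pr2 X X' Y Y')
  have s: "sq K A X Y OOne (MBang X) (MBang Y) (OProd X Y) (MPr1 X Y) (MPr2 X Y)"
    using a_pr2 oeq_refl(1) by (simp add: sq_def) blast
  have "nat_at X OOne (MBang X)" "nat_at Y OOne (MBang Y)" using a_pr2 nat_at_OOne a_bang oeq_refl(1) by blast+
  then show ?case using nat_at_sq[OF s] by simp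
next
  case (a_pair W X h h' Y k k')
  have hk: "aeq K A W X h h" "aeq K A W Y k k" using a_pair aeq_refl(1) by blast+
  have XY: "oeq K A X X" "oeq K A Y Y" using aeq_wf[OF A] hk by blast+
  have s: "sq K A X Y OOne (MBang X) (MBang Y) (OProd X Y) (MPr1 X Y) (MPr2 X Y)"
    using a_pair XY by (simp add: sq_def)
  have "nat_at X OOne (MBang X)" "nat_at Y OOne (MBang Y)"
    using a_pair nat_at_OOne a_bang[OF XY(1)] a_bang[OF XY(2)] unfolding nat_at_def by blast+
  note p = nat_at_sq[OF s this]
  show ?case
    using nat_at_into[OF s p oeq_aeq.a_pair[OF a_pair(1) hk]] nat_at_eq[OF a_pair(3) a_sym[OF a_pr1_pair[OF a_pair(1) hk]]]
      nat_at_eq[OF a_pair(5) a_sym[OF a_pr2_pair[OF a_pair(1) hk]]] by simp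
next
  case (a_pr1_pair W X h Y k) then show ?case using nat_at_eq[OF _ a_sym[OF oeq_aeq.a_pr1_pair]] by blast
next
  case (a_pr2_pair W X h Y k) then show ?case using nat_at_eq[OF _ a_sym[OF oeq_aeq.a_pr2_pair]] by blast
next
  case (a_pair_unique X Y W u) then show ?case by simp
next
  case (o_pb X X' Y Y' Z f f' g g')
  have s: "sq K A X Y Z f g (OPb X Y f g) (MPb1 X Y f g) (MPb2 X Y f g)"
    using o_pb aeq_refl(1) by (simp add: sq_def) blast
  have "ok (OPb X Y f g)" using nat_at_sq(1)[OF s] o_pb unfolding nat_at_def by blast
  moreover note e = oeq_aeq.o_pb[OF o_pb(1,2,4,6,8)] oeq_aeq.a_pb1[OF o_pb(1,2,4,6,8)]
    oeq_aeq.a_pb2[OF o_pb(1,2,4,6,8)]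
  then have "cmpt (OPb X Y f g) = cmpt (OPb X' Y' f' g')"
    using o_pb(3,5) Tob_cong[OF A H e(1)] Tob_cong[OF A G e(1)]
      Tar_cong[OF A H e(2) e(1) o_pb(2)] Tar_cong[OF A G e(2) e(1) o_pb(2)]
      Tar_cong[OF A H e(3) e(1) o_pb(4)] Tar_cong[OF A G e(3) e(1) o_pb(4)]
    by simp
  ultimately show ?case by simp
next
  case (a_pb1 X X' Y Y' Z f f' g g')
  have s: "sq K A X Y Z f g (OPb X Y f g) (MPb1 X Y f g) (MPb2 X Y f g)"
    using a_pb1 aeq_refl(1) by (simp add: sq_def) blast
  show ?case using nat_at_sq[OF s] a_pb1 by simp
next
  case (a_pb2 X X' Y Y' Z f f' g g')
  have s: "sq K A X Y Z f g (OPb X Y f g) (MPb1 X Y f g) (MPb2 X Y f g)"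
    using a_pb2 aeq_refl(1) by (simp add: sq_def) blast
  show ?case using nat_at_sq[OF s] a_pb2 by simp
next
  case (a_pb_square X Z f Y g)
  then have s: "sq K A X Y Z f g (OPb X Y f g) (MPb1 X Y f g) (MPb2 X Y f g)" by (simp add: sq_def)
  show ?case using nat_at_comp[OF _ sq_wf(7)[OF A s] _ a_pb_square(2)] nat_at_sq[OF s] a_pb_square by blast
next
  case (a_lift X X' Y Y' Z f f' g g' W h h' k k')
  have r: "aeq K A X Z f f" "aeq K A Y Z g g" "aeq K A W X h h" "aeq K A W Y k k"
    using a_lift aeq_refl(1) by blast+
  have XY: "oeq K A X X" "oeq K A Y Y" using a_lift oeq_refl(1) by blast+
  have s: "sq K A X Y Z f g (OPb X Y f g) (MPb1 X Y f g) (MPb2 X Y f g)"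
    using a_lift r by (simp add: sq_def)
  have p: "nat_at (OPb X Y f g) X (MPb1 X Y f g)" "nat_at (OPb X Y f g) Y (MPb2 X Y f g)"
    using nat_at_sq[OF s] a_lift by blast+
  have hk: "aeq K A W Z (MComp f h) (MComp g k)" using a_lift by blast
  have "nat_at W X h" "nat_at W Y k" using a_lift by blast+
  then show ?case
    using nat_at_into[OF s p oeq_aeq.a_lift[OF a_lift(1) XY r hk]]
      nat_at_eq[OF _ a_sym[OF a_pb1_lift[OF a_lift(1) r hk]]] nat_at_eq[OF _ a_sym[OF a_pb2_lift[OF a_lift(1) r hk]]] by blast
next
  case (a_pb1_lift X Z f Y g W h k) then show ?case using nat_at_eq[OF _ a_sym[OF oeq_aeq.a_pb1_lift]] by blast
next
  case (a_pb2_lift X Z f Y g W h k) then show ?case using nat_at_eq[OF _ a_sym[OF oeq_aeq.a_pb2_lift]] by blast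
next
  case (a_lift_unique X Z f Y g W u v) then show ?case by simp
qed

lemma extension_exists: "\<exists>c \<in> Nat H G. \<forall>x \<in> Obj A. NCmp c (ocl K A (OGen x)) = \<alpha> x"
proof
  \<comment> \<open>The component at a class is read off a chosen representative; by
    \<open>ext_cmp_natural\<close> any other one gives the same value.\<close>
  let ?c = "\<lparr>NSrc = H, NTgt = G, NCmp = (\<lambda>c\<in>Obj (S_cat K A). cmpt (rep c))\<rparr>"
  have c: "NCmp ?c (ocl K A X) = cmpt X" if "oeq K A X X" for X
    using ext_cmp_natural(1)[OF rep_ocl[OF that]] ocl_Obj[OF that] by simp
  show "\<forall>x \<in> Obj A. NCmp ?c (ocl K A (OGen x)) = \<alpha> x" using c[OF o_gen] by simp
  show "?c \<in> Nat H G"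
  proof (rule NatI[OF _ _ H G])
    fix x assume "x \<in> Obj (S_cat K A)"
    then obtain X where X: "x = ocl K A X" "oeq K A X X" by (rule S_cat_ObjE)
    show "NCmp ?c x \<in> hom D (FOb H x) (FOb G x)"
      using ext_cmp_natural(1)[OF X(2)] unfolding X(1) c[OF X(2)] by (simp add: ok_def Tob_def)
  next
    fix \<phi> x y assume \<phi>: "\<phi> \<in> hom (S_cat K A) x y"
    obtain X Y where XY: "x = ocl K A X" "oeq K A X X" "y = ocl K A Y" "oeq K A Y Y"
      using category.hom_Obj[OF category_S_cat[OF A] \<phi>] by (auto elim!: S_cat_ObjE)
    obtain f where f: "\<phi> = acl K A X Y f" "aeq K A X Y f f"
      using \<phi> unfolding XY by (rule S_cat_homE[OF A _ XY(2,4)])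
    show "Cmp D (NCmp ?c y) (FAr H \<phi>) = Cmp D (FAr G \<phi>) (NCmp ?c x)"
      using ext_cmp_natural(2)[OF f(2)] unfolding f(1) XY(1,3) c[OF XY(2)] c[OF XY(4)] by (simp add: nat_at_def Tar_def)
  qed auto
qed

end

lemma Nat_gen_ext:
  assumes "category A" "H \<in> Fun (S_cat K A) D" "G \<in> Fun (S_cat K A) D" "KLim K A D G"
    and "\<And>x. x \<in> Obj A \<Longrightarrow> \<alpha> x \<in> hom D (Tob K A H (OGen x)) (Tob K A G (OGen x))"
    and "\<And>m x y. m \<in> hom A x y \<Longrightarrow> Cmp D (\<alpha> y) (Tar K A H (OGen x) (OGen y) (MGen m))
      = Cmp D (Tar K A G (OGen x) (OGen y) (MGen m)) (\<alpha> x)"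
  shows "\<exists>c \<in> Nat H G. \<forall>x \<in> Obj A. NCmp c (ocl K A (OGen x)) = \<alpha> x"
  by (rule unit_extension.extension_exists[OF unit_extension.intro]) (use assms in auto)

section \<open>Pseudomorphisms and algebra 2-cells\<close>

text \<open>The syntactic transformation is identified with the extension \<open>c\<close> of the
  components of \<alpha> from generators to the free category. Its naturality is then inherited from
  \<open>c\<close>, and no induction over arrow terms is required here.\<close>

lemma S_nattrans_Nat:
  assumes F: "F \<in> Fun A B" and \<alpha>: "\<alpha> \<in> Nat F G"
  shows "S_nattrans K \<alpha> \<in> Nat (S_functor K F) (S_functor K G)"
    and "x \<in> Obj A \<Longrightarrow> NCmp (S_nattrans K \<alpha>) (ocl K A (OGen x)) = acl K B (OGen (FOb F x)) (OGen (FOb G x)) (MGen (NCmp \<alpha> x))"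
proof -
  have A: "category A" and B: "category B" using Fun_cat[OF F] by auto
  have G: "G \<in> Fun A B" using Nat_Fun[OF \<alpha>] by (simp add: Fun_Src[OF F] Fun_Tgt[OF F])
  have SB: "category (S_cat K B)" using B by (rule category_S_cat)
  note SF = S_functor_Fun[OF F, of K] and SG = S_functor_Fun[OF G, of K]
  let ?H = "S_functor K F" and ?G = "S_functor K G"
  have kG: "KLim K A (S_cat K B) ?G"
    using KLim_S_functor[OF idf_Fun[OF SB] G KLim_free[OF B]] fcomp_idf(2)[OF SG] by simp
  have To: "Tob K A ?H X = ocl K B (map_o F X)" "Tob K A ?G X = ocl K B (map_o G X)" if "oeq K A X X" for X
    using S_functor_ocl[OF F that] S_functor_ocl[OF G that] by (simp_all add: Tob_def)
  have Ta: "Tar K A ?H X Y f = acl K B (map_o F X) (map_o F Y) (map_m F f)"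
    "Tar K A ?G X Y f = acl K B (map_o G X) (map_o G Y) (map_m G f)" if "aeq K A X Y f f" for X Y f
    using S_functor_acl[OF F that] S_functor_acl[OF G that] by (simp_all add: Tar_def)
  let ?\<alpha> = "\<lambda>x. acl K B (OGen (FOb F x)) (OGen (FOb G x)) (MGen (NCmp \<alpha> x))"
  have ah: "aeq K B (OGen (FOb F x)) (OGen (FOb G x)) (MGen (NCmp \<alpha> x)) (MGen (NCmp \<alpha> x))" if "x \<in> Obj A" for x
    using a_gen[of "NCmp \<alpha> x" B] Nat_hom[OF \<alpha> F that] by (auto simp: hom_def)
  obtain c where c: "c \<in> Nat ?H ?G" and cg: "\<And>x. x \<in> Obj A \<Longrightarrow> NCmp c (ocl K A (OGen x)) = ?\<alpha> x"
  proof -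
    have "\<exists>c \<in> Nat ?H ?G. \<forall>x \<in> Obj A. NCmp c (ocl K A (OGen x)) = ?\<alpha> x"
    proof (rule Nat_gen_ext[OF A SF SG kG])
      show "?\<alpha> x \<in> hom (S_cat K B) (Tob K A ?H (OGen x)) (Tob K A ?G (OGen x))" if "x \<in> Obj A" for x
        using acl_hom[OF ah[OF that]] by (simp add: To o_gen[OF that])
      fix m x y assume m: "m \<in> hom A x y"
      have xy: "x \<in> Obj A" "y \<in> Obj A" using category.hom_Obj[OF A m] by auto
      have ma: "aeq K A (OGen x) (OGen y) (MGen m) (MGen m)" using a_gen[of m A] m by (auto simp: hom_def)
      note mF = map_sound(2)[OF F ma] and mG = map_sound(2)[OF G ma]
      have hs: "FAr F m \<in> Arr B" "FAr G m \<in> Arr B" "NCmp \<alpha> x \<in> Arr B" "NCmp \<alpha> y \<in> Arr B"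
        "Dom B (FAr F m) = FOb F x" "Cod B (FAr F m) = FOb F y" "Dom B (FAr G m) = FOb G x" "Cod B (FAr G m) = FOb G y"
        "Dom B (NCmp \<alpha> x) = FOb F x" "Cod B (NCmp \<alpha> x) = FOb G x" "Dom B (NCmp \<alpha> y) = FOb F y" "Cod B (NCmp \<alpha> y) = FOb G y"
        using Fun_hom[OF F m] Fun_hom[OF G m] Nat_hom[OF \<alpha> F xy(1)] Nat_hom[OF \<alpha> F xy(2)] by (auto simp: hom_def)
      have "aeq K B (OGen (FOb F x)) (OGen (FOb G y)) (MComp (MGen (NCmp \<alpha> y)) (MGen (FAr F m)))
          (MComp (MGen (FAr G m)) (MGen (NCmp \<alpha> x)))"
        using a_sym[OF a_gen_comp[of "FAr F m" B "NCmp \<alpha> y" K]] a_gen_comp[of "NCmp \<alpha> x" B "FAr G m" K]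
          Nat_nat[OF \<alpha> F m] hs by (auto intro: a_trans)
      from acl_eqI'[OF B this]
      show "Cmp (S_cat K B) (?\<alpha> y) (Tar K A ?H (OGen x) (OGen y) (MGen m)) =
          Cmp (S_cat K B) (Tar K A ?G (OGen x) (OGen y) (MGen m)) (?\<alpha> x)"
        using S_cat_Cmp[OF B mF, of "OGen (FOb G y)"] S_cat_Cmp[OF B ah[OF xy(1)], of "OGen (FOb G y)"]
          ah[OF xy(2)] mG by (simp add: Ta[OF ma])
    qed
    then show thesis using that by blast
  qed
  have step: "\<exists>u. NCmp c (ocl K A P) = acl K B (map_o F P) (map_o G P) u \<and> aeq K B (map_o F P) (map_o G P) u u
      \<and> aeq K B (map_o F P) (map_o G X) (MComp (map_m G p1) u) (MComp (S_component \<alpha> X) (map_m F p1))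
      \<and> aeq K B (map_o F P) (map_o G Y) (MComp (map_m G p2) u) (MComp (S_component \<alpha> Y) (map_m F p2))"
    if s: "sq K A X Y Z f g P p1 p2"
      and X: "NCmp c (ocl K A X) = acl K B (map_o F X) (map_o G X) (S_component \<alpha> X)"
        "aeq K B (map_o F X) (map_o G X) (S_component \<alpha> X) (S_component \<alpha> X)"
      and Y: "NCmp c (ocl K A Y) = acl K B (map_o F Y) (map_o G Y) (S_component \<alpha> Y)"
        "aeq K B (map_o F Y) (map_o G Y) (S_component \<alpha> Y) (S_component \<alpha> Y)"
    for X Y Z f g P p1 p2
  proof -
    note wf = sq_wf[OF A s]
    have "NCmp c (ocl K A P) \<in> hom (S_cat K B) (ocl K B (map_o F P)) (ocl K B (map_o G P))"
      using Nat_hom[OF c SF ocl_Obj[OF wf(4)]] by (simp add: S_functor_ocl[OF F wf(4)] S_functor_ocl[OF G wf(4)])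
    then obtain u where u: "NCmp c (ocl K A P) = acl K B (map_o F P) (map_o G P) u" "aeq K B (map_o F P) (map_o G P) u u"
      by (rule S_cat_homE[OF B _ map_sound(1)[OF F wf(4)] map_sound(1)[OF G wf(4)]])
    have "acl K B (map_o F P) (map_o G X) (MComp (map_m G p1) u) = acl K B (map_o F P) (map_o G X) (MComp (S_component \<alpha> X) (map_m F p1))"
      using Nat_nat[OF c SF acl_hom[OF wf(7)]] S_cat_Cmp[OF B u(2) map_sound(2)[OF G wf(7)]]
        S_cat_Cmp[OF B map_sound(2)[OF F wf(7)] X(2)]
      by (simp add: u X S_functor_acl[OF F wf(7)] S_functor_acl[OF G wf(7)])
    moreover have "acl K B (map_o F P) (map_o G Y) (MComp (map_m G p2) u) = acl K B (map_o F P) (map_o G Y) (MComp (S_component \<alpha> Y) (map_m F p2))"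
      using Nat_nat[OF c SF acl_hom[OF wf(8)]] S_cat_Cmp[OF B u(2) map_sound(2)[OF G wf(8)]]
        S_cat_Cmp[OF B map_sound(2)[OF F wf(8)] Y(2)]
      by (simp add: u Y S_functor_acl[OF F wf(8)] S_functor_acl[OF G wf(8)])
    ultimately show ?thesis
      using u acl_eqD a_comp[OF u(2) map_sound(2)[OF G wf(7)]] a_comp[OF u(2) map_sound(2)[OF G wf(8)]] by blast
  qed
  \<comment> \<open>The components of \<open>c\<close> are represented by
    \<open>S_component\<close>: at a formal limit both have the same composites with the
    projections, and the uniqueness rule of the calculus applies.\<close>
  have "oeq K A X X \<Longrightarrow> NCmp c (ocl K A X) = acl K B (map_o F X) (map_o G X) (S_component \<alpha> X)
      \<and> aeq K B (map_o F X) (map_o G X) (S_component \<alpha> X) (S_component \<alpha> X)" and True for X and f :: "('a, 'b) mtm"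
  proof (induction X and f)
    case (OGen x)
    then have "x \<in> Obj A" using oeq_wf_parts(1)[OF A OGen] by simp
    then show ?case using cg ah by simp
  next
    case OOne
    have "NCmp c (ocl K A OOne) \<in> hom (S_cat K B) (ocl K B OOne) (ocl K B OOne)"
      using Nat_hom[OF c SF ocl_Obj[OF o_one]] S_functor_ocl[OF F o_one, of K] S_functor_ocl[OF G o_one, of K] by simp
    then obtain u where u: "NCmp c (ocl K A OOne) = acl K B OOne OOne u" "aeq K B OOne OOne u u"
      by (rule S_cat_homE[OF B _ o_one o_one])
    then have "aeq K B OOne OOne u (MId OOne)"
      using a_trans[OF a_bang_unique[OF u(2)] a_sym[OF a_bang_unique[OF a_id[OF o_one]]]] by simp
    then show ?case using u acl_eqI'[OF B] aeq_refl(2) by auto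
  next
    case (OProd X Y)
    note s = sq_OProd[OF A OProd.prems] and w = oeq_OProdD[OF A OProd.prems]
    note wf = sq_wf[OF A s]
    obtain u where u: "NCmp c (ocl K A (OProd X Y)) = acl K B (map_o F (OProd X Y)) (map_o G (OProd X Y)) u"
      "aeq K B (map_o F (OProd X Y)) (map_o G (OProd X Y)) u u"
      "aeq K B (map_o F (OProd X Y)) (map_o G X) (MComp (map_m G (MPr1 X Y)) u) (MComp (S_component \<alpha> X) (map_m F (MPr1 X Y)))"
      "aeq K B (map_o F (OProd X Y)) (map_o G Y) (MComp (map_m G (MPr2 X Y)) u) (MComp (S_component \<alpha> Y) (map_m F (MPr2 X Y)))"
      using step[OF s] OProd.IH(1)[OF wf(1)] OProd.IH(2)[OF wf(2)] by blast
    have "aeq K B (map_o F (OProd X Y)) (map_o G (OProd X Y)) u (S_component \<alpha> (OProd X Y))"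
      using a_trans[OF a_pair_unique[OF w(1) map_sound(1)[OF G wf(1)] map_sound(1)[OF G wf(2)] u(2)[simplified]]
          a_pair[OF w(1) u(3)[simplified] u(4)[simplified]]]
        Nat_Fun[OF \<alpha>] by (simp add: Let_def)
    then show ?case using u(1) acl_eqI'[OF B] aeq_refl(2) by auto
  next
    case (OPb X Y f g)
    obtain Z where Z: "K = FiniteLimits" "aeq K A X Z f f" "aeq K A Y Z g g" using OPb.prems by (elim oeq_OPbE[OF A])
    then have s: "sq K A X Y Z f g (OPb X Y f g) (MPb1 X Y f g) (MPb2 X Y f g)" by (simp add: sq_def)
    note wf = sq_wf[OF A s]
    let ?P = "OPb X Y f g"
    obtain u where u: "NCmp c (ocl K A ?P) = acl K B (map_o F ?P) (map_o G ?P) u"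
      "aeq K B (map_o F ?P) (map_o G ?P) u u"
      "aeq K B (map_o F ?P) (map_o G X) (MComp (map_m G (MPb1 X Y f g)) u) (MComp (S_component \<alpha> X) (map_m F (MPb1 X Y f g)))"
      "aeq K B (map_o F ?P) (map_o G Y) (MComp (map_m G (MPb2 X Y f g)) u) (MComp (S_component \<alpha> Y) (map_m F (MPb2 X Y f g)))"
      using step[OF s] OPb.IH(1)[OF wf(1)] OPb.IH(2)[OF wf(2)] by blast
    note Gwf = map_sound(2)[OF G wf(5)] map_sound(2)[OF G wf(6)] map_sound(2)[OF G wf(7), unfolded otm.map mtm.map]
      map_sound(2)[OF G wf(8), unfolded otm.map mtm.map] map_sound(2)[OF G wf(9), unfolded otm.map mtm.map]
    note u' = u(2-4)[unfolded otm.map mtm.map]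
    note hk = aeq_refl(2)[OF u'(2)] aeq_refl(2)[OF u'(3)]
    note cp0 = a_trans[OF a_assoc[OF u'(1) Gwf(3,1)] a_trans[OF a_comp[OF u'(1) Gwf(5)] a_sym[OF a_assoc[OF u'(1) Gwf(4,2)]]]]
    \<comment> \<open>The two legs must form a cone over the image of the cospan under
      \<open>G\<close> before \<open>MLift\<close> is well-formed. The equation is inherited from
      \<open>u\<close>, whose composites with the projections are these legs.\<close>
    note cp = a_trans[OF a_sym[OF a_comp[OF u'(2) Gwf(1)]] a_trans[OF cp0 a_comp[OF u'(3) Gwf(2)]]]
    note L = a_lift[OF Z(1) map_sound(1)[OF G wf(1)] map_sound(1)[OF G wf(2)] Gwf(1,2) hk cp]
    have "aeq K B (map_o F ?P) (map_o G ?P) u (S_component \<alpha> ?P)"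
      using a_lift_unique[OF Z(1) Gwf(1,2) u'(1) L a_trans[OF u'(2) a_sym[OF a_pb1_lift[OF Z(1) Gwf(1,2) hk cp]]]
          a_trans[OF u'(3) a_sym[OF a_pb2_lift[OF Z(1) Gwf(1,2) hk cp]]]]
        Nat_Fun[OF \<alpha>] by (simp add: Let_def)
    then show ?case using u(1) acl_eqI'[OF B] aeq_refl(2) by auto
  qed simp_all
  note comp = this(1)
  have "S_nattrans K \<alpha> = c"
  proof -
    have "NCmp (S_nattrans K \<alpha>) = NCmp c"
    proof (rule extensionalityI[where A = "Obj (S_cat K A)"])
      show "NCmp (S_nattrans K \<alpha>) \<in> extensional (Obj (S_cat K A))"
        using Nat_Fun[OF \<alpha>] by (simp add: S_nattrans_def Fun_Src[OF F])
      show "NCmp c \<in> extensional (Obj (S_cat K A))"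
        using c Nat_iff[OF SF SG] by simp
      fix x assume x: "x \<in> Obj (S_cat K A)"
      then obtain X where X: "x = ocl K A X" "oeq K A X X" by (rule S_cat_ObjE)
      note r = rep_ocl[OF X(2)]
      show "NCmp (S_nattrans K \<alpha>) x = NCmp c x"
        using comp[OF oeq_refl(2)[OF r]] x Nat_Fun[OF \<alpha>] ocl_eqI[OF r]
        by (simp add: S_nattrans_def Fun_Src[OF F] Fun_Tgt[OF F] X(1))
    qed
    then show ?thesis using Nat_Fun[OF \<alpha>] Nat_Fun[OF c] by (cases c) (simp add: S_nattrans_def)
  qed
  then show "S_nattrans K \<alpha> \<in> Nat (S_functor K F) (S_functor K G)"
    and "x \<in> Obj A \<Longrightarrow> NCmp (S_nattrans K \<alpha>) (ocl K A (OGen x)) = ?\<alpha> x"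
    using c cg by auto
qed

text \<open>Just enough of an algebra to speak of structures normalised on generators. Both strict
  algebras and free categories with \<open>S_mult\<close> are of this form.\<close>

definition action :: "limkind \<Rightarrow> ('o, 'm) cat \<Rightarrow> (('o, 'm) sob, ('o, 'm) sar, 'o, 'm) ftr \<Rightarrow> bool" where
  "action K A a \<longleftrightarrow> category A \<and> a \<in> Fun (S_cat K A) A \<and> a \<circ>\<^sub>F S_unit K A = idf A"

text \<open>The pseudomorphism axioms without the one for the multiplication, which is a consequence.\<close>

definition normal where
  "normal K A a b f f' \<longleftrightarrow> f' \<in> NatIso (b \<circ>\<^sub>F S_functor K f) (f \<circ>\<^sub>F a) \<and> f' \<triangleleft> S_unit K A = idn f"

context
  fixes K A a D b
  assumes Aa: "action K A a" and Db: "action K D b"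
begin

lemma action_facts: "category A" "category D" "a \<in> Fun (S_cat K A) A" "b \<in> Fun (S_cat K D) D"
  using Aa Db by (auto simp: action_def)

lemma gen_action:
  assumes f: "f \<in> Fun A D"
  shows "x \<in> Obj A \<Longrightarrow> FOb (f \<circ>\<^sub>F a) (ocl K A (OGen x)) = FOb f x"
    "m \<in> hom A x y \<Longrightarrow> FAr (f \<circ>\<^sub>F a) (acl K A (OGen x) (OGen y) (MGen m)) = FAr f m"
    "x \<in> Obj A \<Longrightarrow> FOb (b \<circ>\<^sub>F S_functor K f) (ocl K A (OGen x)) = FOb f x"
    "m \<in> hom A x y \<Longrightarrow> FAr (b \<circ>\<^sub>F S_functor K f) (acl K A (OGen x) (OGen y) (MGen m)) = FAr f m"
proof -
  note a = action_facts(3) and b = action_facts(4)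
  have u: "a \<circ>\<^sub>F S_unit K A = idf A" "b \<circ>\<^sub>F S_unit K D = idf D" using Aa Db by (auto simp: action_def)
  show 1: "FOb (f \<circ>\<^sub>F a) (ocl K A (OGen x)) = FOb f x" if "x \<in> Obj A" for x
    using Tob_S_unit[OF a action_facts(1) that] that u
    by (simp add: fcomp_FOb[OF a ocl_Obj[OF o_gen[OF that]]] Tob_def) (simp add: idf_def)
  show 2: "FOb (b \<circ>\<^sub>F S_functor K f) (ocl K A (OGen x)) = FOb f x" if "x \<in> Obj A" for x
    using Tob_S_unit[OF b action_facts(2) Fun_Ob[OF f that]] Fun_Ob[OF f that] u
    by (simp add: fcomp_FOb[OF S_functor_Fun[OF f] ocl_Obj[OF o_gen[OF that]]] S_functor_ocl[OF f o_gen[OF that]] Tob_def)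
      (simp add: idf_def)
  assume m: "m \<in> hom A x y"
  have am: "aeq K A (OGen x) (OGen y) (MGen m) (MGen m)" using a_gen[of m A] m by (auto simp: hom_def)
  show "FAr (f \<circ>\<^sub>F a) (acl K A (OGen x) (OGen y) (MGen m)) = FAr f m"
    using Tar_S_unit[OF a action_facts(1) m] homD[OF m] u
    by (simp add: fcomp_FAr[OF a acl_Arr[OF am]] Tar_def) (simp add: idf_def)
  show "FAr (b \<circ>\<^sub>F S_functor K f) (acl K A (OGen x) (OGen y) (MGen m)) = FAr f m"
    using Tar_S_unit[OF b action_facts(2) Fun_hom[OF f m]] homD[OF Fun_hom[OF f m]] u
    by (simp add: fcomp_FAr[OF S_functor_Fun[OF f] acl_Arr[OF am]] S_functor_acl[OF f am] Tar_def)
      (simp add: idf_def)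
qed

lemma pseudo_Fun:
  assumes f: "f \<in> Fun A D"
  shows "f \<circ>\<^sub>F a \<in> Fun (S_cat K A) D" "b \<circ>\<^sub>F S_functor K f \<in> Fun (S_cat K A) D"
  using fcomp_Fun[OF action_facts(3) f] fcomp_Fun[OF S_functor_Fun[OF f] action_facts(4)] by auto

text \<open>Along the unit both functors restrict to \<open>f\<close>, so the unit axiom is a
  condition on the components at generators.\<close>

lemma normal_iff:
  assumes f: "f \<in> Fun A D"
  shows "normal K A a b f f' \<longleftrightarrow> f' \<in> NatIso (b \<circ>\<^sub>F S_functor K f) (f \<circ>\<^sub>F a)
    \<and> (\<forall>x\<in>Obj A. NCmp f' (ocl K A (OGen x)) = Ide D (FOb f x))"
proof -
  note U = S_unit_Fun[OF action_facts(1), of K]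
  have "f' \<triangleleft> S_unit K A = idn f \<longleftrightarrow> (\<forall>x\<in>Obj A. NCmp f' (ocl K A (OGen x)) = Ide D (FOb f x))"
    if f': "f' \<in> NatIso (b \<circ>\<^sub>F S_functor K f) (f \<circ>\<^sub>F a)"
  proof
    assume e: "f' \<triangleleft> S_unit K A = idn f"
    show "\<forall>x\<in>Obj A. NCmp f' (ocl K A (OGen x)) = Ide D (FOb f x)"
      using whisker_pre_NCmp[OF U, of _ f'] idn_NCmp[OF f] by (simp add: e S_unit_FOb)
  next
    assume e: "\<forall>x\<in>Obj A. NCmp f' (ocl K A (OGen x)) = Ide D (FOb f x)"
    have mh: "m \<in> hom A (Dom A m) (Cod A m)" if "m \<in> Arr A" for m using Arr_hom[OF that] .
    have 1: "(b \<circ>\<^sub>F S_functor K f) \<circ>\<^sub>F S_unit K A = f"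
      by (rule Fun_eqI[OF fcomp_Fun[OF U pseudo_Fun(2)[OF f]] f])
        (simp_all add: fcomp_FOb[OF U] fcomp_FAr[OF U] S_unit_FOb S_unit_FAr gen_action[OF f] gen_action(4)[OF f mh])
    have 2: "(f \<circ>\<^sub>F a) \<circ>\<^sub>F S_unit K A = f"
      by (rule Fun_eqI[OF fcomp_Fun[OF U pseudo_Fun(1)[OF f]] f])
        (simp_all add: fcomp_FOb[OF U] fcomp_FAr[OF U] S_unit_FOb S_unit_FAr gen_action[OF f] gen_action(2)[OF f mh])
    have f'': "f' \<in> Nat (b \<circ>\<^sub>F S_functor K f) (f \<circ>\<^sub>F a)" using f' by (simp add: NatIso_def)
    have "f' \<triangleleft> S_unit K A \<in> Nat f f"
      using whisker_pre_Nat[OF f'' U pseudo_Fun(2)[OF f]] 1 2 by simp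
    then show "f' \<triangleleft> S_unit K A = idn f"
      by (rule Nat_eqI[OF _ idn_Nat[OF f] f])
        (use e in \<open>simp add: whisker_pre_NCmp[OF U] idn_NCmp[OF f] S_unit_FOb\<close>)
  qed
  then show ?thesis by (auto simp: normal_def)
qed

text \<open>Both functors preserve the formal limits and agree with \<open>f\<close> on generators,
  so the identities extend to transformations in both directions. The composites are identities on
  generators, hence identities.\<close>

lemma normal_exists:
  assumes f: "f \<in> Fun A D" and kf: "KLim K A D (f \<circ>\<^sub>F a)" and kb: "KLim K D D b"
  shows "\<exists>f'. normal K A a b f f'"
proof -
  let ?H = "b \<circ>\<^sub>F S_functor K f" and ?G = "f \<circ>\<^sub>F a"
  note A = action_facts(1) and D = action_facts(2)
  note H = pseudo_Fun(2)[OF f] and G = pseudo_Fun(1)[OF f]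
  have kH: "KLim K A D ?H" using KLim_S_functor[OF action_facts(4) f kb] .
  have i: "Ide D (FOb f x) \<in> hom D (FOb f x) (FOb f x)" if "x \<in> Obj A" for x
    using category.ide_in[OF D Fun_Ob[OF f that]] .
  have n: "Cmp D (Ide D (FOb f y)) (FAr f m) = Cmp D (FAr f m) (Ide D (FOb f x))" if "m \<in> hom A x y" for m x y
    using category.ide_cmp[OF D Fun_hom[OF f that]] category.cmp_ide[OF D Fun_hom[OF f that]] by simp
  obtain c where c: "c \<in> Nat ?H ?G" "\<And>x. x \<in> Obj A \<Longrightarrow> NCmp c (ocl K A (OGen x)) = Ide D (FOb f x)"
    using Nat_gen_ext[OF A H G kf, of "\<lambda>x. Ide D (FOb f x)"] i n gen_action[OF f]
    by (auto simp: Tob_def Tar_def)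
  obtain d where d: "d \<in> Nat ?G ?H" "\<And>x. x \<in> Obj A \<Longrightarrow> NCmp d (ocl K A (OGen x)) = Ide D (FOb f x)"
    using Nat_gen_ext[OF A G H kH, of "\<lambda>x. Ide D (FOb f x)"] i n gen_action[OF f]
    by (auto simp: Tob_def Tar_def)
  have dc: "d \<cdot>\<^sub>N c = idn ?H"
    by (rule Nat_gen_eqI[OF A H kH vcomp_Nat[OF c(1) d(1)] idn_Nat[OF H]])
      (simp add: vcomp_NCmp[OF c(1) H] idn_NCmp[OF H] ocl_Obj o_gen gen_action[OF f] c(2) d(2) category.cmp_ide[OF D i])
  have cd: "c \<cdot>\<^sub>N d = idn ?G"
    by (rule Nat_gen_eqI[OF A G kf vcomp_Nat[OF d(1) c(1)] idn_Nat[OF G]])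
      (simp add: vcomp_NCmp[OF d(1) G] idn_NCmp[OF G] ocl_Obj o_gen gen_action[OF f] c(2) d(2) category.cmp_ide[OF D i])
  have "is_iso D (NCmp c x)" if x: "x \<in> Obj (S_cat K A)" for x
    using category.is_iso_iff[OF D Nat_hom[OF c(1) H x]] Nat_hom[OF d(1) G x]
      vcomp_NCmp[OF c(1) H x, of d] vcomp_NCmp[OF d(1) G x, of c] idn_NCmp[OF H x] idn_NCmp[OF G x] dc cd by auto
  then have "c \<in> NatIso ?H ?G" using c(1) by (simp add: NatIso_iff[OF H])
  then show ?thesis using c(2) normal_iff[OF f] by blast
qed

text \<open>Converse of \<open>normal_exists\<close>: \<open>b\<close> after \<open>S f\<close>
  preserves the formal limits because \<open>b\<close> does, and the structure is an isomorphism
  from it to \<open>f\<close> after \<open>a\<close>.\<close>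

lemma normal_KLim:
  assumes f: "f \<in> Fun A D" and n: "normal K A a b f f'" and kb: "KLim K D D b"
  shows "KLim K A D (f \<circ>\<^sub>F a)"
proof -
  have "f' \<in> NatIso (b \<circ>\<^sub>F S_functor K f) (f \<circ>\<^sub>F a)" using n by (simp add: normal_def)
  from KLim_iso[OF action_facts(1) this pseudo_Fun(2)[OF f] KLim_S_functor[OF action_facts(4) f kb]]
  show ?thesis .
qed

text \<open>Both sides are transformations into \<open>g\<close> after \<open>a\<close>, which
  preserves the formal limits. On generators \<open>f'\<close> and \<open>g'\<close> are identities,
  and both sides reduce to the components of \<alpha>.\<close>

lemma normal_2cell:
  assumes kb: "KLim K D D b" and f: "f \<in> Fun A D" "normal K A a b f f'" and g: "g \<in> Fun A D" "normal K A a b g g'"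
    and \<alpha>: "\<alpha> \<in> Nat f g"
  shows "g' \<cdot>\<^sub>N (b \<triangleright> S_nattrans K \<alpha>) = (\<alpha> \<triangleleft> a) \<cdot>\<^sub>N f'"
proof -
  note A = action_facts(1) and D = action_facts(2) and a = action_facts(3) and b = action_facts(4)
  have kg: "KLim K A D (g \<circ>\<^sub>F a)" by (rule normal_KLim[OF g kb])
  note S\<alpha> = S_nattrans_Nat[OF f(1) \<alpha>, where K = K]
  have f': "f' \<in> Nat (b \<circ>\<^sub>F S_functor K f) (f \<circ>\<^sub>F a)" and fg: "\<And>x. x \<in> Obj A \<Longrightarrow> NCmp f' (ocl K A (OGen x)) = Ide D (FOb f x)"
    using f(2) normal_iff[OF f(1)] by (auto simp: NatIso_def)
  have g': "g' \<in> Nat (b \<circ>\<^sub>F S_functor K g) (g \<circ>\<^sub>F a)" and gg: "\<And>x. x \<in> Obj A \<Longrightarrow> NCmp g' (ocl K A (OGen x)) = Ide D (FOb g x)"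
    using g(2) normal_iff[OF g(1)] by (auto simp: NatIso_def)
  note bS = whisker_post_Nat[OF S\<alpha>(1) S_functor_Fun[OF f(1)] b]
  note aa = whisker_pre_Nat[OF \<alpha> a f(1)]
  note H = pseudo_Fun(2)[OF f(1)]
  show ?thesis
  proof (rule Nat_gen_eqI[OF A H kg vcomp_Nat[OF bS g'] vcomp_Nat[OF f' aa]])
    fix x assume x: "x \<in> Obj A"
    note o = ocl_Obj[OF o_gen[OF x], of K]
    have ax: "FOb a (ocl K A (OGen x)) = x"
      using Tob_S_unit[OF a A x] Aa x by (simp add: Tob_def action_def) (simp add: idf_def)
    have h: "NCmp \<alpha> x \<in> hom D (FOb f x) (FOb g x)" by (rule Nat_hom[OF \<alpha> f(1) x])
    have "FAr b (acl K D (OGen (FOb f x)) (OGen (FOb g x)) (MGen (NCmp \<alpha> x))) = NCmp \<alpha> x"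
      using Tar_S_unit[OF b D h] Db homD[OF h] by (simp add: Tar_def action_def) (simp add: idf_def)
    then show "NCmp (g' \<cdot>\<^sub>N (b \<triangleright> S_nattrans K \<alpha>)) (ocl K A (OGen x)) = NCmp ((\<alpha> \<triangleleft> a) \<cdot>\<^sub>N f') (ocl K A (OGen x))"
      using category.ide_cmp[OF D h] category.cmp_ide[OF D h]
      by (simp add: vcomp_NCmp[OF bS H o] vcomp_NCmp[OF f' H o] whisker_pre_NCmp[OF a o] ax fg[OF x] gg[OF x]
          whisker_post_NCmp[OF S\<alpha>(1) S_functor_Fun[OF f(1)] o] S\<alpha>(2)[OF x])
  qed
qed

end

text \<open>The multiplication axiom says that \<open>f'\<close> is a 2-cell between morphisms out of the free algebra on \<open>A\<close>.\<close>

lemma normal_mult: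
  assumes Aa: "action K A a" and Db: "action K D b" and kb: "KLim K D D b"
    and am: "a \<circ>\<^sub>F S_functor K a = a \<circ>\<^sub>F S_mult K A"
    and f: "f \<in> Fun A D" and n: "normal K A a b f f'"
    and bm: "b \<circ>\<^sub>F S_functor K (b \<circ>\<^sub>F S_functor K f) = (b \<circ>\<^sub>F S_functor K f) \<circ>\<^sub>F S_mult K A"
  shows "f' \<triangleleft> S_mult K A = (f' \<triangleleft> S_functor K a) \<cdot>\<^sub>N (b \<triangleright> S_nattrans K f')"
proof -
  have A: "category A" and D: "category D" and a: "a \<in> Fun (S_cat K A) A" and b: "b \<in> Fun (S_cat K D) D"
    using Aa Db by (auto simp: action_def)
  have SA: "category (S_cat K A)" using A by (rule category_S_cat)
  note m = S_mult_Fun[OF A, of K]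
  have M: "action K (S_cat K A) (S_mult K A)" using S_mult_unit[OF A] m SA by (simp add: action_def)
  let ?H = "b \<circ>\<^sub>F S_functor K f" and ?G = "f \<circ>\<^sub>F a"
  note H = pseudo_Fun(2)[OF Aa Db f] and G = pseudo_Fun(1)[OF Aa Db f]
  have f': "f' \<in> NatIso ?H ?G" and fg: "\<And>x. x \<in> Obj A \<Longrightarrow> NCmp f' (ocl K A (OGen x)) = Ide D (FOb f x)"
    using n normal_iff[OF Aa Db f] by auto
  have f'': "f' \<in> Nat ?H ?G" using f' by (simp add: NatIso_def)
  note Sa = S_functor_Fun[OF a, of K]
  \<comment> \<open>By \<open>bm\<close> the source of \<open>f'\<close> is a strict morphism out of
    the free algebra, so its structure is an identity.\<close>
  have "normal K (S_cat K A) (S_mult K A) b ?H (idn (b \<circ>\<^sub>F S_functor K ?H))"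
    unfolding normal_iff[OF M Db H]
    using idn_NatIso[OF pseudo_Fun(2)[OF M Db H]] bm
      gen_action(3)[OF M Db H] idn_NCmp[OF pseudo_Fun(2)[OF M Db H] ocl_Obj[OF o_gen]] by simp
  \<comment> \<open>The algebra law \<open>am\<close> gives the whiskered cell the target that a
    structure over the free algebra must have.\<close>
  moreover have "normal K (S_cat K A) (S_mult K A) b ?G (f' \<triangleleft> S_functor K a)"
  proof -
    have "b \<circ>\<^sub>F S_functor K ?G = ?H \<circ>\<^sub>F S_functor K a"
      using S_functor_fcomp[OF a f] fcomp_assoc[OF Sa S_functor_Fun[OF f] b] by simp
    moreover have "?G \<circ>\<^sub>F S_mult K A = ?G \<circ>\<^sub>F S_functor K a"
      using fcomp_assoc[OF Sa a f] fcomp_assoc[OF m a f] am by simp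
    moreover have "NCmp (f' \<triangleleft> S_functor K a) (ocl K (S_cat K A) (OGen x)) = Ide D (FOb ?G x)" if x: "x \<in> Obj (S_cat K A)" for x
      using fg[OF Fun_Ob[OF a x]] by (simp add: whisker_pre_NCmp[OF Sa ocl_Obj[OF o_gen[OF x]]]
          S_functor_ocl[OF a o_gen[OF x]] fcomp_FOb[OF a x])
    ultimately show ?thesis
      unfolding normal_iff[OF M Db G] using whisker_pre_NatIso[OF f' Sa H] by simp
  qed
  ultimately have *: "(f' \<triangleleft> S_functor K a) \<cdot>\<^sub>N (b \<triangleright> S_nattrans K f') = (f' \<triangleleft> S_mult K A) \<cdot>\<^sub>N idn (b \<circ>\<^sub>F S_functor K ?H)"
    using normal_2cell[OF M Db kb H _ G _ f''] by blast
  note L = whisker_pre_Nat[OF f'' m H]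
  have "(f' \<triangleleft> S_mult K A) \<cdot>\<^sub>N idn (b \<circ>\<^sub>F S_functor K ?H) = f' \<triangleleft> S_mult K A"
    unfolding bm
  proof (rule Nat_eqI[OF vcomp_Nat[OF idn_Nat[OF fcomp_Fun[OF m H]] L] L fcomp_Fun[OF m H]])
    fix x assume x: "x \<in> Obj (S_cat K (S_cat K A))"
    show "NCmp ((f' \<triangleleft> S_mult K A) \<cdot>\<^sub>N idn (?H \<circ>\<^sub>F S_mult K A)) x = NCmp (f' \<triangleleft> S_mult K A) x"
      using category.cmp_ide[OF D Nat_hom[OF L fcomp_Fun[OF m H] x]]
      by (simp add: vcomp_NCmp[OF idn_Nat[OF fcomp_Fun[OF m H]] fcomp_Fun[OF m H] x] idn_NCmp[OF fcomp_Fun[OF m H] x])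
  qed
  with * show ?thesis by simp
qed

lemma normal_pcomp:
  assumes Aa: "action K A a" and Bb: "action K B b" and Cc: "action K C c"
    and f: "f \<in> Fun A B" "normal K A a b f f'" and g: "g \<in> Fun B C" "normal K B b c g g'"
  shows "normal K A a c (fst (pcomp K (g, g') (f, f'))) (snd (pcomp K (g, g') (f, f')))"
proof -
  have a: "a \<in> Fun (S_cat K A) A" and b: "b \<in> Fun (S_cat K B) B" and c: "c \<in> Fun (S_cat K C) C" and C: "category C"
    using Aa Bb Cc by (auto simp: action_def)
  note gf = fcomp_Fun[OF f(1) g(1)] and Sf = S_functor_Fun[OF f(1), of K] and Sg = S_functor_Fun[OF g(1), of K]
  have f': "f' \<in> NatIso (b \<circ>\<^sub>F S_functor K f) (f \<circ>\<^sub>F a)" "\<And>x. x \<in> Obj A \<Longrightarrow> NCmp f' (ocl K A (OGen x)) = Ide B (FOb f x)"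
    using f(2) normal_iff[OF Aa Bb f(1)] by auto
  have g': "g' \<in> NatIso (c \<circ>\<^sub>F S_functor K g) (g \<circ>\<^sub>F b)" "\<And>x. x \<in> Obj B \<Longrightarrow> NCmp g' (ocl K B (OGen x)) = Ide C (FOb g x)"
    using g(2) normal_iff[OF Bb Cc g(1)] by auto
  note 1 = whisker_pre_NatIso[OF g'(1) Sf pseudo_Fun(2)[OF Bb Cc g(1)]]
  note 2 = whisker_post_NatIso[OF f'(1) pseudo_Fun(2)[OF Aa Bb f(1)] g(1)]
  have e: "(c \<circ>\<^sub>F S_functor K g) \<circ>\<^sub>F S_functor K f = c \<circ>\<^sub>F S_functor K (g \<circ>\<^sub>F f)"
    "(g \<circ>\<^sub>F b) \<circ>\<^sub>F S_functor K f = g \<circ>\<^sub>F (b \<circ>\<^sub>F S_functor K f)" "g \<circ>\<^sub>F (f \<circ>\<^sub>F a) = (g \<circ>\<^sub>F f) \<circ>\<^sub>F a"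
    using S_functor_fcomp[OF f(1) g(1), of K] fcomp_assoc[OF Sf Sg c] fcomp_assoc[OF Sf b g(1)] fcomp_assoc[OF a f(1) g(1)] by simp_all
  note n = vcomp_NatIso[OF 1[unfolded e] 2[unfolded e] pseudo_Fun(2)[OF Aa Cc gf]]
  have "NCmp ((g \<triangleright> f') \<cdot>\<^sub>N (g' \<triangleleft> S_functor K f)) (ocl K A (OGen x)) = Ide C (FOb (g \<circ>\<^sub>F f) x)" if x: "x \<in> Obj A" for x
  proof -
    note o = ocl_Obj[OF o_gen[OF x], of K] and fx = Fun_Ob[OF f(1) x]
    have 3: "g' \<triangleleft> S_functor K f \<in> Nat (c \<circ>\<^sub>F S_functor K (g \<circ>\<^sub>F f)) ((g \<circ>\<^sub>F b) \<circ>\<^sub>F S_functor K f)" "f' \<in> Nat (b \<circ>\<^sub>F S_functor K f) (f \<circ>\<^sub>F a)"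
      using 1 f'(1) e by (auto simp: NatIso_def)
    note i = category.ide_in[OF C Fun_Ob[OF g(1) fx]]
    show ?thesis
      using category.cmp_ide[OF C i]
      by (simp add: vcomp_NCmp[OF 3(1) pseudo_Fun(2)[OF Aa Cc gf] o] whisker_post_NCmp[OF 3(2) pseudo_Fun(2)[OF Aa Bb f(1)] o]
        whisker_pre_NCmp[OF Sf o] S_functor_ocl[OF f(1) o_gen[OF x]] f'(2)[OF x] g'(2)[OF fx] Fun_Ide[OF g(1) fx] fcomp_FOb[OF f(1) x])
  qed
  then show ?thesis using n normal_iff[OF Aa Cc gf] by (simp add: pcomp_def)
qed

lemma normal_pid: assumes Aa: "action K A a" shows "normal K A a a (idf A) (idn a)"
proof -
  have A: "category A" and a: "a \<in> Fun (S_cat K A) A" using Aa by (auto simp: action_def)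
  note i = idf_Fun[OF A]
  have "a \<circ>\<^sub>F S_functor K (idf A) = a" "idf A \<circ>\<^sub>F a = a"
    using S_functor_idf[OF A] fcomp_idf[OF a] by simp_all
  then show ?thesis
    using idn_NatIso[OF a] gen_action(1)[OF Aa Aa i] idn_NCmp[OF a ocl_Obj[OF o_gen]]
    unfolding normal_iff[OF Aa Aa i] by simp
qed

subsection \<open>Strict algebras have the chosen limits\<close>

lemma strict_algebra_action: "strict_algebra K (A, a) \<Longrightarrow> action K A a"
  by (simp add: strict_algebra_def action_def)

context
  fixes K A a
  assumes alg: "strict_algebra K (A, a)"
begin

lemma strict_algebra_facts: "category A" "a \<in> Fun (S_cat K A) A" "a \<circ>\<^sub>F S_functor K a = a \<circ>\<^sub>F S_mult K A" "category (S_cat K A)"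
  using alg by (auto simp: strict_algebra_def intro: category_S_cat)

lemma strict_algebra_eval:
  assumes t: "aeq K (S_cat K A) X Y t t" and u: "aeq K A X' Y' (flatten_m t) u"
    and X: "oeq K A (flatten_o X) X'" and Y: "oeq K A (flatten_o Y) Y'"
  shows "Tar K A a X' Y' u = Tar K A a (map_o a X) (map_o a Y) (map_m a t)"
proof -
  have "Tar K A a X' Y' u = Tar K A a (flatten_o X) (flatten_o Y) (flatten_m t)"
    using Tar_cong[OF strict_algebra_facts(1,2) a_conv[OF u o_sym[OF X] o_sym[OF Y]] X Y] Tar_cong'[OF strict_algebra_facts(1,2) u] by metis
  then show ?thesis
    using Tar_S_mult[OF strict_algebra_facts(2,1) t] Tar_S_functor[OF strict_algebra_facts(2,1,2) t] strict_algebra_facts(3) by simp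
qed

lemma flatten_gen: "oeq K A X X \<Longrightarrow> oeq K A (flatten_o (OGen (ocl K A X))) X"
  "aeq K A X Y f f \<Longrightarrow> aeq K A X Y (flatten_m (MGen (acl K A X Y f))) f"
  using o_sym[OF rep_ocl] a_sym[OF rep_acl] by simp_all

lemma gen_aeq: "aeq K A X Y f f \<Longrightarrow>
    aeq K (S_cat K A) (OGen (ocl K A X)) (OGen (ocl K A Y)) (MGen (acl K A X Y f)) (MGen (acl K A X Y f))"
  using a_gen[OF acl_Arr, of K A X Y f K] by (simp add: S_cat_def)

lemma eval_bang:
  assumes X: "oeq K A X X"
  shows "Tar K A a X OOne (MBang X) = Tar K A a (OGen (Tob K A a X)) OOne (MBang (OGen (Tob K A a X)))"
proof -
  have "aeq K A X OOne (flatten_m (MBang (OGen (ocl K A X)))) (MBang X)"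
    using a_conv[OF a_bang[OF flatten_gen(1)[OF X]] flatten_gen(1)[OF X] o_one] by simp
  moreover have "oeq K A (flatten_o OOne) OOne" by (simp add: o_one)
  ultimately show ?thesis
    using strict_algebra_eval[OF a_bang[OF o_gen[OF ocl_Obj[OF X]]] _ flatten_gen(1)[OF X]] by (simp add: Tob_def)
qed

text \<open>The multiplication law is applied to a pairing of generators over \<open>S A\<close>. It
  shows that the value of a formal pairing depends on \<open>h\<close> and \<open>k\<close> only
  through their values.\<close>

lemma eval_pair:
  assumes K: "K = FiniteProducts" and h: "aeq K A W X h h" and k: "aeq K A W Y k k"
  shows "Tar K A a W (OProd X Y) (MPair h k) = Tar K A a (OGen (Tob K A a W))
    (OProd (OGen (Tob K A a X)) (OGen (Tob K A a Y))) (MPair (MGen (Tar K A a W X h)) (MGen (Tar K A a W Y k)))"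
proof -
  have W: "oeq K A W W" "oeq K A X X" "oeq K A Y Y" using aeq_wf[OF strict_algebra_facts(1)] h k by auto
  have P: "oeq K A (flatten_o (OProd (OGen (ocl K A X)) (OGen (ocl K A Y)))) (OProd X Y)"
    using o_prod[OF K flatten_gen(1)[OF W(2)] flatten_gen(1)[OF W(3)]] by simp
  have "aeq K A W (OProd X Y) (flatten_m (MPair (MGen (acl K A W X h)) (MGen (acl K A W Y k)))) (MPair h k)"
    using a_pair[OF K flatten_gen(2)[OF h] flatten_gen(2)[OF k]] by simp
  from strict_algebra_eval[OF a_pair[OF K gen_aeq[OF h] gen_aeq[OF k]] this flatten_gen(1)[OF W(1)] P]
  show ?thesis by (simp add: Tob_def Tar_def)
qed

text \<open>As for pairings. The lift over \<open>S A\<close> is well-formed because a composite of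
  generators there is the generator of the composite class, so \<open>hk\<close> can be
  transported.\<close>

lemma eval_lift:
  assumes K: "K = FiniteLimits" and f: "aeq K A X Z f f" and g: "aeq K A Y Z g g"
    and h: "aeq K A W X h h" and k: "aeq K A W Y k k" and hk: "aeq K A W Z (MComp f h) (MComp g k)"
  shows "Tar K A a W (OPb X Y f g) (MLift X Y f g h k) = Tar K A a (OGen (Tob K A a W))
    (OPb (OGen (Tob K A a X)) (OGen (Tob K A a Y)) (MGen (Tar K A a X Z f)) (MGen (Tar K A a Y Z g)))
    (MLift (OGen (Tob K A a X)) (OGen (Tob K A a Y)) (MGen (Tar K A a X Z f)) (MGen (Tar K A a Y Z g))
      (MGen (Tar K A a W X h)) (MGen (Tar K A a W Y k)))"
proof -
  note A = strict_algebra_facts(1)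
  have W: "oeq K A W W" "oeq K A X X" "oeq K A Y Y" "oeq K A Z Z" using aeq_wf[OF A] h k f by auto
  let ?c = "ocl K A" and ?S = "S_cat K A"
  have comp: "aeq K ?S (OGen (?c U)) (OGen (?c T)) (MComp (MGen (acl K A V T q)) (MGen (acl K A U V p)))
      (MGen (acl K A U T (MComp q p)))" if "aeq K A U V p p" "aeq K A V T q q" for U V T p q
    using a_sym[OF a_gen_comp[OF acl_Arr[OF that(1)] acl_Arr[OF that(2)], of K]] S_cat_Cmp[OF A that]
    by (simp add: S_cat_def)
  have hk': "aeq K ?S (OGen (?c W)) (OGen (?c Z)) (MComp (MGen (acl K A X Z f)) (MGen (acl K A W X h)))
      (MComp (MGen (acl K A Y Z g)) (MGen (acl K A W Y k)))"
    using a_trans[OF comp[OF h f]] a_sym[OF comp[OF k g]] acl_eqI'[OF A hk] by simp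
  note t = a_lift[OF K o_gen[OF ocl_Obj[OF W(2)]] o_gen[OF ocl_Obj[OF W(3)]] gen_aeq[OF f] gen_aeq[OF g]
      gen_aeq[OF h] gen_aeq[OF k] hk']
  note X' = flatten_gen(1)[OF W(2)] and Y' = flatten_gen(1)[OF W(3)] and Z' = flatten_gen(1)[OF W(4)]
  note fl = flatten_gen(2)[OF f] flatten_gen(2)[OF g] flatten_gen(2)[OF h] flatten_gen(2)[OF k]
  have P: "oeq K A (flatten_o (OPb (OGen (?c X)) (OGen (?c Y)) (MGen (acl K A X Z f)) (MGen (acl K A Y Z g)))) (OPb X Y f g)"
    using o_sym[OF o_pb[OF K o_sym[OF X'] o_sym[OF Y'] a_sym[OF fl(1)] a_sym[OF fl(2)]]] by simp
  have "aeq K A W (OPb X Y f g) (MLift X Y f g h k) (flatten_m (MLift (OGen (?c X)) (OGen (?c Y)) (MGen (acl K A X Z f))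
      (MGen (acl K A Y Z g)) (MGen (acl K A W X h)) (MGen (acl K A W Y k))))"
    using a_lift[OF K o_sym[OF X'] o_sym[OF Y'] a_sym[OF fl(1)] a_sym[OF fl(2)] a_sym[OF fl(3)] a_sym[OF fl(4)] hk] by simp
  from strict_algebra_eval[OF t a_sym[OF this] flatten_gen(1)[OF W(1)] P]
  show ?thesis by (simp add: Tob_def Tar_def)
qed

text \<open>The action is right adjoint to the unit functor of \<open>S\<close>. The counit compares
  a term with the generator named by its value; the work lies in showing that \<open>a\<close> sends
  it to identities. Right adjoints preserve the formal limits, which are limits in the free
  category.\<close>

lemma KLim_strict_algebra: "KLim K A A a"
proof -
  note A = strict_algebra_facts(1) and a = strict_algebra_facts(2) and S = strict_algebra_facts(4)
  note r = S_unit_Fun[OF A, of K]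
  let ?S = "S_cat K A" and ?r = "S_unit K A"
  note ra = fcomp_Fun[OF a r] and i = idf_Fun[OF S]
  have ar: "a \<circ>\<^sub>F ?r = idf A" using alg by (simp add: strict_algebra_def)
  have To: "Tob K A a (OGen x) = x" if "x \<in> Obj A" for x
    using Tob_S_unit[OF a A that] that by (simp add: ar) (simp add: idf_def)
  have Ta: "Tar K A a (OGen x) (OGen y) (MGen m) = m" if "m \<in> hom A x y" for m x y
    using Tar_S_unit[OF a A that] homD[OF that] by (simp add: ar) (simp add: idf_def)
  have rTo: "Tob K A (?r \<circ>\<^sub>F a) X = ocl K A (OGen (Tob K A a X))" if "oeq K A X X" for X
    using Tob_Obj[OF A a that] by (simp add: Tob_def fcomp_FOb[OF a ocl_Obj[OF that]] S_unit_FOb)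
  have rTa: "Tar K A (?r \<circ>\<^sub>F a) X Y f = acl K A (OGen (Tob K A a X)) (OGen (Tob K A a Y)) (MGen (Tar K A a X Y f))"
    if "aeq K A X Y f f" for X Y f
    using Tar_hom[OF A a that] by (auto simp: Tar_def fcomp_FAr[OF a acl_Arr[OF that]] S_unit_FAr hom_def)
  have iTo: "Tob K A (idf ?S) X = ocl K A X" if "oeq K A X X" for X
    using ocl_Obj[OF that] by (simp add: Tob_def idf_def)
  have iTa: "Tar K A (idf ?S) X Y f = acl K A X Y f" if "aeq K A X Y f f" for X Y f
    using acl_Arr[OF that] by (simp add: Tar_def idf_def)
  have Tm: "aeq K A (OGen (Tob K A a X)) (OGen (Tob K A a Y)) (MGen (Tar K A a X Y f)) (MGen (Tar K A a X Y f))"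
    if "aeq K A X Y f f" for X Y f
    using a_gen[of "Tar K A a X Y f" A K] Tar_hom[OF A a that] by (auto simp: hom_def)
  \<comment> \<open>The candidate counit. Identities on generators extend along the unit because the
    formal limits are limits in the free category.\<close>
  have "\<exists>c \<in> Nat (?r \<circ>\<^sub>F a) (idf ?S). \<forall>x \<in> Obj A. NCmp c (ocl K A (OGen x)) = Ide ?S (ocl K A (OGen x))"
  proof (rule Nat_gen_ext[OF A ra i KLim_free[OF A]])
    show "Ide ?S (ocl K A (OGen x)) \<in> hom ?S (Tob K A (?r \<circ>\<^sub>F a) (OGen x)) (Tob K A (idf ?S) (OGen x))" if "x \<in> Obj A" for x
      using category.ide_in[OF S ocl_Obj[OF o_gen[OF that]]] by (simp add: rTo iTo o_gen that To)
    fix m x y assume m: "m \<in> hom A x y"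
    have am: "aeq K A (OGen x) (OGen y) (MGen m) (MGen m)" using a_gen[of m A] m by (auto simp: hom_def)
    have xy: "x \<in> Obj A" "y \<in> Obj A" using category.hom_Obj[OF A m] by auto
    have "Tar K A (?r \<circ>\<^sub>F a) (OGen x) (OGen y) (MGen m) = acl K A (OGen x) (OGen y) (MGen m)"
      by (simp add: rTa[OF am] Ta[OF m] To xy)
    then show "Cmp ?S (Ide ?S (ocl K A (OGen y))) (Tar K A (?r \<circ>\<^sub>F a) (OGen x) (OGen y) (MGen m)) =
        Cmp ?S (Tar K A (idf ?S) (OGen x) (OGen y) (MGen m)) (Ide ?S (ocl K A (OGen x)))"
      using category.ide_cmp[OF S acl_hom[OF am]] category.cmp_ide[OF S acl_hom[OF am]] by (simp add: iTa[OF am])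
  qed
  then obtain c where c: "c \<in> Nat (?r \<circ>\<^sub>F a) (idf ?S)" "\<And>x. x \<in> Obj A \<Longrightarrow> NCmp c (ocl K A (OGen x)) = Ide ?S (ocl K A (OGen x))"
    by blast
  have ch: "\<exists>q. NCmp c (ocl K A X) = acl K A (OGen (Tob K A a X)) X q \<and> aeq K A (OGen (Tob K A a X)) X q q"
    if X: "oeq K A X X" for X
  proof -
    have "NCmp c (ocl K A X) \<in> hom ?S (ocl K A (OGen (Tob K A a X))) (ocl K A X)"
      using Nat_hom[OF c(1) ra ocl_Obj[OF X]] rTo[OF X] iTo[OF X] by (simp add: Tob_def)
    then show ?thesis using S_cat_homE[OF A _ o_gen[OF Tob_Obj[OF A a X]] X] by metis
  qed
  have cn: "aeq K A (OGen (Tob K A a X)) Y (MComp p q) (MComp q' (MGen (Tar K A a X Y p)))"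
    if p: "aeq K A X Y p p" and q: "NCmp c (ocl K A X) = acl K A (OGen (Tob K A a X)) X q" "aeq K A (OGen (Tob K A a X)) X q q"
      and q': "NCmp c (ocl K A Y) = acl K A (OGen (Tob K A a Y)) Y q'" "aeq K A (OGen (Tob K A a Y)) Y q' q'" for X Y p q q'
  proof (rule acl_eqD[OF _ a_comp[OF q(2) p]])
    show "acl K A (OGen (Tob K A a X)) Y (MComp p q) = acl K A (OGen (Tob K A a X)) Y (MComp q' (MGen (Tar K A a X Y p)))"
      using Nat_nat[OF c(1) ra acl_hom[OF p]] rTa[OF p] iTa[OF p] S_cat_Cmp[OF A q(2) p] S_cat_Cmp[OF A Tm[OF p] q'(2)]
      by (simp add: q q' Tar_def)
  qed
  have Tq: "Tar K A a (OGen (Tob K A a X)) Y (MComp q' (MGen (Tar K A a X Y p))) = Tar K A a X Y p"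
    if p: "aeq K A X Y p p" and q': "aeq K A (OGen (Tob K A a Y)) Y q' q'" "Tar K A a (OGen (Tob K A a Y)) Y q' = Ide A (Tob K A a Y)"
    for X Y p q'
    using Tar_comp[OF A a Tm[OF p] q'(1)] Ta[OF Tar_hom[OF A a p]] q'(2) category.ide_cmp[OF A Tar_hom[OF A a p]] by simp
  \<comment> \<open>The remaining triangle identity, that \<open>a\<close> sends the counit to
    identities, by induction on the term.\<close>
  have "oeq K A X X \<Longrightarrow> FAr a (NCmp c (ocl K A X)) = Ide A (Tob K A a X)" and True for X and f :: "('a, 'b) mtm"
  proof (induction X and f)
    case (OGen x)
    then have x: "x \<in> Obj A" using oeq_wf_parts(1)[OF A OGen] by simp
    show ?case using Fun_Ide[OF a ocl_Obj[OF o_gen[OF x]]] by (simp add: c(2)[OF x] Tob_def)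
  next
    case OOne
    obtain q where q: "NCmp c (ocl K A OOne) = acl K A (OGen (Tob K A a OOne)) OOne q" "aeq K A (OGen (Tob K A a OOne)) OOne q q"
      using ch[OF o_one] by blast
    have "Tar K A a (OGen (Tob K A a OOne)) OOne q = Tar K A a OOne OOne (MBang OOne)"
      using Tar_cong'[OF A a a_bang_unique[OF q(2)]] eval_bang[OF o_one] by simp
    also have "\<dots> = Ide A (Tob K A a OOne)"
      using Tar_cong'[OF A a a_bang_unique[OF a_id[OF o_one]]] Tar_id[OF A a o_one] by simp
    finally show ?case by (simp add: q(1) Tar_def)
  next
    case (OProd X Y)
    note s = sq_OProd[OF A OProd.prems] and w = oeq_OProdD[OF A OProd.prems]
    note wf = sq_wf[OF A s]
    let ?P = "OProd X Y" and ?p1 = "MPr1 X Y" and ?p2 = "MPr2 X Y"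
    obtain q where q: "NCmp c (ocl K A ?P) = acl K A (OGen (Tob K A a ?P)) ?P q" "aeq K A (OGen (Tob K A a ?P)) ?P q q"
      using ch[OF wf(4)] by blast
    obtain x where x: "NCmp c (ocl K A X) = acl K A (OGen (Tob K A a X)) X x" "aeq K A (OGen (Tob K A a X)) X x x"
      using ch[OF wf(1)] by blast
    obtain y where y: "NCmp c (ocl K A Y) = acl K A (OGen (Tob K A a Y)) Y y" "aeq K A (OGen (Tob K A a Y)) Y y y"
      using ch[OF wf(2)] by blast
    have xy: "Tar K A a (OGen (Tob K A a X)) X x = Ide A (Tob K A a X)" "Tar K A a (OGen (Tob K A a Y)) Y y = Ide A (Tob K A a Y)"
      using OProd.IH wf x y by (simp_all add: Tar_def)
    note n = cn[OF wf(7) q x] cn[OF wf(8) q y]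
    note T = Tq[OF wf(7) x(2) xy(1)] Tq[OF wf(8) y(2) xy(2)]
    have Tg: "Tob K A a (OGen (Tob K A a ?P)) = Tob K A a ?P" using To[OF Tob_Obj[OF A a wf(4)]] .
    have "Tar K A a (OGen (Tob K A a ?P)) ?P q = Tar K A a (OGen (Tob K A a ?P)) ?P
        (MPair (MComp x (MGen (Tar K A a ?P X ?p1))) (MComp y (MGen (Tar K A a ?P Y ?p2))))"
      by (rule Tar_cong'[OF A a a_trans[OF a_pair_unique[OF w(1) wf(1,2) q(2)] a_pair[OF w(1) n]]])
    \<comment> \<open>By induction \<open>x\<close> and \<open>y\<close> evaluate to identities, so
      the two legs have the same values as the projections. Since a pairing is evaluated through the
      values of its legs, the legs may be replaced by the projections.\<close>
    also have "\<dots> = Tar K A a ?P ?P (MPair ?p1 ?p2)"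
      using eval_pair[OF w(1) aeq_refl(2)[OF n(1)] aeq_refl(2)[OF n(2)]] eval_pair[OF w(1) wf(7,8)] T Tg by simp
    also have "\<dots> = Tar K A a ?P ?P (MId ?P)"
    proof (rule Tar_cong'[OF A a])
      note id = a_id[OF wf(4)]
      show "aeq K A ?P ?P (MPair ?p1 ?p2) (MId ?P)"
        using a_trans[OF a_pair_unique[OF w(1) wf(1,2) id] a_pair[OF w(1) a_comp_id[OF wf(7)] a_comp_id[OF wf(8)]]]
        by (rule a_sym)
    qed
    finally show ?case using Tar_id[OF A a wf(4)] by (simp add: q(1) Tar_def)
  next
    case (OPb X Y f g)
    obtain Z where Z: "K = FiniteLimits" "aeq K A X Z f f" "aeq K A Y Z g g" using OPb.prems by (elim oeq_OPbE[OF A])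
    let ?P = "OPb X Y f g" and ?p1 = "MPb1 X Y f g" and ?p2 = "MPb2 X Y f g"
    from Z have s: "sq K A X Y Z f g ?P ?p1 ?p2" by (simp add: sq_def)
    note wf = sq_wf[OF A s]
    obtain q where q: "NCmp c (ocl K A ?P) = acl K A (OGen (Tob K A a ?P)) ?P q" "aeq K A (OGen (Tob K A a ?P)) ?P q q"
      using ch[OF wf(4)] by blast
    obtain x where x: "NCmp c (ocl K A X) = acl K A (OGen (Tob K A a X)) X x" "aeq K A (OGen (Tob K A a X)) X x x"
      using ch[OF wf(1)] by blast
    obtain y where y: "NCmp c (ocl K A Y) = acl K A (OGen (Tob K A a Y)) Y y" "aeq K A (OGen (Tob K A a Y)) Y y y"
      using ch[OF wf(2)] by blast
    have xy: "Tar K A a (OGen (Tob K A a X)) X x = Ide A (Tob K A a X)" "Tar K A a (OGen (Tob K A a Y)) Y y = Ide A (Tob K A a Y)"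
      using OPb.IH wf x y by (simp_all add: Tar_def)
    note n = cn[OF wf(7) q x] cn[OF wf(8) q y]
    note T = Tq[OF wf(7) x(2) xy(1)] Tq[OF wf(8) y(2) xy(2)]
    have Tg: "Tob K A a (OGen (Tob K A a ?P)) = Tob K A a ?P" using To[OF Tob_Obj[OF A a wf(4)]] .
    let ?h = "MComp x (MGen (Tar K A a ?P X ?p1))" and ?k = "MComp y (MGen (Tar K A a ?P Y ?p2))" and ?W = "OGen (Tob K A a ?P)"
    have hk: "aeq K A ?W Z (MComp f ?h) (MComp g ?k)"
      using a_trans[OF a_comp[OF a_sym[OF n(1)] wf(5)] a_trans[OF a_assoc[OF q(2) wf(7,5)]
            a_trans[OF a_comp[OF q(2) wf(9)] a_trans[OF a_sym[OF a_assoc[OF q(2) wf(8,6)]] a_comp[OF n(2) wf(6)]]]]] .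
    note h = aeq_refl(2)[OF n(1)] and k = aeq_refl(2)[OF n(2)]
    have "Tar K A a ?W ?P q = Tar K A a ?W ?P (MLift X Y f g ?h ?k)"
      by (rule Tar_cong'[OF A a a_lift_unique[OF Z q(2) a_lift[OF Z(1) wf(1,2) Z(2,3) h k hk]
        a_trans[OF n(1) a_sym[OF a_pb1_lift[OF Z h k hk]]] a_trans[OF n(2) a_sym[OF a_pb2_lift[OF Z h k hk]]]]])
    also have "\<dots> = Tar K A a ?P ?P (MLift X Y f g ?p1 ?p2)"
      using eval_lift[OF Z h k hk] eval_lift[OF Z wf(7,8,9)] T Tg by simp
    also have "\<dots> = Tar K A a ?P ?P (MId ?P)"
      by (rule Tar_cong'[OF A a a_lift_unique[OF Z a_lift[OF Z(1) wf(1,2) Z(2,3) wf(7,8,9)] a_id[OF wf(4)]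
        a_trans[OF a_pb1_lift[OF Z wf(7,8,9)] a_sym[OF a_comp_id[OF wf(7)]]]
        a_trans[OF a_pb2_lift[OF Z wf(7,8,9)] a_sym[OF a_comp_id[OF wf(8)]]]]])
    finally show ?case using Tar_id[OF A a wf(4)] by (simp add: q(1) Tar_def)
  qed simp_all
  then have ac: "FAr a (NCmp c X) = Ide A (FOb a X)" if "X \<in> Obj ?S" for X
    using that by (auto elim!: S_cat_ObjE simp: Tob_def)
  have t: "is_term ?S (ocl K A OOne)" using KLimD(1)[OF KLim_free[OF A], of K] iTo[OF o_one] by simp
  have pb: "is_pb ?S (acl K A X Z f) (acl K A Y Z g) (acl K A P X p1) (acl K A P Y p2)"
    if s: "sq K A X Y Z f g P p1 p2" for X Y Z f g P p1 p2
    using KLimD(2)[OF KLim_free[OF A] s] sq_wf[OF A s] iTa by simp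
  show ?thesis
    unfolding KLim_def Tob_def Tar_def
    using right_adjoint_is_term[OF a r ar c(1) ac t] right_adjoint_is_pb[OF a r ar c(1) ac pb] by blast
qed

end

section \<open>Evaluation in a category with chosen limits\<close>

definition bang :: "('o, 'm) cat \<Rightarrow> 'o \<Rightarrow> 'o \<Rightarrow> 'm" where
  "bang C t x = (THE u. u \<in> hom C x t)"

definition plift :: "('o, 'm) cat \<Rightarrow> 'm \<Rightarrow> 'm \<Rightarrow> 'm \<Rightarrow> 'm \<Rightarrow> 'm" where
  "plift C p1 p2 h k = (THE u. u \<in> hom C (Dom C h) (Dom C p1) \<and> Cmp C p1 u = h \<and> Cmp C p2 u = k)"

text \<open>Here \<open>p\<close> and \<open>q\<close> select the two projections of a pullback of a
  cospan, and products are pullbacks over \<open>t\<close>. A pairing does not record its factors,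
  so these are recovered as codomains of the evaluated arrows.\<close>

primrec ev_o :: "('o, 'm) cat \<Rightarrow> 'o \<Rightarrow> ('m \<Rightarrow> 'm \<Rightarrow> 'm) \<Rightarrow> ('m \<Rightarrow> 'm \<Rightarrow> 'm) \<Rightarrow> ('o, 'm) otm \<Rightarrow> 'o"
  and ev_m :: "('o, 'm) cat \<Rightarrow> 'o \<Rightarrow> ('m \<Rightarrow> 'm \<Rightarrow> 'm) \<Rightarrow> ('m \<Rightarrow> 'm \<Rightarrow> 'm) \<Rightarrow> ('o, 'm) mtm \<Rightarrow> 'm" where
  "ev_o C t p q (OGen x) = x"
| "ev_o C t p q OOne = t"
| "ev_o C t p q (OProd X Y) = Dom C (p (bang C t (ev_o C t p q X)) (bang C t (ev_o C t p q Y)))"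
| "ev_o C t p q (OPb X Y f g) = Dom C (p (ev_m C t p q f) (ev_m C t p q g))"
| "ev_m C t p q (MGen m) = m"
| "ev_m C t p q (MId X) = Ide C (ev_o C t p q X)"
| "ev_m C t p q (MComp g f) = Cmp C (ev_m C t p q g) (ev_m C t p q f)"
| "ev_m C t p q (MBang X) = bang C t (ev_o C t p q X)"
| "ev_m C t p q (MPr1 X Y) = p (bang C t (ev_o C t p q X)) (bang C t (ev_o C t p q Y))"
| "ev_m C t p q (MPr2 X Y) = q (bang C t (ev_o C t p q X)) (bang C t (ev_o C t p q Y))"
| "ev_m C t p q (MPair h k) =
     plift C (p (bang C t (Cod C (ev_m C t p q h))) (bang C t (Cod C (ev_m C t p q k))))
       (q (bang C t (Cod C (ev_m C t p q h))) (bang C t (Cod C (ev_m C t p q k)))) (ev_m C t p q h) (ev_m C t p q k)"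
| "ev_m C t p q (MPb1 X Y f g) = p (ev_m C t p q f) (ev_m C t p q g)"
| "ev_m C t p q (MPb2 X Y f g) = q (ev_m C t p q f) (ev_m C t p q g)"
| "ev_m C t p q (MLift X Y f g h k) = plift C (p (ev_m C t p q f) (ev_m C t p q g)) (q (ev_m C t p q f) (ev_m C t p q g))
     (ev_m C t p q h) (ev_m C t p q k)"

definition ev_functor where
  "ev_functor K C t p q = \<lparr>Src = S_cat K C, Tgt = C,
     FOb = (\<lambda>c\<in>Obj (S_cat K C). ev_o C t p q (rep c)),
     FAr = (\<lambda>\<phi>\<in>Arr (S_cat K C). ev_m C t p q (rep (scls \<phi>)))\<rparr>"

locale chosen_limits = category C for C :: "('o, 'm) cat" +
  fixes t :: 'o and p q :: "'m \<Rightarrow> 'm \<Rightarrow> 'm"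
  assumes terminal: "is_term C t"
    and pb: "f \<in> hom C x z \<Longrightarrow> g \<in> hom C y z \<Longrightarrow> is_pb C f g (p f g) (q f g)"
begin

abbreviation "eo \<equiv> ev_o C t p q"
abbreviation "em \<equiv> ev_m C t p q"
abbreviation "bg \<equiv> bang C t"

lemma bg_hom: "x \<in> Obj C \<Longrightarrow> bg x \<in> hom C x t"
  using terminal theI'[of "\<lambda>u. u \<in> hom C x t"] by (simp add: bang_def is_term_def)

lemma bg_unique: "u \<in> hom C x t \<Longrightarrow> u = bg x"
  using is_termD[OF terminal _ _ category_axioms] bg_hom hom_Obj by blast

lemma proj_hom:
  assumes "f \<in> hom C x z" "g \<in> hom C y z"
  shows "p f g \<in> hom C (Dom C (p f g)) x" "q f g \<in> hom C (Dom C (p f g)) y" "Cmp C f (p f g) = Cmp C g (q f g)"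
    "Dom C (p f g) \<in> Obj C"
  using pb[OF assms] assms dom_in by (auto simp: is_pb_def hom_def)

lemma plift_props:
  assumes "f \<in> hom C x z" "g \<in> hom C y z" "h \<in> hom C w x" "k \<in> hom C w y" "Cmp C f h = Cmp C g k"
  shows "plift C (p f g) (q f g) h k \<in> hom C w (Dom C (p f g))"
    "Cmp C (p f g) (plift C (p f g) (q f g) h k) = h" "Cmp C (q f g) (plift C (p f g) (q f g) h k) = k"
proof -
  have "Dom C h = w" using assms by (simp add: hom_def)
  with theI'[OF is_pb_ex1[OF pb[OF assms(1,2)] proj_hom(1,2)[OF assms(1,2)] assms(3-5)]]
  show "plift C (p f g) (q f g) h k \<in> hom C w (Dom C (p f g))"
    "Cmp C (p f g) (plift C (p f g) (q f g) h k) = h" "Cmp C (q f g) (plift C (p f g) (q f g) h k) = k"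
    by (simp_all add: plift_def)
qed

lemma proj_unique:
  assumes "f \<in> hom C x z" "g \<in> hom C y z" "u \<in> hom C w (Dom C (p f g))" "v \<in> hom C w (Dom C (p f g))"
    "Cmp C (p f g) u = Cmp C (p f g) v" "Cmp C (q f g) u = Cmp C (q f g) v"
  shows "u = v"
  using is_pb_unique[OF pb[OF assms(1,2)] category_axioms proj_hom(1)[OF assms(1,2)] assms(3-6)] .

lemma bg_commute: "h \<in> hom C w x \<Longrightarrow> k \<in> hom C w y \<Longrightarrow> Cmp C (bg x) h = Cmp C (bg y) k"
  using bg_unique cmp_in[OF _ bg_hom] hom_Obj by metis

lemma Cod_hom: "h \<in> hom C w x \<Longrightarrow> Cod C h = x"
  by (simp add: hom_def)

text \<open>Soundness of the calculus in \<open>C\<close>. Equal terms get equal and not just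
  isomorphic values, because the selections depend only on evaluated data.\<close>

lemma ev_sound:
  shows "oeq K C X X' \<Longrightarrow> eo X = eo X' \<and> eo X \<in> Obj C"
    and "aeq K C X Y f f' \<Longrightarrow> em f = em f' \<and> em f \<in> hom C (eo X) (eo Y)"
proof (induction rule: oeq_aeq.inducts)
  case (a_conv X Y f g X' Y') then show ?case by metis
next
  case (a_id X X') then show ?case using ide_in by auto
next
  case (a_comp X Y f f' Z g g') then show ?case using cmp_in by auto
next
  case (a_comp_id X Y f) then show ?case using cmp_ide by auto
next
  case (a_id_comp X Y f) then show ?case using ide_cmp by auto
next
  case (a_assoc X Y f Z g W h) then show ?case using cmp_assoc cmp_in by auto
next
  case (a_gen m) then show ?case by (simp add: hom_def)
next
  case (a_gen_id x) then show ?case using ide_in by auto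
next
  case (a_gen_comp m n) then show ?case using cmp_in[of m "Dom C m" "Cod C m" n "Cod C n"] by (simp add: hom_def)
next
  case o_one then show ?case using terminal by (simp add: is_term_def)
next
  case (a_bang X X') then show ?case using bg_hom by auto
next
  case (a_bang_unique X f) then show ?case using bg_unique by auto
next
  case (o_prod X X' Y Y') then show ?case using proj_hom(4)[OF bg_hom bg_hom] by auto
next
  case (a_pr1 X X' Y Y') then show ?case using proj_hom(1)[OF bg_hom bg_hom] by auto
next
  case (a_pr2 X X' Y Y') then show ?case using proj_hom(2)[OF bg_hom bg_hom] by auto
next
  case (a_pair W X h h' Y k k')
  then have h: "em h \<in> hom C (eo W) (eo X)" "em k \<in> hom C (eo W) (eo Y)" by auto
  then show ?case
    using a_pair plift_props(1)[OF bg_hom bg_hom h bg_commute[OF h]] hom_Obj Cod_hom[OF h(1)] Cod_hom[OF h(2)]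
    by (simp add: conj_ac)
next
  case (a_pr1_pair W X h Y k)
  then have h: "em h \<in> hom C (eo W) (eo X)" "em k \<in> hom C (eo W) (eo Y)" by auto
  then show ?case
    using plift_props(2)[OF bg_hom bg_hom h bg_commute[OF h]] hom_Obj Cod_hom[OF h(1)] Cod_hom[OF h(2)]
    by simp
next
  case (a_pr2_pair W X h Y k)
  then have h: "em h \<in> hom C (eo W) (eo X)" "em k \<in> hom C (eo W) (eo Y)" by auto
  then show ?case
    using plift_props(3)[OF bg_hom bg_hom h bg_commute[OF h]] hom_Obj Cod_hom[OF h(1)] Cod_hom[OF h(2)]
    by simp
next
  case (a_pair_unique X Y W u)
  then have X: "eo X \<in> Obj C" "eo Y \<in> Obj C" and u: "em u \<in> hom C (eo W) (eo (OProd X Y))" by auto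
  note b = bg_hom[OF X(1)] bg_hom[OF X(2)]
  note h = cmp_in[OF u[simplified] proj_hom(1)[OF b]] cmp_in[OF u[simplified] proj_hom(2)[OF b]]
  have "em u = em (MPair (MComp (MPr1 X Y) u) (MComp (MPr2 X Y) u))"
    using proj_unique[OF b u[simplified] plift_props(1)[OF b h bg_commute[OF h]]] plift_props(2,3)[OF b h bg_commute[OF h]]
      Cod_hom[OF h(1)] Cod_hom[OF h(2)] by simp
  then show ?case using u by blast
next
  case (o_pb X X' Y Y' Z f f' g g') then show ?case using proj_hom(4)[of "em f" _ _ "em g"] by auto
next
  case (a_pb1 X X' Y Y' Z f f' g g') then show ?case using proj_hom(1)[of "em f" _ _ "em g"] by auto
next
  case (a_pb2 X X' Y Y' Z f f' g g') then show ?case using proj_hom(2)[of "em f" _ _ "em g"] by auto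
next
  case (a_pb_square X Z f Y g)
  then have h: "em f \<in> hom C (eo X) (eo Z)" "em g \<in> hom C (eo Y) (eo Z)" by auto
  show ?case using proj_hom(3)[OF h] cmp_in[OF proj_hom(1)[OF h] h(1)] by simp
next
  case (a_lift X X' Y Y' Z f f' g g' W h h' k k')
  then have h: "em f \<in> hom C (eo X) (eo Z)" "em g \<in> hom C (eo Y) (eo Z)" "em h \<in> hom C (eo W) (eo X)"
    "em k \<in> hom C (eo W) (eo Y)" "Cmp C (em f) (em h) = Cmp C (em g) (em k)"
    "em f = em f'" "em g = em g'" "em h = em h'" "em k = em k'" by auto
  show ?case using plift_props(1)[OF h(1-5)] h(6-9) by simp
next
  case (a_pb1_lift X Z f Y g W h k)
  then have h: "em f \<in> hom C (eo X) (eo Z)" "em g \<in> hom C (eo Y) (eo Z)" "em h \<in> hom C (eo W) (eo X)"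
    "em k \<in> hom C (eo W) (eo Y)" "Cmp C (em f) (em h) = Cmp C (em g) (em k)" by auto
  show ?case using plift_props(2)[OF h] h(3) by simp
next
  case (a_pb2_lift X Z f Y g W h k)
  then have h: "em f \<in> hom C (eo X) (eo Z)" "em g \<in> hom C (eo Y) (eo Z)" "em h \<in> hom C (eo W) (eo X)"
    "em k \<in> hom C (eo W) (eo Y)" "Cmp C (em f) (em h) = Cmp C (em g) (em k)" by auto
  show ?case using plift_props(3)[OF h] h(4) by simp
next
  case (a_lift_unique X Z f Y g W u v)
  then have h: "em f \<in> hom C (eo X) (eo Z)" "em g \<in> hom C (eo Y) (eo Z)"
    "em u \<in> hom C (eo W) (Dom C (p (em f) (em g)))" "em v \<in> hom C (eo W) (Dom C (p (em f) (em g)))"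
    "Cmp C (p (em f) (em g)) (em u) = Cmp C (p (em f) (em g)) (em v)"
    "Cmp C (q (em f) (em g)) (em u) = Cmp C (q (em f) (em g)) (em v)" by auto
  show ?case using proj_unique[OF h] h(3) by simp
qed auto

abbreviation "EV K \<equiv> ev_functor K C t p q"

lemma EV_ocl: "oeq K C X X \<Longrightarrow> FOb (EV K) (ocl K C X) = eo X"
  by (simp add: ev_functor_def ocl_Obj conjunct1[OF ev_sound(1)[OF rep_ocl], symmetric])

lemma EV_acl: "aeq K C X Y f f \<Longrightarrow> FAr (EV K) (acl K C X Y f) = em f"
  by (simp add: ev_functor_def acl_Arr conjunct1[OF ev_sound(2)[OF rep_acl], symmetric])

lemma EV_Fun: "EV K \<in> Fun (S_cat K C) C"
proof (rule S_cat_FunI[OF category_axioms category_axioms])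
  note wf = aeq_wf[OF category_axioms]
  show "FOb (EV K) (ocl K C X) \<in> Obj C" if "oeq K C X X" for X
    using ev_sound(1)[OF that] by (simp add: EV_ocl that)
  show "FAr (EV K) (acl K C X Y f) \<in> hom C (FOb (EV K) (ocl K C X)) (FOb (EV K) (ocl K C Y))" if "aeq K C X Y f f" for X Y f
    using ev_sound(2)[OF that] wf[OF that] by (simp add: EV_acl that EV_ocl)
  show "FAr (EV K) (acl K C X X (MId X)) = Ide C (FOb (EV K) (ocl K C X))" if "oeq K C X X" for X
    by (simp add: EV_acl[OF a_id[OF that]] EV_ocl that)
  show "FAr (EV K) (acl K C X Z (MComp g f)) = Cmp C (FAr (EV K) (acl K C Y Z g)) (FAr (EV K) (acl K C X Y f))"
    if "aeq K C X Y f f" "aeq K C Y Z g g" for X Y Z f g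
    using that by (simp add: EV_acl EV_acl[OF a_comp[OF that]])
qed (auto simp: ev_functor_def)

lemma EV_unit: "EV K \<circ>\<^sub>F S_unit K C = idf C"
  by (rule Fun_eqI[OF fcomp_Fun[OF S_unit_Fun[OF category_axioms] EV_Fun] idf_Fun[OF category_axioms]])
    (simp_all add: fcomp_FOb[OF S_unit_Fun[OF category_axioms]] fcomp_FAr[OF S_unit_Fun[OF category_axioms]]
      S_unit_FOb S_unit_FAr EV_ocl[OF o_gen] EV_acl[OF a_gen], simp_all add: idf_def)

text \<open>Evaluation is compositional, so inner terms may be evaluated first. The identity functor
  gives the algebra law of \<open>C\<close>; a general \<open>f\<close> is allowed because
  \<open>normal_mult\<close> asks for this strictness of \<open>EV K\<close> after
  \<open>S f\<close>.\<close>

lemma EV_mult: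
  assumes f: "f \<in> Fun A C"
  shows "EV K \<circ>\<^sub>F S_functor K (EV K \<circ>\<^sub>F S_functor K f) = (EV K \<circ>\<^sub>F S_functor K f) \<circ>\<^sub>F S_mult K A"
proof -
  have A: "category A" using Fun_cat[OF f] by simp
  have SA: "category (S_cat K A)" using A by (rule category_S_cat)
  note Sf = S_functor_Fun[OF f, of K]
  let ?H = "EV K \<circ>\<^sub>F S_functor K f"
  note H = fcomp_Fun[OF Sf EV_Fun]
  note SH = S_functor_Fun[OF H, of K] and m = S_mult_Fun[OF A, of K]
  have Ho: "FOb ?H (ocl K A X) = eo (map_o f X)" if "oeq K A X X" for X
    using EV_ocl[OF map_sound(1)[OF f that]] by (simp add: fcomp_FOb[OF Sf ocl_Obj[OF that]] S_functor_ocl[OF f that])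
  have Ha: "FAr ?H (acl K A X Y g) = em (map_m f g)" if "aeq K A X Y g g" for X Y g
    using EV_acl[OF map_sound(2)[OF f that]] by (simp add: fcomp_FAr[OF Sf acl_Arr[OF that]] S_functor_acl[OF f that])
  have go: "FOb ?H c = eo (map_o f (rep c))" if "c \<in> Obj (S_cat K A)" for c
  proof -
    obtain X where X: "c = ocl K A X" "oeq K A X X" using \<open>c \<in> _\<close> by (rule S_cat_ObjE)
    show ?thesis using Ho[OF X(2)] ev_sound(1)[OF map_sound(1)[OF f rep_ocl[OF X(2)]]] by (simp add: X(1))
  qed
  have ga: "FAr ?H \<phi> = em (map_m f (rep (scls \<phi>)))" if "\<phi> \<in> Arr (S_cat K A)" for \<phi>
  proof -
    obtain X Y g where g: "\<phi> = acl K A X Y g" "aeq K A X Y g g" using \<open>\<phi> \<in> _\<close> by (rule S_cat_ArrE)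
    show ?thesis using Ha[OF g(2)] ev_sound(2)[OF map_sound(2)[OF f rep_acl[OF g(2)]]] by (simp add: g(1))
  qed
  \<comment> \<open>A raw induction: the only requirement on a term is that its generators lie in
    the free category, where \<open>go\<close> and \<open>ga\<close> evaluate
    representatives.\<close>
  have "set1_otm T \<subseteq> Obj (S_cat K A) \<Longrightarrow> set2_otm T \<subseteq> Arr (S_cat K A) \<Longrightarrow> eo (map_o ?H T) = eo (map_o f (flatten_o T))"
    and "set1_mtm u \<subseteq> Obj (S_cat K A) \<Longrightarrow> set2_mtm u \<subseteq> Arr (S_cat K A) \<Longrightarrow> em (map_m ?H u) = em (map_m f (flatten_m u))"
    for T u
    by (induction T and u) (simp_all add: go ga)
  note eq = this
  show ?thesis
  proof (rule S_cat_Fun_eqI[OF fcomp_Fun[OF SH EV_Fun] fcomp_Fun[OF m H]])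
    fix T assume T: "oeq K (S_cat K A) T T"
    have "FOb (EV K \<circ>\<^sub>F S_functor K ?H) (ocl K (S_cat K A) T) = eo (map_o ?H T)"
      using EV_ocl[OF map_sound(1)[OF H T]] by (simp add: fcomp_FOb[OF SH ocl_Obj[OF T]] S_functor_ocl[OF H T])
    also have "\<dots> = eo (map_o f (flatten_o T))" using eq(1) oeq_aeq_gens(1)[OF SA T] by blast
    also have "\<dots> = FOb (?H \<circ>\<^sub>F S_mult K A) (ocl K (S_cat K A) T)"
      using Ho[OF flatten_sound(1)[OF A T]] by (simp add: fcomp_FOb[OF m ocl_Obj[OF T]] S_mult_ocl[OF A T])
    finally show "FOb (EV K \<circ>\<^sub>F S_functor K ?H) (ocl K (S_cat K A) T) = FOb (?H \<circ>\<^sub>F S_mult K A) (ocl K (S_cat K A) T)" .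
  next
    fix X Y u assume u: "aeq K (S_cat K A) X Y u u"
    have "FAr (EV K \<circ>\<^sub>F S_functor K ?H) (acl K (S_cat K A) X Y u) = em (map_m ?H u)"
      using EV_acl[OF map_sound(2)[OF H u]] by (simp add: fcomp_FAr[OF SH acl_Arr[OF u]] S_functor_acl[OF H u])
    also have "\<dots> = em (map_m f (flatten_m u))" using eq(2) oeq_aeq_gens(2)[OF SA u] by blast
    also have "\<dots> = FAr (?H \<circ>\<^sub>F S_mult K A) (acl K (S_cat K A) X Y u)"
      using Ha[OF flatten_sound(2)[OF A u]] by (simp add: fcomp_FAr[OF m acl_Arr[OF u]] S_mult_acl[OF A u])
    finally show "FAr (EV K \<circ>\<^sub>F S_functor K ?H) (acl K (S_cat K A) X Y u) = FAr (?H \<circ>\<^sub>F S_mult K A) (acl K (S_cat K A) X Y u)" .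
  qed
qed

lemma EV_strict_algebra: "strict_algebra K (C, EV K)"
proof -
  have "EV K \<circ>\<^sub>F S_functor K (idf C) = EV K"
    using S_functor_idf[OF category_axioms] fcomp_idf(1)[OF EV_Fun] by simp
  then show ?thesis
    using EV_mult[OF idf_Fun[OF category_axioms], of K] EV_Fun EV_unit category_axioms by (simp add: strict_algebra_def)
qed

end

section \<open>Presheaf categories\<close>

lemma small_subset: "small U B \<Longrightarrow> A \<subseteq> B \<Longrightarrow> small U A"
  unfolding small_def by (meson lesspoll_trans1 subset_imp_lepoll)

lemma small_lepoll: "small U B \<Longrightarrow> A \<lesssim> B \<Longrightarrow> small U A"
  unfolding small_def by (meson lesspoll_trans1)

lemma small_finite: "finite A \<Longrightarrow> small TYPE('u::universe) A"
  unfolding small_def by (simp add: finite_lesspoll_infinite infinite_universe)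

text \<open>An infinite set is equipotent to its square, so triples can be coded injectively by
  single elements.\<close>

lemma inj_pack: "inj (pack :: 'u::universe \<times> 'u \<times> 'u \<Rightarrow> 'u)"
proof -
  have i: "infinite (UNIV :: 'u set)" by (rule infinite_universe)
  obtain e :: "'u \<times> 'u \<Rightarrow> 'u" where "bij_betw e (UNIV \<times> UNIV) UNIV"
    using iffD2[OF card_of_ordIso card_of_Times_same_infinite[OF i]] by (rule exE)
  then have e: "inj e" by (simp add: bij_betw_def)
  have "inj (\<lambda>(x, y, z). e (x, e (y, z)))"
    by (rule injI) (auto dest!: injD[OF e])
  then show ?thesis unfolding pack_def by (rule someI[where P = inj])
qed

lemma unpack_pack [simp]: "unpack (pack w :: 'u::universe) = w"
  by (simp add: unpack_def inj_pack)

lemma pack_eq_iff [simp]: "pack w = (pack v :: 'u::universe) \<longleftrightarrow> w = v"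
  using inj_pack by (auto dest: injD)

section \<open>Opposite categories and the category of small sets\<close>

lemma op_sel [simp]: "Obj (op C) = Obj C" "Arr (op C) = Arr C" "Dom (op C) = Cod C" "Cod (op C) = Dom C"
  "Ide (op C) = Ide C" "Cmp (op C) g f = Cmp C f g"
  by (simp_all add: op_def)

lemma hom_op: "f \<in> hom (op C) x y \<longleftrightarrow> f \<in> hom C y x"
  by (auto simp: hom_def)

lemma category_op: assumes C: "category C" shows "category (op C)"
proof
  show "f \<in> Arr (op C) \<Longrightarrow> Dom (op C) f \<in> Obj (op C)" "f \<in> Arr (op C) \<Longrightarrow> Cod (op C) f \<in> Obj (op C)" for f
    using category.dom_in[OF C] category.cod_in[OF C] by auto
  show "x \<in> Obj (op C) \<Longrightarrow> Ide (op C) x \<in> hom (op C) x x" for x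
    using category.ide_in[OF C] by (simp add: hom_op)
qed (use category.cmp_in[OF C] category.ide_cmp[OF C] category.cmp_ide[OF C] category.cmp_assoc[OF C] in
    \<open>auto simp: hom_op\<close>)

lemma Set_cat_hom: "\<phi> \<in> hom Set_cat A (B :: 'u set) \<longleftrightarrow>
    small TYPE('u) A \<and> small TYPE('u) B \<and> (\<exists>f \<in> A \<rightarrow>\<^sub>E B. \<phi> = (A, f, B))"
  by (auto simp: Set_cat_def hom_def)

lemma Set_cat_sel [simp]: "Obj Set_cat = {A :: 'u set. small TYPE('u) A}"
  "Ide Set_cat A = (A, (\<lambda>x\<in>A. x), A)"
  "Cmp Set_cat (B, g, D) (A, f, B) = (A, compose A g f, D)"
  by (simp_all add: Set_cat_def)

lemma category_Set_cat: "category (Set_cat :: ('u set, 'u setarr) cat)"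
proof
  fix f g h x y z w
  show "f \<in> Arr Set_cat \<Longrightarrow> Dom Set_cat f \<in> Obj (Set_cat :: ('u set, 'u setarr) cat)"
    "f \<in> Arr Set_cat \<Longrightarrow> Cod Set_cat f \<in> Obj (Set_cat :: ('u set, 'u setarr) cat)"
    by (auto simp: Set_cat_def)
  show "x \<in> Obj Set_cat \<Longrightarrow> Ide Set_cat x \<in> hom (Set_cat :: ('u set, 'u setarr) cat) x x"
    by (auto simp: Set_cat_hom)
  show "f \<in> hom Set_cat x y \<Longrightarrow> Cmp Set_cat f (Ide (Set_cat :: ('u set, 'u setarr) cat) x) = f"
    by (auto simp: Set_cat_hom compose_def PiE_iff intro!: extensionalityI[of _ x])
  show "f \<in> hom Set_cat x y \<Longrightarrow> Cmp Set_cat (Ide (Set_cat :: ('u set, 'u setarr) cat) y) f = f"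
    by (auto simp: Set_cat_hom compose_def PiE_iff intro!: extensionalityI[of _ x])
  assume f: "f \<in> hom (Set_cat :: ('u set, 'u setarr) cat) x y"
  show "g \<in> hom Set_cat y z \<Longrightarrow> Cmp Set_cat g f \<in> hom Set_cat x z"
    using f by (auto simp: Set_cat_hom compose_def PiE_iff)
  show "g \<in> hom Set_cat y z \<Longrightarrow> h \<in> hom Set_cat z w \<Longrightarrow>
      Cmp Set_cat h (Cmp Set_cat g f) = Cmp Set_cat (Cmp Set_cat h g) f"
    using f by (auto simp: Set_cat_hom compose_def PiE_iff intro!: extensionalityI[of _ x])
qed

lemma category_psh: "category (psh X)"
  unfolding psh_def by (rule category_functor_category)

section \<open>Presheaves and their maps, elementwise\<close>

definition pact :: "'u presheaf \<Rightarrow> 'u \<Rightarrow> 'u \<Rightarrow> 'u" where "pact p h t = app (FAr p h) t"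
definition ap :: "'u pshmap \<Rightarrow> 'u \<Rightarrow> 'u \<Rightarrow> 'u" where "ap \<alpha> x t = app (NCmp \<alpha> x) t"

definition mkP :: "('u, 'u) cat \<Rightarrow> ('u \<Rightarrow> 'u set) \<Rightarrow> ('u \<Rightarrow> 'u \<Rightarrow> 'u) \<Rightarrow> 'u presheaf" where
  "mkP X P act = \<lparr>Src = op X, Tgt = Set_cat, FOb = (\<lambda>x\<in>Obj X. P x),
     FAr = (\<lambda>h\<in>Arr X. (P (Cod X h), (\<lambda>t\<in>P (Cod X h). act h t), P (Dom X h)))\<rparr>"

definition mkN :: "('u, 'u) cat \<Rightarrow> 'u presheaf \<Rightarrow> 'u presheaf \<Rightarrow> ('u \<Rightarrow> 'u \<Rightarrow> 'u) \<Rightarrow> 'u pshmap" where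
  "mkN X p q \<phi> = \<lparr>NSrc = p, NTgt = q,
     NCmp = (\<lambda>x\<in>Obj X. (FOb p x, (\<lambda>t\<in>FOb p x. \<phi> x t), FOb q x))\<rparr>"

lemma representable_mkP: "representable X x = mkP X (\<lambda>z. hom X z x) (\<lambda>h k. Cmp X k h)"
  by (simp add: representable_def mkP_def)

locale small_cat =
  fixes X :: "('u::universe, 'u) cat"
  assumes small_X: "small_category X"

sublocale small_cat \<subseteq> category X
  using small_X by (simp add: small_category_def)

context small_cat
begin

lemma psh_Obj: "p \<in> Obj (psh X) \<longleftrightarrow> p \<in> Fun (op X) Set_cat"
  by (simp add: psh_def functor_category_def)

lemma psh_hom: "\<alpha> \<in> hom (psh X) p q \<longleftrightarrow> p \<in> Obj (psh X) \<and> q \<in> Obj (psh X) \<and> \<alpha> \<in> Nat p q"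
  by (simp add: psh_def functor_category_hom) (simp add: functor_category_def)

context
  fixes p assumes p: "p \<in> Obj (psh X)"
begin

lemma p_Fun: "p \<in> Fun (op X) Set_cat" using p by (simp add: psh_Obj)

lemma psh_small: "x \<in> Obj X \<Longrightarrow> small TYPE('u) (FOb p x)"
  using Fun_Ob[OF p_Fun, of x] by simp

lemma FAr_psh: "h \<in> hom X x y \<Longrightarrow> FAr p h = (FOb p y, (\<lambda>t\<in>FOb p y. pact p h t), FOb p x)"
  using Fun_hom[OF p_Fun, of h y x]
  by (auto simp: hom_op Set_cat_hom pact_def extensional_def PiE_def fun_eq_iff)

lemma pact_in: "h \<in> hom X x y \<Longrightarrow> t \<in> FOb p y \<Longrightarrow> pact p h t \<in> FOb p x"
  using Fun_hom[OF p_Fun, of h y x] by (auto simp: hom_op Set_cat_hom pact_def)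

lemma pact_ide: "x \<in> Obj X \<Longrightarrow> t \<in> FOb p x \<Longrightarrow> pact p (Ide X x) t = t"
  using Fun_Ide[OF p_Fun, of x] by (simp add: pact_def)

lemma pact_cmp:
  assumes "f \<in> hom X x y" "g \<in> hom X y z" "t \<in> FOb p z"
  shows "pact p (Cmp X g f) t = pact p f (pact p g t)"
proof -
  have "FAr p (Cmp X g f) = Cmp Set_cat (FAr p f) (FAr p g)"
    using Fun_Cmp[OF p_Fun, of g z y f x] assms by (simp add: hom_op)
  also have "\<dots> = (FOb p z, (\<lambda>t\<in>FOb p z. pact p f (pact p g t)), FOb p x)"
    using pact_in[OF assms(2)] by (auto simp: FAr_psh[OF assms(1)] FAr_psh[OF assms(2)] compose_def)
  finally show ?thesis using assms(3) by (simp add: pact_def)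
qed

end

lemma mkP_sel: "x \<in> Obj X \<Longrightarrow> FOb (mkP X P act) x = P x"
  "h \<in> hom X x y \<Longrightarrow> t \<in> P y \<Longrightarrow> pact (mkP X P act) h t = act h t"
  by (auto simp: mkP_def pact_def hom_def)

lemma mkP_Obj:
  assumes "\<And>x. x \<in> Obj X \<Longrightarrow> small TYPE('u) (P x)"
    and "\<And>h x y t. h \<in> hom X x y \<Longrightarrow> t \<in> P y \<Longrightarrow> act h t \<in> P x"
    and "\<And>x t. x \<in> Obj X \<Longrightarrow> t \<in> P x \<Longrightarrow> act (Ide X x) t = t"
    and "\<And>f g x y z t. f \<in> hom X x y \<Longrightarrow> g \<in> hom X y z \<Longrightarrow> t \<in> P z \<Longrightarrow> act (Cmp X g f) t = act f (act g t)"
  shows "mkP X P act \<in> Obj (psh X)"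
  unfolding psh_Obj
proof (rule FunI)
  show "category (op X)" "category Set_cat" using category_axioms category_op category_Set_cat by auto
  show "FAr (mkP X P act) f \<in> hom Set_cat (FOb (mkP X P act) x) (FOb (mkP X P act) y)"
    if f: "f \<in> hom (op X) x y" for f x y
  proof -
    have f': "f \<in> hom X y x" using f by (simp add: hom_op)
    then have "f \<in> Arr X" "Cod X f = x" "Dom X f = y" "x \<in> Obj X" "y \<in> Obj X"
      using hom_Obj[OF f'] by (auto simp: hom_def)
    then show ?thesis using assms(1) assms(2)[OF f'] by (auto simp: mkP_def Set_cat_hom)
  qed
  show "FAr (mkP X P act) (Ide (op X) x) = Ide Set_cat (FOb (mkP X P act) x)" if "x \<in> Obj (op X)" for x
    using that ide_in[of x] assms(3) by (auto simp: mkP_def hom_def intro!: restrict_ext)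
  show "FAr (mkP X P act) (Cmp (op X) g f) = Cmp Set_cat (FAr (mkP X P act) g) (FAr (mkP X P act) f)"
    if "f \<in> hom (op X) x y" "g \<in> hom (op X) y z" for f g x y z
    using that cmp_in[of g z y f x] assms(2)[of f y x] assms(4)[of g z y f x]
    by (auto simp: mkP_def hom_op hom_def compose_def intro!: restrict_ext)
qed (use assms(1) in \<open>auto simp: mkP_def\<close>)

lemma ap_in: "\<alpha> \<in> hom (psh X) p q \<Longrightarrow> x \<in> Obj X \<Longrightarrow> t \<in> FOb p x \<Longrightarrow> ap \<alpha> x t \<in> FOb q x"
  using Nat_hom[of \<alpha> p q "op X" Set_cat x] by (auto simp: psh_hom psh_Obj Set_cat_hom ap_def)

lemma NCmp_psh: "\<alpha> \<in> hom (psh X) p q \<Longrightarrow> x \<in> Obj X \<Longrightarrow> NCmp \<alpha> x = (FOb p x, (\<lambda>t\<in>FOb p x. ap \<alpha> x t), FOb q x)"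
  using Nat_hom[of \<alpha> p q "op X" Set_cat x]
  by (auto simp: psh_hom psh_Obj Set_cat_hom ap_def extensional_def PiE_def fun_eq_iff)

lemma ap_nat:
  assumes \<alpha>: "\<alpha> \<in> hom (psh X) p q" and h: "h \<in> hom X x y" and t: "t \<in> FOb p y"
  shows "ap \<alpha> x (pact p h t) = pact q h (ap \<alpha> y t)"
proof -
  have pq: "p \<in> Obj (psh X)" "q \<in> Obj (psh X)" "\<alpha> \<in> Nat p q" using \<alpha> by (auto simp: psh_hom)
  have xy: "x \<in> Obj X" "y \<in> Obj X" using hom_Obj[OF h] by auto
  have "Cmp Set_cat (NCmp \<alpha> x) (FAr p h) = Cmp Set_cat (FAr q h) (NCmp \<alpha> y)"
    using Nat_nat[OF pq(3) p_Fun[OF pq(1)], of h y x] h by (simp add: hom_op)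
  then have "compose (FOb p y) (\<lambda>t\<in>FOb p x. ap \<alpha> x t) (\<lambda>t\<in>FOb p y. pact p h t) t
      = compose (FOb p y) (\<lambda>t\<in>FOb q y. pact q h t) (\<lambda>t\<in>FOb p y. ap \<alpha> y t) t"
    by (simp add: NCmp_psh[OF \<alpha> xy(1)] NCmp_psh[OF \<alpha> xy(2)] FAr_psh[OF pq(1) h] FAr_psh[OF pq(2) h])
  then show ?thesis
    using t pact_in[OF pq(1) h t] ap_in[OF \<alpha> xy(2) t] by (simp add: compose_def)
qed

lemma psh_hom_eqI:
  assumes "\<alpha> \<in> hom (psh X) p q" "\<beta> \<in> hom (psh X) p q"
    and "\<And>x t. x \<in> Obj X \<Longrightarrow> t \<in> FOb p x \<Longrightarrow> ap \<alpha> x t = ap \<beta> x t"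
  shows "\<alpha> = \<beta>"
proof (rule Nat_eqI[of _ p q _ "op X" Set_cat])
  show "\<alpha> \<in> Nat p q" "\<beta> \<in> Nat p q" "p \<in> Fun (op X) Set_cat" using assms by (auto simp: psh_hom psh_Obj)
  show "NCmp \<alpha> x = NCmp \<beta> x" if "x \<in> Obj (op X)" for x
    using that assms(3) by (auto simp: NCmp_psh[OF assms(1)] NCmp_psh[OF assms(2)] intro!: restrict_ext)
qed

lemma mkN_hom:
  assumes p: "p \<in> Obj (psh X)" and q: "q \<in> Obj (psh X)"
    and i: "\<And>x t. x \<in> Obj X \<Longrightarrow> t \<in> FOb p x \<Longrightarrow> \<phi> x t \<in> FOb q x"
    and n: "\<And>h x y t. h \<in> hom X x y \<Longrightarrow> t \<in> FOb p y \<Longrightarrow> \<phi> x (pact p h t) = pact q h (\<phi> y t)"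
  shows "mkN X p q \<phi> \<in> hom (psh X) p q"
  unfolding psh_hom
proof (intro conjI p q NatI[OF _ _ p_Fun[OF p] p_Fun[OF q]])
  show "NCmp (mkN X p q \<phi>) x \<in> hom Set_cat (FOb p x) (FOb q x)" if "x \<in> Obj (op X)" for x
    using that i psh_small[OF p] psh_small[OF q] by (auto simp: mkN_def Set_cat_hom)
  show "Cmp Set_cat (NCmp (mkN X p q \<phi>) y) (FAr p f) = Cmp Set_cat (FAr q f) (NCmp (mkN X p q \<phi>) x)"
    if "f \<in> hom (op X) x y" for f x y
  proof -
    have f: "f \<in> hom X y x" using that by (simp add: hom_op)
    then have xy: "x \<in> Obj X" "y \<in> Obj X" using hom_Obj by auto
    then show ?thesis
      using pact_in[OF p f] i[of x] n[OF f]
      by (auto simp: mkN_def FAr_psh[OF p f] FAr_psh[OF q f] compose_def intro!: restrict_ext)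
  qed
qed (auto simp: mkN_def)

lemma ap_mkN: "x \<in> Obj X \<Longrightarrow> t \<in> FOb p x \<Longrightarrow> ap (mkN X p q \<phi>) x t = \<phi> x t"
  by (simp add: mkN_def ap_def)

lemma ap_cmp:
  assumes \<alpha>: "\<alpha> \<in> hom (psh X) p q" and \<beta>: "\<beta> \<in> hom (psh X) q r" and x: "x \<in> Obj X" and t: "t \<in> FOb p x"
  shows "ap (Cmp (psh X) \<beta> \<alpha>) x t = ap \<beta> x (ap \<alpha> x t)"
proof -
  have "\<alpha> \<in> Nat p q" "p \<in> Fun (op X) Set_cat" using \<alpha> by (auto simp: psh_hom psh_Obj)
  then have "NCmp (Cmp (psh X) \<beta> \<alpha>) x = Cmp Set_cat (NCmp \<beta> x) (NCmp \<alpha> x)"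
    using vcomp_NCmp[of \<alpha> p q "op X" Set_cat x \<beta>] x by (simp add: psh_def functor_category_def)
  then show ?thesis
    using t ap_in[OF \<alpha> x t] by (simp add: ap_def[of "Cmp (psh X) \<beta> \<alpha>"] NCmp_psh[OF \<alpha> x] NCmp_psh[OF \<beta> x] compose_def)
qed

lemma ap_ide: "p \<in> Obj (psh X) \<Longrightarrow> x \<in> Obj X \<Longrightarrow> t \<in> FOb p x \<Longrightarrow> ap (Ide (psh X) p) x t = t"
  using idn_NCmp[of p "op X" Set_cat x] by (simp add: ap_def psh_Obj) (simp add: psh_def functor_category_def)

lemma psh_iso:
  assumes \<alpha>: "\<alpha> \<in> hom (psh X) p q" and b: "\<And>x. x \<in> Obj X \<Longrightarrow> bij_betw (ap \<alpha> x) (FOb p x) (FOb q x)"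
  shows "is_iso (psh X) \<alpha>"
proof -
  have pq: "p \<in> Obj (psh X)" "q \<in> Obj (psh X)" using \<alpha> by (auto simp: psh_hom)
  define \<psi> where "\<psi> x = inv_into (FOb p x) (ap \<alpha> x)" for x
  have \<psi>: "\<psi> x t \<in> FOb p x" "ap \<alpha> x (\<psi> x t) = t" if "x \<in> Obj X" "t \<in> FOb q x" for x t
    using b[OF that(1)] that(2) unfolding \<psi>_def
    by (auto simp: bij_betw_def intro: inv_into_into f_inv_into_f)
  have \<psi>': "\<psi> x (ap \<alpha> x t) = t" if "x \<in> Obj X" "t \<in> FOb p x" for x t
    using b[OF that(1)] that(2) unfolding \<psi>_def by (auto simp: bij_betw_def)
  let ?\<beta> = "mkN X q p \<psi>"
  have \<beta>: "?\<beta> \<in> hom (psh X) q p"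
  proof (rule mkN_hom[OF pq(2,1) \<psi>(1)])
    fix h x y t assume h: "h \<in> hom X x y" and t: "t \<in> FOb q y"
    have xy: "x \<in> Obj X" "y \<in> Obj X" using hom_Obj[OF h] by auto
    have "\<psi> x (pact q h t) = \<psi> x (ap \<alpha> x (pact p h (\<psi> y t)))"
      using ap_nat[OF \<alpha> h \<psi>(1)[OF xy(2) t]] \<psi>(2)[OF xy(2) t] by simp
    also have "\<dots> = pact p h (\<psi> y t)"
      by (rule \<psi>'[OF xy(1) pact_in[OF pq(1) h \<psi>(1)[OF xy(2) t]]])
    finally show "\<psi> x (pact q h t) = pact p h (\<psi> y t)" .
  qed
  note cin = category.cmp_in[OF category_psh] and iin = category.ide_in[OF category_psh]
  have "Cmp (psh X) ?\<beta> \<alpha> = Ide (psh X) p"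
    by (rule psh_hom_eqI[OF cin[OF \<alpha> \<beta>] iin[OF pq(1)]])
      (simp add: ap_cmp[OF \<alpha> \<beta>] ap_mkN ap_in[OF \<alpha>] \<psi>' ap_ide[OF pq(1)])
  moreover have "Cmp (psh X) \<alpha> ?\<beta> = Ide (psh X) q"
    by (rule psh_hom_eqI[OF cin[OF \<beta> \<alpha>] iin[OF pq(2)]])
      (simp add: ap_cmp[OF \<beta> \<alpha>] ap_mkN \<psi> ap_ide[OF pq(2)])
  ultimately show ?thesis using category.is_iso_iff[OF category_psh \<alpha>] \<beta> by blast
qed

section \<open>Representables and the Yoneda lemma\<close>

lemma small_hom: "small TYPE('u) (hom X x y)"
  using small_X small_subset[of "TYPE('u)" "Arr X" "hom X x y"] by (auto simp: small_category_def hom_def)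

lemma representable_Obj: "x \<in> Obj X \<Longrightarrow> representable X x \<in> Obj (psh X)"
  unfolding representable_mkP
  by (rule mkP_Obj)
    (auto simp: small_hom intro: cmp_in cmp_ide
      cmp_assoc)

lemma representable_sel: "z \<in> Obj X \<Longrightarrow> FOb (representable X x) z = hom X z x"
  "h \<in> hom X z w \<Longrightarrow> k \<in> hom X w x \<Longrightarrow> pact (representable X x) h k = Cmp X k h"
  unfolding representable_mkP by (simp_all add: mkP_sel)

text \<open>The map out of the representable that corresponds to the element \<open>t\<close> under
  the Yoneda lemma.\<close>

definition yoneda_map :: "'u presheaf \<Rightarrow> 'u \<Rightarrow> 'u \<Rightarrow> 'u pshmap" where
  "yoneda_map p x t = mkN X (representable X x) p (\<lambda>z k. pact p k t)"

lemma yoneda_map_hom: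
  assumes p: "p \<in> Obj (psh X)" and x: "x \<in> Obj X" and t: "t \<in> FOb p x"
  shows "yoneda_map p x t \<in> hom (psh X) (representable X x) p"
  unfolding yoneda_map_def
proof (rule mkN_hom[OF representable_Obj[OF x] p])
  show "pact p k t \<in> FOb p z" if "z \<in> Obj X" "k \<in> FOb (representable X x) z" for z k
    using that t pact_in[OF p] by (simp add: representable_sel)
  show "pact p (pact (representable X x) h k) t = pact p h (pact p k t)"
    if h: "h \<in> hom X z w" and k: "k \<in> FOb (representable X x) w" for h z w k
  proof -
    have "k \<in> hom X w x" using k hom_Obj[OF h] by (simp add: representable_sel)
    then show ?thesis using pact_cmp[OF p h _ t] representable_sel(2)[OF h] by simp
  qed
qed

lemma ap_yoneda_map: "z \<in> Obj X \<Longrightarrow> k \<in> hom X z x \<Longrightarrow> ap (yoneda_map p x t) z k = pact p k t"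
  unfolding yoneda_map_def by (rule ap_mkN) (simp_all add: representable_sel)

lemma yoneda_map_ide: "p \<in> Obj (psh X) \<Longrightarrow> x \<in> Obj X \<Longrightarrow> t \<in> FOb p x \<Longrightarrow> ap (yoneda_map p x t) x (Ide X x) = t"
  using ide_in pact_ide by (simp add: ap_yoneda_map)

text \<open>Naturality at \<open>k\<close>, applied to the identity of \<open>x\<close>, determines
  the value at \<open>k\<close>.\<close>

lemma yoneda_eq:
  assumes \<alpha>: "\<alpha> \<in> hom (psh X) (representable X x) p" and x: "x \<in> Obj X"
  shows "\<alpha> = yoneda_map p x (ap \<alpha> x (Ide X x))"
proof -
  have p: "p \<in> Obj (psh X)" using \<alpha> by (simp add: psh_hom)
  note i = ide_in[OF x]
  have t: "ap \<alpha> x (Ide X x) \<in> FOb p x" using ap_in[OF \<alpha> x] i x by (simp add: representable_sel)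
  show ?thesis
  proof (rule psh_hom_eqI[OF \<alpha> yoneda_map_hom[OF p x t]])
    fix z k assume z: "z \<in> Obj X" and "k \<in> FOb (representable X x) z"
    then have k: "k \<in> hom X z x" by (simp add: representable_sel)
    show "ap \<alpha> z k = ap (yoneda_map p x (ap \<alpha> x (Ide X x))) z k"
      using ap_nat[OF \<alpha> k, of "Ide X x"] i x ide_cmp[OF k]
      by (simp add: ap_yoneda_map[OF z k] representable_sel representable_sel(2)[OF k i])
  qed
qed

lemma cmp_yoneda_map:
  assumes \<alpha>: "\<alpha> \<in> hom (psh X) p q" and x: "x \<in> Obj X" and t: "t \<in> FOb p x"
  shows "Cmp (psh X) \<alpha> (yoneda_map p x t) = yoneda_map q x (ap \<alpha> x t)"
proof -
  have p: "p \<in> Obj (psh X)" using \<alpha> by (simp add: psh_hom)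
  note h = yoneda_map_hom[OF p x t]
  show ?thesis
    using yoneda_eq[OF category.cmp_in[OF category_psh h \<alpha>] x] ap_cmp[OF h \<alpha> x, of "Ide X x"]
      ide_in[OF x] x yoneda_map_ide[OF p x t] by (simp add: representable_sel)
qed

lemma yoneda_FOb: "x \<in> Obj X \<Longrightarrow> FOb (yoneda X) x = representable X x"
  by (simp add: yoneda_def)

lemma yoneda_FAr:
  assumes m: "m \<in> hom X x y"
  shows "FAr (yoneda X) m = yoneda_map (representable X y) x m"
proof -
  have *: "m \<in> Arr X" "Dom X m = x" "Cod X m = y" using m by (auto simp: hom_def)
  have "(\<lambda>k\<in>hom X z x. pact (representable X y) k m) = (\<lambda>k\<in>hom X z x. Cmp X m k)" for z
    using representable_sel(2)[OF _ m] by (auto intro!: restrict_ext)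
  then show ?thesis
    using * by (auto simp: yoneda_def yoneda_map_def mkN_def representable_sel intro!: restrict_ext)
qed

lemma yoneda_Fun: "yoneda X \<in> Fun X (psh X)"
proof (rule FunI)
  show "category X" "category (psh X)" using category_axioms category_psh by auto
  note i = ide_in
  have R: "m \<in> FOb (representable X y) x" if "m \<in> hom X x y" for m x y
    using that hom_Obj[OF that] by (simp add: representable_sel)
  show yh: "FAr (yoneda X) f \<in> hom (psh X) (FOb (yoneda X) x) (FOb (yoneda X) y)" if f: "f \<in> hom X x y" for f x y
    using yoneda_map_hom[OF representable_Obj _ R[OF f]] hom_Obj[OF f]
    by (simp add: yoneda_FAr[OF f] yoneda_FOb)
  show "FAr (yoneda X) (Ide X x) = Ide (psh X) (FOb (yoneda X) x)" if x: "x \<in> Obj X" for x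
    using yoneda_eq[OF category.ide_in[OF category_psh representable_Obj[OF x]] x] i[OF x]
    by (simp add: yoneda_FAr[OF i[OF x]] yoneda_FOb[OF x] ap_ide[OF representable_Obj[OF x] x] representable_sel x)
  show "FAr (yoneda X) (Cmp X g f) = Cmp (psh X) (FAr (yoneda X) g) (FAr (yoneda X) f)"
    if f: "f \<in> hom X x y" and g: "g \<in> hom X y z" for f g x y z
  proof -
    have o: "x \<in> Obj X" "y \<in> Obj X" "z \<in> Obj X" using hom_Obj[OF f] hom_Obj[OF g] by auto
    note gh = yh[OF g, unfolded yoneda_FOb[OF o(2)] yoneda_FOb[OF o(3)]]
    show ?thesis
      using cmp_yoneda_map[OF gh o(1) R[OF f]] ap_yoneda_map[OF o(1) f, of "representable X z" g] representable_sel(2)[OF f g]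
      by (simp add: yoneda_FAr[OF f] yoneda_FAr[OF g] yoneda_FAr[OF cmp_in[OF f g]])
  qed
qed (auto simp: yoneda_def representable_Obj)

subsection \<open>Pointwise limits\<close>

text \<open>Elements at \<open>x\<close> are maps out of the representable at \<open>x\<close>, so
  testing terminality on representables yields the pointwise condition.\<close>

lemma psh_is_term_iff:
  "is_term (psh X) t \<longleftrightarrow> t \<in> Obj (psh X) \<and> (\<forall>x\<in>Obj X. \<exists>!e. e \<in> FOb t x)"
proof (intro iffI conjI ballI)
  assume t: "is_term (psh X) t"
  then show tO: "t \<in> Obj (psh X)" by (simp add: is_term_def)
  fix x assume x: "x \<in> Obj X"
  obtain u where u: "u \<in> hom (psh X) (representable X x) t" using t representable_Obj[OF x] unfolding is_term_def by blast
  show "\<exists>!e. e \<in> FOb t x"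
  proof (rule ex_ex1I)
    show "\<exists>e. e \<in> FOb t x"
      using ap_in[OF u x, of "Ide X x"] ide_in[OF x] x by (auto simp: representable_sel)
    show "e = e'" if "e \<in> FOb t x" "e' \<in> FOb t x" for e e'
      using is_termD[OF t yoneda_map_hom[OF tO x that(1)] yoneda_map_hom[OF tO x that(2)] category_psh]
        yoneda_map_ide[OF tO x that(1)] yoneda_map_ide[OF tO x that(2)] by metis
  qed
next
  assume t: "t \<in> Obj (psh X) \<and> (\<forall>x\<in>Obj X. \<exists>!e. e \<in> FOb t x)"
  show "is_term (psh X) t"
    unfolding is_term_def
  proof (intro conjI ballI ex_ex1I)
    show tO: "t \<in> Obj (psh X)" using t by simp
    fix p assume p: "p \<in> Obj (psh X)"
    define \<phi> where "\<phi> x s = (THE e. e \<in> FOb t x)" for x and s :: 'u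
    have \<phi>: "\<phi> x s \<in> FOb t x" if "x \<in> Obj X" for x s
      unfolding \<phi>_def by (rule theI') (use t that in blast)
    have eq: "e = e'" if "x \<in> Obj X" "e \<in> FOb t x" "e' \<in> FOb t x" for x e e' using t that by blast
    have "mkN X p t \<phi> \<in> hom (psh X) p t"
    proof (rule mkN_hom[OF p tO])
      fix h x y s assume h: "h \<in> hom X x y"
      show "\<phi> x (pact p h s) = pact t h (\<phi> y s)"
        using eq[OF _ \<phi> pact_in[OF tO h \<phi>]] hom_Obj[OF h] by blast
    qed (use \<phi> in auto)
    then show "\<exists>u. u \<in> hom (psh X) p t" by blast
    show "u = v" if "u \<in> hom (psh X) p t" "v \<in> hom (psh X) p t" for u v
      by (rule psh_hom_eqI[OF that]) (use eq ap_in[OF that(1)] ap_in[OF that(2)] in blast)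
  qed
qed

lemma psh_is_pbI:
  assumes h: "f \<in> hom (psh X) p r" "g \<in> hom (psh X) q r" "p1 \<in> hom (psh X) s p" "p2 \<in> hom (psh X) s q"
    and c: "\<And>x e. x \<in> Obj X \<Longrightarrow> e \<in> FOb s x \<Longrightarrow> ap f x (ap p1 x e) = ap g x (ap p2 x e)"
    and ex: "\<And>x a b. x \<in> Obj X \<Longrightarrow> a \<in> FOb p x \<Longrightarrow> b \<in> FOb q x \<Longrightarrow> ap f x a = ap g x b \<Longrightarrow>
      \<exists>e. e \<in> FOb s x \<and> ap p1 x e = a \<and> ap p2 x e = b"
    and un: "\<And>x e e'. x \<in> Obj X \<Longrightarrow> e \<in> FOb s x \<Longrightarrow> e' \<in> FOb s x \<Longrightarrow> ap p1 x e = ap p1 x e' \<Longrightarrow>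
      ap p2 x e = ap p2 x e' \<Longrightarrow> e = e'"
  shows "is_pb (psh X) f g p1 p2"
proof (rule is_pbI[OF h])
  show "Cmp (psh X) f p1 = Cmp (psh X) g p2"
    by (rule psh_hom_eqI[OF category.cmp_in[OF category_psh h(3,1)] category.cmp_in[OF category_psh h(4,2)]])
      (simp add: ap_cmp[OF h(3,1)] ap_cmp[OF h(4,2)] c)
next
  fix w k l assume k: "k \<in> hom (psh X) w p" and l: "l \<in> hom (psh X) w q" and kl: "Cmp (psh X) f k = Cmp (psh X) g l"
  have wO: "w \<in> Obj (psh X)" and sO: "s \<in> Obj (psh X)" using k h by (auto simp: psh_hom)
  \<comment> \<open>The mediating elements are picked pointwise; their uniqueness \<open>un\<close>
    makes the choice natural.\<close>
  define \<phi> where "\<phi> x t = (SOME e. e \<in> FOb s x \<and> ap p1 x e = ap k x t \<and> ap p2 x e = ap l x t)" for x t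
  have \<phi>: "\<phi> x t \<in> FOb s x" "ap p1 x (\<phi> x t) = ap k x t" "ap p2 x (\<phi> x t) = ap l x t"
    if "x \<in> Obj X" "t \<in> FOb w x" for x t
  proof -
    have "ap f x (ap k x t) = ap g x (ap l x t)"
      using kl ap_cmp[OF k h(1) that] ap_cmp[OF l h(2) that] by simp
    from someI_ex[OF ex[OF that(1) ap_in[OF k that] ap_in[OF l that] this]]
    show "\<phi> x t \<in> FOb s x" "ap p1 x (\<phi> x t) = ap k x t" "ap p2 x (\<phi> x t) = ap l x t"
      unfolding \<phi>_def by blast+
  qed
  have u: "mkN X w s \<phi> \<in> hom (psh X) w s"
  proof (rule mkN_hom[OF wO sO \<phi>(1)])
    fix m x y t assume m: "m \<in> hom X x y" and t: "t \<in> FOb w y"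
    have xy: "x \<in> Obj X" "y \<in> Obj X" using hom_Obj[OF m] by auto
    note mt = pact_in[OF wO m t] and \<phi>t = \<phi>[OF xy(2) t]
    show "\<phi> x (pact w m t) = pact s m (\<phi> y t)"
      by (rule un[OF xy(1) \<phi>(1)[OF xy(1) mt] pact_in[OF sO m \<phi>t(1)]])
        (simp_all add: \<phi>[OF xy(1) mt] ap_nat[OF h(3) m \<phi>t(1)] ap_nat[OF h(4) m \<phi>t(1)] \<phi>t
          ap_nat[OF k m t] ap_nat[OF l m t])
  qed
  have "Cmp (psh X) p1 (mkN X w s \<phi>) = k"
    by (rule psh_hom_eqI[OF category.cmp_in[OF category_psh u h(3)] k]) (simp add: ap_cmp[OF u h(3)] ap_mkN \<phi>)
  moreover have "Cmp (psh X) p2 (mkN X w s \<phi>) = l"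
    by (rule psh_hom_eqI[OF category.cmp_in[OF category_psh u h(4)] l]) (simp add: ap_cmp[OF u h(4)] ap_mkN \<phi>)
  ultimately show "\<exists>u. u \<in> hom (psh X) w s \<and> Cmp (psh X) p1 u = k \<and> Cmp (psh X) p2 u = l" using u by blast
next
  fix w u v assume u: "u \<in> hom (psh X) w s" and v: "v \<in> hom (psh X) w s"
    and uv: "Cmp (psh X) p1 u = Cmp (psh X) p1 v" "Cmp (psh X) p2 u = Cmp (psh X) p2 v"
  show "u = v"
  proof (rule psh_hom_eqI[OF u v])
    fix x t assume xt: "x \<in> Obj X" "t \<in> FOb w x"
    show "ap u x t = ap v x t"
      using un[OF xt(1) ap_in[OF u xt] ap_in[OF v xt]] uv
        ap_cmp[OF u h(3) xt] ap_cmp[OF v h(3) xt] ap_cmp[OF u h(4) xt] ap_cmp[OF v h(4) xt]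
      by simp
  qed
qed

text \<open>The universal property is applied to Yoneda maps, and elements are recovered by
  evaluating at the identity of \<open>x\<close>.\<close>

lemma psh_is_pbD:
  assumes pb: "is_pb (psh X) f g p1 p2" and h: "f \<in> hom (psh X) p r" "g \<in> hom (psh X) q r" "p1 \<in> hom (psh X) s p" "p2 \<in> hom (psh X) s q"
    and x: "x \<in> Obj X"
  shows "e \<in> FOb s x \<Longrightarrow> ap f x (ap p1 x e) = ap g x (ap p2 x e)"
    and "a \<in> FOb p x \<Longrightarrow> b \<in> FOb q x \<Longrightarrow> ap f x a = ap g x b \<Longrightarrow> \<exists>e. e \<in> FOb s x \<and> ap p1 x e = a \<and> ap p2 x e = b"
    and "e \<in> FOb s x \<Longrightarrow> e' \<in> FOb s x \<Longrightarrow> ap p1 x e = ap p1 x e' \<Longrightarrow> ap p2 x e = ap p2 x e' \<Longrightarrow> e = e'"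
proof -
  have O: "p \<in> Obj (psh X)" "q \<in> Obj (psh X)" "s \<in> Obj (psh X)" "r \<in> Obj (psh X)"
    using h by (auto simp: psh_hom)
  note i = ide_in[OF x]
  have iR: "Ide X x \<in> FOb (representable X x) x" using i x by (simp add: representable_sel)
  show "ap f x (ap p1 x e) = ap g x (ap p2 x e)" if "e \<in> FOb s x" for e
  proof -
    have "Cmp (psh X) f p1 = Cmp (psh X) g p2" using pb by (simp add: is_pb_def)
    then show ?thesis using ap_cmp[OF h(3,1) x that] ap_cmp[OF h(4,2) x that] by simp
  qed
  show "\<exists>e. e \<in> FOb s x \<and> ap p1 x e = a \<and> ap p2 x e = b" if ab: "a \<in> FOb p x" "b \<in> FOb q x" "ap f x a = ap g x b" for a b
  proof -
    have "Cmp (psh X) f (yoneda_map p x a) = Cmp (psh X) g (yoneda_map q x b)"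
      using cmp_yoneda_map[OF h(1) x ab(1)] cmp_yoneda_map[OF h(2) x ab(2)] ab(3) by simp
    from is_pb_ex1[OF pb h(3,4) yoneda_map_hom[OF O(1) x ab(1)] yoneda_map_hom[OF O(2) x ab(2)] this]
    obtain u where u: "u \<in> hom (psh X) (representable X x) s" "Cmp (psh X) p1 u = yoneda_map p x a" "Cmp (psh X) p2 u = yoneda_map q x b" by blast
    show ?thesis
      using ap_in[OF u(1) x iR] ap_cmp[OF u(1) h(3) x iR] ap_cmp[OF u(1) h(4) x iR] u(2,3)
        yoneda_map_ide[OF O(1) x ab(1)] yoneda_map_ide[OF O(2) x ab(2)] by metis
  qed
  show "e = e'" if e: "e \<in> FOb s x" "e' \<in> FOb s x" "ap p1 x e = ap p1 x e'" "ap p2 x e = ap p2 x e'" for e e'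
  proof -
    have "yoneda_map s x e = yoneda_map s x e'"
      by (rule is_pb_unique[OF pb category_psh h(3) yoneda_map_hom[OF O(3) x e(1)] yoneda_map_hom[OF O(3) x e(2)]])
        (simp_all add: cmp_yoneda_map[OF h(3) x e(1)] cmp_yoneda_map[OF h(3) x e(2)] cmp_yoneda_map[OF h(4) x e(1)] cmp_yoneda_map[OF h(4) x e(2)] e(3,4))
    then show ?thesis using yoneda_map_ide[OF O(3) x e(1)] yoneda_map_ide[OF O(3) x e(2)] by metis
  qed
qed

lemma psh_terminal_exists: "\<exists>t. is_term (psh X) t"
proof
  let ?t = "mkP X (\<lambda>_. {undefined}) (\<lambda>_ _. undefined)"
  have "?t \<in> Obj (psh X)" by (rule mkP_Obj) (auto intro: small_finite)
  then show "is_term (psh X) ?t" by (simp add: psh_is_term_iff mkP_sel)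
qed

lemma psh_pullback_exists:
  assumes f: "f \<in> hom (psh X) p r" and g: "g \<in> hom (psh X) q r"
  shows "\<exists>p1 p2. is_pb (psh X) f g p1 p2"
proof -
  have O: "p \<in> Obj (psh X)" "q \<in> Obj (psh X)" "r \<in> Obj (psh X)" using f g by (auto simp: psh_hom)
  \<comment> \<open>Pairs have to be coded inside the universe type. The code at hand is for
    triples, so the second entry is repeated.\<close>
  define code :: "'u \<Rightarrow> 'u \<Rightarrow> 'u" where "code a b = pack (a, b, b)" for a b
  define d1 :: "'u \<Rightarrow> 'u" where "d1 e = fst (unpack e)" for e
  define d2 :: "'u \<Rightarrow> 'u" where "d2 e = fst (snd (unpack e))" for e
  have [simp]: "d1 (code a b) = a" "d2 (code a b) = b" for a b by (simp_all add: code_def d1_def d2_def)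
  \<comment> \<open>The fibre product is written as an iterated union of singletons, the form to
    which \<open>small_UN\<close> applies.\<close>
  define P where "P x = (\<Union>a\<in>FOb p x. \<Union>b\<in>{b \<in> FOb q x. ap f x a = ap g x b}. {code a b})" for x
  have Pin: "e \<in> P x \<longleftrightarrow> (\<exists>a\<in>FOb p x. \<exists>b\<in>FOb q x. ap f x a = ap g x b \<and> e = code a b)" for e x
    by (auto simp: P_def)
  define act where "act h e = code (pact p h (d1 e)) (pact q h (d2 e))" for h e
  let ?s = "mkP X P act"
  have s: "?s \<in> Obj (psh X)"
  proof (rule mkP_Obj)
    show "small TYPE('u) (P x)" if x: "x \<in> Obj X" for x
      unfolding P_def
    proof (rule small_UN[OF psh_small[OF O(1) x]])
      fix a
      have "small TYPE('u) {b \<in> FOb q x. ap f x a = ap g x b}"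
        by (rule small_subset[OF psh_small[OF O(2) x]]) auto
      then show "small TYPE('u) (\<Union>b\<in>{b \<in> FOb q x. ap f x a = ap g x b}. {code a b})"
        by (rule small_UN) (simp add: small_finite)
    qed
    show "act h e \<in> P x" if h: "h \<in> hom X x y" and e: "e \<in> P y" for h x y e
    proof -
      obtain a b where ab: "a \<in> FOb p y" "b \<in> FOb q y" "ap f y a = ap g y b" "e = code a b" using e by (auto simp: Pin)
      moreover have "ap f x (pact p h a) = ap g x (pact q h b)"
        using ap_nat[OF f h ab(1)] ap_nat[OF g h ab(2)] ab(3) by simp
      ultimately show ?thesis
        using pact_in[OF O(1) h ab(1)] pact_in[OF O(2) h ab(2)] unfolding Pin act_def
        by (intro bexI[of _ "pact p h a"] bexI[of _ "pact q h b"]) simp_all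
    qed
    show "act (Ide X x) e = e" if "x \<in> Obj X" "e \<in> P x" for x e
      using that pact_ide[OF O(1)] pact_ide[OF O(2)] by (auto simp: Pin act_def)
    show "act (Cmp X k h) e = act h (act k e)" if "h \<in> hom X x y" "k \<in> hom X y z" "e \<in> P z" for h k x y z e
      using that pact_cmp[OF O(1) that(1,2)] pact_cmp[OF O(2) that(1,2)] by (auto simp: Pin act_def)
  qed
  have sel: "FOb ?s x = P x" if "x \<in> Obj X" for x using mkP_sel(1)[OF that] .
  have sact: "pact ?s h e = act h e" if "h \<in> hom X x y" "e \<in> P y" for h x y e using mkP_sel(2)[where P = P and act = act, OF that] .
  let ?p1 = "mkN X ?s p (\<lambda>x. d1)" and ?p2 = "mkN X ?s q (\<lambda>x. d2)"
  have p1: "?p1 \<in> hom (psh X) ?s p"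
  proof (rule mkN_hom[OF s O(1)])
    show "d1 t \<in> FOb p x" if "x \<in> Obj X" "t \<in> FOb ?s x" for x t using that by (auto simp: sel Pin)
    show "d1 (pact ?s h t) = pact p h (d1 t)" if h: "h \<in> hom X x y" and t: "t \<in> FOb ?s y" for h x y t
      using t hom_Obj[OF h] sact[OF h] by (simp add: sel act_def)
  qed
  have p2: "?p2 \<in> hom (psh X) ?s q"
  proof (rule mkN_hom[OF s O(2)])
    show "d2 t \<in> FOb q x" if "x \<in> Obj X" "t \<in> FOb ?s x" for x t using that by (auto simp: sel Pin)
    show "d2 (pact ?s h t) = pact q h (d2 t)" if h: "h \<in> hom X x y" and t: "t \<in> FOb ?s y" for h x y t
      using t hom_Obj[OF h] sact[OF h] by (simp add: sel act_def)
  qed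
  have a1: "ap ?p1 x e = d1 e" "ap ?p2 x e = d2 e" if "x \<in> Obj X" "e \<in> FOb ?s x" for x e
    using ap_mkN[OF that] by auto
  have "is_pb (psh X) f g ?p1 ?p2"
  proof (rule psh_is_pbI[OF f g p1 p2])
    show "ap f x (ap ?p1 x e) = ap g x (ap ?p2 x e)" if "x \<in> Obj X" "e \<in> FOb ?s x" for x e
      using a1[OF that] that by (auto simp: sel Pin)
    show "\<exists>e. e \<in> FOb ?s x \<and> ap ?p1 x e = a \<and> ap ?p2 x e = b"
      if "x \<in> Obj X" "a \<in> FOb p x" "b \<in> FOb q x" "ap f x a = ap g x b" for x a b
      using that a1[OF that(1), of "code a b"] by (intro exI[of _ "code a b"]) (auto simp: sel Pin)
    show "e = e'" if "x \<in> Obj X" "e \<in> FOb ?s x" "e' \<in> FOb ?s x" "ap ?p1 x e = ap ?p1 x e'" "ap ?p2 x e = ap ?p2 x e'" for x e e'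
      using that(4,5) that(2,3) unfolding a1[OF that(1,2)] a1[OF that(1,3)] sel[OF that(1)] by (auto simp: Pin)
  qed
  then show ?thesis by blast
qed

text \<open>A map of presheaves is determined by its graph, which is a subset of one small set of
  coded triples, and power sets of small sets are small.\<close>

lemma locally_small_psh: "locally_small TYPE('u) (psh X)"
  unfolding locally_small_def
proof (intro ballI)
  fix p q assume p: "p \<in> Obj (psh X)" and q: "q \<in> Obj (psh X)"
  define T where "T = (\<Union>x\<in>Obj X. \<Union>a\<in>FOb p x. \<Union>b\<in>FOb q x. {pack (x, a, b)})"
  have oX: "small TYPE('u) (Obj X)" using small_X by (simp add: small_category_def)
  have "small TYPE('u) T"
    unfolding T_def
    by (rule small_UN[OF oX], rule small_UN[OF psh_small[OF p]], assumption,
        rule small_UN[OF psh_small[OF q]], assumption, simp add: small_finite)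
  then have sT: "small TYPE('u) (Pow T)" by (rule small_Pow)
  define gr where "gr \<alpha> = {pack (x, a, ap \<alpha> x a) | x a. x \<in> Obj X \<and> a \<in> FOb p x}" for \<alpha> :: "'u pshmap"
  have "inj_on gr (hom (psh X) p q)"
  proof (rule inj_onI)
    fix \<alpha> \<beta> assume h: "\<alpha> \<in> hom (psh X) p q" "\<beta> \<in> hom (psh X) p q" and e: "gr \<alpha> = gr \<beta>"
    show "\<alpha> = \<beta>"
    proof (rule psh_hom_eqI[OF h])
      fix x a assume "x \<in> Obj X" "a \<in> FOb p x"
      then have "pack (x, a, ap \<alpha> x a) \<in> gr \<beta>" unfolding e[symmetric] by (auto simp: gr_def)
      then show "ap \<alpha> x a = ap \<beta> x a" by (auto simp: gr_def)
    qed
  qed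
  moreover have "gr ` hom (psh X) p q \<subseteq> Pow T" using ap_in by (fastforce simp: gr_def T_def)
  ultimately have "hom (psh X) p q \<lesssim> Pow T" unfolding lepoll_def by blast
  with sT show "small TYPE('u) (hom (psh X) p q)" by (rule small_lepoll)
qed

end

section \<open>Coends and the extension functor\<close>

abbreviation cl :: "'u profunctor \<Rightarrow> 'u presheaf \<Rightarrow> 'u \<Rightarrow> 'u \<Rightarrow> 'u \<Rightarrow> 'u \<Rightarrow> 'u" where
  "cl F p y x s t \<equiv> coend_class F p y (x, s, t)"

lemma coend_equiv_props:
  "(w, w) \<in> coend_equiv F p y" "(w, w') \<in> coend_equiv F p y \<Longrightarrow> (w', w) \<in> coend_equiv F p y"
  "(w, w') \<in> coend_equiv F p y \<Longrightarrow> (w', w'') \<in> coend_equiv F p y \<Longrightarrow> (w, w'') \<in> coend_equiv F p y"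
proof -
  show "(w, w) \<in> coend_equiv F p y" by (simp add: coend_equiv_def)
  have "sym (coend_equiv F p y)" unfolding coend_equiv_def by (intro sym_rtrancl) (auto simp: sym_def)
  then show "(w, w') \<in> coend_equiv F p y \<Longrightarrow> (w', w) \<in> coend_equiv F p y" by (rule symD)
  show "(w, w') \<in> coend_equiv F p y \<Longrightarrow> (w', w'') \<in> coend_equiv F p y \<Longrightarrow> (w, w'') \<in> coend_equiv F p y"
    unfolding coend_equiv_def by (rule rtrancl_trans)
qed

lemma coend_rep: "(w, rep (coend_equiv F p y `` {w})) \<in> coend_equiv F p y"
proof -
  have "rep (coend_equiv F p y `` {w}) \<in> coend_equiv F p y `` {w}"
    unfolding rep_def by (rule someI[of _ w]) (simp add: coend_equiv_props)
  then show ?thesis by simp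
qed

text \<open>The chosen member depends only on the class and its code is injective, so codes separate
  exactly the classes.\<close>

lemma coend_class_eq_iff:
  fixes F :: "'u::universe profunctor"
  shows "coend_class F p y w = coend_class F p y w' \<longleftrightarrow> (w, w') \<in> coend_equiv F p y"
proof
  assume "coend_class F p y w = coend_class F p y w'"
  then have eq: "rep (coend_equiv F p y `` {w}) = rep (coend_equiv F p y `` {w'})"
    by (simp add: coend_class_def)
  show "(w, w') \<in> coend_equiv F p y"
    using coend_rep[of w F p y] unfolding eq
    by (rule coend_equiv_props(3)[OF _ coend_equiv_props(2)[OF coend_rep]])
next
  assume w: "(w, w') \<in> coend_equiv F p y"
  have "(w, v) \<in> coend_equiv F p y \<longleftrightarrow> (w', v) \<in> coend_equiv F p y" for v
    using coend_equiv_props(3)[OF w, of v] coend_equiv_props(3)[OF coend_equiv_props(2)[OF w], of v] by (rule iffI[rotated])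
  then have "coend_equiv F p y `` {w} = coend_equiv F p y `` {w'}" by auto
  then show "coend_class F p y w = coend_class F p y w'" by (simp add: coend_class_def)
qed

lemma unpack_coend_class: "(w, unpack (coend_class F p y w :: 'u::universe)) \<in> coend_equiv F p y"
  using coend_rep by (simp add: coend_class_def)

lemma coend_equiv_invariant:
  assumes "(w, w') \<in> coend_equiv F p y" and "\<And>v v'. (v, v') \<in> coend_step F p y \<Longrightarrow> \<phi> v = \<phi> v'"
  shows "\<phi> w = \<phi> w'"
  using assms(1) unfolding coend_equiv_def by (induction rule: rtrancl_induct) (use assms(2) in auto)

text \<open>The universal property of the quotient: a function that is constant along the generating
  steps may be evaluated at the stored representative. All maps out of the coend are shown to be
  well defined in this way.\<close>

lemma coend_lift:
  fixes F :: "'u::universe profunctor"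
  assumes "\<And>v v'. (v, v') \<in> coend_step F p y \<Longrightarrow> \<phi> v = \<phi> v'"
  shows "\<phi> (unpack (coend_class F p y w)) = \<phi> w"
  by (rule coend_equiv_invariant[OF unpack_coend_class, symmetric]) (rule assms)

lemma ext_ob_mkP: "ext_ob Y F p = mkP Y (coend F p)
    (\<lambda>h e. case unpack e of (x, s, t) \<Rightarrow> cl F p (Dom Y h) x (pact (FOb F x) h s) t)"
  by (simp add: ext_ob_def mkP_def pact_def)

lemma ext_ar_mkN: "ext_ar Y F \<alpha> = mkN Y (ext_ob Y F (NSrc \<alpha>)) (ext_ob Y F (NTgt \<alpha>))
    (\<lambda>y e. case unpack e of (x, s, t) \<Rightarrow> cl F (NTgt \<alpha>) y x s (ap \<alpha> x t))"
proof -
  have "FOb (ext_ob Y F p) y = coend F p y" if "y \<in> Obj Y" for y p using that by (simp add: ext_ob_def)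
  then show ?thesis by (auto simp: ext_ar_def mkN_def ap_def intro!: restrict_ext)
qed

section \<open>The extension of a functor into presheaves\<close>

locale small_profunctor = X: small_cat X + Y: small_cat Y for X Y :: "('u::universe, 'u) cat" +
  fixes F :: "'u profunctor"
  assumes F: "F \<in> Fun X (psh Y)"
begin

lemma F_Obj: "x \<in> Obj X \<Longrightarrow> FOb F x \<in> Obj (psh Y)" by (rule Fun_Ob[OF F])

lemma F_hom: "h \<in> hom X x x' \<Longrightarrow> FAr F h \<in> hom (psh Y) (FOb F x) (FOb F x')" by (rule Fun_hom[OF F])

lemma coend_stepE:
  assumes "(v, v') \<in> coend_step F p y"
  obtains h x x' s t where "h \<in> hom X x x'" "s \<in> FOb (FOb F x) y" "t \<in> FOb p x'"
    "v = (x, s, pact p h t)" "v' = (x', ap (FAr F h) y s, t)"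
proof -
  from assms obtain h s t where h: "h \<in> Arr X" "s \<in> FOb (FOb F (Dom X h)) y" "t \<in> FOb p (Cod X h)"
    "v = (Dom X h, s, pact p h t)" "v' = (Cod X h, ap (FAr F h) y s, t)"
    unfolding coend_step_def Fun_Src[OF F] pact_def ap_def by blast
  show thesis by (rule that[OF Arr_hom[OF h(1)] h(2-5)])
qed

lemma coend_step: "h \<in> hom X x x' \<Longrightarrow> s \<in> FOb (FOb F x) y \<Longrightarrow> t \<in> FOb p x' \<Longrightarrow>
    ((x, s, pact p h t), (x', ap (FAr F h) y s, t)) \<in> coend_step F p y"
  unfolding coend_step_def Fun_Src[OF F] pact_def ap_def hom_def by blast

lemma cl_step: "h \<in> hom X x x' \<Longrightarrow> s \<in> FOb (FOb F x) y \<Longrightarrow> t \<in> FOb p x' \<Longrightarrow>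
    cl F p y x s (pact p h t) = cl F p y x' (ap (FAr F h) y s) t"
  using coend_step by (simp add: coend_class_eq_iff coend_equiv_def r_into_rtrancl)

lemma coend_iff: "e \<in> coend F p y \<longleftrightarrow>
    (\<exists>x s t. x \<in> Obj X \<and> s \<in> FOb (FOb F x) y \<and> t \<in> FOb p x \<and> e = cl F p y x s t)"
  unfolding coend_def triples_def Fun_Src[OF F] by auto

lemma small_coend:
  assumes p: "p \<in> Obj (psh X)" and y: "y \<in> Obj Y" shows "small TYPE('u) (coend F p y)"
proof -
  have oX: "small TYPE('u) (Obj X)" using X.small_X by (simp add: small_category_def)
  have "coend F p y = (\<Union>x\<in>Obj X. \<Union>s\<in>FOb (FOb F x) y. \<Union>t\<in>FOb p x. {cl F p y x s t})"
    by (auto simp: coend_iff) blast+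
  moreover have "small TYPE('u) (\<Union>x\<in>Obj X. \<Union>s\<in>FOb (FOb F x) y. \<Union>t\<in>FOb p x. {cl F p y x s t})"
    by (rule small_UN[OF oX], rule small_UN[OF Y.psh_small[OF F_Obj y]], assumption,
        rule small_UN[OF X.psh_small[OF p]], assumption, simp add: small_finite)
  ultimately show ?thesis by simp
qed

context
  fixes p assumes p: "p \<in> Obj (psh X)"
begin

lemma ext_act_cl:
  assumes h: "h \<in> hom Y y' y"
  shows "(case unpack (cl F p y x s t) of (x, s, t) \<Rightarrow> cl F p y' x (pact (FOb F x) h s) t)
    = cl F p y' x (pact (FOb F x) h s) t"
proof -
  have "(\<lambda>(x, s, t). cl F p y' x (pact (FOb F x) h s) t) (unpack (cl F p y x s t))
      = (\<lambda>(x, s, t). cl F p y' x (pact (FOb F x) h s) t) (x, s, t)"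
  proof (rule coend_lift)
    fix v v' assume "(v, v') \<in> coend_step F p y"
    then obtain k x x' s t where k: "k \<in> hom X x x'" "s \<in> FOb (FOb F x) y" "t \<in> FOb p x'"
      "v = (x, s, pact p k t)" "v' = (x', ap (FAr F k) y s, t)" by (rule coend_stepE)
    have x: "x \<in> Obj X" using X.hom_Obj[OF k(1)] by simp
    show "(case v of (x, s, t) \<Rightarrow> cl F p y' x (pact (FOb F x) h s) t) = (case v' of (x, s, t) \<Rightarrow> cl F p y' x (pact (FOb F x) h s) t)"
      using cl_step[OF k(1) Y.pact_in[OF F_Obj[OF x] h k(2)] k(3)] Y.ap_nat[OF F_hom[OF k(1)] h k(2)]
      by (simp add: k)
  qed
  then show ?thesis by simp
qed

lemma ext_Obj: "ext_ob Y F p \<in> Obj (psh Y)"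
  unfolding ext_ob_mkP
proof (rule Y.mkP_Obj[OF small_coend[OF p]])
  let ?act = "\<lambda>h e. case unpack e of (x, s, t) \<Rightarrow> cl F p (Dom Y h) x (pact (FOb F x) h s) t"
  have act: "?act h (cl F p y x s t) = cl F p y' x (pact (FOb F x) h s) t" if "h \<in> hom Y y' y" for h y y' x s t
    using ext_act_cl[OF that] that by (simp add: hom_def)
  show "?act h e \<in> coend F p y'" if h: "h \<in> hom Y y' y" and e: "e \<in> coend F p y" for h y y' e
  proof -
    obtain x s t where e': "x \<in> Obj X" "s \<in> FOb (FOb F x) y" "t \<in> FOb p x" "e = cl F p y x s t"
      using e by (auto simp: coend_iff)
    show ?thesis unfolding e'(4) act[OF h] coend_iff using e' Y.pact_in[OF F_Obj h] by blast
  qed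
  show "?act (Ide Y y) e = e" if y: "y \<in> Obj Y" and e: "e \<in> coend F p y" for y e
    using e act[OF Y.ide_in[OF y]] Y.pact_ide[OF F_Obj y] by (auto simp: coend_iff)
  show "?act (Cmp Y g h) e = ?act h (?act g e)" if h: "h \<in> hom Y y1 y2" and g: "g \<in> hom Y y2 y3" and e: "e \<in> coend F p y3"
    for h g y1 y2 y3 e
    using e act[OF g] act[OF h] act[OF Y.cmp_in[OF h g]] Y.pact_cmp[OF F_Obj h g]
    by (auto simp: coend_iff)
qed

lemma ext_sel: "y \<in> Obj Y \<Longrightarrow> FOb (ext_ob Y F p) y = coend F p y"
  by (simp add: ext_ob_def)

lemma cl_in: "y \<in> Obj Y \<Longrightarrow> x \<in> Obj X \<Longrightarrow> s \<in> FOb (FOb F x) y \<Longrightarrow> t \<in> FOb p x \<Longrightarrow>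
    cl F p y x s t \<in> FOb (ext_ob Y F p) y"
  by (auto simp: ext_sel coend_iff)

lemma ext_elE:
  assumes "e \<in> FOb (ext_ob Y F p) y" "y \<in> Obj Y"
  obtains x s t where "x \<in> Obj X" "s \<in> FOb (FOb F x) y" "t \<in> FOb p x" "e = cl F p y x s t"
  using assms by (auto simp: ext_sel coend_iff)

lemma pact_cl:
  assumes h: "h \<in> hom Y y' y" and "x \<in> Obj X" "s \<in> FOb (FOb F x) y" "t \<in> FOb p x"
  shows "pact (ext_ob Y F p) h (cl F p y x s t) = cl F p y' x (pact (FOb F x) h s) t"
proof -
  have "cl F p y x s t \<in> coend F p y" using assms by (auto simp: coend_iff)
  from Y.mkP_sel(2)[where P = "coend F p", OF h this] show ?thesis
    unfolding ext_ob_mkP using ext_act_cl[OF h] h by (simp add: hom_def)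
qed

text \<open>\<open>ext_ob Y F p\<close> is the colimit of \<open>F\<close> weighted by
  \<open>p\<close>: the family \<tau> is a cocone indexed by the category of elements of
  \<open>p\<close>, and \<open>u\<close> is the induced map.\<close>

lemma coend_universal:
  assumes \<tau>: "\<And>x t. x \<in> Obj X \<Longrightarrow> t \<in> FOb p x \<Longrightarrow> \<tau> x t \<in> hom (psh Y) (FOb F x) q"
    and nat: "\<And>h x x' t. h \<in> hom X x x' \<Longrightarrow> t \<in> FOb p x' \<Longrightarrow> Cmp (psh Y) (\<tau> x' t) (FAr F h) = \<tau> x (pact p h t)"
    and q: "q \<in> Obj (psh Y)"
  defines "u \<equiv> mkN Y (ext_ob Y F p) q (\<lambda>y e. case unpack e of (x, s, t) \<Rightarrow> ap (\<tau> x t) y s)"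
  shows "u \<in> hom (psh Y) (ext_ob Y F p) q"
    and "y \<in> Obj Y \<Longrightarrow> x \<in> Obj X \<Longrightarrow> s \<in> FOb (FOb F x) y \<Longrightarrow> t \<in> FOb p x \<Longrightarrow> ap u y (cl F p y x s t) = ap (\<tau> x t) y s"
proof -
  let ?\<phi> = "\<lambda>y e. case unpack e of (x, s, t) \<Rightarrow> ap (\<tau> x t) y s"
  have \<phi>: "?\<phi> y (cl F p y x s t) = ap (\<tau> x t) y s" if y: "y \<in> Obj Y" for y x s t
  proof -
    have "(\<lambda>(x, s, t). ap (\<tau> x t) y s) (unpack (cl F p y x s t)) = (\<lambda>(x, s, t). ap (\<tau> x t) y s) (x, s, t)"
    proof (rule coend_lift)
      fix v v' assume "(v, v') \<in> coend_step F p y"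
      then obtain k x x' s t where k: "k \<in> hom X x x'" "s \<in> FOb (FOb F x) y" "t \<in> FOb p x'"
        "v = (x, s, pact p k t)" "v' = (x', ap (FAr F k) y s, t)" by (rule coend_stepE)
      have x': "x' \<in> Obj X" using X.hom_Obj[OF k(1)] by simp
      show "(case v of (x, s, t) \<Rightarrow> ap (\<tau> x t) y s) = (case v' of (x, s, t) \<Rightarrow> ap (\<tau> x t) y s)"
        using Y.ap_cmp[OF F_hom[OF k(1)] \<tau>[OF x' k(3)] y k(2)] k nat[OF k(1,3)] by simp
    qed
    then show ?thesis by simp
  qed
  show u: "u \<in> hom (psh Y) (ext_ob Y F p) q"
    unfolding u_def
  proof (rule Y.mkN_hom[OF ext_Obj q])
    show "?\<phi> y e \<in> FOb q y" if y: "y \<in> Obj Y" and e: "e \<in> FOb (ext_ob Y F p) y" for y e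
      using e y by (rule ext_elE) (use \<phi>[OF y] Y.ap_in[OF \<tau> y] in simp)
    fix h y' y e assume h: "h \<in> hom Y y' y" and e: "e \<in> FOb (ext_ob Y F p) y"
    have y: "y \<in> Obj Y" "y' \<in> Obj Y" using Y.hom_Obj[OF h] by auto
    obtain x s t where e': "x \<in> Obj X" "s \<in> FOb (FOb F x) y" "t \<in> FOb p x" "e = cl F p y x s t" using e y(1) by (rule ext_elE)
    show "?\<phi> y' (pact (ext_ob Y F p) h e) = pact q h (?\<phi> y e)"
      unfolding e'(4) pact_cl[OF h e'(1-3)] \<phi>[OF y(1)] \<phi>[OF y(2)]
      by (rule Y.ap_nat[OF \<tau>[OF e'(1,3)] h e'(2)])
  qed
  show "ap u y (cl F p y x s t) = ap (\<tau> x t) y s"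
    if "y \<in> Obj Y" "x \<in> Obj X" "s \<in> FOb (FOb F x) y" "t \<in> FOb p x" for x y s t
    unfolding u_def Y.ap_mkN[OF that(1) cl_in[OF that]] by (rule \<phi>[OF that(1)])
qed

end

lemma ext_ar_hom:
  assumes \<alpha>: "\<alpha> \<in> hom (psh X) p q"
  shows "ext_ar Y F \<alpha> \<in> hom (psh Y) (ext_ob Y F p) (ext_ob Y F q)"
    and "y \<in> Obj Y \<Longrightarrow> x \<in> Obj X \<Longrightarrow> s \<in> FOb (FOb F x) y \<Longrightarrow> t \<in> FOb p x \<Longrightarrow>
      ap (ext_ar Y F \<alpha>) y (cl F p y x s t) = cl F q y x s (ap \<alpha> x t)"
proof -
  have pq: "p \<in> Obj (psh X)" "q \<in> Obj (psh X)" and n: "NSrc \<alpha> = p" "NTgt \<alpha> = q"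
    using \<alpha> Nat_Fun[of \<alpha> p q] by (auto simp: X.psh_hom)
  let ?\<phi> = "\<lambda>y e. case unpack e of (x, s, t) \<Rightarrow> cl F q y x s (ap \<alpha> x t)"
  have \<phi>: "?\<phi> y (cl F p y x s t) = cl F q y x s (ap \<alpha> x t)" for y x s t
  proof -
    have "(\<lambda>(x, s, t). cl F q y x s (ap \<alpha> x t)) (unpack (cl F p y x s t)) = (\<lambda>(x, s, t). cl F q y x s (ap \<alpha> x t)) (x, s, t)"
    proof (rule coend_lift)
      fix v v' assume "(v, v') \<in> coend_step F p y"
      then obtain k x x' s t where k: "k \<in> hom X x x'" "s \<in> FOb (FOb F x) y" "t \<in> FOb p x'"
        "v = (x, s, pact p k t)" "v' = (x', ap (FAr F k) y s, t)" by (rule coend_stepE)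
      have "x' \<in> Obj X" using X.hom_Obj[OF k(1)] by simp
      then show "(case v of (x, s, t) \<Rightarrow> cl F q y x s (ap \<alpha> x t)) = (case v' of (x, s, t) \<Rightarrow> cl F q y x s (ap \<alpha> x t))"
        using cl_step[OF k(1,2) X.ap_in[OF \<alpha> _ k(3)]] X.ap_nat[OF \<alpha> k(1,3)] k by simp
    qed
    then show ?thesis by simp
  qed
  show "ext_ar Y F \<alpha> \<in> hom (psh Y) (ext_ob Y F p) (ext_ob Y F q)"
    unfolding ext_ar_mkN n
  proof (rule Y.mkN_hom[OF ext_Obj[OF pq(1)] ext_Obj[OF pq(2)]])
    show "?\<phi> y e \<in> FOb (ext_ob Y F q) y" if y: "y \<in> Obj Y" and e: "e \<in> FOb (ext_ob Y F p) y" for y e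
      by (rule ext_elE[OF pq(1) e y]) (use \<phi> X.ap_in[OF \<alpha>] cl_in[OF pq(2) y] in simp)
    fix h y' y e assume h: "h \<in> hom Y y' y" and e: "e \<in> FOb (ext_ob Y F p) y"
    have y: "y \<in> Obj Y" "y' \<in> Obj Y" using Y.hom_Obj[OF h] by auto
    obtain x s t where e': "x \<in> Obj X" "s \<in> FOb (FOb F x) y" "t \<in> FOb p x" "e = cl F p y x s t" by (rule ext_elE[OF pq(1) e y(1)])
    show "?\<phi> y' (pact (ext_ob Y F p) h e) = pact (ext_ob Y F q) h (?\<phi> y e)"
      unfolding e'(4) pact_cl[OF pq(1) h e'(1-3)] \<phi>
      by (rule pact_cl[OF pq(2) h e'(1,2) X.ap_in[OF \<alpha> e'(1,3)], symmetric])
  qed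
  show "ap (ext_ar Y F \<alpha>) y (cl F p y x s t) = cl F q y x s (ap \<alpha> x t)"
    if "y \<in> Obj Y" "x \<in> Obj X" "s \<in> FOb (FOb F x) y" "t \<in> FOb p x" for x y s t
    unfolding ext_ar_mkN n Y.ap_mkN[OF that(1) cl_in[OF pq(1) that]] by (rule \<phi>)
qed

lemma ext_FOb: "p \<in> Obj (psh X) \<Longrightarrow> FOb (ext Y F) p = ext_ob Y F p"
  by (simp add: ext_def Fun_Src[OF F])

lemma ext_FAr: "\<alpha> \<in> hom (psh X) p q \<Longrightarrow> FAr (ext Y F) \<alpha> = ext_ar Y F \<alpha>"
  by (simp add: ext_def Fun_Src[OF F] hom_def)

lemma ext_Fun: "ext Y F \<in> Fun (psh X) (psh Y)"
proof (rule FunI)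
  show "FOb (ext Y F) p \<in> Obj (psh Y)" if "p \<in> Obj (psh X)" for p using ext_Obj[OF that] by (simp add: ext_FOb that)
  show "FAr (ext Y F) f \<in> hom (psh Y) (FOb (ext Y F) p) (FOb (ext Y F) q)" if f: "f \<in> hom (psh X) p q" for f p q
    using ext_ar_hom(1)[OF f] f by (simp add: ext_FAr[OF f] ext_FOb X.psh_hom)
  show "FAr (ext Y F) (Ide (psh X) p) = Ide (psh Y) (FOb (ext Y F) p)" if p: "p \<in> Obj (psh X)" for p
  proof -
    note i = category.ide_in[OF category_psh p]
    have "ext_ar Y F (Ide (psh X) p) = Ide (psh Y) (ext_ob Y F p)"
    proof (rule Y.psh_hom_eqI[OF ext_ar_hom(1)[OF i] category.ide_in[OF category_psh ext_Obj[OF p]]])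
      fix y e assume y: "y \<in> Obj Y" and e: "e \<in> FOb (ext_ob Y F p) y"
      obtain x s t where e': "x \<in> Obj X" "s \<in> FOb (FOb F x) y" "t \<in> FOb p x" "e = cl F p y x s t" by (rule ext_elE[OF p e y])
      show "ap (ext_ar Y F (Ide (psh X) p)) y e = ap (Ide (psh Y) (ext_ob Y F p)) y e"
        unfolding Y.ap_ide[OF ext_Obj[OF p] y e]
        using ext_ar_hom(2)[OF i y e'(1-3)] X.ap_ide[OF p e'(1,3)] by (simp add: e'(4))
    qed
    then show ?thesis by (simp add: ext_FAr[OF i] ext_FOb[OF p])
  qed
  show "FAr (ext Y F) (Cmp (psh X) g f) = Cmp (psh Y) (FAr (ext Y F) g) (FAr (ext Y F) f)"
    if f: "f \<in> hom (psh X) p q" and g: "g \<in> hom (psh X) q r" for f g p q r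
  proof -
    note gf = category.cmp_in[OF category_psh f g]
    have p: "p \<in> Obj (psh X)" using f by (simp add: X.psh_hom)
    note c = category.cmp_in[OF category_psh ext_ar_hom(1)[OF f] ext_ar_hom(1)[OF g]]
    have "ext_ar Y F (Cmp (psh X) g f) = Cmp (psh Y) (ext_ar Y F g) (ext_ar Y F f)"
    proof (rule Y.psh_hom_eqI[OF ext_ar_hom(1)[OF gf] c])
      fix y e assume y: "y \<in> Obj Y" and e: "e \<in> FOb (ext_ob Y F p) y"
      obtain x s t where e': "x \<in> Obj X" "s \<in> FOb (FOb F x) y" "t \<in> FOb p x" "e = cl F p y x s t" by (rule ext_elE[OF p e y])
      show "ap (ext_ar Y F (Cmp (psh X) g f)) y e = ap (Cmp (psh Y) (ext_ar Y F g) (ext_ar Y F f)) y e"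
        unfolding Y.ap_cmp[OF ext_ar_hom(1)[OF f] ext_ar_hom(1)[OF g] y e]
        using ext_ar_hom(2)[OF gf y e'(1-3)] ext_ar_hom(2)[OF f y e'(1-3)]
          ext_ar_hom(2)[OF g y e'(1,2) X.ap_in[OF f e'(1,3)]] X.ap_cmp[OF f g e'(1,3)] by (simp add: e'(4))
    qed
    then show ?thesis by (simp add: ext_FAr[OF f] ext_FAr[OF g] ext_FAr[OF gf])
  qed
qed (auto simp: ext_def Fun_Src[OF F] category_psh)

subsection \<open>The unit of the extension\<close>

text \<open>The coprojection of the weighted colimit at the element \<open>t\<close> of
  \<open>p\<close>.\<close>

definition coproj :: "'u presheaf \<Rightarrow> 'u \<Rightarrow> 'u \<Rightarrow> 'u pshmap" where
  "coproj p x t = mkN Y (FOb F x) (ext_ob Y F p) (\<lambda>y s. cl F p y x s t)"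

lemma coproj_hom: "p \<in> Obj (psh X) \<Longrightarrow> x \<in> Obj X \<Longrightarrow> t \<in> FOb p x \<Longrightarrow> coproj p x t \<in> hom (psh Y) (FOb F x) (ext_ob Y F p)"
  unfolding coproj_def by (rule Y.mkN_hom[OF F_Obj ext_Obj]) (auto intro: cl_in simp: pact_cl)

lemma ap_coproj: "y \<in> Obj Y \<Longrightarrow> s \<in> FOb (FOb F x) y \<Longrightarrow> ap (coproj p x t) y s = cl F p y x s t"
  unfolding coproj_def by (rule Y.ap_mkN)

lemma coproj_step:
  assumes p: "p \<in> Obj (psh X)" and h: "h \<in> hom X x x'" and t: "t \<in> FOb p x'"
  shows "Cmp (psh Y) (coproj p x' t) (FAr F h) = coproj p x (pact p h t)"
proof -
  have x: "x \<in> Obj X" "x' \<in> Obj X" using X.hom_Obj[OF h] by auto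
  note s = coproj_hom[OF p x(2) t] and s' = coproj_hom[OF p x(1) X.pact_in[OF p h t]]
  show ?thesis
    by (rule Y.psh_hom_eqI[OF category.cmp_in[OF category_psh F_hom[OF h] s] s'])
      (simp add: Y.ap_cmp[OF F_hom[OF h] s] ap_coproj Y.ap_in[OF F_hom[OF h]] cl_step[OF h _ t])
qed

lemma coproj_nat:
  assumes \<alpha>: "\<alpha> \<in> hom (psh X) p q" and x: "x \<in> Obj X" and t: "t \<in> FOb p x"
  shows "Cmp (psh Y) (ext_ar Y F \<alpha>) (coproj p x t) = coproj q x (ap \<alpha> x t)"
proof -
  have pq: "p \<in> Obj (psh X)" "q \<in> Obj (psh X)" using \<alpha> by (auto simp: X.psh_hom)
  note s = coproj_hom[OF pq(1) x t] and s' = coproj_hom[OF pq(2) x X.ap_in[OF \<alpha> x t]] and e = ext_ar_hom(1)[OF \<alpha>]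
  show ?thesis
    by (rule Y.psh_hom_eqI[OF category.cmp_in[OF category_psh s e] s'])
      (simp add: Y.ap_cmp[OF s e] ap_coproj ext_ar_hom(2)[OF \<alpha> _ x _ t])
qed

text \<open>The unit is the coprojection at the universal element of the representable, its
  identity.\<close>

lemma eta_coproj: "x \<in> Obj X \<Longrightarrow> NCmp (eta Y F) x = coproj (representable X x) x (Ide X x)"
  unfolding eta_def coproj_def mkN_def
  by (auto simp: Fun_Src[OF F] ext_ob_def intro!: restrict_ext)

lemma ide_rep: "x \<in> Obj X \<Longrightarrow> Ide X x \<in> FOb (representable X x) x"
  using X.ide_in by (simp add: X.representable_sel)

lemma eta_Nat: "eta Y F \<in> Nat F (ext Y F \<circ>\<^sub>F yoneda X)"
proof (rule NatI[OF _ _ F fcomp_Fun[OF X.yoneda_Fun ext_Fun]])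
  note R = X.representable_Obj
  show "NCmp (eta Y F) x \<in> hom (psh Y) (FOb F x) (FOb (ext Y F \<circ>\<^sub>F yoneda X) x)" if x: "x \<in> Obj X" for x
    using coproj_hom[OF R[OF x] x ide_rep[OF x]]
    by (simp add: eta_coproj[OF x] fcomp_FOb[OF X.yoneda_Fun x] X.yoneda_FOb[OF x] ext_FOb[OF R[OF x]])
  fix m x x' assume m: "m \<in> hom X x x'"
  have x: "x \<in> Obj X" "x' \<in> Obj X" using X.hom_Obj[OF m] by auto
  have mr: "m \<in> FOb (representable X x') x" using m x by (simp add: X.representable_sel)
  have mA: "m \<in> Arr X" using m by (simp add: hom_def)
  note ym = X.yoneda_map_hom[OF R[OF x(2)] x(1) mr]
  have "Cmp (psh Y) (coproj (representable X x') x' (Ide X x')) (FAr F m) = coproj (representable X x') x m"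
    using coproj_step[OF R[OF x(2)] m ide_rep[OF x(2)]] X.representable_sel(2)[OF m X.ide_in[OF x(2)]]
      X.ide_cmp[OF m] by simp
  also have "\<dots> = Cmp (psh Y) (ext_ar Y F (X.yoneda_map (representable X x') x m)) (coproj (representable X x) x (Ide X x))"
    using coproj_nat[OF ym x(1) ide_rep[OF x(1)]] X.yoneda_map_ide[OF R[OF x(2)] x(1) mr] by simp
  finally show "Cmp (psh Y) (NCmp (eta Y F) x') (FAr F m) = Cmp (psh Y) (FAr (ext Y F \<circ>\<^sub>F yoneda X) m) (NCmp (eta Y F) x)"
    by (simp add: eta_coproj x fcomp_FAr[OF X.yoneda_Fun mA] X.yoneda_FAr[OF m] ext_FAr[OF ym])
qed (auto simp: eta_def Fun_Src[OF F])

text \<open>The element \<open>t\<close> is the image of the universal element under its Yoneda map.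
  So every element of the coend is carried there, by the image of a Yoneda map, from a value of the
  unit.\<close>

lemma cl_eta:
  assumes p: "p \<in> Obj (psh X)" and y: "y \<in> Obj Y" and x: "x \<in> Obj X" and s: "s \<in> FOb (FOb F x) y" and t: "t \<in> FOb p x"
  shows "cl F p y x s t = ap (ext_ar Y F (X.yoneda_map p x t)) y (ap (NCmp (eta Y F) x) y s)"
  using ext_ar_hom(2)[OF X.yoneda_map_hom[OF p x t] y x s ide_rep[OF x]] X.yoneda_map_ide[OF p x t]
  by (simp add: eta_coproj[OF x] ap_coproj[OF y s])

text \<open>By naturality at Yoneda maps and \<open>cl_eta\<close>, a transformation out of
  \<open>ext Y F\<close> is fixed by its composite with the unit. This gives uniqueness of both
  \<mu> and \<theta>.\<close>

lemma ext_Nat_eqI: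
  assumes m: "m \<in> Nat (ext Y F) H" and n: "n \<in> Nat (ext Y F) H"
    and eq: "(m \<triangleleft> yoneda X) \<cdot>\<^sub>N eta Y F = (n \<triangleleft> yoneda X) \<cdot>\<^sub>N eta Y F"
  shows "m = n"
proof (rule Nat_eqI[OF m n ext_Fun])
  fix p assume p: "p \<in> Obj (psh X)"
  note mh = Nat_hom[OF m ext_Fun] and nh = Nat_hom[OF n ext_Fun]
  note R = X.representable_Obj
  have mh': "NCmp m r \<in> hom (psh Y) (ext_ob Y F r) (FOb H r)" "NCmp n r \<in> hom (psh Y) (ext_ob Y F r) (FOb H r)"
    if "r \<in> Obj (psh X)" for r
    using mh[OF that] nh[OF that] by (simp_all add: ext_FOb[OF that])
  show "NCmp m p = NCmp n p"
  proof (rule Y.psh_hom_eqI[OF mh'[OF p]])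
    fix y e assume y: "y \<in> Obj Y" and e: "e \<in> FOb (ext_ob Y F p) y"
    obtain x s t where e': "x \<in> Obj X" "s \<in> FOb (FOb F x) y" "t \<in> FOb p x" "e = cl F p y x s t" by (rule ext_elE[OF p e y])
    let ?r = "representable X x" and ?i = "ap (NCmp (eta Y F) x) y s"
    note yh = X.yoneda_map_hom[OF p e'(1,3)]
    have H: "FAr H (X.yoneda_map p x t) \<in> hom (psh Y) (FOb H ?r) (FOb H p)"
      using Fun_hom[OF _ yh] Nat_Fun[OF m] Fun_Src[OF ext_Fun] Fun_Tgt[OF ext_Fun] by metis
    have i: "?i \<in> FOb (ext_ob Y F ?r) y"
      using cl_in[OF R[OF e'(1)] y e'(1,2) ide_rep[OF e'(1)]] by (simp add: eta_coproj[OF e'(1)] ap_coproj[OF y e'(2)])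
    have eh: "NCmp (eta Y F) x \<in> hom (psh Y) (FOb F x) (ext_ob Y F ?r)"
      using coproj_hom[OF R[OF e'(1)] e'(1) ide_rep[OF e'(1)]] by (simp add: eta_coproj[OF e'(1)])
    have gen: "ap (NCmp k p) y e = ap (FAr H (X.yoneda_map p x t)) y (ap (Cmp (psh Y) (NCmp k ?r) (NCmp (eta Y F) x)) y s)"
      if k: "k \<in> Nat (ext Y F) H" and kh: "NCmp k ?r \<in> hom (psh Y) (ext_ob Y F ?r) (FOb H ?r)"
        and kp: "NCmp k p \<in> hom (psh Y) (ext_ob Y F p) (FOb H p)" for k
      using Y.ap_cmp[OF ext_ar_hom(1)[OF yh] kp y i] Y.ap_cmp[OF kh H y i]
        Nat_nat[OF k ext_Fun yh] cl_eta[OF p y e'(1-3)] Y.ap_cmp[OF eh kh y e'(2)]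
      by (simp add: ext_FAr[OF yh] e'(4))
    have restr: "NCmp ((k \<triangleleft> yoneda X) \<cdot>\<^sub>N eta Y F) x = Cmp (psh Y) (NCmp k ?r) (NCmp (eta Y F) x)" for k
      by (simp add: vcomp_NCmp[OF eta_Nat F e'(1)] whisker_pre_NCmp[OF X.yoneda_Fun e'(1)] X.yoneda_FOb[OF e'(1)])
    show "ap (NCmp m p) y e = ap (NCmp n p) y e"
      using gen[OF m mh'(1)[OF R[OF e'(1)]] mh'(1)[OF p]] gen[OF n mh'(2)[OF R[OF e'(1)]] mh'(2)[OF p]]
        restr[of m] restr[of n] eq by simp
  qed
qed

end

section \<open>Extensions of limit-preserving functors preserve limits\<close>

context small_profunctor
begin

lemma F_cmp:
  assumes "h \<in> hom X x1 x2" "k \<in> hom X x2 x3" "y \<in> Obj Y" "s \<in> FOb (FOb F x1) y"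
  shows "ap (FAr F (Cmp X k h)) y s = ap (FAr F k) y (ap (FAr F h) y s)"
  using Y.ap_cmp[OF F_hom[OF assms(1)] F_hom[OF assms(2)] assms(3,4)] by (simp add: Fun_Cmp[OF F assms(1,2)])

lemma F_ide: "x \<in> Obj X \<Longrightarrow> y \<in> Obj Y \<Longrightarrow> s \<in> FOb (FOb F x) y \<Longrightarrow> ap (FAr F (Ide X x)) y s = s"
  using Y.ap_ide[OF F_Obj] by (simp add: Fun_Ide[OF F])

lemma F_in: "h \<in> hom X x1 x2 \<Longrightarrow> y \<in> Obj Y \<Longrightarrow> s \<in> FOb (FOb F x1) y \<Longrightarrow> ap (FAr F h) y s \<in> FOb (FOb F x2) y"
  by (rule Y.ap_in[OF F_hom])

context
  fixes T assumes T: "is_term X T" and FT: "is_term (psh Y) (FOb F T)"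
begin

lemma FT_eq: "y \<in> Obj Y \<Longrightarrow> s \<in> FOb (FOb F T) y \<Longrightarrow> s' \<in> FOb (FOb F T) y \<Longrightarrow> s = s'"
  using FT unfolding Y.psh_is_term_iff by blast

text \<open>Each index has an arrow to \<open>T\<close>, and the coend step along it carries any
  triple to one over \<open>T\<close>. There is only one such triple, as \<open>F T\<close> and
  \<open>p\<close> have single elements there.\<close>

lemma ext_is_term:
  assumes p: "is_term (psh X) p" shows "is_term (psh Y) (ext_ob Y F p)"
proof -
  have pO: "p \<in> Obj (psh X)" and p1: "\<And>x. x \<in> Obj X \<Longrightarrow> \<exists>!e. e \<in> FOb p x"
    using p unfolding X.psh_is_term_iff by auto
  have TO: "T \<in> Obj X" using T by (simp add: is_term_def)
  obtain t0 where t0: "t0 \<in> FOb p T" using p1[OF TO] by blast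
  have "\<exists>!e. e \<in> FOb (ext_ob Y F p) y" if y: "y \<in> Obj Y" for y
  proof -
    obtain s0 where s0: "s0 \<in> FOb (FOb F T) y" using FT y unfolding Y.psh_is_term_iff by blast
    show ?thesis
    proof (rule ex1I)
      show "cl F p y T s0 t0 \<in> FOb (ext_ob Y F p) y" by (rule cl_in[OF pO y TO s0 t0])
      fix e assume "e \<in> FOb (ext_ob Y F p) y"
      then obtain x s t where e: "x \<in> Obj X" "s \<in> FOb (FOb F x) y" "t \<in> FOb p x" "e = cl F p y x s t"
        by (rule ext_elE[OF pO _ y])
      obtain b where b: "b \<in> hom X x T" using T e(1) unfolding is_term_def by blast
      have "t = pact p b t0" using p1[OF e(1)] e(3) X.pact_in[OF pO b t0] by blast
      then show "e = cl F p y T s0 t0"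
        using cl_step[OF b e(2) t0] FT_eq[OF y F_in[OF b y e(2)] s0] by (simp add: e(4))
    qed
  qed
  then show ?thesis using ext_Obj[OF pO] by (simp add: Y.psh_is_term_iff)
qed

context
  assumes prods: "\<And>x x'. x \<in> Obj X \<Longrightarrow> x' \<in> Obj X \<Longrightarrow> \<exists>f g p1 p2. f \<in> hom X x T \<and> g \<in> hom X x' T \<and>
    is_pb X f g p1 p2 \<and> is_pb (psh Y) (FAr F f) (FAr F g) (FAr F p1) (FAr F p2)"
begin

text \<open>Over the terminal object the compatibility conditions of the pullback hold
  automatically, in \<open>X\<close> as well as among elements of \<open>F\<close>, and what remains
  is a product preserved by \<open>F\<close>.\<close>

lemma product:
  assumes x: "x \<in> Obj X" "x' \<in> Obj X"
  obtains P p1 p2 where "p1 \<in> hom X P x" "p2 \<in> hom X P x'"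
    "\<And>w h k. h \<in> hom X w x \<Longrightarrow> k \<in> hom X w x' \<Longrightarrow> \<exists>u. u \<in> hom X w P \<and> Cmp X p1 u = h \<and> Cmp X p2 u = k"
    "\<And>y s s'. y \<in> Obj Y \<Longrightarrow> s \<in> FOb (FOb F x) y \<Longrightarrow> s' \<in> FOb (FOb F x') y \<Longrightarrow>
      \<exists>w. w \<in> FOb (FOb F P) y \<and> ap (FAr F p1) y w = s \<and> ap (FAr F p2) y w = s'"
    "\<And>y w w'. y \<in> Obj Y \<Longrightarrow> w \<in> FOb (FOb F P) y \<Longrightarrow> w' \<in> FOb (FOb F P) y \<Longrightarrow>
      ap (FAr F p1) y w = ap (FAr F p1) y w' \<Longrightarrow> ap (FAr F p2) y w = ap (FAr F p2) y w' \<Longrightarrow> w = w'"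
proof -
  obtain f g p1 p2 where f: "f \<in> hom X x T" and g: "g \<in> hom X x' T" and pb: "is_pb X f g p1 p2"
    and Fpb: "is_pb (psh Y) (FAr F f) (FAr F g) (FAr F p1) (FAr F p2)" using prods[OF x] by blast
  obtain P where p: "p1 \<in> hom X P x" "p2 \<in> hom X P x'" using pb f g by (auto simp: is_pb_def hom_def)
  note D = Y.psh_is_pbD[OF Fpb F_hom[OF f] F_hom[OF g] F_hom[OF p(1)] F_hom[OF p(2)]]
  show thesis
  proof (rule that[OF p])
    show "\<exists>u. u \<in> hom X w P \<and> Cmp X p1 u = h \<and> Cmp X p2 u = k" if "h \<in> hom X w x" "k \<in> hom X w x'" for w h k
      using is_pb_ex1[OF pb p that] is_termD[OF T X.cmp_in[OF that(1) f] X.cmp_in[OF that(2) g] X.category_axioms] by blast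
    show "\<exists>w. w \<in> FOb (FOb F P) y \<and> ap (FAr F p1) y w = s \<and> ap (FAr F p2) y w = s'"
      if "y \<in> Obj Y" "s \<in> FOb (FOb F x) y" "s' \<in> FOb (FOb F x') y" for y s s'
      using D(2)[OF that] FT_eq[OF that(1) F_in[OF f that(1,2)] F_in[OF g that(1,3)]] by simp
    show "w = w'" if "y \<in> Obj Y" "w \<in> FOb (FOb F P) y" "w' \<in> FOb (FOb F P) y"
      "ap (FAr F p1) y w = ap (FAr F p1) y w'" "ap (FAr F p2) y w = ap (FAr F p2) y w'" for y w w'
      using D(3)[OF that] .
  qed
qed

context
  fixes f g p1 p2 :: "'u pshmap" and p q r m
  assumes pb: "is_pb (psh X) f g p1 p2"
    and fg: "f \<in> hom (psh X) p r" "g \<in> hom (psh X) q r" "p1 \<in> hom (psh X) m p" "p2 \<in> hom (psh X) m q"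
begin

lemma pO: "p \<in> Obj (psh X)" "q \<in> Obj (psh X)" "r \<in> Obj (psh X)" "m \<in> Obj (psh X)"
  using fg by (auto simp: X.psh_hom)

lemmas pbD = X.psh_is_pbD[OF pb fg]

text \<open>
  For products, \<open>F(-)(y)\<close> is sifted: the element of the coend given by two triples does not depend
  on the cone over their indices by which they are joined, and a step in either triple keeps the cone.
\<close>

definition joins where
  "joins y v v' E \<longleftrightarrow> (case v of (x, s, t) \<Rightarrow> case v' of (x', s', t') \<Rightarrow>
    \<exists>z a b w \<tau>. a \<in> hom X z x \<and> b \<in> hom X z x' \<and> w \<in> FOb (FOb F z) y \<and> \<tau> \<in> FOb m z \<and>
      ap (FAr F a) y w = s \<and> ap (FAr F b) y w = s' \<and> ap p1 z \<tau> = pact p a t \<and> ap p2 z \<tau> = pact q b t' \<and>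
      E = cl F m y z w \<tau>)"

text \<open>Every join factors through a canonical one over the product \<open>P\<close> of the
  indices: the mediating arrow \<open>u\<close> carries \<open>w\<close> to \<open>W\<close> and
  restricts \<sigma> to \<tau>, which is one step of the coend. The condition \<open>r1\<close>
  makes all pairs of elements of \<open>p\<close> and \<open>q\<close> compatible, so that \<sigma>
  exists.\<close>

lemma joins_unique:
  assumes y: "y \<in> Obj Y" and j: "joins y (x, s, t) (x', s', t') E" "joins y (x, s, t) (x', s', t') E'"
    and t: "t \<in> FOb p x" "t' \<in> FOb q x'" and r1: "\<forall>x\<in>Obj X. \<forall>a\<in>FOb r x. \<forall>b\<in>FOb r x. a = b"
  shows "E = E'"
proof -
  obtain z a b w \<tau> where E: "a \<in> hom X z x" "b \<in> hom X z x'" "w \<in> FOb (FOb F z) y" "\<tau> \<in> FOb m z"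
    "ap (FAr F a) y w = s" "ap (FAr F b) y w = s'" "ap p1 z \<tau> = pact p a t" "ap p2 z \<tau> = pact q b t'" "E = cl F m y z w \<tau>"
    using j(1) unfolding joins_def by auto
  have xx: "x \<in> Obj X" "x' \<in> Obj X" using X.hom_Obj[OF E(1)] X.hom_Obj[OF E(2)] by auto
  obtain P q1 q2 where P: "q1 \<in> hom X P x" "q2 \<in> hom X P x'"
    and pair: "\<And>w h k. h \<in> hom X w x \<Longrightarrow> k \<in> hom X w x' \<Longrightarrow> \<exists>u. u \<in> hom X w P \<and> Cmp X q1 u = h \<and> Cmp X q2 u = k"
    and ex: "\<And>y s s'. y \<in> Obj Y \<Longrightarrow> s \<in> FOb (FOb F x) y \<Longrightarrow> s' \<in> FOb (FOb F x') y \<Longrightarrow>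
      \<exists>w. w \<in> FOb (FOb F P) y \<and> ap (FAr F q1) y w = s \<and> ap (FAr F q2) y w = s'"
    and un: "\<And>y w w'. y \<in> Obj Y \<Longrightarrow> w \<in> FOb (FOb F P) y \<Longrightarrow> w' \<in> FOb (FOb F P) y \<Longrightarrow>
      ap (FAr F q1) y w = ap (FAr F q1) y w' \<Longrightarrow> ap (FAr F q2) y w = ap (FAr F q2) y w' \<Longrightarrow> w = w'"
    by (rule product[OF xx]) blast
  have PO: "P \<in> Obj X" using X.hom_Obj[OF P(1)] by simp
  have s: "s \<in> FOb (FOb F x) y" "s' \<in> FOb (FOb F x') y" using E F_in[OF E(1) y E(3)] F_in[OF E(2) y E(3)] by auto
  obtain W where W: "W \<in> FOb (FOb F P) y" "ap (FAr F q1) y W = s" "ap (FAr F q2) y W = s'" using ex[OF y s] by blast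
  have Pt: "pact p q1 t \<in> FOb p P" "pact q q2 t' \<in> FOb q P"
    using X.pact_in[OF pO(1) P(1) t(1)] X.pact_in[OF pO(2) P(2) t(2)] by auto
  obtain \<sigma> where \<sigma>: "\<sigma> \<in> FOb m P" "ap p1 P \<sigma> = pact p q1 t" "ap p2 P \<sigma> = pact q q2 t'"
    using pbD(2)[OF PO Pt r1[rule_format, OF PO X.ap_in[OF fg(1) PO Pt(1)] X.ap_in[OF fg(2) PO Pt(2)]]] by blast
  have "joins y (x, s, t) (x', s', t') e \<Longrightarrow> e = cl F m y P W \<sigma>" for e
  proof -
    assume "joins y (x, s, t) (x', s', t') e"
    then obtain z a b w \<tau> where E: "a \<in> hom X z x" "b \<in> hom X z x'" "w \<in> FOb (FOb F z) y" "\<tau> \<in> FOb m z"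
      "ap (FAr F a) y w = s" "ap (FAr F b) y w = s'" "ap p1 z \<tau> = pact p a t" "ap p2 z \<tau> = pact q b t'" "e = cl F m y z w \<tau>"
      unfolding joins_def by auto
    obtain u where u: "u \<in> hom X z P" "Cmp X q1 u = a" "Cmp X q2 u = b" using pair[OF E(1,2)] by blast
    have zO: "z \<in> Obj X" using X.hom_Obj[OF u(1)] by simp
    have "ap (FAr F u) y w = W"
      using F_cmp[OF u(1) P(1) y E(3)] F_cmp[OF u(1) P(2) y E(3)] u(2,3) E W
      by (intro un[OF y F_in[OF u(1) y E(3)] W(1)]) simp_all
    moreover have "pact m u \<sigma> = \<tau>"
      by (rule pbD(3)[OF zO X.pact_in[OF pO(4) u(1) \<sigma>(1)] E(4)])
        (use X.ap_nat[OF fg(3) u(1) \<sigma>(1)] X.ap_nat[OF fg(4) u(1) \<sigma>(1)] \<sigma> u E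
          X.pact_cmp[OF pO(1) u(1) P(1) t(1)] X.pact_cmp[OF pO(2) u(1) P(2) t(2)] in simp_all)
    ultimately show "e = cl F m y P W \<sigma>" using cl_step[OF u(1) E(3) \<sigma>(1)] E(9) by simp
  qed
  then show ?thesis using j by blast
qed

text \<open>A forward step only lengthens one leg of the joining span; its apex and the element over
  it stay fixed.\<close>

lemma joins_step1:
  assumes y: "y \<in> Obj Y" and st: "(v, v2) \<in> coend_step F p y" and j: "joins y v v' E"
  shows "joins y v2 v' E"
proof -
  obtain h x x2 s t where h: "h \<in> hom X x x2" "s \<in> FOb (FOb F x) y" "t \<in> FOb p x2"
    "v = (x, s, pact p h t)" "v2 = (x2, ap (FAr F h) y s, t)" using st by (rule coend_stepE)
  obtain x' s' t' where v': "v' = (x', s', t')" by (cases v') auto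
  from j[unfolded h(4) v'] obtain z a b w \<tau> where E: "a \<in> hom X z x" "b \<in> hom X z x'" "w \<in> FOb (FOb F z) y" "\<tau> \<in> FOb m z"
    "ap (FAr F a) y w = s" "ap (FAr F b) y w = s'" "ap p1 z \<tau> = pact p a (pact p h t)" "ap p2 z \<tau> = pact q b t'" "E = cl F m y z w \<tau>"
    unfolding joins_def by auto
  have "Cmp X h a \<in> hom X z x2" "ap (FAr F (Cmp X h a)) y w = ap (FAr F h) y s" "ap p1 z \<tau> = pact p (Cmp X h a) t"
    using X.cmp_in[OF E(1) h(1)] F_cmp[OF E(1) h(1) y E(3)] E X.pact_cmp[OF pO(1) E(1) h(1,3)] by auto
  then show ?thesis unfolding h(5) v' joins_def prod.case using E by blast
qed

lemma joins_step2:
  assumes y: "y \<in> Obj Y" and st: "(v', v2) \<in> coend_step F q y" and j: "joins y v v' E"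
  shows "joins y v v2 E"
proof -
  obtain h x' x2 s' t' where h: "h \<in> hom X x' x2" "s' \<in> FOb (FOb F x') y" "t' \<in> FOb q x2"
    "v' = (x', s', pact q h t')" "v2 = (x2, ap (FAr F h) y s', t')" using st by (rule coend_stepE)
  obtain x s t where v: "v = (x, s, t)" by (cases v) auto
  from j[unfolded h(4) v] obtain z a b w \<tau> where E: "a \<in> hom X z x" "b \<in> hom X z x'" "w \<in> FOb (FOb F z) y" "\<tau> \<in> FOb m z"
    "ap (FAr F a) y w = s" "ap (FAr F b) y w = s'" "ap p1 z \<tau> = pact p a t" "ap p2 z \<tau> = pact q b (pact q h t')" "E = cl F m y z w \<tau>"
    unfolding joins_def by auto
  have "Cmp X h b \<in> hom X z x2" "ap (FAr F (Cmp X h b)) y w = ap (FAr F h) y s'" "ap p2 z \<tau> = pact q (Cmp X h b) t'"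
    using X.cmp_in[OF E(2) h(1)] F_cmp[OF E(2) h(1) y E(3)] E X.pact_cmp[OF pO(2) E(2) h(1,3)] by auto
  then show ?thesis unfolding h(5) v joins_def prod.case using E by blast
qed

lemma joins_exists:
  assumes y: "y \<in> Obj Y" and r1: "\<forall>x\<in>Obj X. \<forall>a\<in>FOb r x. \<forall>b\<in>FOb r x. a = b"
    and x: "x \<in> Obj X" "s \<in> FOb (FOb F x) y" "t \<in> FOb p x" and x': "x' \<in> Obj X" "s' \<in> FOb (FOb F x') y" "t' \<in> FOb q x'"
  shows "\<exists>E. joins y (x, s, t) (x', s', t') E"
proof -
  obtain P q1 q2 where P: "q1 \<in> hom X P x" "q2 \<in> hom X P x'"
    and ex: "\<And>y s s'. y \<in> Obj Y \<Longrightarrow> s \<in> FOb (FOb F x) y \<Longrightarrow> s' \<in> FOb (FOb F x') y \<Longrightarrow>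
      \<exists>w. w \<in> FOb (FOb F P) y \<and> ap (FAr F q1) y w = s \<and> ap (FAr F q2) y w = s'"
    by (rule product[OF x(1) x'(1)]) blast
  have PO: "P \<in> Obj X" using X.hom_Obj[OF P(1)] by simp
  obtain W where W: "W \<in> FOb (FOb F P) y" "ap (FAr F q1) y W = s" "ap (FAr F q2) y W = s'" using ex[OF y x(2) x'(2)] by blast
  have Pt: "pact p q1 t \<in> FOb p P" "pact q q2 t' \<in> FOb q P"
    using X.pact_in[OF pO(1) P(1) x(3)] X.pact_in[OF pO(2) P(2) x'(3)] by auto
  obtain \<sigma> where \<sigma>: "\<sigma> \<in> FOb m P" "ap p1 P \<sigma> = pact p q1 t" "ap p2 P \<sigma> = pact q q2 t'"
    using pbD(2)[OF PO Pt r1[rule_format, OF PO X.ap_in[OF fg(1) PO Pt(1)] X.ap_in[OF fg(2) PO Pt(2)]]] by blast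
  show ?thesis unfolding joins_def prod.case using P W \<sigma> by blast
qed

text \<open>Joins are total and functional on triples, so equivalent triples have the same joins.\<close>

lemma joins_equiv:
  assumes y: "y \<in> Obj Y" and r1: "\<forall>x\<in>Obj X. \<forall>a\<in>FOb r x. \<forall>b\<in>FOb r x. a = b"
  shows "(v, v2) \<in> coend_equiv F p y \<Longrightarrow> v' \<in> triples F q y \<Longrightarrow> joins y v v' E \<Longrightarrow> joins y v2 v' E"
    and "(v', v2) \<in> coend_equiv F q y \<Longrightarrow> v \<in> triples F p y \<Longrightarrow> joins y v v' E \<Longrightarrow> joins y v v2 E"
proof -
  have tr: "(x, s, t) \<in> triples F p' y \<longleftrightarrow> x \<in> Obj X \<and> s \<in> FOb (FOb F x) y \<and> t \<in> FOb p' x" for x s t p'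
    by (simp add: triples_def Fun_Src[OF F])
  have st: "v \<in> triples F p' y \<and> v2 \<in> triples F p' y" if vst: "(v, v2) \<in> coend_step F p' y" and p'O: "p' \<in> Obj (psh X)" for v v2 p'
  proof -
    obtain h x x2 s t where h: "h \<in> hom X x x2" "s \<in> FOb (FOb F x) y" "t \<in> FOb p' x2"
      "v = (x, s, pact p' h t)" "v2 = (x2, ap (FAr F h) y s, t)" using vst by (rule coend_stepE)
    then show ?thesis using X.hom_Obj[OF h(1)] X.pact_in[OF p'O h(1,3)] F_in[OF h(1) y h(2)] by (simp add: tr)
  qed
  have ex: "\<exists>E. joins y v v' E" if "v \<in> triples F p y" "v' \<in> triples F q y" for v v'
    using that joins_exists[OF y r1] by (cases v; cases v') (simp add: tr)
  have un: "E = E'" if "v \<in> triples F p y" "v' \<in> triples F q y" "joins y v v' E" "joins y v v' E'" for v v' E E'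
    using that joins_unique[OF y _ _ _ _ r1] by (cases v; cases v') (auto simp: tr)
  show "joins y v2 v' E" if e: "(v, v2) \<in> coend_equiv F p y" and tr': "v' \<in> triples F q y" and j: "joins y v v' E"
    using e j unfolding coend_equiv_def
  proof (induction rule: rtrancl_induct)
    case (step u w)
    show ?case
    proof (cases "(u, w) \<in> coend_step F p y")
      case True then show ?thesis using joins_step1[OF y] step by blast
    next
      \<comment> \<open>A backward step cannot be followed directly. Any join of the new triple is
        pushed forward along the step and compared with the given one by uniqueness.\<close>
      case False
      then have wu: "(w, u) \<in> coend_step F p y" using step by blast
      obtain E' where E': "joins y w v' E'" using ex[of w v'] st[OF wu pO(1)] tr' by blast
      then have "E' = E" using un[OF _ tr' joins_step1[OF y wu E'] step.IH[OF step.prems]] st[OF wu pO(1)] by blast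
      then show ?thesis using E' by simp
    qed
  qed
  show "joins y v v2 E" if e: "(v', v2) \<in> coend_equiv F q y" and tr': "v \<in> triples F p y" and j: "joins y v v' E"
    using e j unfolding coend_equiv_def
  proof (induction rule: rtrancl_induct)
    case (step u w)
    show ?case
    proof (cases "(u, w) \<in> coend_step F q y")
      case True then show ?thesis using joins_step2[OF y] step by blast
    next
      case False
      then have wu: "(w, u) \<in> coend_step F q y" using step by blast
      obtain E' where E': "joins y v w E'" using ex[of v w] st[OF wu pO(2)] tr' by blast
      then have "E' = E" using un[OF tr' _ joins_step2[OF y wu E'] step.IH[OF step.prems]] st[OF wu pO(2)] by blast
      then show ?thesis using E' by simp
    qed
  qed
qed

text \<open>A join of two triples provides an element with prescribed projections. Conversely an
  element is the join of its own projections, and joins depend only on the classes of the triples,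
  so it is determined by them.\<close>

lemma ext_is_pb_product:
  assumes r1: "\<forall>x\<in>Obj X. \<forall>a\<in>FOb r x. \<forall>b\<in>FOb r x. a = b"
  shows "is_pb (psh Y) (ext_ar Y F f) (ext_ar Y F g) (ext_ar Y F p1) (ext_ar Y F p2)"
proof (rule Y.psh_is_pbI[OF ext_ar_hom(1)[OF fg(1)] ext_ar_hom(1)[OF fg(2)] ext_ar_hom(1)[OF fg(3)] ext_ar_hom(1)[OF fg(4)]])
  fix y e assume y: "y \<in> Obj Y" and e: "e \<in> FOb (ext_ob Y F m) y"
  obtain x s t where e': "x \<in> Obj X" "s \<in> FOb (FOb F x) y" "t \<in> FOb m x" "e = cl F m y x s t" by (rule ext_elE[OF pO(4) e y])
  show "ap (ext_ar Y F f) y (ap (ext_ar Y F p1) y e) = ap (ext_ar Y F g) y (ap (ext_ar Y F p2) y e)"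
    using ext_ar_hom(2)[OF fg(3) y e'(1-3)] ext_ar_hom(2)[OF fg(4) y e'(1-3)] ext_ar_hom(2)[OF fg(1) y e'(1,2) X.ap_in[OF fg(3) e'(1,3)]]
      ext_ar_hom(2)[OF fg(2) y e'(1,2) X.ap_in[OF fg(4) e'(1,3)]] pbD(1)[OF e'(1,3)] by (simp add: e'(4))
next
  fix y e1 e2 assume y: "y \<in> Obj Y" and e1: "e1 \<in> FOb (ext_ob Y F p) y" and e2: "e2 \<in> FOb (ext_ob Y F q) y"
  obtain x s t where e: "x \<in> Obj X" "s \<in> FOb (FOb F x) y" "t \<in> FOb p x" "e1 = cl F p y x s t" by (rule ext_elE[OF pO(1) e1 y])
  obtain x' s' t' where e': "x' \<in> Obj X" "s' \<in> FOb (FOb F x') y" "t' \<in> FOb q x'" "e2 = cl F q y x' s' t'" by (rule ext_elE[OF pO(2) e2 y])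
  obtain E where "joins y (x, s, t) (x', s', t') E" using joins_exists[OF y r1 e(1-3) e'(1-3)] by blast
  then obtain z a b w \<tau> where E: "a \<in> hom X z x" "b \<in> hom X z x'" "w \<in> FOb (FOb F z) y" "\<tau> \<in> FOb m z"
    "ap (FAr F a) y w = s" "ap (FAr F b) y w = s'" "ap p1 z \<tau> = pact p a t" "ap p2 z \<tau> = pact q b t'" "E = cl F m y z w \<tau>"
    unfolding joins_def by auto
  have zO: "z \<in> Obj X" using X.hom_Obj[OF E(1)] by simp
  have "ap (ext_ar Y F p1) y E = e1" "ap (ext_ar Y F p2) y E = e2"
    using ext_ar_hom(2)[OF fg(3) y zO E(3,4)] ext_ar_hom(2)[OF fg(4) y zO E(3,4)] cl_step[OF E(1,3) e(3)] cl_step[OF E(2,3) e'(3)] E e(4) e'(4) by simp_all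
  then show "\<exists>e. e \<in> FOb (ext_ob Y F m) y \<and> ap (ext_ar Y F p1) y e = e1 \<and> ap (ext_ar Y F p2) y e = e2"
    using cl_in[OF pO(4) y zO E(3,4)] E(9) by blast
next
  fix y E E' assume y: "y \<in> Obj Y" and E: "E \<in> FOb (ext_ob Y F m) y" and E': "E' \<in> FOb (ext_ob Y F m) y"
    and eq: "ap (ext_ar Y F p1) y E = ap (ext_ar Y F p1) y E'" "ap (ext_ar Y F p2) y E = ap (ext_ar Y F p2) y E'"
  \<comment> \<open>An element is a join of its two projections, along the span of
    identities.\<close>
  have self: "joins y (x, s, ap p1 x t) (x, s, ap p2 x t) (cl F m y x s t)"
    if "x \<in> Obj X" "s \<in> FOb (FOb F x) y" "t \<in> FOb m x" for x s t
    unfolding joins_def prod.case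
    using that X.ide_in[OF that(1)] F_ide[OF that(1) y that(2)]
      X.pact_ide[OF pO(1) that(1) X.ap_in[OF fg(3) that(1,3)]]
      X.pact_ide[OF pO(2) that(1) X.ap_in[OF fg(4) that(1,3)]]
    by (intro exI[of _ x] exI[of _ "Ide X x"] exI[of _ s] exI[of _ t]) simp
  obtain x s t where e: "x \<in> Obj X" "s \<in> FOb (FOb F x) y" "t \<in> FOb m x" "E = cl F m y x s t" by (rule ext_elE[OF pO(4) E y])
  obtain x' s' t' where e': "x' \<in> Obj X" "s' \<in> FOb (FOb F x') y" "t' \<in> FOb m x'" "E' = cl F m y x' s' t'" by (rule ext_elE[OF pO(4) E' y])
  note i = X.ap_in[OF fg(3) e(1,3)] X.ap_in[OF fg(4) e(1,3)] X.ap_in[OF fg(3) e'(1,3)] X.ap_in[OF fg(4) e'(1,3)]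
  have q1: "((x, s, ap p1 x t), (x', s', ap p1 x' t')) \<in> coend_equiv F p y"
    and q2: "((x, s, ap p2 x t), (x', s', ap p2 x' t')) \<in> coend_equiv F q y"
    using eq ext_ar_hom(2)[OF fg(3) y e(1-3)] ext_ar_hom(2)[OF fg(3) y e'(1-3)] ext_ar_hom(2)[OF fg(4) y e(1-3)] ext_ar_hom(2)[OF fg(4) y e'(1-3)]
    by (simp_all add: e(4) e'(4) coend_class_eq_iff)
  have t: "(x, s, ap p2 x t) \<in> triples F q y" "(x', s', ap p1 x' t') \<in> triples F p y"
    using e e' i by (simp_all add: triples_def Fun_Src[OF F])
  have "joins y (x', s', ap p1 x' t') (x', s', ap p2 x' t') E"
    using joins_equiv(2)[OF y r1 q2 t(2) joins_equiv(1)[OF y r1 q1 t(1) self[OF e(1-3)]]] e(4) by simp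
  then show "E = E'" using joins_unique[OF y _ self[OF e'(1-3)] i(3,4) r1] e'(4) by blast
qed

text \<open>For finite limits, \<open>F(-)(y)\<close> is flat: equality in the coend is witnessed by a single span.\<close>

context
  assumes pbs: "\<And>f g x y z. f \<in> hom X x z \<Longrightarrow> g \<in> hom X y z \<Longrightarrow> \<exists>p1 p2.
    is_pb X f g p1 p2 \<and> is_pb (psh Y) (FAr F f) (FAr F g) (FAr F p1) (FAr F p2)"
begin

lemma flat1:
  assumes y: "y \<in> Obj Y" and x: "x \<in> Obj X" "s \<in> FOb (FOb F x) y" and x': "x' \<in> Obj X" "s' \<in> FOb (FOb F x') y"
  shows "\<exists>z w a b. w \<in> FOb (FOb F z) y \<and> a \<in> hom X z x \<and> b \<in> hom X z x' \<and> ap (FAr F a) y w = s \<and> ap (FAr F b) y w = s'"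
  by (rule product[OF x(1) x'(1)]) (use x x' y in blast)

text \<open>The equalizer of \<open>h\<close> and \<open>k\<close> is formed as the pullback of the
  arrows (1,h) and (1,k) into the product of \<open>x\<close> and \<open>x'\<close>. Since
  \<open>F\<close> preserves product and pullback, \<open>s\<close> lifts to it.\<close>

lemma flat2:
  assumes y: "y \<in> Obj Y" and h: "h \<in> hom X x x'" and k: "k \<in> hom X x x'" and s: "s \<in> FOb (FOb F x) y"
    and eq: "ap (FAr F h) y s = ap (FAr F k) y s"
  shows "\<exists>z w a. w \<in> FOb (FOb F z) y \<and> a \<in> hom X z x \<and> ap (FAr F a) y w = s \<and> Cmp X h a = Cmp X k a"
proof -
  have x: "x \<in> Obj X" "x' \<in> Obj X" using X.hom_Obj[OF h] by auto
  obtain P q1 q2 where P: "q1 \<in> hom X P x" "q2 \<in> hom X P x'"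
    and pair: "\<And>w h k. h \<in> hom X w x \<Longrightarrow> k \<in> hom X w x' \<Longrightarrow> \<exists>u. u \<in> hom X w P \<and> Cmp X q1 u = h \<and> Cmp X q2 u = k"
    and un: "\<And>y w w'. y \<in> Obj Y \<Longrightarrow> w \<in> FOb (FOb F P) y \<Longrightarrow> w' \<in> FOb (FOb F P) y \<Longrightarrow>
      ap (FAr F q1) y w = ap (FAr F q1) y w' \<Longrightarrow> ap (FAr F q2) y w = ap (FAr F q2) y w' \<Longrightarrow> w = w'"
    by (rule product[OF x]) blast
  note i = X.ide_in[OF x(1)]
  obtain u where u: "u \<in> hom X x P" "Cmp X q1 u = Ide X x" "Cmp X q2 u = h" using pair[OF i h] by blast
  obtain v where v: "v \<in> hom X x P" "Cmp X q1 v = Ide X x" "Cmp X q2 v = k" using pair[OF i k] by blast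
  have uv: "ap (FAr F u) y s = ap (FAr F v) y s"
    using F_cmp[OF u(1) P(1) y s] F_cmp[OF v(1) P(1) y s] F_cmp[OF u(1) P(2) y s] F_cmp[OF v(1) P(2) y s] u v eq
    by (intro un[OF y F_in[OF u(1) y s] F_in[OF v(1) y s]]) simp_all
  obtain e1 e2 where e: "is_pb X u v e1 e2" and Fe: "is_pb (psh Y) (FAr F u) (FAr F v) (FAr F e1) (FAr F e2)"
    using pbs[OF u(1) v(1)] by blast
  obtain Q where Q: "e1 \<in> hom X Q x" "e2 \<in> hom X Q x" and c: "Cmp X u e1 = Cmp X v e2"
    using e u(1) v(1) by (auto simp: is_pb_def hom_def)
  obtain w where w: "w \<in> FOb (FOb F Q) y" "ap (FAr F e1) y w = s"
    using Y.psh_is_pbD(2)[OF Fe F_hom[OF u(1)] F_hom[OF v(1)] F_hom[OF Q(1)] F_hom[OF Q(2)] y s s uv] by blast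
  note as = X.cmp_assoc
  have "e1 = e2"
    using as[OF Q(1) u(1) P(1)] as[OF Q(2) v(1) P(1)] c u(2) v(2) X.ide_cmp[OF Q(1)] X.ide_cmp[OF Q(2)]
    by simp
  moreover have "Cmp X h e1 = Cmp X k e2"
    using as[OF Q(1) u(1) P(2)] as[OF Q(2) v(1) P(2)] c u(3) v(3) by simp
  ultimately show ?thesis using w Q by blast
qed

text \<open>First a span over the two elements by \<open>flat1\<close>, then an arrow from
  \<open>flat2\<close> that makes the square commute. With these three facts the category of
  elements of \<open>F(-)(y)\<close> is cofiltered in the sense required.\<close>

lemma flat_ore:
  assumes y: "y \<in> Obj Y" and a: "a \<in> hom X x1 x" and b: "b \<in> hom X x2 x"
    and s: "s1 \<in> FOb (FOb F x1) y" "s2 \<in> FOb (FOb F x2) y" and eq: "ap (FAr F a) y s1 = ap (FAr F b) y s2"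
  shows "\<exists>z w c d. w \<in> FOb (FOb F z) y \<and> c \<in> hom X z x1 \<and> d \<in> hom X z x2 \<and> ap (FAr F c) y w = s1 \<and>
    ap (FAr F d) y w = s2 \<and> Cmp X a c = Cmp X b d"
proof -
  have x: "x1 \<in> Obj X" "x2 \<in> Obj X" using X.hom_Obj[OF a] X.hom_Obj[OF b] by auto
  obtain z w c d where z: "w \<in> FOb (FOb F z) y" "c \<in> hom X z x1" "d \<in> hom X z x2" "ap (FAr F c) y w = s1" "ap (FAr F d) y w = s2"
    using flat1[OF y x(1) s(1) x(2) s(2)] by blast
  have "ap (FAr F (Cmp X a c)) y w = ap (FAr F (Cmp X b d)) y w"
    using F_cmp[OF z(2) a y z(1)] F_cmp[OF z(3) b y z(1)] z eq by simp
  from flat2[OF y X.cmp_in[OF z(2) a] X.cmp_in[OF z(3) b] z(1) this] obtain z' w' e where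
    e: "w' \<in> FOb (FOb F z') y" "e \<in> hom X z' z" "ap (FAr F e) y w' = w" "Cmp X (Cmp X a c) e = Cmp X (Cmp X b d) e" by blast
  note as = X.cmp_assoc[OF e(2)]
  have "Cmp X a (Cmp X c e) = Cmp X b (Cmp X d e)" using as[OF z(2) a] as[OF z(3) b] e(4) by simp
  moreover have "ap (FAr F (Cmp X c e)) y w' = s1" "ap (FAr F (Cmp X d e)) y w' = s2"
    using F_cmp[OF e(2) z(2) y e(1)] F_cmp[OF e(2) z(3) y e(1)] e z by simp_all
  ultimately show ?thesis using e(1) X.cmp_in[OF e(2) z(2)] X.cmp_in[OF e(2) z(3)] by blast
qed

text \<open>A zigzag of steps collapses to one span: a forward step lengthens the right leg, a
  backward step is absorbed by the Ore condition. Membership of \<open>t'\<close> is carried along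
  so that the induction can continue.\<close>

lemma flat_coend:
  assumes y: "y \<in> Obj Y" and p': "p' \<in> Obj (psh X)" and v: "(v, v') \<in> coend_equiv F p' y" and tr: "v \<in> triples F p' y"
  shows "case v of (x, s, t) \<Rightarrow> case v' of (x', s', t') \<Rightarrow> t' \<in> FOb p' x' \<and> (\<exists>z w a b. w \<in> FOb (FOb F z) y \<and> a \<in> hom X z x \<and>
    b \<in> hom X z x' \<and> ap (FAr F a) y w = s \<and> ap (FAr F b) y w = s' \<and> pact p' a t = pact p' b t')"
  using v unfolding coend_equiv_def
proof (induction rule: rtrancl_induct)
  case base
  obtain x s t where vv: "v = (x, s, t)" by (cases v) auto
  then have "x \<in> Obj X" "s \<in> FOb (FOb F x) y" "t \<in> FOb p' x" using tr by (auto simp: triples_def Fun_Src[OF F])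
  then show ?case unfolding vv prod.case
    using X.ide_in F_ide[OF _ y] by (intro conjI exI[of _ x] exI[of _ s] exI[of _ "Ide X x"]) auto
next
  case (step v1 v2)
  obtain x s t where vv: "v = (x, s, t)" by (cases v) auto
  then have t: "t \<in> FOb p' x" using tr by (auto simp: triples_def)
  obtain x1 s1 t1 where v1: "v1 = (x1, s1, t1)" by (cases v1) auto
  from step.IH[unfolded vv v1 prod.case] obtain z w a b where z: "w \<in> FOb (FOb F z) y" "a \<in> hom X z x" "b \<in> hom X z x1"
    "ap (FAr F a) y w = s" "ap (FAr F b) y w = s1" "pact p' a t = pact p' b t1" and t1: "t1 \<in> FOb p' x1" by blast
  show ?case
  proof (cases "(v1, v2) \<in> coend_step F p' y")
    case True
    then obtain h u u' \<sigma> \<tau> where h: "h \<in> hom X u u'" "\<sigma> \<in> FOb (FOb F u) y" "\<tau> \<in> FOb p' u'"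
      "v1 = (u, \<sigma>, pact p' h \<tau>)" "v2 = (u', ap (FAr F h) y \<sigma>, \<tau>)" by (rule coend_stepE)
    have [simp]: "u = x1" "\<sigma> = s1" "t1 = pact p' h \<tau>" using h(4) v1 by auto
    have b: "b \<in> hom X z u" using z(3) by simp
    have "ap (FAr F (Cmp X h b)) y w = ap (FAr F h) y \<sigma>" "pact p' a t = pact p' (Cmp X h b) \<tau>"
      using F_cmp[OF b h(1) y z(1)] z X.pact_cmp[OF p' b h(1,3)] by simp_all
    then show ?thesis unfolding vv h(5) prod.case using z(1,2,4) X.cmp_in[OF b h(1)] h(3) by blast
  next
    case False
    then have "(v2, v1) \<in> coend_step F p' y" using step.hyps by blast
    then obtain h u u' \<sigma> \<tau> where h: "h \<in> hom X u u'" "\<sigma> \<in> FOb (FOb F u) y" "\<tau> \<in> FOb p' u'"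
      "v2 = (u, \<sigma>, pact p' h \<tau>)" "v1 = (u', ap (FAr F h) y \<sigma>, \<tau>)" by (rule coend_stepE)
    have e: "u' = x1" "ap (FAr F h) y \<sigma> = s1" "t1 = \<tau>" using h(5) v1 by auto
    have b: "b \<in> hom X z u'" using z(3) e by simp
    \<comment> \<open>The right leg \<open>b\<close> and the backward arrow \<open>h\<close> form a
      cospan; completing it to a square gives the new span.\<close>
    obtain z' w' c d where z': "w' \<in> FOb (FOb F z') y" "c \<in> hom X z' z" "d \<in> hom X z' u" "ap (FAr F c) y w' = w"
      "ap (FAr F d) y w' = \<sigma>" "Cmp X b c = Cmp X h d" using flat_ore[OF y b h(1) z(1) h(2)] z(5) e by auto
    have "pact p' (Cmp X a c) t = pact p' d (pact p' h \<tau>)"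
      using X.pact_cmp[OF p' z'(2) z(2) t] X.pact_cmp[OF p' z'(2) b h(3)] X.pact_cmp[OF p' z'(3) h(1,3)] z(6) e(3) z'(6) by simp
    moreover have "ap (FAr F (Cmp X a c)) y w' = s" using F_cmp[OF z'(2) z(2) y z'(1)] z' z by simp
    ultimately show ?thesis unfolding vv h(4) prod.case
      using z'(1,3,5) X.cmp_in[OF z'(2) z(2)] X.pact_in[OF p' h(1,3)] by blast
  qed
qed

lemma flat_clE:
  assumes y: "y \<in> Obj Y" and p': "p' \<in> Obj (psh X)" and eq: "cl F p' y x s t = cl F p' y x' s' t'"
    and tr: "x \<in> Obj X" "s \<in> FOb (FOb F x) y" "t \<in> FOb p' x"
  obtains z w a b where "w \<in> FOb (FOb F z) y" "a \<in> hom X z x" "b \<in> hom X z x'" "ap (FAr F a) y w = s"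
    "ap (FAr F b) y w = s'" "pact p' a t = pact p' b t'"
proof -
  have "(x, s, t) \<in> triples F p' y" using tr by (simp add: triples_def Fun_Src[OF F])
  from flat_coend[OF y p' _ this, of "(x', s', t')"] eq show thesis using that by (auto simp: coend_class_eq_iff)
qed

lemma ext_is_pb_pullback: "is_pb (psh Y) (ext_ar Y F f) (ext_ar Y F g) (ext_ar Y F p1) (ext_ar Y F p2)"
proof (rule Y.psh_is_pbI[OF ext_ar_hom(1)[OF fg(1)] ext_ar_hom(1)[OF fg(2)] ext_ar_hom(1)[OF fg(3)] ext_ar_hom(1)[OF fg(4)]])
  fix y e assume y: "y \<in> Obj Y" and e: "e \<in> FOb (ext_ob Y F m) y"
  obtain x s t where e': "x \<in> Obj X" "s \<in> FOb (FOb F x) y" "t \<in> FOb m x" "e = cl F m y x s t" by (rule ext_elE[OF pO(4) e y])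
  show "ap (ext_ar Y F f) y (ap (ext_ar Y F p1) y e) = ap (ext_ar Y F g) y (ap (ext_ar Y F p2) y e)"
    using ext_ar_hom(2)[OF fg(3) y e'(1-3)] ext_ar_hom(2)[OF fg(4) y e'(1-3)] ext_ar_hom(2)[OF fg(1) y e'(1,2) X.ap_in[OF fg(3) e'(1,3)]]
      ext_ar_hom(2)[OF fg(2) y e'(1,2) X.ap_in[OF fg(4) e'(1,3)]] pbD(1)[OF e'(1,3)] by (simp add: e'(4))
next
  fix y e1 e2 assume y: "y \<in> Obj Y" and e1: "e1 \<in> FOb (ext_ob Y F p) y" and e2: "e2 \<in> FOb (ext_ob Y F q) y"
    and eq: "ap (ext_ar Y F f) y e1 = ap (ext_ar Y F g) y e2"
  obtain x s t where e: "x \<in> Obj X" "s \<in> FOb (FOb F x) y" "t \<in> FOb p x" "e1 = cl F p y x s t" by (rule ext_elE[OF pO(1) e1 y])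
  obtain x' s' t' where e': "x' \<in> Obj X" "s' \<in> FOb (FOb F x') y" "t' \<in> FOb q x'" "e2 = cl F q y x' s' t'" by (rule ext_elE[OF pO(2) e2 y])
  have "cl F r y x s (ap f x t) = cl F r y x' s' (ap g x' t')"
    using ext_ar_hom(2)[OF fg(1) y e(1-3)] ext_ar_hom(2)[OF fg(2) y e'(1-3)] eq e(4) e'(4) by simp
  then obtain z w a b where z: "w \<in> FOb (FOb F z) y" "a \<in> hom X z x" "b \<in> hom X z x'" "ap (FAr F a) y w = s"
    "ap (FAr F b) y w = s'" "pact r a (ap f x t) = pact r b (ap g x' t')"
    by (rule flat_clE[OF y pO(3) _ e(1,2) X.ap_in[OF fg(1) e(1,3)]])
  have zO: "z \<in> Obj X" using X.hom_Obj[OF z(2)] by simp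
  have "ap f z (pact p a t) = ap g z (pact q b t')" using X.ap_nat[OF fg(1) z(2) e(3)] X.ap_nat[OF fg(2) z(3) e'(3)] z(6) by simp
  from pbD(2)[OF zO X.pact_in[OF pO(1) z(2) e(3)] X.pact_in[OF pO(2) z(3) e'(3)] this] obtain \<tau> where
    \<tau>: "\<tau> \<in> FOb m z" "ap p1 z \<tau> = pact p a t" "ap p2 z \<tau> = pact q b t'" by blast
  have "ap (ext_ar Y F p1) y (cl F m y z w \<tau>) = e1" "ap (ext_ar Y F p2) y (cl F m y z w \<tau>) = e2"
    using ext_ar_hom(2)[OF fg(3) y zO z(1) \<tau>(1)] ext_ar_hom(2)[OF fg(4) y zO z(1) \<tau>(1)] cl_step[OF z(2,1) e(3)] cl_step[OF z(3,1) e'(3)] \<tau> z e(4) e'(4) by simp_all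
  then show "\<exists>e. e \<in> FOb (ext_ob Y F m) y \<and> ap (ext_ar Y F p1) y e = e1 \<and> ap (ext_ar Y F p2) y e = e2"
    using cl_in[OF pO(4) y zO z(1) \<tau>(1)] by blast
next
  fix y E E' assume y: "y \<in> Obj Y" and E: "E \<in> FOb (ext_ob Y F m) y" and E': "E' \<in> FOb (ext_ob Y F m) y"
    and eq: "ap (ext_ar Y F p1) y E = ap (ext_ar Y F p1) y E'" "ap (ext_ar Y F p2) y E = ap (ext_ar Y F p2) y E'"
  obtain x s t where e: "x \<in> Obj X" "s \<in> FOb (FOb F x) y" "t \<in> FOb m x" "E = cl F m y x s t" by (rule ext_elE[OF pO(4) E y])
  obtain x' s' t' where e': "x' \<in> Obj X" "s' \<in> FOb (FOb F x') y" "t' \<in> FOb m x'" "E' = cl F m y x' s' t'" by (rule ext_elE[OF pO(4) E' y])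
  note i = X.ap_in[OF fg(3) e(1,3)] X.ap_in[OF fg(4) e(1,3)] X.ap_in[OF fg(3) e'(1,3)] X.ap_in[OF fg(4) e'(1,3)]
  have q1: "cl F p y x s (ap p1 x t) = cl F p y x' s' (ap p1 x' t')" and q2: "cl F q y x s (ap p2 x t) = cl F q y x' s' (ap p2 x' t')"
    using eq ext_ar_hom(2)[OF fg(3) y e(1-3)] ext_ar_hom(2)[OF fg(3) y e'(1-3)] ext_ar_hom(2)[OF fg(4) y e(1-3)] ext_ar_hom(2)[OF fg(4) y e'(1-3)] e(4) e'(4) by simp_all
  obtain z w u v where z: "w \<in> FOb (FOb F z) y" "u \<in> hom X z x" "v \<in> hom X z x'" "ap (FAr F u) y w = s"
    "ap (FAr F v) y w = s'" "pact p u (ap p1 x t) = pact p v (ap p1 x' t')"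
    by (rule flat_clE[OF y pO(1) q1 e(1,2) i(1)])
  obtain z2 w2 u2 v2 where z2: "w2 \<in> FOb (FOb F z2) y" "u2 \<in> hom X z2 x" "v2 \<in> hom X z2 x'" "ap (FAr F u2) y w2 = s"
    "ap (FAr F v2) y w2 = s'" "pact q u2 (ap p2 x t) = pact q v2 (ap p2 x' t')"
    by (rule flat_clE[OF y pO(2) q2 e(1,2) i(2)])
  \<comment> \<open>Equality over \<open>p\<close> and equality over \<open>q\<close> come with
    different spans, while uniqueness in \<open>m\<close> needs one span for both. The Ore condition
    makes the left legs agree, and then \<open>flat2\<close> the right legs.\<close>
  obtain z3 w3 c d where z3: "w3 \<in> FOb (FOb F z3) y" "c \<in> hom X z3 z" "d \<in> hom X z3 z2" "ap (FAr F c) y w3 = w"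
    "ap (FAr F d) y w3 = w2" "Cmp X u c = Cmp X u2 d"
    using flat_ore[OF y z(2) z2(2) z(1) z2(1)] z(4) z2(4) by auto
  have "ap (FAr F (Cmp X v c)) y w3 = ap (FAr F (Cmp X v2 d)) y w3"
    using F_cmp[OF z3(2) z(3) y z3(1)] F_cmp[OF z3(3) z2(3) y z3(1)] z3 z(5) z2(5) by simp
  from flat2[OF y X.cmp_in[OF z3(2) z(3)] X.cmp_in[OF z3(3) z2(3)] z3(1) this] obtain Z W k where
    Z: "W \<in> FOb (FOb F Z) y" "k \<in> hom X Z z3" "ap (FAr F k) y W = w3" "Cmp X (Cmp X v c) k = Cmp X (Cmp X v2 d) k" by blast
  let ?a = "Cmp X (Cmp X u c) k" and ?b = "Cmp X (Cmp X v c) k"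
  note uc = X.cmp_in[OF z3(2) z(2)] and vc = X.cmp_in[OF z3(2) z(3)] and ud = X.cmp_in[OF z3(3) z2(2)] and vd = X.cmp_in[OF z3(3) z2(3)]
  have a: "?a \<in> hom X Z x" "?b \<in> hom X Z x'" using X.cmp_in[OF Z(2) uc] X.cmp_in[OF Z(2) vc] by auto
  have ZO: "Z \<in> Obj X" using X.hom_Obj[OF Z(2)] by simp
  have s: "ap (FAr F ?a) y W = s" "ap (FAr F ?b) y W = s'"
    using F_cmp[OF Z(2) uc y Z(1)] F_cmp[OF Z(2) vc y Z(1)] F_cmp[OF z3(2) z(2) y z3(1)] F_cmp[OF z3(2) z(3) y z3(1)] Z(3) z3(4) z(4,5) by simp_all
  have P1: "pact p ?a (ap p1 x t) = pact p ?b (ap p1 x' t')"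
    using X.pact_cmp[OF pO(1) Z(2) uc i(1)] X.pact_cmp[OF pO(1) Z(2) vc i(3)]
      X.pact_cmp[OF pO(1) z3(2) z(2) i(1)] X.pact_cmp[OF pO(1) z3(2) z(3) i(3)] z(6) by simp
  have P2: "pact q ?a (ap p2 x t) = pact q ?b (ap p2 x' t')"
    unfolding Z(4) z3(6) using X.pact_cmp[OF pO(2) Z(2) ud i(2)] X.pact_cmp[OF pO(2) Z(2) vd i(4)]
      X.pact_cmp[OF pO(2) z3(3) z2(2) i(2)] X.pact_cmp[OF pO(2) z3(3) z2(3) i(4)] z2(6) by simp
  have "pact m ?a t = pact m ?b t'"
    by (rule pbD(3)[OF ZO X.pact_in[OF pO(4) a(1) e(3)] X.pact_in[OF pO(4) a(2) e'(3)]])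
      (simp_all add: X.ap_nat[OF fg(3) a(1) e(3)] X.ap_nat[OF fg(3) a(2) e'(3)]
        X.ap_nat[OF fg(4) a(1) e(3)] X.ap_nat[OF fg(4) a(2) e'(3)] P1 P2)
  then show "E = E'" using cl_step[OF a(1) Z(1) e(3)] cl_step[OF a(2) Z(1) e'(3)] s e(4) e'(4) by simp
qed

end
end
end
end

text \<open>Translates the preservation of formal limits by \<open>F\<close> after \<open>a\<close>
  into statements about limits in \<open>X\<close>, applies the results on coends, and translates
  back for presheaves.\<close>

lemma KLim_ext:
  assumes Xa: "action K X a" and ka: "KLim K X X a" and kF: "KLim K X (psh Y) (F \<circ>\<^sub>F a)"
    and b: "b \<in> Fun (S_cat K (psh X)) (psh X)" and kb: "KLim K (psh X) (psh X) b"
  shows "KLim K (psh X) (psh Y) (ext Y F \<circ>\<^sub>F b)"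
proof -
  have a: "a \<in> Fun (S_cat K X) X" using Xa by (simp add: action_def)
  have au: "a \<circ>\<^sub>F S_unit K X = idf X" using Xa by (simp add: action_def)
  note PX = category_psh[of X]
  let ?T = "Tob K X a OOne"
  have T: "is_term X ?T" using KLimD(1)[OF ka] .
  have To: "Tob K X (F \<circ>\<^sub>F a) U = FOb F (Tob K X a U)" if "oeq K X U U" for U
    by (simp add: Tob_def fcomp_FOb[OF a ocl_Obj[OF that]])
  have Ta: "Tar K X (F \<circ>\<^sub>F a) U V h = FAr F (Tar K X a U V h)" if "aeq K X U V h h" for U V h
    by (simp add: Tar_def fcomp_FAr[OF a acl_Arr[OF that]])
  have gen: "Tob K X a (OGen x) = x" if "x \<in> Obj X" for x
    using Tob_S_unit[OF a X.category_axioms that] that by (simp add: au) (simp add: idf_def)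
  have gen_m: "Tar K X a (OGen x) (OGen x') (MGen h) = h" if "h \<in> hom X x x'" for h x x'
    using Tar_S_unit[OF a X.category_axioms that] homD[OF that] by (simp add: au) (simp add: idf_def)
  have FT: "is_term (psh Y) (FOb F ?T)" using KLimD(1)[OF kF] by (simp add: To[OF o_one])
  have sqs: "is_pb X (Tar K X a U W f) (Tar K X a V W g) (Tar K X a P U p1) (Tar K X a P V p2) \<and>
      is_pb (psh Y) (FAr F (Tar K X a U W f)) (FAr F (Tar K X a V W g)) (FAr F (Tar K X a P U p1)) (FAr F (Tar K X a P V p2))"
    if s: "sq K X U V W f g P p1 p2" for U V W f g P p1 p2
    using KLimD(2)[OF ka s] KLimD(2)[OF kF s] sq_wf[OF X.category_axioms s] Ta by simp
  \<comment> \<open>Every cospan of \<open>X\<close> is the value of a formal one made of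
    generators, so the value of the formal pullback is a pullback preserved by
    \<open>F\<close>.\<close>
  have pbs: "\<exists>p1 p2. is_pb X f g p1 p2 \<and> is_pb (psh Y) (FAr F f) (FAr F g) (FAr F p1) (FAr F p2)"
    if K: "K = FiniteLimits" and f: "f \<in> hom X x z" and g: "g \<in> hom X y z" for f g x y z
  proof -
    have "sq K X (OGen x) (OGen y) (OGen z) (MGen f) (MGen g) (OPb (OGen x) (OGen y) (MGen f) (MGen g))
        (MPb1 (OGen x) (OGen y) (MGen f) (MGen g)) (MPb2 (OGen x) (OGen y) (MGen f) (MGen g))"
      using K a_gen[of f X] a_gen[of g X] homD[OF f] homD[OF g] by (auto simp: sq_def)
    from sqs[OF this] show ?thesis unfolding gen_m[OF f] gen_m[OF g] by blast
  qed
  have prods: "\<exists>f g p1 p2. f \<in> hom X x ?T \<and> g \<in> hom X x' ?T \<and> is_pb X f g p1 p2 \<and>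
      is_pb (psh Y) (FAr F f) (FAr F g) (FAr F p1) (FAr F p2)"
    if K: "K \<noteq> TerminalObject" and x: "x \<in> Obj X" "x' \<in> Obj X" for x x'
  proof (cases "K = FiniteLimits")
    case True
    obtain f g where fg: "f \<in> hom X x ?T" "g \<in> hom X x' ?T" using T x unfolding is_term_def by blast
    then show ?thesis using pbs[OF True fg] by blast
  next
    case False
    then have K: "K = FiniteProducts" using K by (cases K) auto
    then have s: "sq K X (OGen x) (OGen x') OOne (MBang (OGen x)) (MBang (OGen x')) (OProd (OGen x) (OGen x'))
        (MPr1 (OGen x) (OGen x')) (MPr2 (OGen x) (OGen x'))" using o_gen[OF x(1)] o_gen[OF x(2)] by (simp add: sq_def)
    note wf = sq_wf[OF X.category_axioms s]
    show ?thesis using sqs[OF s] Tar_hom[OF X.category_axioms a wf(5)] Tar_hom[OF X.category_axioms a wf(6)] unfolding gen[OF x(1)] gen[OF x(2)] by blast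
  qed
  have bo: "Tob K (psh X) (ext Y F \<circ>\<^sub>F b) U = ext_ob Y F (Tob K (psh X) b U)" if "oeq K (psh X) U U" for U
    using Tob_Obj[OF PX b that] by (simp add: Tob_def fcomp_FOb[OF b ocl_Obj[OF that]] ext_FOb)
  have ba: "Tar K (psh X) (ext Y F \<circ>\<^sub>F b) U V h = ext_ar Y F (Tar K (psh X) b U V h)" if "aeq K (psh X) U V h h" for U V h
    using Tar_hom[OF PX b that] by (simp add: Tar_def Tob_def fcomp_FAr[OF b acl_Arr[OF that]] ext_FAr)
  show ?thesis
    unfolding KLim_def
  proof (intro conjI allI impI)
    show "is_term (psh Y) (Tob K (psh X) (ext Y F \<circ>\<^sub>F b) OOne)"
      unfolding bo[OF o_one] by (rule ext_is_term[OF T FT KLimD(1)[OF kb]])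
    fix U V W f g P p1 p2 assume s: "sq K (psh X) U V W f g P p1 p2"
    note wf = sq_wf[OF PX s]
    note pb = KLimD(2)[OF kb s] and h = Tar_hom[OF PX b wf(5)] Tar_hom[OF PX b wf(6)] Tar_hom[OF PX b wf(7)] Tar_hom[OF PX b wf(8)]
    have K: "K \<noteq> TerminalObject" using s by (auto simp: sq_def)
    have "is_pb (psh Y) (ext_ar Y F (Tar K (psh X) b U W f)) (ext_ar Y F (Tar K (psh X) b V W g))
        (ext_ar Y F (Tar K (psh X) b P U p1)) (ext_ar Y F (Tar K (psh X) b P V p2))"
    proof (cases "K = FiniteProducts")
      case True
      \<comment> \<open>The formal products are squares over \<open>OOne\<close>, whose value is
        terminal; this is what supplies the condition \<open>r1\<close>.\<close>
      then have W: "W = OOne" using s by (auto simp: sq_def)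
      show ?thesis
      proof (rule ext_is_pb_product[OF T FT _ pb h])
        show "\<forall>x\<in>Obj X. \<forall>e\<in>FOb (Tob K (psh X) b W) x. \<forall>e'\<in>FOb (Tob K (psh X) b W) x. e = e'"
          using KLimD(1)[OF kb] unfolding W X.psh_is_term_iff by blast
      qed (rule prods[OF K])
    next
      case False
      then have "K = FiniteLimits" using K by (cases K) auto
      show ?thesis
        by (rule ext_is_pb_pullback[OF T FT _ pb h]) (rule prods[OF K], assumption+, rule pbs[OF \<open>K = FiniteLimits\<close>])
    qed
    then show "is_pb (psh Y) (Tar K (psh X) (ext Y F \<circ>\<^sub>F b) U W f) (Tar K (psh X) (ext Y F \<circ>\<^sub>F b) V W g)
        (Tar K (psh X) (ext Y F \<circ>\<^sub>F b) P U p1) (Tar K (psh X) (ext Y F \<circ>\<^sub>F b) P V p2)"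
      using wf ba by simp
  qed
qed

end

section \<open>The multiplication and unit 2-cells of the presheaf pseudomonad\<close>

lemma bij_betw_inverse:
  assumes "\<And>a. a \<in> A \<Longrightarrow> f a \<in> B \<and> g (f a) = a" "\<And>b. b \<in> B \<Longrightarrow> g b \<in> A \<and> f (g b) = b"
  shows "bij_betw f A B"
  by (rule bij_betw_byWitness[where f' = g]) (use assms in auto)

lemma (in small_cat) psh_NatIsoI:
  assumes H: "H \<in> Fun (psh W) (psh X)" and G: "G \<in> Fun (psh W) (psh X)"
    and u: "\<And>p. p \<in> Obj (psh W) \<Longrightarrow> u p \<in> hom (psh X) (FOb H p) (FOb G p)"
    and b: "\<And>p x. p \<in> Obj (psh W) \<Longrightarrow> x \<in> Obj X \<Longrightarrow> bij_betw (ap (u p) x) (FOb (FOb H p) x) (FOb (FOb G p) x)"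
    and n: "\<And>\<alpha> p q x e. \<alpha> \<in> hom (psh W) p q \<Longrightarrow> x \<in> Obj X \<Longrightarrow> e \<in> FOb (FOb H p) x \<Longrightarrow>
      ap (u q) x (ap (FAr H \<alpha>) x e) = ap (FAr G \<alpha>) x (ap (u p) x e)"
  shows "\<lparr>NSrc = H, NTgt = G, NCmp = (\<lambda>p\<in>Obj (psh W). u p)\<rparr> \<in> NatIso H G"
proof -
  have "\<lparr>NSrc = H, NTgt = G, NCmp = (\<lambda>p\<in>Obj (psh W). u p)\<rparr> \<in> Nat H G"
  proof (rule NatI[OF _ _ H G])
    fix \<alpha> p q assume \<alpha>: "\<alpha> \<in> hom (psh W) p q"
    have pq: "p \<in> Obj (psh W)" "q \<in> Obj (psh W)" using category.hom_Obj[OF category_psh \<alpha>] by auto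
    note H\<alpha> = Fun_hom[OF H \<alpha>] and G\<alpha> = Fun_hom[OF G \<alpha>] and up = u[OF pq(1)] and uq = u[OF pq(2)]
    have "Cmp (psh X) (u q) (FAr H \<alpha>) = Cmp (psh X) (FAr G \<alpha>) (u p)"
      by (rule psh_hom_eqI[OF category.cmp_in[OF category_psh H\<alpha> uq] category.cmp_in[OF category_psh up G\<alpha>]])
        (simp add: ap_cmp[OF H\<alpha> uq] ap_cmp[OF up G\<alpha>] n[OF \<alpha>])
    then show "Cmp (psh X) (NCmp \<lparr>NSrc = H, NTgt = G, NCmp = (\<lambda>p\<in>Obj (psh W). u p)\<rparr> q) (FAr H \<alpha>)
        = Cmp (psh X) (FAr G \<alpha>) (NCmp \<lparr>NSrc = H, NTgt = G, NCmp = (\<lambda>p\<in>Obj (psh W). u p)\<rparr> p)" using pq by simp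
  qed (auto simp: u)
  then show ?thesis using psh_iso[OF u b] by (simp add: NatIso_iff[OF H])
qed

lemma (in small_profunctor) ext_ar_cmp:
  assumes f: "f \<in> hom (psh X) p q" and g: "g \<in> hom (psh X) q r"
  shows "ext_ar Y F (Cmp (psh X) g f) = Cmp (psh Y) (ext_ar Y F g) (ext_ar Y F f)"
  using Fun_Cmp[OF ext_Fun f g] ext_FAr[OF f] ext_FAr[OF g] ext_FAr[OF category.cmp_in[OF category_psh f g]] by simp

section \<open>The comparison 2-cell \<mu>\<close>

locale composable_profunctors = F: small_profunctor X Y F + G: small_profunctor Y Z G
  for X Y Z :: "('u::universe, 'u) cat" and F G :: "'u profunctor"
begin

abbreviation GoF where "GoF \<equiv> ext Z G \<circ>\<^sub>F F"

sublocale GoF: small_profunctor X Z GoF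
  by unfold_locales (rule fcomp_Fun[OF F.F G.ext_Fun])

lemma K_ob: "x \<in> Obj X \<Longrightarrow> FOb GoF x = ext_ob Z G (FOb F x)"
  by (simp add: fcomp_FOb[OF F.F] G.ext_FOb[OF Fun_Ob[OF F.F]])

lemma K_ar: "h \<in> hom X x x' \<Longrightarrow> FAr GoF h = ext_ar Z G (FAr F h)"
  using G.ext_FAr[OF Fun_hom[OF F.F]] by (simp add: fcomp_FAr[OF F.F] hom_def[of X])

text \<open>Induced by the cocone obtained from the coprojections of the inner extension by applying
  the outer one; it expresses that the extension of \<open>G\<close> preserves weighted
  colimits.\<close>

definition mu_comp where
  "mu_comp p = mkN Z (ext_ob Z GoF p) (ext_ob Z G (ext_ob Y F p))
     (\<lambda>z e. case unpack e of (x, s, t) \<Rightarrow> ap (ext_ar Z G (F.coproj p x t)) z s)"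

text \<open>Interchange of two coends on elements: (y, s', (x, s, t)) is rebracketed to (x, (y, s',
  s), t).\<close>

definition mu_inv where
  "mu_inv p z e = (case unpack e of (y, s', w) \<Rightarrow> case unpack w of (x, s, t) \<Rightarrow> cl GoF p z x (cl G (FOb F x) z y s' s) t)"

context
  fixes p assumes p: "p \<in> Obj (psh X)"
begin

lemma mu_comp:
  shows "mu_comp p \<in> hom (psh Z) (ext_ob Z GoF p) (ext_ob Z G (ext_ob Y F p))"
    and "z \<in> Obj Z \<Longrightarrow> x \<in> Obj X \<Longrightarrow> e \<in> FOb (FOb GoF x) z \<Longrightarrow> t \<in> FOb p x \<Longrightarrow>
      ap (mu_comp p) z (cl GoF p z x e t) = ap (ext_ar Z G (F.coproj p x t)) z e"
proof -
  note s = F.coproj_hom[OF p]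
  have \<tau>: "ext_ar Z G (F.coproj p x t) \<in> hom (psh Z) (FOb GoF x) (ext_ob Z G (ext_ob Y F p))" if "x \<in> Obj X" "t \<in> FOb p x" for x t
    using G.ext_ar_hom(1)[OF s[OF that]] by (simp add: K_ob[OF that(1)])
  have nat: "Cmp (psh Z) (ext_ar Z G (F.coproj p x' t)) (FAr GoF h) = ext_ar Z G (F.coproj p x (pact p h t))"
    if h: "h \<in> hom X x x'" and t: "t \<in> FOb p x'" for h x x' t
  proof -
    have x': "x' \<in> Obj X" using F.X.hom_Obj[OF h] by simp
    show ?thesis
      using G.ext_ar_cmp[OF Fun_hom[OF F.F h] s[OF x' t]] F.coproj_step[OF p h t] by (simp add: K_ar[OF h])
  qed
  note Q = G.ext_Obj[OF F.ext_Obj[OF p]]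
  show "mu_comp p \<in> hom (psh Z) (ext_ob Z GoF p) (ext_ob Z G (ext_ob Y F p))"
    unfolding mu_comp_def by (rule GoF.coend_universal(1)[OF p \<tau> nat Q])
  show "ap (mu_comp p) z (cl GoF p z x e t) = ap (ext_ar Z G (F.coproj p x t)) z e"
    if "z \<in> Obj Z" "x \<in> Obj X" "e \<in> FOb (FOb GoF x) z" "t \<in> FOb p x" for z x e t
    unfolding mu_comp_def by (rule GoF.coend_universal(2)[OF p \<tau> nat Q that])
qed

lemma mu_comp_cl:
  assumes "z \<in> Obj Z" "x \<in> Obj X" "y \<in> Obj Y" "s' \<in> FOb (FOb G y) z" "s \<in> FOb (FOb F x) y" "t \<in> FOb p x"
  shows "ap (mu_comp p) z (cl GoF p z x (cl G (FOb F x) z y s' s) t) = cl G (ext_ob Y F p) z y s' (cl F p y x s t)"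
  using mu_comp(2)[OF assms(1,2) _ assms(6)] G.cl_in[OF Fun_Ob[OF F.F assms(2)] assms(1,3,4,5)]
    G.ext_ar_hom(2)[OF F.coproj_hom[OF p assms(2,6)] assms(1,3,4,5)]
  by (simp add: K_ob[OF assms(2)] F.ap_coproj[OF assms(3,5)])

lemma mu_inv_cl:
  assumes z: "z \<in> Obj Z" and v: "x \<in> Obj X" "y \<in> Obj Y" "s' \<in> FOb (FOb G y) z" "s \<in> FOb (FOb F x) y" "t \<in> FOb p x"
  shows "mu_inv p z (cl G (ext_ob Y F p) z y s' (cl F p y x s t)) = cl GoF p z x (cl G (FOb F x) z y s' s) t"
proof -
  \<comment> \<open>Invariance is checked in two stages, for the inner coend with \<open>y\<close>
    and \<open>s'\<close> fixed, and then for the outer one.\<close>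
  define \<psi> where "\<psi> y s' w = (case unpack w of (x, s, t) \<Rightarrow> cl GoF p z x (cl G (FOb F x) z y s' s) t)" for y s' w
  have \<psi>: "\<psi> y s' (cl F p y x s t) = cl GoF p z x (cl G (FOb F x) z y s' s) t"
    if y: "y \<in> Obj Y" and s': "s' \<in> FOb (FOb G y) z" for y s' x s t
  proof -
    have "(\<lambda>(x, s, t). cl GoF p z x (cl G (FOb F x) z y s' s) t) (unpack (cl F p y x s t))
        = (\<lambda>(x, s, t). cl GoF p z x (cl G (FOb F x) z y s' s) t) (x, s, t)"
    proof (rule coend_lift)
      fix v v' assume "(v, v') \<in> coend_step F p y"
      then obtain h x x' s t where h: "h \<in> hom X x x'" "s \<in> FOb (FOb F x) y" "t \<in> FOb p x'"
        "v = (x, s, pact p h t)" "v' = (x', ap (FAr F h) y s, t)" by (rule F.coend_stepE)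
      have x: "x \<in> Obj X" using F.X.hom_Obj[OF h(1)] by simp
      have "cl G (FOb F x) z y s' s \<in> FOb (FOb GoF x) z"
        using G.cl_in[OF Fun_Ob[OF F.F x] z y s' h(2)] by (simp add: K_ob[OF x])
      from GoF.cl_step[OF h(1) this h(3)]
      show "(case v of (x, s, t) \<Rightarrow> cl GoF p z x (cl G (FOb F x) z y s' s) t) = (case v' of (x, s, t) \<Rightarrow> cl GoF p z x (cl G (FOb F x) z y s' s) t)"
        using G.ext_ar_hom(2)[OF Fun_hom[OF F.F h(1)] z y s' h(2)] by (simp add: h(4,5) K_ar[OF h(1)])
    qed
    then show ?thesis by (simp add: \<psi>_def)
  qed
  have "(\<lambda>(y, s', w). \<psi> y s' w) (unpack (cl G (ext_ob Y F p) z y s' (cl F p y x s t))) = (\<lambda>(y, s', w). \<psi> y s' w) (y, s', cl F p y x s t)"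
  proof (rule coend_lift)
    fix v v' assume "(v, v') \<in> coend_step G (ext_ob Y F p) z"
    then obtain k y y2 s' w where k: "k \<in> hom Y y y2" "s' \<in> FOb (FOb G y) z" "w \<in> FOb (ext_ob Y F p) y2"
      "v = (y, s', pact (ext_ob Y F p) k w)" "v' = (y2, ap (FAr G k) z s', w)" by (rule G.coend_stepE)
    have y: "y \<in> Obj Y" "y2 \<in> Obj Y" using F.Y.hom_Obj[OF k(1)] by auto
    obtain x s t where w: "x \<in> Obj X" "s \<in> FOb (FOb F x) y2" "t \<in> FOb p x" "w = cl F p y2 x s t"
      by (rule F.ext_elE[OF p k(3) y(2)])
    show "(case v of (y, s', w) \<Rightarrow> \<psi> y s' w) = (case v' of (y, s', w) \<Rightarrow> \<psi> y s' w)"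
      using \<psi>[OF y(1) k(2)] \<psi>[OF y(2) G.Y.ap_in[OF Fun_hom[OF G.F k(1)] z k(2)]] G.cl_step[OF k(1,2) w(2)]
      by (simp add: k(4,5) w(4) F.pact_cl[OF p k(1) w(1-3)])
  qed
  then show ?thesis using \<psi>[OF v(2,3)] by (simp add: mu_inv_def \<psi>_def)
qed

lemma mu_comp_bij:
  assumes z: "z \<in> Obj Z"
  shows "bij_betw (ap (mu_comp p) z) (FOb (ext_ob Z GoF p) z) (FOb (ext_ob Z G (ext_ob Y F p)) z)"
proof (rule bij_betw_inverse[where g = "mu_inv p z"])
  fix e assume "e \<in> FOb (ext_ob Z GoF p) z"
  then obtain x e1 t where e: "x \<in> Obj X" "e1 \<in> FOb (FOb GoF x) z" "t \<in> FOb p x" "e = cl GoF p z x e1 t"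
    by (rule GoF.ext_elE[OF p _ z])
  obtain y s' s where e1: "y \<in> Obj Y" "s' \<in> FOb (FOb G y) z" "s \<in> FOb (FOb F x) y" "e1 = cl G (FOb F x) z y s' s"
    by (rule G.ext_elE[OF Fun_Ob[OF F.F e(1)] e(2)[unfolded K_ob[OF e(1)]] z])
  show "ap (mu_comp p) z e \<in> FOb (ext_ob Z G (ext_ob Y F p)) z \<and> mu_inv p z (ap (mu_comp p) z e) = e"
    using G.Y.ap_in[OF mu_comp(1) z \<open>e \<in> _\<close>]
    by (simp add: e(4) e1(4) mu_comp_cl[OF z e(1) e1(1-3) e(3)] mu_inv_cl[OF z e(1) e1(1-3) e(3)])
next
  fix e assume "e \<in> FOb (ext_ob Z G (ext_ob Y F p)) z"
  then obtain y s' w where e: "y \<in> Obj Y" "s' \<in> FOb (FOb G y) z" "w \<in> FOb (ext_ob Y F p) y" "e = cl G (ext_ob Y F p) z y s' w"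
    by (rule G.ext_elE[OF F.ext_Obj[OF p] _ z])
  obtain x s t where w: "x \<in> Obj X" "s \<in> FOb (FOb F x) y" "t \<in> FOb p x" "w = cl F p y x s t"
    by (rule F.ext_elE[OF p e(3,1)])
  have "cl G (FOb F x) z y s' s \<in> FOb (FOb GoF x) z"
    using G.cl_in[OF Fun_Ob[OF F.F w(1)] z e(1,2) w(2)] by (simp add: K_ob[OF w(1)])
  from GoF.cl_in[OF p z w(1) this w(3)]
  show "mu_inv p z e \<in> FOb (ext_ob Z GoF p) z \<and> ap (mu_comp p) z (mu_inv p z e) = e"
    by (simp add: e(4) w(4) mu_comp_cl[OF z w(1) e(1,2) w(2,3)] mu_inv_cl[OF z w(1) e(1,2) w(2,3)])
qed

end

lemma mu_exists:
  "\<exists>m \<in> NatIso (ext Z GoF) (ext Z G \<circ>\<^sub>F ext Y F). (m \<triangleleft> yoneda X) \<cdot>\<^sub>N eta Z GoF = ext Z G \<triangleright> eta Y F"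
proof
  let ?m = "\<lparr>NSrc = ext Z GoF, NTgt = ext Z G \<circ>\<^sub>F ext Y F, NCmp = (\<lambda>p\<in>Obj (psh X). mu_comp p)\<rparr>"
  note eF = F.ext_Fun and eG = G.ext_Fun and eK = GoF.ext_Fun
  note GF = fcomp_Fun[OF eF eG] and y = F.X.yoneda_Fun
  have Ko: "FOb (ext Z GoF) p = ext_ob Z GoF p" if "p \<in> Obj (psh X)" for p using GoF.ext_FOb[OF that] .
  have Go: "FOb (ext Z G \<circ>\<^sub>F ext Y F) p = ext_ob Z G (ext_ob Y F p)" if "p \<in> Obj (psh X)" for p
    using G.ext_FOb[OF F.ext_Obj[OF that]] by (simp add: fcomp_FOb[OF eF that] F.ext_FOb[OF that])
  have Ga: "FAr (ext Z G \<circ>\<^sub>F ext Y F) \<alpha> = ext_ar Z G (ext_ar Y F \<alpha>)" if "\<alpha> \<in> hom (psh X) p q" for \<alpha> p q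
    using G.ext_FAr[OF F.ext_ar_hom(1)[OF that]] homD[OF that] by (simp add: fcomp_FAr[OF eF] F.ext_FAr[OF that])
  show m: "?m \<in> NatIso (ext Z GoF) (ext Z G \<circ>\<^sub>F ext Y F)"
  proof (rule G.Y.psh_NatIsoI[OF eK GF])
    show "mu_comp p \<in> hom (psh Z) (FOb (ext Z GoF) p) (FOb (ext Z G \<circ>\<^sub>F ext Y F) p)" if "p \<in> Obj (psh X)" for p
      using mu_comp(1)[OF that] by (simp add: Ko Go that)
    show "bij_betw (ap (mu_comp p) z) (FOb (FOb (ext Z GoF) p) z) (FOb (FOb (ext Z G \<circ>\<^sub>F ext Y F) p) z)"
      if "p \<in> Obj (psh X)" "z \<in> Obj Z" for p z
      using mu_comp_bij[OF that] by (simp add: Ko Go that)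
    fix \<alpha> p q z e assume \<alpha>: "\<alpha> \<in> hom (psh X) p q" and z: "z \<in> Obj Z" and "e \<in> FOb (FOb (ext Z GoF) p) z"
    have pq: "p \<in> Obj (psh X)" "q \<in> Obj (psh X)" using category.hom_Obj[OF category_psh \<alpha>] by auto
    have "e \<in> FOb (ext_ob Z GoF p) z" using \<open>e \<in> _\<close> by (simp add: Ko pq)
    then obtain x e1 t where e: "x \<in> Obj X" "e1 \<in> FOb (FOb GoF x) z" "t \<in> FOb p x" "e = cl GoF p z x e1 t"
      by (rule GoF.ext_elE[OF pq(1) _ z])
    note s = F.coproj_hom[OF pq(1) e(1,3)]
    have "ap (mu_comp q) z (ap (ext_ar Z GoF \<alpha>) z e) = ap (ext_ar Z G (F.coproj q x (ap \<alpha> x t))) z e1"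
      using GoF.ext_ar_hom(2)[OF \<alpha> z e(1-3)] mu_comp(2)[OF pq(2) z e(1,2) F.X.ap_in[OF \<alpha> e(1,3)]] by (simp add: e(4))
    also have "\<dots> = ap (ext_ar Z G (ext_ar Y F \<alpha>)) z (ap (ext_ar Z G (F.coproj p x t)) z e1)"
      using G.ext_ar_cmp[OF s F.ext_ar_hom(1)[OF \<alpha>]] F.coproj_nat[OF \<alpha> e(1,3)]
        G.Y.ap_cmp[OF G.ext_ar_hom(1)[OF s] G.ext_ar_hom(1)[OF F.ext_ar_hom(1)[OF \<alpha>]] z, of e1] e(2)
      by (simp add: K_ob[OF e(1)])
    also have "ap (ext_ar Z G (F.coproj p x t)) z e1 = ap (mu_comp p) z e"
      using mu_comp(2)[OF pq(1) z e(1-3)] by (simp add: e(4))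
    finally show "ap (mu_comp q) z (ap (FAr (ext Z GoF) \<alpha>) z e) = ap (FAr (ext Z G \<circ>\<^sub>F ext Y F) \<alpha>) z (ap (mu_comp p) z e)"
      by (simp add: Ga[OF \<alpha>] GoF.ext_FAr[OF \<alpha>])
  qed
  then have m': "?m \<in> Nat (ext Z GoF) (ext Z G \<circ>\<^sub>F ext Y F)" by (simp add: NatIso_def)
  note etaF = F.eta_Nat and etaK = GoF.eta_Nat
  note L = vcomp_Nat[OF etaK whisker_pre_Nat[OF m' y eK]] and R = whisker_post_Nat[OF etaF F.F eG]
  have e: "ext Z G \<circ>\<^sub>F (ext Y F \<circ>\<^sub>F yoneda X) = (ext Z G \<circ>\<^sub>F ext Y F) \<circ>\<^sub>F yoneda X"
    by (rule fcomp_assoc[OF y eF eG])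
  show "(?m \<triangleleft> yoneda X) \<cdot>\<^sub>N eta Z GoF = ext Z G \<triangleright> eta Y F"
  proof (rule Nat_eqI[OF L R[unfolded e] GoF.F])
    fix x assume x: "x \<in> Obj X"
    let ?r = "representable X x" and ?i = "Ide X x"
    note r = F.X.representable_Obj[OF x] and i = F.ide_rep[OF x]
    note sF = F.coproj_hom[OF r x i] and sK = GoF.coproj_hom[OF r x i]
    have "Cmp (psh Z) (mu_comp ?r) (GoF.coproj ?r x ?i) = ext_ar Z G (F.coproj ?r x ?i)"
    proof (rule G.Y.psh_hom_eqI[OF category.cmp_in[OF category_psh sK mu_comp(1)[OF r]]])
      show "ext_ar Z G (F.coproj ?r x ?i) \<in> hom (psh Z) (FOb GoF x) (ext_ob Z G (ext_ob Y F ?r))"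
        using G.ext_ar_hom(1)[OF sF] by (simp add: K_ob[OF x])
      fix z e assume z: "z \<in> Obj Z" and e: "e \<in> FOb (FOb GoF x) z"
      show "ap (Cmp (psh Z) (mu_comp ?r) (GoF.coproj ?r x ?i)) z e = ap (ext_ar Z G (F.coproj ?r x ?i)) z e"
        using G.Y.ap_cmp[OF sK mu_comp(1)[OF r] z e] mu_comp(2)[OF r z x e i] by (simp add: GoF.ap_coproj[OF z e])
    qed
    then show "NCmp ((?m \<triangleleft> yoneda X) \<cdot>\<^sub>N eta Z GoF) x = NCmp (ext Z G \<triangleright> eta Y F) x"
      using r by (simp add: vcomp_NCmp[OF etaK GoF.F x] whisker_pre_NCmp[OF y x] whisker_post_NCmp[OF etaF F.F x]
          F.X.yoneda_FOb[OF x] F.eta_coproj[OF x] GoF.eta_coproj[OF x] G.ext_FAr[OF sF])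
  qed
qed

text \<open>The definite description denotes: \<open>mu_exists\<close> gives existence and
  \<open>ext_Nat_eqI\<close> uniqueness.\<close>

lemma mu_Nat: "mu Y Z G F \<in> Nat (ext Z GoF) (ext Z G \<circ>\<^sub>F ext Y F)"
proof -
  have "\<exists>!m. m \<in> NatIso (ext Z GoF) (ext Z G \<circ>\<^sub>F ext Y F) \<and> (m \<triangleleft> yoneda (Src F)) \<cdot>\<^sub>N eta Z GoF = ext Z G \<triangleright> eta Y F"
    unfolding Fun_Src[OF F.F]
  proof (rule ex_ex1I)
    show "\<exists>m. m \<in> NatIso (ext Z GoF) (ext Z G \<circ>\<^sub>F ext Y F) \<and> (m \<triangleleft> yoneda X) \<cdot>\<^sub>N eta Z GoF = ext Z G \<triangleright> eta Y F"
      using mu_exists by blast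
    fix m n assume "m \<in> NatIso (ext Z GoF) (ext Z G \<circ>\<^sub>F ext Y F) \<and> (m \<triangleleft> yoneda X) \<cdot>\<^sub>N eta Z GoF = ext Z G \<triangleright> eta Y F"
      "n \<in> NatIso (ext Z GoF) (ext Z G \<circ>\<^sub>F ext Y F) \<and> (n \<triangleleft> yoneda X) \<cdot>\<^sub>N eta Z GoF = ext Z G \<triangleright> eta Y F"
    then show "m = n" by (intro GoF.ext_Nat_eqI[of m _ n]) (auto simp: NatIso_def)
  qed
  from theI'[OF this] show ?thesis by (simp add: mu_def NatIso_def)
qed

end

section \<open>The comparison 2-cell \<theta>\<close>

context small_cat
begin

text \<open>The density isomorphism: the class of \<open>(x, s, t)\<close> goes to the restriction
  of \<open>t\<close> along \<open>s\<close>.\<close>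

definition theta_comp where
  "theta_comp p = mkN X (ext_ob X (yoneda X) p) p (\<lambda>y e. case unpack e of (x, s, t) \<Rightarrow> ap (yoneda_map p x t) y s)"

lemma theta_comp:
  assumes p: "p \<in> Obj (psh X)"
  shows "theta_comp p \<in> hom (psh X) (ext_ob X (yoneda X) p) p"
    and "y \<in> Obj X \<Longrightarrow> s \<in> hom X y x \<Longrightarrow> t \<in> FOb p x \<Longrightarrow> ap (theta_comp p) y (cl (yoneda X) p y x s t) = pact p s t"
proof -
  interpret Y: small_profunctor X X "yoneda X" by unfold_locales (rule yoneda_Fun)
  note Y = Y.F
  have \<tau>: "yoneda_map p x t \<in> hom (psh X) (FOb (yoneda X) x) p" if "x \<in> Obj X" "t \<in> FOb p x" for x t
    using yoneda_map_hom[OF p that] by (simp add: yoneda_FOb[OF that(1)])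
  have nat: "Cmp (psh X) (yoneda_map p x' t) (FAr (yoneda X) h) = yoneda_map p x (pact p h t)"
    if h: "h \<in> hom X x x'" and t: "t \<in> FOb p x'" for h x x' t
  proof -
    have x: "x \<in> Obj X" "x' \<in> Obj X" using hom_Obj[OF h] by auto
    have "h \<in> FOb (representable X x') x" using h x by (simp add: representable_sel)
    then show ?thesis using cmp_yoneda_map[OF yoneda_map_hom[OF p x(2) t] x(1)] by (simp add: yoneda_FAr[OF h] ap_yoneda_map[OF x(1) h])
  qed
  show "theta_comp p \<in> hom (psh X) (ext_ob X (yoneda X) p) p"
    unfolding theta_comp_def by (rule Y.coend_universal(1)[OF p \<tau> nat p])
  show "ap (theta_comp p) y (cl (yoneda X) p y x s t) = pact p s t"
    if "y \<in> Obj X" "s \<in> hom X y x" "t \<in> FOb p x" for y s x t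
  proof -
    have x: "x \<in> Obj X" using hom_Obj[OF that(2)] by simp
    have s: "s \<in> FOb (FOb (yoneda X) x) y" using that by (simp add: yoneda_FOb[OF x] representable_sel)
    have "ap (theta_comp p) y (cl (yoneda X) p y x s t) = ap (yoneda_map p x t) y s"
      unfolding theta_comp_def by (rule Y.coend_universal(2)[OF p \<tau> nat p that(1) x s that(3)])
    then show ?thesis by (simp add: ap_yoneda_map[OF that(1,2)])
  qed
qed

text \<open>The coend step along \<open>s\<close> itself brings any triple into a normal form whose
  middle entry is an identity. The element in third place is then a free parameter, which gives the
  inverse of \<theta>.\<close>

lemma theta_elE:
  assumes p: "p \<in> Obj (psh X)" and y: "y \<in> Obj X" and e: "e \<in> FOb (ext_ob X (yoneda X) p) y"
  obtains x s t where "x \<in> Obj X" "s \<in> hom X y x" "t \<in> FOb p x" "e = cl (yoneda X) p y x s t" "pact p s t \<in> FOb p y"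
    "e = cl (yoneda X) p y y (Ide X y) (pact p s t)"
proof -
  interpret Y: small_profunctor X X "yoneda X" by unfold_locales (rule yoneda_Fun)
  obtain x s t where e': "x \<in> Obj X" "s \<in> FOb (FOb (yoneda X) x) y" "t \<in> FOb p x" "e = cl (yoneda X) p y x s t"
    by (rule Y.ext_elE[OF p e y])
  have s: "s \<in> hom X y x" using e'(2) y by (simp add: yoneda_FOb[OF e'(1)] representable_sel)
  note i = ide_in[OF y]
  have "Ide X y \<in> FOb (FOb (yoneda X) y) y" using i y by (simp add: yoneda_FOb[OF y] representable_sel)
  from Y.cl_step[OF s this e'(3)]
  have "e = cl (yoneda X) p y y (Ide X y) (pact p s t)"
    using representable_sel(2)[OF i s] cmp_ide[OF s] by (simp add: e'(4) yoneda_FAr[OF s] ap_yoneda_map[OF y i])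
  with that[OF e'(1) s e'(3,4) pact_in[OF p s e'(3)]] show thesis .
qed

lemma theta_exists:
  "\<exists>t \<in> NatIso (ext X (yoneda X)) (idf (psh X)). (t \<triangleleft> yoneda X) \<cdot>\<^sub>N eta X (yoneda X) = idn (yoneda X)"
proof
  interpret Y: small_profunctor X X "yoneda X" by unfold_locales (rule yoneda_Fun)
  let ?t = "\<lparr>NSrc = ext X (yoneda X), NTgt = idf (psh X), NCmp = (\<lambda>p\<in>Obj (psh X). theta_comp p)\<rparr>"
  note Y = Y.F
  note E = Y.ext_Fun and I = idf_Fun[OF category_psh[of X]]
  have Eo: "FOb (ext X (yoneda X)) p = ext_ob X (yoneda X) p" if "p \<in> Obj (psh X)" for p using Y.ext_FOb[OF that] .
  have iY: "Ide X y \<in> FOb (FOb (yoneda X) y) y" if "y \<in> Obj X" for y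
    using ide_in[OF that] that by (simp add: yoneda_FOb[OF that] representable_sel)
  show m: "?t \<in> NatIso (ext X (yoneda X)) (idf (psh X))"
  proof (rule psh_NatIsoI[OF E I])
    show "theta_comp p \<in> hom (psh X) (FOb (ext X (yoneda X)) p) (FOb (idf (psh X)) p)" if "p \<in> Obj (psh X)" for p
      using theta_comp(1)[OF that] that by (simp add: Eo) (simp add: idf_def)
    show "bij_betw (ap (theta_comp p) y) (FOb (FOb (ext X (yoneda X)) p) y) (FOb (FOb (idf (psh X)) p) y)"
      if p: "p \<in> Obj (psh X)" and y: "y \<in> Obj X" for p y
    proof -
      have "bij_betw (ap (theta_comp p) y) (FOb (ext_ob X (yoneda X) p) y) (FOb p y)"
      proof (rule bij_betw_inverse[where g = "\<lambda>t. cl (yoneda X) p y y (Ide X y) t"])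
        fix e assume e: "e \<in> FOb (ext_ob X (yoneda X) p) y"
        obtain x s t where e': "s \<in> hom X y x" "t \<in> FOb p x" "e = cl (yoneda X) p y x s t" "pact p s t \<in> FOb p y"
          "e = cl (yoneda X) p y y (Ide X y) (pact p s t)" by (rule theta_elE[OF p y e])
        have "ap (theta_comp p) y e = pact p s t" using theta_comp(2)[OF p y e'(1,2)] by (simp add: e'(3))
        then show "ap (theta_comp p) y e \<in> FOb p y \<and> cl (yoneda X) p y y (Ide X y) (ap (theta_comp p) y e) = e"
          using e'(4,5) by simp
      next
        fix t assume t: "t \<in> FOb p y"
        show "cl (yoneda X) p y y (Ide X y) t \<in> FOb (ext_ob X (yoneda X) p) y \<and>
            ap (theta_comp p) y (cl (yoneda X) p y y (Ide X y) t) = t"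
          using Y.cl_in[OF p y y iY[OF y] t] theta_comp(2)[OF p y ide_in[OF y] t] pact_ide[OF p y t] by simp
      qed
      then show ?thesis using p by (simp add: Eo) (simp add: idf_def)
    qed
    fix \<alpha> p q y e assume \<alpha>: "\<alpha> \<in> hom (psh X) p q" and y: "y \<in> Obj X" and "e \<in> FOb (FOb (ext X (yoneda X)) p) y"
    have pq: "p \<in> Obj (psh X)" "q \<in> Obj (psh X)" using category.hom_Obj[OF category_psh \<alpha>] by auto
    have "e \<in> FOb (ext_ob X (yoneda X) p) y" using \<open>e \<in> _\<close> by (simp add: Eo pq)
    then obtain x s t where e: "x \<in> Obj X" "s \<in> hom X y x" "t \<in> FOb p x" "e = cl (yoneda X) p y x s t" by (rule theta_elE[OF pq(1) y])
    have s: "s \<in> FOb (FOb (yoneda X) x) y" using e y by (simp add: yoneda_FOb[OF e(1)] representable_sel)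
    have "ap (theta_comp q) y (ap (ext_ar X (yoneda X) \<alpha>) y e) = ap \<alpha> y (ap (theta_comp p) y e)"
      using Y.ext_ar_hom(2)[OF \<alpha> y e(1) s e(3)] theta_comp(2)[OF pq(2) y e(2) ap_in[OF \<alpha> e(1,3)]]
        theta_comp(2)[OF pq(1) y e(2,3)] ap_nat[OF \<alpha> e(2,3)] by (simp add: e(4))
    then show "ap (theta_comp q) y (ap (FAr (ext X (yoneda X)) \<alpha>) y e) = ap (FAr (idf (psh X)) \<alpha>) y (ap (theta_comp p) y e)"
      using homD[OF \<alpha>] by (simp add: Y.ext_FAr[OF \<alpha>]) (simp add: idf_def)
  qed
  then have m': "?t \<in> Nat (ext X (yoneda X)) (idf (psh X))" by (simp add: NatIso_def)
  note eta = Y.eta_Nat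
  note L = vcomp_Nat[OF eta whisker_pre_Nat[OF m' Y E]]
  show "(?t \<triangleleft> yoneda X) \<cdot>\<^sub>N eta X (yoneda X) = idn (yoneda X)"
  proof (rule Nat_eqI[OF L[unfolded fcomp_idf(2)[OF Y]] idn_Nat[OF Y] Y])
    fix x assume x: "x \<in> Obj X"
    let ?r = "representable X x" and ?i = "Ide X x"
    note r = representable_Obj[OF x] and i = Y.ide_rep[OF x]
    note s = Y.coproj_hom[OF r x i, unfolded yoneda_FOb[OF x]]
    have "Cmp (psh X) (theta_comp ?r) (Y.coproj ?r x ?i) = Ide (psh X) ?r"
    proof (rule psh_hom_eqI[OF category.cmp_in[OF category_psh s theta_comp(1)[OF r]] category.ide_in[OF category_psh r]])
      fix y k assume y: "y \<in> Obj X" and kr: "k \<in> FOb ?r y"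
      then have k: "k \<in> hom X y x" by (simp add: representable_sel)
      have ky: "k \<in> FOb (FOb (yoneda X) x) y" using kr by (simp add: yoneda_FOb[OF x])
      show "ap (Cmp (psh X) (theta_comp ?r) (Y.coproj ?r x ?i)) y k = ap (Ide (psh X) ?r) y k"
        using ap_cmp[OF s theta_comp(1)[OF r] y kr] theta_comp(2)[OF r y k i] ap_ide[OF r y kr]
          representable_sel(2)[OF k ide_in[OF x]] ide_cmp[OF k]
        by (simp add: Y.ap_coproj[OF y ky])
    qed
    then show "NCmp ((?t \<triangleleft> yoneda X) \<cdot>\<^sub>N eta X (yoneda X)) x = NCmp (idn (yoneda X)) x"
      using r by (simp add: vcomp_NCmp[OF eta Y x] whisker_pre_NCmp[OF Y x] idn_NCmp[OF Y x]
          yoneda_FOb[OF x] Y.eta_coproj[OF x])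
  qed
qed

lemma theta_Nat: "theta X \<in> Nat (ext X (yoneda X)) (idf (psh X))"
proof -
  interpret Y: small_profunctor X X "yoneda X" by unfold_locales (rule yoneda_Fun)
  note Y = Y.F
  have "\<exists>!t. t \<in> NatIso (ext X (yoneda X)) (idf (psh X)) \<and> (t \<triangleleft> yoneda X) \<cdot>\<^sub>N eta X (yoneda X) = idn (yoneda X)"
  proof (rule ex_ex1I)
    show "\<exists>t. t \<in> NatIso (ext X (yoneda X)) (idf (psh X)) \<and> (t \<triangleleft> yoneda X) \<cdot>\<^sub>N eta X (yoneda X) = idn (yoneda X)"
      using theta_exists by blast
    fix m n assume "m \<in> NatIso (ext X (yoneda X)) (idf (psh X)) \<and> (m \<triangleleft> yoneda X) \<cdot>\<^sub>N eta X (yoneda X) = idn (yoneda X)"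
      "n \<in> NatIso (ext X (yoneda X)) (idf (psh X)) \<and> (n \<triangleleft> yoneda X) \<cdot>\<^sub>N eta X (yoneda X) = idn (yoneda X)"
    then show "m = n" by (intro Y.ext_Nat_eqI[of m _ n]) (auto simp: NatIso_def)
  qed
  from theI'[OF this] show ?thesis by (simp add: theta_def NatIso_def)
qed

end

section \<open>The lifting\<close>

text \<open>Any choice of limits would do, since evaluation is strict for each. The two projections
  must belong to the same pullback, so a pair is selected and then split.\<close>

definition psh_algebra :: "limkind \<Rightarrow> ('u::universe, 'u) cat \<Rightarrow> 'u psh_action" where
  "psh_algebra K X = ev_functor K (psh X) (SOME t. is_term (psh X) t)
     (\<lambda>f g. fst (SOME (p1, p2). is_pb (psh X) f g p1 p2)) (\<lambda>f g. snd (SOME (p1, p2). is_pb (psh X) f g p1 p2))"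

context small_cat
begin

lemma psh_chosen_limits: "chosen_limits (psh X) (SOME t. is_term (psh X) t)
    (\<lambda>f g. fst (SOME (p1, p2). is_pb (psh X) f g p1 p2)) (\<lambda>f g. snd (SOME (p1, p2). is_pb (psh X) f g p1 p2))"
proof -
  interpret category "psh X" by (rule category_psh)
  show ?thesis
  proof
    show "is_term (psh X) (SOME t. is_term (psh X) t)" by (rule someI_ex[OF psh_terminal_exists])
    fix f g x y z assume "f \<in> hom (psh X) x z" "g \<in> hom (psh X) y z"
    from psh_pullback_exists[OF this] obtain p1 p2 where "is_pb (psh X) f g p1 p2" by blast
    then have "\<exists>pp. case pp of (p1, p2) \<Rightarrow> is_pb (psh X) f g p1 p2" by auto
    from someI_ex[OF this]
    show "is_pb (psh X) f g (fst (SOME (p1, p2). is_pb (psh X) f g p1 p2)) (snd (SOME (p1, p2). is_pb (psh X) f g p1 p2))"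
      by (simp add: case_prod_unfold)
  qed
qed

lemma psh_algebra_strict: "strict_algebra K (psh X, psh_algebra K X)"
  unfolding psh_algebra_def by (rule chosen_limits.EV_strict_algebra[OF psh_chosen_limits])

lemmas psh_action = strict_algebra_action[OF psh_algebra_strict]

lemma psh_algebra_mult: "f \<in> Fun A (psh X) \<Longrightarrow>
    psh_algebra K X \<circ>\<^sub>F S_functor K (psh_algebra K X \<circ>\<^sub>F S_functor K f)
      = (psh_algebra K X \<circ>\<^sub>F S_functor K f) \<circ>\<^sub>F S_mult K A"
  unfolding psh_algebra_def by (rule chosen_limits.EV_mult[OF psh_chosen_limits])

lemma psh_algebra_Fun: "psh_algebra K X \<in> Fun (S_cat K (psh X)) (psh X)"
  using psh_action by (simp add: action_def)

lemma psh_KLim: "KLim K (psh X) (psh X) (psh_algebra K X)"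
  by (rule KLim_strict_algebra[OF psh_algebra_strict])

text \<open>Restores the multiplication axiom left out of \<open>normal\<close>. The strictness that
  \<open>normal_mult\<close> demands holds because the action on presheaves is evaluation of
  terms.\<close>

lemma normal_pseudomorphism:
  assumes alg: "strict_algebra K (A, a)" and f: "f \<in> Fun A (psh X)" and n: "normal K A a (psh_algebra K X) f f'"
  shows "(f, f') \<in> pseudomorphisms K (A, a) (psh X, psh_algebra K X)"
proof -
  have "a \<circ>\<^sub>F S_functor K a = a \<circ>\<^sub>F S_mult K A" using alg by (simp add: strict_algebra_def)
  from normal_mult[OF strict_algebra_action[OF alg] psh_action psh_KLim this f n psh_algebra_mult[OF f]]
  show ?thesis using f n by (simp add: pseudomorphisms_def normal_def)
qed

end

lemma pseudomorphism_normal: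
  assumes "F \<in> pseudomorphisms K (A, a) (psh X, b)"
  shows "fst F \<in> Fun A (psh X)" "normal K A a b (fst F) (snd F)"
  using assms by (auto simp: pseudomorphisms_def normal_def)

section \<open>Limit preservation by the Yoneda embedding\<close>

context small_cat
begin

lemma yoneda_is_term: assumes T: "is_term X T" shows "is_term (psh X) (FOb (yoneda X) T)"
proof -
  have "T \<in> Obj X" "\<forall>x\<in>Obj X. \<exists>!u. u \<in> hom X x T" using T by (simp_all add: is_term_def)
  then show ?thesis
    using representable_Obj unfolding psh_is_term_iff
    by (simp add: yoneda_FOb representable_sel)
qed

text \<open>At a stage \<open>w\<close> the image square consists of hom-sets out of
  \<open>w\<close>, and the pointwise condition is the universal property of the given square tested
  at \<open>w\<close>.\<close>

lemma yoneda_is_pb: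
  assumes pb: "is_pb X f g p1 p2"
  shows "is_pb (psh X) (FAr (yoneda X) f) (FAr (yoneda X) g) (FAr (yoneda X) p1) (FAr (yoneda X) p2)"
proof -
  obtain x y z p where h: "f \<in> hom X x z" "g \<in> hom X y z" "p1 \<in> hom X p x" "p2 \<in> hom X p y" "Cmp X f p1 = Cmp X g p2"
    using is_pbD[OF pb] .
  note O = hom_Obj[OF h(1)] hom_Obj[OF h(2)] hom_Obj[OF h(3)]
  have Yo: "FOb (FOb (yoneda X) u) w = hom X w u" if "u \<in> Obj X" "w \<in> Obj X" for u w
    using that by (simp add: yoneda_FOb representable_sel)
  have Ya: "ap (FAr (yoneda X) m) w k = Cmp X m k" if "m \<in> hom X u v" "k \<in> hom X w u" for m u v w k
    using ap_yoneda_map[OF _ that(2)] representable_sel(2)[OF that(2,1)] hom_Obj[OF that(2)]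
    by (simp add: yoneda_FAr[OF that(1)])
  note Yh = Fun_hom[OF yoneda_Fun]
  show ?thesis
  proof (rule psh_is_pbI[OF Yh[OF h(1)] Yh[OF h(2)] Yh[OF h(3)] Yh[OF h(4)]])
    fix w e assume w: "w \<in> Obj X" and "e \<in> FOb (FOb (yoneda X) p) w"
    then have e: "e \<in> hom X w p" using O by (simp add: Yo)
    show "ap (FAr (yoneda X) f) w (ap (FAr (yoneda X) p1) w e) = ap (FAr (yoneda X) g) w (ap (FAr (yoneda X) p2) w e)"
      using cmp_assoc[OF e h(3,1)] cmp_assoc[OF e h(4,2)] h(5)
      by (simp add: Ya[OF h(3) e] Ya[OF h(4) e] Ya[OF h(1) cmp_in[OF e h(3)]] Ya[OF h(2) cmp_in[OF e h(4)]])
  next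
    fix w k l assume w: "w \<in> Obj X" and "k \<in> FOb (FOb (yoneda X) x) w" "l \<in> FOb (FOb (yoneda X) y) w"
      and eq: "ap (FAr (yoneda X) f) w k = ap (FAr (yoneda X) g) w l"
    then have k: "k \<in> hom X w x" "l \<in> hom X w y" using O by (auto simp: Yo)
    obtain u where u: "u \<in> hom X w p" "Cmp X p1 u = k" "Cmp X p2 u = l"
      using is_pb_ex1[OF pb h(3,4) k] eq by (auto simp: Ya[OF h(1) k(1)] Ya[OF h(2) k(2)])
    then show "\<exists>e. e \<in> FOb (FOb (yoneda X) p) w \<and> ap (FAr (yoneda X) p1) w e = k \<and> ap (FAr (yoneda X) p2) w e = l"
      using O w by (intro exI[of _ u]) (simp add: Yo Ya[OF h(3) u(1)] Ya[OF h(4) u(1)])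
  next
    fix w u v assume w: "w \<in> Obj X" and "u \<in> FOb (FOb (yoneda X) p) w" "v \<in> FOb (FOb (yoneda X) p) w"
      and eq: "ap (FAr (yoneda X) p1) w u = ap (FAr (yoneda X) p1) w v" "ap (FAr (yoneda X) p2) w u = ap (FAr (yoneda X) p2) w v"
    then have u: "u \<in> hom X w p" "v \<in> hom X w p" using O by (auto simp: Yo)
    show "u = v"
      using is_pb_unique[OF pb category_axioms h(3) u] eq by (simp add: Ya[OF h(3) u(1)] Ya[OF h(4) u(1)] Ya[OF h(3) u(2)] Ya[OF h(4) u(2)])
  qed
qed

lemma KLim_yoneda:
  assumes alg: "strict_algebra K (X, a)" shows "KLim K X (psh X) (yoneda X \<circ>\<^sub>F a)"
proof -
  have a: "a \<in> Fun (S_cat K X) X" using alg by (auto simp: strict_algebra_def)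
  note k = KLim_strict_algebra[OF alg]
  have To: "Tob K X (yoneda X \<circ>\<^sub>F a) U = FOb (yoneda X) (Tob K X a U)" if "oeq K X U U" for U
    by (simp add: Tob_def fcomp_FOb[OF a ocl_Obj[OF that]])
  have Ta: "Tar K X (yoneda X \<circ>\<^sub>F a) U V h = FAr (yoneda X) (Tar K X a U V h)" if "aeq K X U V h h" for U V h
    by (simp add: Tar_def fcomp_FAr[OF a acl_Arr[OF that]])
  show ?thesis
    unfolding KLim_def
  proof (intro conjI allI impI)
    show "is_term (psh X) (Tob K X (yoneda X \<circ>\<^sub>F a) OOne)" unfolding To[OF o_one] by (rule yoneda_is_term[OF KLimD(1)[OF k]])
    fix U V W f g P p1 p2 assume s: "sq K X U V W f g P p1 p2"
    show "is_pb (psh X) (Tar K X (yoneda X \<circ>\<^sub>F a) U W f) (Tar K X (yoneda X \<circ>\<^sub>F a) V W g)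
        (Tar K X (yoneda X \<circ>\<^sub>F a) P U p1) (Tar K X (yoneda X \<circ>\<^sub>F a) P V p2)"
      using yoneda_is_pb[OF KLimD(2)[OF k s]] sq_wf[OF category_axioms s] Ta by simp
  qed
qed

end

lemma small_profunctorI: "small_cat X \<Longrightarrow> small_cat Y \<Longrightarrow> F \<in> Fun X (psh Y) \<Longrightarrow> small_profunctor X Y F"
  by (simp add: small_profunctor_def small_profunctor_axioms_def)

text \<open>Only the underlying functor of \<open>F\<close> enters. The structure 2-cell of
  \<open>F\<close> matters solely as evidence that this functor preserves limits.\<close>

definition ext_2cell where
  "ext_2cell K \<AA> \<BB> F = (SOME f'. normal K (psh (fst \<AA>)) (psh_algebra K (fst \<AA>)) (psh_algebra K (fst \<BB>)) (ext (fst \<BB>) (fst F)) f')"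

definition yoneda_2cell where
  "yoneda_2cell K \<AA> = (SOME f'. normal K (fst \<AA>) (snd \<AA>) (psh_algebra K (fst \<AA>)) (yoneda (fst \<AA>)) f')"

context
  fixes K :: limkind and \<AA> :: "('u::universe, 'u) algebra"
  assumes \<AA>: "\<AA> \<in> S_Alg_Cat K"
begin

lemma S_Alg_Cat_facts: "strict_algebra K (fst \<AA>, snd \<AA>)" "small_cat (fst \<AA>)" "action K (fst \<AA>) (snd \<AA>)"
  using \<AA> strict_algebra_action[of K "fst \<AA>" "snd \<AA>"] by (auto simp: S_Alg_Cat_def small_cat_def)

text \<open>A structure on the functor gives preservation of limits, its extension inherits
  preservation, and preservation gives a structure on the extension.\<close>

lemma ext_2cell_normal:
  assumes sY: "small_cat (fst \<BB>)" and F: "fst F \<in> Fun (fst \<AA>) (psh (fst \<BB>))"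
    and n: "normal K (fst \<AA>) (snd \<AA>) (psh_algebra K (fst \<BB>)) (fst F) f'"
  shows "normal K (psh (fst \<AA>)) (psh_algebra K (fst \<AA>)) (psh_algebra K (fst \<BB>)) (ext (fst \<BB>) (fst F)) (ext_2cell K \<AA> \<BB> F)"
proof -
  note s = S_Alg_Cat_facts(2)
  have "KLim K (fst \<AA>) (psh (fst \<BB>)) (fst F \<circ>\<^sub>F snd \<AA>)"
    by (rule normal_KLim[OF S_Alg_Cat_facts(3) small_cat.psh_action[OF sY] F n small_cat.psh_KLim[OF sY]])
  from small_profunctor.KLim_ext[OF small_profunctorI[OF s sY F] S_Alg_Cat_facts(3) KLim_strict_algebra[OF S_Alg_Cat_facts(1)] this small_cat.psh_algebra_Fun[OF s] small_cat.psh_KLim[OF s]]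
  show ?thesis
    unfolding ext_2cell_def
    by (rule someI_ex[OF normal_exists[OF small_cat.psh_action[OF s] small_cat.psh_action[OF sY] small_profunctor.ext_Fun[OF small_profunctorI[OF s sY F]] _ small_cat.psh_KLim[OF sY]]])
qed

lemma yoneda_2cell_normal:
  "normal K (fst \<AA>) (snd \<AA>) (psh_algebra K (fst \<AA>)) (yoneda (fst \<AA>)) (yoneda_2cell K \<AA>)"
  unfolding yoneda_2cell_def
  by (rule someI_ex[OF normal_exists[OF S_Alg_Cat_facts(3) small_cat.psh_action[OF S_Alg_Cat_facts(2)] small_cat.yoneda_Fun[OF S_Alg_Cat_facts(2)]
        small_cat.KLim_yoneda[OF S_Alg_Cat_facts(2,1)] small_cat.psh_KLim[OF S_Alg_Cat_facts(2)]]])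

end

text \<open>With this, the conditions on \<mu>, \<eta> and \<theta> shrink to their naturality
  together with normality of the structures at both ends.\<close>

lemma normal_algebra_2cell:
  assumes Aa: "action K A a" and sX: "small_cat X"
    and F: "fst F \<in> Fun A (psh X)" "normal K A a (psh_algebra K X) (fst F) (snd F)"
    and G: "fst G \<in> Fun A (psh X)" "normal K A a (psh_algebra K X) (fst G) (snd G)"
    and \<alpha>: "\<alpha> \<in> Nat (fst F) (fst G)"
  shows "\<alpha> \<in> algebra_2cells K (A, a) (psh X, psh_algebra K X) F G"
  using normal_2cell[OF Aa small_cat.psh_action[OF sX] small_cat.psh_KLim[OF sX] F G \<alpha>] \<alpha>
  by (cases F; cases G) (simp add: algebra_2cells_def)

theorem theorem7p1:
  fixes K :: limkind
  shows "\<exists>(alg :: ('u :: universe, 'u) algebra \<Rightarrow> 'u psh_action) es ys. is_lifting K alg es ys"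
proof (intro exI)
  let ?alg = "\<lambda>\<AA> :: ('u, 'u) algebra. psh_algebra K (fst \<AA>)"
  have lo: "lift_ob ?alg \<AA> = (psh (fst \<AA>), psh_algebra K (fst \<AA>))" for \<AA> by (simp add: lift_ob_def)
  have le: "lift_ext (ext_2cell K) \<AA> \<BB> F = (ext (fst \<BB>) (fst F), ext_2cell K \<AA> \<BB> F)" for \<AA> \<BB> F by (simp add: lift_ext_def)
  have ly: "lift_yoneda (yoneda_2cell K) \<AA> = (yoneda (fst \<AA>), yoneda_2cell K \<AA>)" for \<AA> by (simp add: lift_yoneda_def)
  have ps: "fst F \<in> Fun (fst \<AA>) (psh (fst \<BB>))" "normal K (fst \<AA>) (snd \<AA>) (psh_algebra K (fst \<BB>)) (fst F) (snd F)"
    if "F \<in> pseudomorphisms K \<AA> (lift_ob ?alg \<BB>)" for \<AA> \<BB> F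
    using pseudomorphism_normal[of F K "fst \<AA>" "snd \<AA>" "fst \<BB>" "psh_algebra K (fst \<BB>)"] that by (auto simp: lo)
  have pc: "fst (pcomp K G F) = fst G \<circ>\<^sub>F fst F" for G F by (simp add: pcomp_def case_prod_unfold)
  have np: "normal K A a c (fst (pcomp K G F)) (snd (pcomp K G F))"
    if "action K A a" "action K B b" "action K C c" "fst F \<in> Fun A B" "normal K A a b (fst F) (snd F)"
      "fst G \<in> Fun B C" "normal K B b c (fst G) (snd G)" for A a B b C c F G
    using normal_pcomp[OF that(1-7)] by simp
  show "is_lifting K ?alg (ext_2cell K) (yoneda_2cell K)"
    unfolding is_lifting_def
  proof (intro conjI ballI)
    \<comment> \<open>The conditions quantify over one, two or three algebras. The block fixes these
      one after the other and settles each condition as soon as its parameters are present.\<close>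
    fix \<AA> :: "('u, 'u) algebra" assume \<AA>: "\<AA> \<in> S_Alg_Cat K"
    note A = S_Alg_Cat_facts[OF \<AA>] and yA = yoneda_2cell_normal[OF \<AA>] and YA = small_cat.yoneda_Fun[OF S_Alg_Cat_facts(2)[OF \<AA>]]
    show "lift_ob ?alg \<AA> \<in> S_Alg_CAT TYPE('u) K"
      using small_cat.psh_algebra_strict[OF A(2)] small_cat.locally_small_psh[OF A(2)] by (simp add: S_Alg_CAT_def lo)
    show "lift_yoneda (yoneda_2cell K) \<AA> \<in> pseudomorphisms K \<AA> (lift_ob ?alg \<AA>)"
      using small_cat.normal_pseudomorphism[OF A(2,1) YA yA] by (simp add: lo ly)
    show "theta (fst \<AA>) \<in> algebra_2cells K (lift_ob ?alg \<AA>) (lift_ob ?alg \<AA>)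
        (lift_ext (ext_2cell K) \<AA> \<AA> (lift_yoneda (yoneda_2cell K) \<AA>)) (pid (lift_ob ?alg \<AA>))"
    proof -
      have F: "fst (yoneda (fst \<AA>), yoneda_2cell K \<AA>) \<in> Fun (fst \<AA>) (psh (fst \<AA>))" using YA by simp
      show ?thesis
        unfolding lo le ly pid_def prod.case
        by (rule normal_algebra_2cell[OF small_cat.psh_action[OF A(2)] A(2)])
          (use small_profunctor.ext_Fun[OF small_profunctorI[OF A(2,2) YA]] ext_2cell_normal[OF \<AA> A(2) F] yA idf_Fun[OF category_psh]
            normal_pid[OF small_cat.psh_action[OF A(2)]] small_cat.theta_Nat[OF A(2)] in simp_all)
    qed
    fix \<BB> :: "('u, 'u) algebra" assume \<BB>: "\<BB> \<in> S_Alg_Cat K"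
    note B = S_Alg_Cat_facts[OF \<BB>]
    fix F assume F: "F \<in> pseudomorphisms K \<AA> (lift_ob ?alg \<BB>)"
    note f = ps[OF F]
    note fF = small_profunctorI[OF A(2) B(2) f(1)]
    note EF = small_profunctor.ext_Fun[OF fF] and eF = ext_2cell_normal[OF \<AA> B(2) ps[OF F]]
    show "lift_ext (ext_2cell K) \<AA> \<BB> F \<in> pseudomorphisms K (lift_ob ?alg \<AA>) (lift_ob ?alg \<BB>)"
      using small_cat.normal_pseudomorphism[OF B(2) small_cat.psh_algebra_strict[OF A(2)] EF eF] by (simp add: lo le)
    let ?Y = "(yoneda (fst \<AA>), yoneda_2cell K \<AA>)" and ?E = "(ext (fst \<BB>) (fst F), ext_2cell K \<AA> \<BB> F)"
    have "eta (fst \<BB>) (fst F) \<in> algebra_2cells K (fst \<AA>, snd \<AA>) (psh (fst \<BB>), psh_algebra K (fst \<BB>)) F (pcomp K ?E ?Y)"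
    proof (rule normal_algebra_2cell[OF A(3) B(2) f])
      show "fst (pcomp K ?E ?Y) \<in> Fun (fst \<AA>) (psh (fst \<BB>))" using fcomp_Fun[OF YA EF] by (simp add: pc)
      show "normal K (fst \<AA>) (snd \<AA>) (psh_algebra K (fst \<BB>)) (fst (pcomp K ?E ?Y)) (snd (pcomp K ?E ?Y))"
        by (rule np[OF A(3) small_cat.psh_action[OF A(2)] small_cat.psh_action[OF B(2)]]) (use YA yA EF eF in simp_all)
      show "eta (fst \<BB>) (fst F) \<in> Nat (fst F) (fst (pcomp K ?E ?Y))" using small_profunctor.eta_Nat[OF fF] by (simp add: pc)
    qed
    then show "eta (fst \<BB>) (fst F) \<in> algebra_2cells K \<AA> (lift_ob ?alg \<BB>) F
        (pcomp K (lift_ext (ext_2cell K) \<AA> \<BB> F) (lift_yoneda (yoneda_2cell K) \<AA>))" by (simp add: lo le ly)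
    fix \<CC> :: "('u, 'u) algebra" assume \<CC>: "\<CC> \<in> S_Alg_Cat K"
    note C = S_Alg_Cat_facts[OF \<CC>]
    fix G assume G: "G \<in> pseudomorphisms K \<BB> (lift_ob ?alg \<CC>)"
    note g = ps[OF G]
    note gG = small_profunctorI[OF B(2) C(2) g(1)]
    note EG = small_profunctor.ext_Fun[OF gG] and eG = ext_2cell_normal[OF \<BB> C(2) ps[OF G]]
    let ?G = "(ext (fst \<CC>) (fst G), ext_2cell K \<BB> \<CC> G)" let ?K = "pcomp K ?G F"
    have KF: "fst ?K \<in> Fun (fst \<AA>) (psh (fst \<CC>))" using fcomp_Fun[OF f(1) EG] by (simp add: pc)
    \<comment> \<open>The composite must itself be normal, hence limit preserving, before its
      extension is known to carry a structure.\<close>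
    have Kn: "normal K (fst \<AA>) (snd \<AA>) (psh_algebra K (fst \<CC>)) (fst ?K) (snd ?K)"
      by (rule np[OF A(3) small_cat.psh_action[OF B(2)] small_cat.psh_action[OF C(2)]]) (use f EG eG in simp_all)
    let ?EK = "(ext (fst \<CC>) (fst ?K), ext_2cell K \<AA> \<CC> ?K)"
    have "mu (fst \<BB>) (fst \<CC>) (fst G) (fst F) \<in> algebra_2cells K (psh (fst \<AA>), psh_algebra K (fst \<AA>))
        (psh (fst \<CC>), psh_algebra K (fst \<CC>)) ?EK (pcomp K ?G ?E)"
    proof (rule normal_algebra_2cell[OF small_cat.psh_action[OF A(2)] C(2)])
      show "fst ?EK \<in> Fun (psh (fst \<AA>)) (psh (fst \<CC>))" using small_profunctor.ext_Fun[OF small_profunctorI[OF A(2) C(2) KF]] by simp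
      show "normal K (psh (fst \<AA>)) (psh_algebra K (fst \<AA>)) (psh_algebra K (fst \<CC>)) (fst ?EK) (snd ?EK)"
        using ext_2cell_normal[OF \<AA> C(2) KF Kn] by simp
      show "fst (pcomp K ?G ?E) \<in> Fun (psh (fst \<AA>)) (psh (fst \<CC>))" using fcomp_Fun[OF EF EG] by (simp add: pc)
      show "normal K (psh (fst \<AA>)) (psh_algebra K (fst \<AA>)) (psh_algebra K (fst \<CC>)) (fst (pcomp K ?G ?E)) (snd (pcomp K ?G ?E))"
        by (rule np[OF small_cat.psh_action[OF A(2)] small_cat.psh_action[OF B(2)] small_cat.psh_action[OF C(2)]]) (use EF eF EG eG in simp_all)
      show "mu (fst \<BB>) (fst \<CC>) (fst G) (fst F) \<in> Nat (fst ?EK) (fst (pcomp K ?G ?E))"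
        using composable_profunctors.mu_Nat[OF composable_profunctors.intro[OF fF gG]] by (simp add: pc)
    qed
    then show "mu (fst \<BB>) (fst \<CC>) (fst G) (fst F) \<in> algebra_2cells K (lift_ob ?alg \<AA>) (lift_ob ?alg \<CC>)
        (lift_ext (ext_2cell K) \<AA> \<CC> (pcomp K (lift_ext (ext_2cell K) \<BB> \<CC> G) F))
        (pcomp K (lift_ext (ext_2cell K) \<BB> \<CC> G) (lift_ext (ext_2cell K) \<AA> \<BB> F))" by (simp add: lo le)
  qed
qed

end
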